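(* Let $M$ be an oriented 6-manifold equipped with a $G_2$-pair $(\rho,\tau)\in\Omega^3(M)\times\Omega^4(M)$ where both $\rho$ and $\tau$ are closed. Let $P$ be a closed oriented 3-manifold and let $L=\iota(P)\subset M$ be a 3-submanifold, where $\iota:P\to M$ is a smooth embedding with $\iota^*\hat\rho>0$. Then $L$ is a solution to the Lagrange multipliers problem (i.e. a critical point of $f_\tau$ restricted to the constraint $\rho|_L=0$, as defined in the context) if and only if there exists $\lambda\in C^\infty(L)$ such that $$\tau_N+d\lambda\wedge\rho_N=0,\qquad \rho|_L=0 .$$
   Context: Stable forms. A 3-form $\rho$ on an oriented 6-manifold is called stable (positive) if at each point its $GL(6,\mathbb R)$-orbit is open with stabilizer $SL(3,\mathbb C)$. Such a $\rho$ determines an almost complex structure, and its Hitchin dual $\hat\rho$ is the unique 3-form such that $\rho+i\hat\rho$ is a nowhere vanishing complex volume form for that almost complex structure (with $\rho\wedge\hat\rho>0$). A 4-form $\psi$ on a 7-manifold is stable if at each point its $GL(7,\mathbb R)$-orbit is open with stabilizer $\pm G_2$, with $G_2$ the compact group. A $G_2$-pair on $M$ is a pair $(\rho,\tau)\in\Omega^3(M)\times\Omega^4(M)$ such that $\psi=dt\wedge\rho+\tau$ is stable on $\mathbb R\times M$ ($t$ the $\mathbb R$-coordinate); in particular $\rho$ is stable. Lagrange multipliers problem. Fix a homology class $A\in H_3(M;\mathbb Z)$ and let $\mathcal F$ be the space of smooth embeddings $\iota:P\to M$ with $[\iota]=A$ and $\iota^*\hat\rho>0$. Fix $\iota_0\in\mathcal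 F$ and let $\tilde{\mathcal F}$ be the universal cover of $\mathcal F$ based at $\iota_0$: homotopy classes with fixed endpoints of smooth paths $\tilde\iota:[0,1]\times P\to M$ with $\tilde\iota(0,\cdot)=\iota_0$, $\tilde\iota(t,\cdot)\in\mathcal F$. Define $f_\tau:\tilde{\mathcal F}\to\mathbb R$, $f_\tau(\tilde\iota)=\int_{[0,1]\times P}\tilde\iota^*\tau$. Its differential is the well-defined one-form on $\mathcal F$ given by $(df_\tau)_\iota(n)=\int_P\iota^*(n\lrcorner\tau)$ for $n\in T_\iota\mathcal F=\Gamma(\iota^*TM)$. The constraint set is $\tilde C_\rho=\{\tilde\iota : \tilde\iota(1,\cdot)^*\rho=0\}$. The Lagrange multipliers problem is to find the critical points of $f_\tau|_{\tilde C_\rho}$. Thus $L=\iota(P)$ (with $A=[\iota]$) is a solution if $\iota^*\rho=0$ and $(df_\tau)_\iota(n)=0$ for every $n\in\Gamma(\iota^*TM)$ tangent to the constraint, i.e. with $d(\iota^*(n\lrcorner\rho))=0$. Notation. For a $k$-form $\alpha$ on $M$ and an embedding $\iota:P\to M$ with $\iota^*\alpha=0$, $\alpha_N$ is the $\iota^*T^*M$-valued $(k-1)$-form on $P$ given by $\alpha_N(v_1,\dots,v_{k-1})=\alpha(\iota_*v_1,\dots,\iota_*v_{k-1},\cdot)$. Functions on $L$ are identified with functions on $P$ via $\iota$. *)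

theory Defs
  imports "HOL-Analysis.Analysis" "HOL-Combinatorics.Permutations"
begin

section \<open>Alternating forms on a vector space\<close>

text \<open>
  A \<open>k\<close>-form on a vector space is a function of a list of \<open>k\<close> vectors, extended by 0 to lists
  of any other length.  Consequently \<open>alt_forms k\<close> is a finite-dimensional space of functions when
  the vector space is finite-dimensional, and the topology it inherits from the product topology
  on \<open>'v list \<Rightarrow> real\<close> is its usual one.
\<close>

type_synonym 'v form = "'v list \<Rightarrow> real"

definition alt_forms :: "nat \<Rightarrow> 'v::real_vector form set" where
  "alt_forms k = {\<alpha>.
     (\<forall>vs. length vs \<noteq> k \<longrightarrow> \<alpha> vs = 0) \<and>
     (\<forall>us ws. length us + 1 + length ws = k \<longrightarrow> linear (\<lambda>v. \<alpha> (us @ v # ws))) \<and>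
     (\<forall>vs. \<not> distinct vs \<longrightarrow> \<alpha> vs = 0)}"

definition pull :: "('v \<Rightarrow> 'w) \<Rightarrow> 'w form \<Rightarrow> 'v form" where
  "pull g \<alpha> = (\<lambda>vs. \<alpha> (map g vs))"

text \<open>The normalisation for which \<open>dx\<^sub>1 \<and> \<dots> \<and> dx\<^sub>n\<close> takes the value 1 on the standard basis.\<close>

definition wedge :: "nat \<Rightarrow> nat \<Rightarrow> 'v form \<Rightarrow> 'v form \<Rightarrow> 'v form" where
  "wedge k l \<alpha> \<beta> = (\<lambda>vs. if length vs = k + l then
     (\<Sum>\<sigma> | \<sigma> permutes {..<k + l}.
        of_int (sign \<sigma>) * \<alpha> (map (\<lambda>i. vs ! \<sigma> i) [0..<k]) * \<beta> (map (\<lambda>i. vs ! \<sigma> i) [k..<k + l]))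
       / (fact k * fact l) else 0)"

definition GL :: "('v::real_vector \<Rightarrow> 'v) set" where
  "GL = {g. linear g \<and> bij g}"

definition orbit :: "'v::real_vector form \<Rightarrow> 'v form set" where
  "orbit \<alpha> = (\<lambda>g. pull g \<alpha>) ` GL"

definition stabilizer :: "'v::real_vector form \<Rightarrow> ('v \<Rightarrow> 'v) set" where
  "stabilizer \<alpha> = {g \<in> GL. pull g \<alpha> = \<alpha>}"

subsection \<open>Stable 4-forms in dimension 7\<close>

definition dx :: "'n \<Rightarrow> (real^'n::finite) form" where
  "dx i = (\<lambda>vs. if length vs = 1 then hd vs $ i else 0)"

definition dx3 :: "'n \<Rightarrow> 'n \<Rightarrow> 'n \<Rightarrow> (real^'n::finite) form" where
  "dx3 i j k = wedge 1 2 (dx i) (wedge 1 1 (dx j) (dx k))"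

text \<open>
  The standard definite 3-form on \<open>\<real>\<^sup>7\<close>; its stabilizer is the compact group \<open>G\<^sub>2\<close>.
  In the index type \<open>7\<close> the numeral 7 denotes the same element as 0.
\<close>

definition phi0 :: "(real^7) form" where
  "phi0 = (\<lambda>vs. dx3 1 2 3 vs + dx3 1 4 5 vs + dx3 1 6 7 vs + dx3 2 4 6 vs
                 - dx3 2 5 7 vs - dx3 3 4 7 vs - dx3 3 5 6 vs)"

definition G2 :: "(real^7 \<Rightarrow> real^7) set" where
  "G2 = stabilizer phi0"

definition pmG2 :: "(real^7 \<Rightarrow> real^7) set" where
  "pmG2 = G2 \<union> (\<lambda>g v. - g v) ` G2"

text \<open>
  That the stabilizer is \<open>\<plusminus>G\<^sub>2\<close> is meant up to an identification \<open>f\<close> of the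
  7-dimensional space with \<open>\<real>\<^sup>7\<close>, i.e. up to conjugation.
\<close>

definition stable4 :: "'v::euclidean_space form \<Rightarrow> bool" where
  "stable4 \<psi> \<longleftrightarrow> \<psi> \<in> alt_forms 4 \<and>
     openin (top_of_set (alt_forms 4)) (orbit \<psi>) \<and>
     (\<exists>f :: 'v \<Rightarrow> real^7. linear f \<and> bij f \<and>
        stabilizer \<psi> = (\<lambda>g. inv f \<circ> g \<circ> f) ` pmG2)"

subsection \<open>The Hitchin dual of a stable 3-form on oriented 6-space\<close>

text \<open>
  The orientation of \<open>\<real>\<^sup>3\<close> and \<open>\<real>\<^sup>6\<close> is the one given by these frames
  (in the index types, 3 and 6 denote the same elements as 0).
\<close>

definition frame3 :: "(real^3) list" where
  "frame3 = map (\<lambda>i. axis i 1) [1, 2, 3]"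

definition frame6 :: "(real^6) list" where
  "frame6 = map (\<lambda>i. axis i 1) [1, 2, 3, 4, 5, 6]"

text \<open>
  The stabilizer of a positive stable 3-form in the full group \<open>GL(6,\<real>)\<close> also contains
  orientation-reversing maps (complex conjugation on \<open>\<complex>\<^sup>3\<close> fixes the real part of
  \<open>dz\<^sub>1 \<and> dz\<^sub>2 \<and> dz\<^sub>3\<close>); the copy of \<open>SL(3,\<complex>)\<close> is the stabilizer in \<open>GL\<^sup>+(6,\<real>)\<close>.
\<close>

definition oriented_stabilizer :: "(real^6) form \<Rightarrow> (real^6 \<Rightarrow> real^6) set" where
  "oriented_stabilizer \<rho> = {g \<in> stabilizer \<rho>. det (matrix g) > 0}"

text \<open>
  The complex structure determined by \<open>\<rho>\<close>: multiplication by \<open>\<i>\<close>, transported along an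
  identification \<open>f\<close> with \<open>\<complex>\<^sup>3\<close> under which the stabilizer becomes \<open>SL(3,\<complex>)\<close>.  This pins
  \<open>J\<close> down up to sign; the sign is fixed by the condition \<open>\<rho> \<and> \<sigma> > 0\<close> on the Hitchin
  dual \<open>\<sigma>\<close> of \<open>\<rho>\<close>.
\<close>

definition induced_complex_structure :: "(real^6) form \<Rightarrow> (real^6 \<Rightarrow> real^6) \<Rightarrow> bool" where
  "induced_complex_structure \<rho> J \<longleftrightarrow>
     (\<exists>f :: real^6 \<Rightarrow> complex^3. linear f \<and> bij f \<and>
        oriented_stabilizer \<rho> =
          {inv f \<circ> (\<lambda>z. A *v z) \<circ> f | A :: complex^3^3. det A = 1} \<and>
        J = inv f \<circ> (\<lambda>z. \<i> *s z) \<circ> f)"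

text \<open>\<open>\<rho> + \<i> \<sigma>\<close> is a nonzero 3-form of type (3,0) with respect to \<open>J\<close>.\<close>

definition complex_volume_form ::
  "(real^6 \<Rightarrow> real^6) \<Rightarrow> (real^6) form \<Rightarrow> (real^6) form \<Rightarrow> bool" where
  "complex_volume_form J \<rho> \<sigma> \<longleftrightarrow> \<rho> \<in> alt_forms 3 \<and> \<sigma> \<in> alt_forms 3 \<and>
     (\<forall>vs i. length vs = 3 \<longrightarrow> i < 3 \<longrightarrow>
        Complex (\<rho> (vs[i := J (vs ! i)])) (\<sigma> (vs[i := J (vs ! i)]))
          = \<i> * Complex (\<rho> vs) (\<sigma> vs)) \<and>
     (\<exists>vs. Complex (\<rho> vs) (\<sigma> vs) \<noteq> 0)"

definition hitchin_dual :: "(real^6) form \<Rightarrow> (real^6) form" where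
  "hitchin_dual \<rho> = (THE \<sigma>. \<exists>J. induced_complex_structure \<rho> J \<and>
     complex_volume_form J \<rho> \<sigma> \<and> wedge 3 3 \<rho> \<sigma> frame6 > 0)"

section \<open>Smooth maps between Euclidean spaces\<close>

primrec Ck_on :: "nat \<Rightarrow> 'a::euclidean_space set \<Rightarrow> ('a \<Rightarrow> 'b::real_normed_vector) \<Rightarrow> bool" where
  "Ck_on 0 S f = continuous_on S f"
| "Ck_on (Suc k) S f = ((\<forall>x\<in>S. f differentiable (at x)) \<and>
     (\<forall>v. Ck_on k S (\<lambda>x. frechet_derivative f (at x) v)))"

text \<open>Only meaningful for open \<open>S\<close>.\<close>

definition smooth_on :: "'a::euclidean_space set \<Rightarrow> ('a \<Rightarrow> 'b::real_normed_vector) \<Rightarrow> bool" where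
  "smooth_on S f \<longleftrightarrow> (\<forall>k. Ck_on k S f)"

section \<open>Oriented manifolds\<close>

text \<open>
  The points of a manifold are the elements of a type, and its smooth structure is given by
  an atlas indexed by the points: \<open>chart_at C p\<close> is a chart on the open neighbourhood
  \<open>dom_at C p\<close> of \<open>p\<close>.  (Every atlas contains such a family, which is again an atlas of the same
  structure.)  The manifold is oriented by requiring the transition maps to preserve
  orientation.

  The tangent space at \<open>p\<close> is identified with the model space by means of the distinguished chart
  \<open>chart_at C p\<close>.  Tangent vectors, forms and derivatives at \<open>p\<close> are always expressed
  in this chart, and passing to another chart is done explicitly by \<open>tangent_coords\<close> and
  \<open>local_form\<close> below.
\<close>

record ('m, 'e) charts =
  dom_at :: "'m \<Rightarrow> 'm set"
  chart_at :: "'m \<Rightarrow> 'm \<Rightarrow> 'e"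

definition range_at :: "('m, 'e) charts \<Rightarrow> 'm \<Rightarrow> 'e set" where
  "range_at C p = chart_at C p ` dom_at C p"

definition inv_chart :: "('m, 'e) charts \<Rightarrow> 'm \<Rightarrow> 'e \<Rightarrow> 'm" where
  "inv_chart C p = inv_into (dom_at C p) (chart_at C p)"

definition oriented_manifold ::
  "('m::{t2_space, second_countable_topology}, real^'n::finite) charts \<Rightarrow> bool" where
  "oriented_manifold C \<longleftrightarrow>
     (\<forall>p. p \<in> dom_at C p \<and> open (dom_at C p) \<and> open (range_at C p) \<and>
        homeomorphism (dom_at C p) (range_at C p) (chart_at C p) (inv_chart C p)) \<and>
     (\<forall>p q. smooth_on (chart_at C p ` (dom_at C p \<inter> dom_at C q))
              (chart_at C q \<circ> inv_chart C p)) \<and>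
     (\<forall>p q. \<forall>x \<in> chart_at C p ` (dom_at C p \<inter> dom_at C q).
        det (matrix (frechet_derivative (chart_at C q \<circ> inv_chart C p) (at x))) > 0)"

text \<open>The components of \<open>v \<in> T\<^sub>qM\<close> in the chart \<open>chart_at C p\<close>, for \<open>q \<in> dom_at C p\<close>.\<close>

definition tangent_coords ::
  "('m, 'e::euclidean_space) charts \<Rightarrow> 'm \<Rightarrow> 'm \<Rightarrow> 'e \<Rightarrow> 'e" where
  "tangent_coords C p q v =
     frechet_derivative (chart_at C p \<circ> inv_chart C q) (at (chart_at C q q)) v"

definition smooth_function :: "('m, 'e::euclidean_space) charts \<Rightarrow> ('m \<Rightarrow> real) \<Rightarrow> bool" where
  "smooth_function C u \<longleftrightarrow> (\<forall>p. smooth_on (range_at C p) (u \<circ> inv_chart C p))"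

subsection \<open>Differential forms\<close>

text \<open>The form \<open>\<omega>\<close> written in the chart \<open>chart_at C p\<close>, at the point with coordinates \<open>x\<close>.\<close>

definition local_form ::
  "('m, 'e::euclidean_space) charts \<Rightarrow> ('m \<Rightarrow> 'e form) \<Rightarrow> 'm \<Rightarrow> 'e \<Rightarrow> 'e form" where
  "local_form C \<omega> p x =
     pull (frechet_derivative (chart_at C (inv_chart C p x) \<circ> inv_chart C p) (at x))
       (\<omega> (inv_chart C p x))"

definition diff_form :: "nat \<Rightarrow> ('m, 'e::euclidean_space) charts \<Rightarrow> ('m \<Rightarrow> 'e form) \<Rightarrow> bool" where
  "diff_form k C \<omega> \<longleftrightarrow> (\<forall>p. \<omega> p \<in> alt_forms k) \<and>
     (\<forall>p vs. smooth_on (range_at C p) (\<lambda>x. local_form C \<omega> p x vs))"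

text \<open>
  The coordinate formula
  \<open>d\<omega>(v\<^sub>0, \<dots>, v\<^sub>k) = \<Sum>\<^sub>i (-1)\<^sup>i (D\<omega>)(v\<^sub>i)(v\<^sub>0, \<dots>, v\<^sub>i\<^sub>-\<^sub>1, v\<^sub>i\<^sub>+\<^sub>1, \<dots>, v\<^sub>k)\<close>
  in the chart at \<open>p\<close>.
\<close>

definition ext_deriv ::
  "('m, 'e::euclidean_space) charts \<Rightarrow> ('m \<Rightarrow> 'e form) \<Rightarrow> 'm \<Rightarrow> 'e form" where
  "ext_deriv C \<omega> p vs = (\<Sum>i<length vs. (-1) ^ i *
     frechet_derivative (\<lambda>x. local_form C \<omega> p x (take i vs @ drop (Suc i) vs))
       (at (chart_at C p p)) (vs ! i))"

definition closed_form :: "('m, 'e::euclidean_space) charts \<Rightarrow> ('m \<Rightarrow> 'e form) \<Rightarrow> bool" where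
  "closed_form C \<omega> \<longleftrightarrow> (\<forall>p vs. ext_deriv C \<omega> p vs = 0)"

definition zero_form :: "('m \<Rightarrow> real) \<Rightarrow> 'm \<Rightarrow> 'e form" where
  "zero_form u p vs = (if vs = [] then u p else 0)"

subsection \<open>Integration over a closed oriented 3-manifold\<close>

definition partition_of_unity ::
  "('m::topological_space, 'e::euclidean_space) charts \<Rightarrow> 'm set \<Rightarrow> ('m \<Rightarrow> 'm \<Rightarrow> real) \<Rightarrow> bool" where
  "partition_of_unity C F h \<longleftrightarrow> finite F \<and>
     (\<forall>a\<in>F. smooth_function C (h a) \<and> (\<forall>q. h a q \<ge> 0) \<and>
        closure {q. h a q \<noteq> 0} \<subseteq> dom_at C a) \<and>
     (\<forall>q. (\<Sum>a\<in>F. h a q) = 1)"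

text \<open>
  As usual, the integral is defined through a choice of partition of unity subordinate to
  positively oriented charts; the result does not depend on this choice.
\<close>

definition integral_form ::
  "('p::topological_space, real^3) charts \<Rightarrow> ('p \<Rightarrow> (real^3) form) \<Rightarrow> real" where
  "integral_form P \<omega> =
     (let (F, h) = (SOME (F, h). partition_of_unity P F h) in
      \<Sum>a\<in>F. integral (range_at P a)
        (\<lambda>x. h a (inv_chart P a x) * local_form P \<omega> a x frame3))"

subsection \<open>Smooth embeddings\<close>

definition tangent_map ::
  "('p, 'd::euclidean_space) charts \<Rightarrow> ('m, 'e::euclidean_space) charts \<Rightarrow> ('p \<Rightarrow> 'm)
     \<Rightarrow> 'p \<Rightarrow> 'd \<Rightarrow> 'e" where
  "tangent_map P M \<iota> p =
     frechet_derivative (chart_at M (\<iota> p) \<circ> \<iota> \<circ> inv_chart P p) (at (chart_at P p p))"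

definition smooth_map ::
  "('p::topological_space, 'd::euclidean_space) charts
     \<Rightarrow> ('m::topological_space, 'e::euclidean_space) charts \<Rightarrow> ('p \<Rightarrow> 'm) \<Rightarrow> bool" where
  "smooth_map P M \<iota> \<longleftrightarrow> continuous_on UNIV \<iota> \<and>
     (\<forall>p q. smooth_on (chart_at P p ` (dom_at P p \<inter> \<iota> -` dom_at M q))
              (chart_at M q \<circ> \<iota> \<circ> inv_chart P p))"

definition smooth_embedding ::
  "('p::topological_space, 'd::euclidean_space) charts
     \<Rightarrow> ('m::topological_space, 'e::euclidean_space) charts \<Rightarrow> ('p \<Rightarrow> 'm) \<Rightarrow> bool" where
  "smooth_embedding P M \<iota> \<longleftrightarrow> smooth_map P M \<iota> \<and>
     (\<forall>p. inj (tangent_map P M \<iota> p)) \<and>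
     homeomorphism UNIV (range \<iota>) \<iota> (inv \<iota>)"

definition pullback_form ::
  "('p, 'd::euclidean_space) charts \<Rightarrow> ('m, 'e::euclidean_space) charts \<Rightarrow> ('p \<Rightarrow> 'm)
     \<Rightarrow> ('m \<Rightarrow> 'e form) \<Rightarrow> 'p \<Rightarrow> 'd form" where
  "pullback_form P M \<iota> \<alpha> p = pull (tangent_map P M \<iota> p) (\<alpha> (\<iota> p))"

definition vanishes :: "('p \<Rightarrow> 'd form) \<Rightarrow> bool" where
  "vanishes \<alpha> \<longleftrightarrow> (\<forall>p vs. \<alpha> p vs = 0)"

text \<open>The smooth sections of \<open>\<iota>\<^sup>*TM\<close>.\<close>

definition section_along ::
  "('p, 'd::euclidean_space) charts \<Rightarrow> ('m, 'e::euclidean_space) charts \<Rightarrow> ('p \<Rightarrow> 'm)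
     \<Rightarrow> ('p \<Rightarrow> 'e) \<Rightarrow> bool" where
  "section_along P M \<iota> n \<longleftrightarrow>
     (\<forall>p q. smooth_on (chart_at P p ` (dom_at P p \<inter> \<iota> -` dom_at M q))
        (\<lambda>x. tangent_coords M q (\<iota> (inv_chart P p x)) (n (inv_chart P p x))))"

text \<open>\<open>\<iota>\<^sup>*(n \<lrcorner> \<alpha>)\<close> for a section \<open>n\<close> of \<open>\<iota>\<^sup>*TM\<close>, and the \<open>\<iota>\<^sup>*T\<^sup>*M\<close>-valued form \<open>\<alpha>\<^sub>N\<close>.\<close>

definition pullback_interior ::
  "('p, 'd::euclidean_space) charts \<Rightarrow> ('m, 'e::euclidean_space) charts \<Rightarrow> ('p \<Rightarrow> 'm)
     \<Rightarrow> ('p \<Rightarrow> 'e) \<Rightarrow> ('m \<Rightarrow> 'e form) \<Rightarrow> 'p \<Rightarrow> 'd form" where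
  "pullback_interior P M \<iota> n \<alpha> p vs = \<alpha> (\<iota> p) (n p # map (tangent_map P M \<iota> p) vs)"

definition normal_part ::
  "('p, 'd::euclidean_space) charts \<Rightarrow> ('m, 'e::euclidean_space) charts \<Rightarrow> ('p \<Rightarrow> 'm)
     \<Rightarrow> ('m \<Rightarrow> 'e form) \<Rightarrow> 'p \<Rightarrow> 'd list \<Rightarrow> 'e \<Rightarrow> real" where
  "normal_part P M \<iota> \<alpha> p vs w = \<alpha> (\<iota> p) (map (tangent_map P M \<iota> p) vs @ [w])"

section \<open>\<open>G\<^sub>2\<close>-pairs and the Lagrange multipliers problem\<close>

text \<open>
  At \<open>(t,p) \<in> \<real> \<times> M\<close> the tangent space is \<open>\<real> \<times> T\<^sub>pM\<close>, and \<open>dt \<and> \<rho> + \<tau>\<close> does not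
  depend on \<open>t\<close>.
\<close>

definition dt :: "(real \<times> 'e) form" where
  "dt = (\<lambda>vs. if length vs = 1 then fst (hd vs) else 0)"

definition G2_pair ::
  "('m, real^6) charts \<Rightarrow> ('m \<Rightarrow> (real^6) form) \<Rightarrow> ('m \<Rightarrow> (real^6) form) \<Rightarrow> bool" where
  "G2_pair M \<rho> \<tau> \<longleftrightarrow> diff_form 3 M \<rho> \<and> diff_form 4 M \<tau> \<and>
     (\<forall>p. stable4 (\<lambda>vs. wedge 1 3 dt (pull snd (\<rho> p)) vs + pull snd (\<tau> p) vs))"

definition positive_3form :: "('p \<Rightarrow> (real^3) form) \<Rightarrow> bool" where
  "positive_3form \<omega> \<longleftrightarrow> (\<forall>p. \<omega> p frame3 > 0)"

text \<open>The differential \<open>(df\<^sub>\<tau>)\<^sub>\<iota>(n) = \<integral>\<^sub>P \<iota>\<^sup>*(n \<lrcorner> \<tau>)\<close>.\<close>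

definition d_functional ::
  "('p::topological_space, real^3) charts \<Rightarrow> ('m, real^6) charts \<Rightarrow> ('m \<Rightarrow> (real^6) form)
     \<Rightarrow> ('p \<Rightarrow> 'm) \<Rightarrow> ('p \<Rightarrow> real^6) \<Rightarrow> real" where
  "d_functional P M \<tau> \<iota> n = integral_form P (pullback_interior P M \<iota> n \<tau>)"

definition tangent_to_constraint ::
  "('p, real^3) charts \<Rightarrow> ('m, real^6) charts \<Rightarrow> ('m \<Rightarrow> (real^6) form)
     \<Rightarrow> ('p \<Rightarrow> 'm) \<Rightarrow> ('p \<Rightarrow> real^6) \<Rightarrow> bool" where
  "tangent_to_constraint P M \<rho> \<iota> n \<longleftrightarrow>
     section_along P M \<iota> n \<and> closed_form P (pullback_interior P M \<iota> n \<rho>)"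

definition lagrange_solution ::
  "('p::topological_space, real^3) charts \<Rightarrow> ('m, real^6) charts
     \<Rightarrow> ('m \<Rightarrow> (real^6) form) \<Rightarrow> ('m \<Rightarrow> (real^6) form) \<Rightarrow> ('p \<Rightarrow> 'm) \<Rightarrow> bool" where
  "lagrange_solution P M \<rho> \<tau> \<iota> \<longleftrightarrow> vanishes (pullback_form P M \<iota> \<rho>) \<and>
     (\<forall>n. tangent_to_constraint P M \<rho> \<iota> n \<longrightarrow> d_functional P M \<tau> \<iota> n = 0)"

end

theory Submission
  imports Defs
begin

text \<open>
  Suppose that \<open>\<rho>\<close> vanishes on \<open>L = \<iota>(P)\<close>; both sides of the equivalence contain this condition.
  A section \<open>n\<close> of \<open>\<iota>\<^sup>*TM\<close> enters the problem through the 2-form \<open>\<iota>\<^sup>*(n \<lrcorner> \<rho>)\<close>, which must be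
  closed, and the 3-form \<open>\<iota>\<^sup>*(n \<lrcorner> \<tau>)\<close>, whose integral must vanish.  The proof has a pointwise and a
  global part.

  At a point, every 2-form on the tangent space of \<open>P\<close> is \<open>\<iota>\<^sup>*(n \<lrcorner> \<rho>)\<close> for some \<open>n\<close>, because the
  Hitchin dual of \<open>\<rho>\<close> is positive there (lemma \<open>contractions_onto\<close>).  Counting dimensions, this 2-form
  vanishes only for tangent \<open>n\<close>, and then \<open>\<iota>\<^sup>*(n \<lrcorner> \<tau>)\<close> vanishes as well, since four tangent vectors are
  linearly dependent.  So there is exactly one 1-form \<open>\<alpha>\<close> on \<open>P\<close> with
  \<open>\<iota>\<^sup>*(n \<lrcorner> \<tau>) = \<alpha> \<and> \<iota>\<^sup>*(n \<lrcorner> \<rho>)\<close> for all \<open>n\<close> (lemma \<open>normal_volume_eq\<close>), and the equation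
  \<open>\<tau>\<^sub>N + d\<lambda> \<and> \<rho>\<^sub>N = 0\<close> says that \<open>d\<lambda> = \<alpha>\<close> (lemma \<open>multiplier_equation_iff\<close>).

  Globally, local solutions of \<open>\<iota>\<^sup>*(n \<lrcorner> \<rho>) = \<eta>\<close> are glued by a partition of unity, so that every 2-form
  \<open>\<eta>\<close> on \<open>P\<close> arises from a section (lemma \<open>vector_density_is_contraction\<close>).  Hence \<open>L\<close> is critical if and
  only if the integral of \<open>\<alpha> \<and> \<eta>\<close> vanishes for all closed \<open>\<eta>\<close>, and this means that \<open>\<alpha>\<close> is exact.  If
  \<open>\<alpha> = d\<lambda>\<close>, the integral vanishes by Stokes' theorem.  The converse, theorem \<open>null_one_form_exact\<close>, is an
  instance of Poincare duality.  Its proof is elementary: testing against forms \<open>\<eta>\<close> supported in a chart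
  shows that \<open>\<alpha>\<close> is closed, so that it has local primitives.  A primitive may be recovered from
  its integrals against bumps; and the difference of two bumps of the same mass that
  can be moved to each other is \<open>d\<eta>\<close> for some \<open>\<eta>\<close>, so that the integral of \<open>\<alpha> \<and> \<eta>\<close> tells how to choose the
  constants in the local primitives.  This choice is consistent because \<open>\<eta>\<close> is unique
  up to a closed form, on which \<open>\<alpha>\<close> integrates to zero.

  The Hitchin dual has to be computed from its definition.  A 4-form with stabiliser \<open>\<plusminus>G\<^sub>2\<close> is invariant
  under enough sign changes and permutations of coordinates to be a multiple of the dual of the standard
  3-form \<open>\<phi>\<close> (lemma \<open>stable4_normal_form\<close>).  Contracted with a vector \<open>u\<close> it gives a 3-form on the
  complement of \<open>u\<close> for which the cross product with \<open>u\<close> is a complex structure, and which therefore is the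
  real part of a complex determinant (lemma \<open>G2_pair_3form_normal_form\<close>).  The stabiliser of such a
  form in the orientation preserving group is \<open>SL(3,\<complex>)\<close>, and a complex structure commuting with all of
  \<open>SL(3,\<complex>)\<close> is multiplication with \<open>\<plusminus>\<i>\<close>.  So the Hitchin dual is the imaginary part of the
  determinant (lemma \<open>hitchin_dual_eq\<close>).
\<close>

section \<open>Calculus of smooth maps\<close>

lemma Ck_on_subset: "Ck_on k S f \<Longrightarrow> T \<subseteq> S \<Longrightarrow> Ck_on k T f"
  by (induction k arbitrary: f) (auto intro: continuous_on_subset)

lemma Ck_on_cong:
  assumes "open S" "\<And>x. x \<in> S \<Longrightarrow> f x = g x" "Ck_on k S f"
  shows "Ck_on k S g"
  using assms(2,3)
proof (induction k arbitrary: f g)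
  case 0
  then show ?case by (simp add: continuous_on_cong[of S S f g])
next
  case (Suc k)
  have der: "(g has_derivative frechet_derivative f (at x)) (at x)" if "x \<in> S" for x
  proof -
    have "(f has_derivative frechet_derivative f (at x)) (at x)"
      using Suc.prems(2) that by (simp add: frechet_derivative_works)
    then show ?thesis
      by (rule has_derivative_transform_within_open[OF _ assms(1) that]) (use Suc.prems in auto)
  qed
  have eq: "frechet_derivative g (at x) = frechet_derivative f (at x)" if "x \<in> S" for x
    using frechet_derivative_at[OF der[OF that]] by simp
  have "Ck_on k S (\<lambda>x. frechet_derivative g (at x) v)" for v
    by (rule Suc.IH[of "\<lambda>x. frechet_derivative f (at x) v"]) (use eq Suc.prems in auto)
  then show ?case using der by (auto simp: differentiable_def)
qed

lemma Ck_on_SucI: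
  assumes "open S" "\<And>x. x \<in> S \<Longrightarrow> (f has_derivative f' x) (at x)"
    and "\<And>v. Ck_on k S (\<lambda>x. f' x v)"
  shows "Ck_on (Suc k) S f"
proof -
  have "frechet_derivative f (at x) = f' x" if "x \<in> S" for x
    using frechet_derivative_at[OF assms(2)[OF that]] by simp
  then have "Ck_on k S (\<lambda>x. frechet_derivative f (at x) v)" for v
    by (intro Ck_on_cong[OF assms(1) _ assms(3)[of v]]) auto
  then show ?thesis using assms(2) by (auto simp: differentiable_def)
qed

lemma Ck_on_Suc_derivative:
  "Ck_on (Suc k) S f \<Longrightarrow> x \<in> S \<Longrightarrow> (f has_derivative frechet_derivative f (at x)) (at x)"
  by (simp add: frechet_derivative_works)

lemma Ck_on_SucD: "Ck_on (Suc k) S f \<Longrightarrow> Ck_on k S f"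
proof (induction k arbitrary: f)
  case 0
  then show ?case
    by (auto intro!: continuous_at_imp_continuous_on differentiable_imp_continuous_within)
next
  case (Suc k)
  then show ?case by (metis Ck_on.simps(2))
qed

lemma Ck_on_local:
  assumes "\<And>x. x \<in> S \<Longrightarrow> \<exists>T. open T \<and> x \<in> T \<and> Ck_on k T f"
  shows "Ck_on k S f"
  using assms
proof (induction k arbitrary: f)
  case 0
  show ?case
  proof (intro continuous_at_imp_continuous_on ballI Ck_on.simps(1)[THEN iffD2])
    fix x assume "x \<in> S"
    then obtain T where "open T" "x \<in> T" "continuous_on T f" using 0 by force
    then show "isCont f x" by (simp add: continuous_on_eq_continuous_at)
  qed
next
  case (Suc k)
  have "Ck_on k S (\<lambda>x. frechet_derivative f (at x) v)" for v
    by (rule Suc.IH) (use Suc.prems in fastforce)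
  then show ?case using Suc.prems by fastforce
qed

lemma Ck_on_const: "Ck_on k S (\<lambda>x. c)"
  by (induction k arbitrary: c) (auto simp: frechet_derivative_const)

lemma Ck_on_linear:
  assumes "open S" "bounded_linear L" shows "Ck_on k S L"
proof (cases k)
  case 0
  then show ?thesis using assms(2) by (simp add: linear_continuous_on)
next
  case (Suc j)
  show ?thesis unfolding Suc
    by (rule Ck_on_SucI[OF assms(1), where f'="\<lambda>_. L"])
       (auto intro: bounded_linear_imp_has_derivative assms Ck_on_const)
qed

lemma Ck_on_linear_compose:
  assumes S: "open S" and L: "bounded_linear L" and "Ck_on k S f"
  shows "Ck_on k S (\<lambda>x. L (f x))"
  using assms(3)
proof (induction k arbitrary: f)
  case 0
  then show ?case using L by (simp add: linear_continuous_on_compose bounded_linear.continuous_on)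
next
  case (Suc k)
  show ?case
  proof (rule Ck_on_SucI[OF S])
    show "((\<lambda>x. L (f x)) has_derivative (\<lambda>v. L (frechet_derivative f (at x) v))) (at x)"
      if "x \<in> S" for x
      by (rule bounded_linear.has_derivative[OF L Ck_on_Suc_derivative[OF Suc.prems that]])
  qed (use Suc in auto)
qed

lemma Ck_on_add:
  assumes S: "open S" and "Ck_on k S f" "Ck_on k S g"
  shows "Ck_on k S (\<lambda>x. f x + g x)"
  using assms(2,3)
proof (induction k arbitrary: f g)
  case 0
  then show ?case by (auto intro: continuous_on_add)
next
  case (Suc k)
  show ?case
    by (rule Ck_on_SucI[OF S has_derivative_add[OF Ck_on_Suc_derivative[OF Suc.prems(1)]
          Ck_on_Suc_derivative[OF Suc.prems(2)]]])
       (use Suc in auto)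
qed

lemma Ck_on_bilinear:
  assumes S: "open S" and B: "bounded_bilinear B" and "Ck_on k S f" "Ck_on k S g"
  shows "Ck_on k S (\<lambda>x. B (f x) (g x))"
  using assms(3,4)
proof (induction k arbitrary: f g)
  case 0
  then show ?case by (auto intro: bounded_bilinear.continuous_on[OF B])
next
  case (Suc k)
  show ?case
  proof (rule Ck_on_SucI[OF S bounded_bilinear.FDERIV[OF B Ck_on_Suc_derivative[OF Suc.prems(1)]
          Ck_on_Suc_derivative[OF Suc.prems(2)]]])
    show "Ck_on k S (\<lambda>x. B (f x) (frechet_derivative g (at x) v) + B (frechet_derivative f (at x) v) (g x))"
      for v
      using Suc.prems Ck_on_SucD[OF Suc.prems(1)] Ck_on_SucD[OF Suc.prems(2)]
      by (intro Ck_on_add[OF S] Suc.IH) simp_all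
  qed
qed

lemma Ck_on_sum:
  assumes "open S" "finite I" "\<And>i. i \<in> I \<Longrightarrow> Ck_on k S (f i)"
  shows "Ck_on k S (\<lambda>x. \<Sum>i\<in>I. f i x)"
  using assms(2,3) by (induction I rule: finite_induct) (auto intro: Ck_on_const Ck_on_add assms(1))

lemma Ck_on_compose:
  fixes g :: "'a::euclidean_space \<Rightarrow> 'b::euclidean_space" and f :: "'b \<Rightarrow> 'c::real_normed_vector"
  assumes S: "open S" and T: "open T" and gS: "\<And>x. x \<in> S \<Longrightarrow> g x \<in> T"
    and "Ck_on k T f" "Ck_on k S g"
  shows "Ck_on k S (\<lambda>x. f (g x))"
  using assms(4,5)
proof (induction k arbitrary: f)
  case 0
  then show ?case using gS by (auto intro: continuous_on_compose2)
next
  case (Suc k)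
  show ?case
  proof (rule Ck_on_SucI[OF S])
    fix x assume x: "x \<in> S"
    have df: "(f has_derivative frechet_derivative f (at (g x))) (at (g x))"
      by (rule Ck_on_Suc_derivative[OF Suc.prems(1) gS[OF x]])
    have lin: "linear (frechet_derivative f (at (g x)))"
      using df has_derivative_linear by blast
    have "frechet_derivative f (at (g x)) (\<Sum>b\<in>Basis. (w \<bullet> b) *\<^sub>R b)
        = (\<Sum>b\<in>Basis. (w \<bullet> b) *\<^sub>R frechet_derivative f (at (g x)) b)" for w
      by (simp only: linear_sum[OF lin] linear_cmul[OF lin])
    then have rep: "(\<Sum>b\<in>Basis. (w \<bullet> b) *\<^sub>R frechet_derivative f (at (g x)) b)
        = frechet_derivative f (at (g x)) w" for w
      by (metis euclidean_representation)
    show "((\<lambda>x. f (g x)) has_derivative (\<lambda>v. \<Sum>b\<in>Basis.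
        (frechet_derivative g (at x) v \<bullet> b) *\<^sub>R frechet_derivative f (at (g x)) b)) (at x)"
      unfolding rep
      by (rule has_derivative_compose[OF Ck_on_Suc_derivative[OF Suc.prems(2) x] df])
  next
    fix v
    show "Ck_on k S (\<lambda>x. \<Sum>b\<in>Basis.
        (frechet_derivative g (at x) v \<bullet> b) *\<^sub>R frechet_derivative f (at (g x)) b)"
      using Suc.prems Ck_on_SucD[OF Suc.prems(2)]
      by (intro Ck_on_sum[OF S] Ck_on_bilinear[OF S bounded_bilinear_scaleR]
          Ck_on_linear_compose[OF S bounded_linear_inner_left] Suc.IH) simp_all
  qed
qed

lemma Ck_on_inverse:
  fixes f :: "'a::euclidean_space \<Rightarrow> real"
  assumes S: "open S" and "\<And>x. x \<in> S \<Longrightarrow> f x \<noteq> 0" and "Ck_on k S f"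
  shows "Ck_on k S (\<lambda>x. inverse (f x))"
  using assms(3)
proof (induction k)
  case 0
  then show ?case using assms(2) by (auto intro: continuous_on_inverse)
next
  case (Suc k)
  have inv: "Ck_on k S (\<lambda>x. inverse (f x))" by (rule Suc.IH[OF Ck_on_SucD[OF Suc.prems]])
  show ?case
  proof (rule Ck_on_SucI[OF S])
    show "((\<lambda>x. inverse (f x)) has_derivative
        (\<lambda>v. - 1 * ((inverse (f x) * frechet_derivative f (at x) v) * inverse (f x)))) (at x)"
      if "x \<in> S" for x
      using Deriv.has_derivative_inverse[OF assms(2)[OF that] Ck_on_Suc_derivative[OF Suc.prems that]]
      by simp
    show "Ck_on k S (\<lambda>x. - 1 * ((inverse (f x) * frechet_derivative f (at x) v) * inverse (f x)))" for v
      using Suc.prems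
      by (intro Ck_on_bilinear[OF S bounded_bilinear_mult] Ck_on_const inv) auto
  qed
qed

subsection \<open>Smooth maps\<close>

lemma smooth_on_continuous: "smooth_on S f \<Longrightarrow> continuous_on S f"
  unfolding smooth_on_def by (metis Ck_on.simps(1))

lemma smooth_on_Ck_on: "smooth_on S f \<Longrightarrow> Ck_on k S f"
  by (simp add: smooth_on_def)

lemma smooth_on_subset: "smooth_on S f \<Longrightarrow> T \<subseteq> S \<Longrightarrow> smooth_on T f"
  unfolding smooth_on_def using Ck_on_subset by blast

lemma smooth_on_cong:
  "smooth_on S f \<Longrightarrow> open S \<Longrightarrow> (\<And>x. x \<in> S \<Longrightarrow> f x = g x) \<Longrightarrow> smooth_on S g"
  unfolding smooth_on_def using Ck_on_cong by blast

lemma smooth_on_local: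
  assumes "\<And>x. x \<in> S \<Longrightarrow> \<exists>T. open T \<and> x \<in> T \<and> smooth_on T f"
  shows "smooth_on S f"
  unfolding smooth_on_def
proof
  fix k show "Ck_on k S f"
    by (rule Ck_on_local) (use assms in \<open>force simp: smooth_on_def\<close>)
qed

lemma smooth_on_has_derivative:
  "smooth_on S f \<Longrightarrow> x \<in> S \<Longrightarrow> (f has_derivative frechet_derivative f (at x)) (at x)"
  unfolding smooth_on_def by (rule Ck_on_Suc_derivative[of 0]) blast+

lemma smooth_on_derivative: "smooth_on S f \<Longrightarrow> smooth_on S (\<lambda>x. frechet_derivative f (at x) v)"
  unfolding smooth_on_def by (metis Ck_on.simps(2))

lemma smooth_on_derivativeI:
  assumes "open S" "\<And>x. x \<in> S \<Longrightarrow> (f has_derivative f' x) (at x)"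
    and "\<And>v. smooth_on S (\<lambda>x. f' x v)"
  shows "smooth_on S f"
  unfolding smooth_on_def
proof
  fix k show "Ck_on k S f"
    by (rule Ck_on_SucD[OF Ck_on_SucI[OF assms(1,2)]]) (use assms(3) in \<open>simp_all add: smooth_on_def\<close>)
qed

lemma linear_frechet_derivative_smooth:
  "smooth_on S f \<Longrightarrow> x \<in> S \<Longrightarrow> linear (frechet_derivative f (at x))"
  using smooth_on_has_derivative has_derivative_linear by blast

lemma smooth_on_const [simp, intro]: "smooth_on S (\<lambda>x. c)"
  by (simp add: smooth_on_def Ck_on_const)

lemma smooth_on_ident: "open S \<Longrightarrow> smooth_on S (\<lambda>x. x)"
  by (simp add: smooth_on_def Ck_on_linear)

lemma smooth_on_linear_compose:
  "open S \<Longrightarrow> bounded_linear L \<Longrightarrow> smooth_on S f \<Longrightarrow> smooth_on S (\<lambda>x. L (f x))"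
  by (simp add: smooth_on_def Ck_on_linear_compose)

lemma smooth_on_add: "open S \<Longrightarrow> smooth_on S f \<Longrightarrow> smooth_on S g \<Longrightarrow> smooth_on S (\<lambda>x. f x + g x)"
  by (simp add: smooth_on_def Ck_on_add)

lemma smooth_on_scaleR:
  "open S \<Longrightarrow> smooth_on S f \<Longrightarrow> smooth_on S g \<Longrightarrow> smooth_on S (\<lambda>x. f x *\<^sub>R g x)"
  by (simp add: smooth_on_def Ck_on_bilinear[OF _ bounded_bilinear_scaleR])

lemma smooth_on_inner:
  fixes f g :: "_ \<Rightarrow> 'b::real_inner"
  shows "open S \<Longrightarrow> smooth_on S f \<Longrightarrow> smooth_on S g \<Longrightarrow> smooth_on S (\<lambda>x. f x \<bullet> g x)"
  by (simp add: smooth_on_def Ck_on_bilinear[OF _ bounded_bilinear_inner])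

lemma smooth_on_mult:
  fixes f g :: "_ \<Rightarrow> real"
  shows "open S \<Longrightarrow> smooth_on S f \<Longrightarrow> smooth_on S g \<Longrightarrow> smooth_on S (\<lambda>x. f x * g x)"
  by (simp add: smooth_on_def Ck_on_bilinear[OF _ bounded_bilinear_mult])

lemma smooth_on_minus: "open S \<Longrightarrow> smooth_on S f \<Longrightarrow> smooth_on S (\<lambda>x. - f x)"
  using smooth_on_linear_compose[of S uminus f] by (simp add: bounded_linear_minus bounded_linear_ident)

lemma smooth_on_diff: "open S \<Longrightarrow> smooth_on S f \<Longrightarrow> smooth_on S g \<Longrightarrow> smooth_on S (\<lambda>x. f x - g x)"
  using smooth_on_add[OF _ _ smooth_on_minus, of S f g] by simp

lemma smooth_on_sum:
  "open S \<Longrightarrow> (\<And>i. i \<in> I \<Longrightarrow> smooth_on S (f i)) \<Longrightarrow> smooth_on S (\<lambda>x. \<Sum>i\<in>I. f i x)"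
  by (cases "finite I") (simp_all add: smooth_on_def Ck_on_sum Ck_on_const)

lemma smooth_on_prod:
  fixes f :: "'i \<Rightarrow> 'a::euclidean_space \<Rightarrow> real"
  assumes "open S" "\<And>i. i \<in> I \<Longrightarrow> smooth_on S (f i)"
  shows "smooth_on S (\<lambda>x. \<Prod>i\<in>I. f i x)"
proof (cases "finite I")
  case True
  then show ?thesis using assms(2)
    by (induction I rule: finite_induct) (auto intro: smooth_on_mult assms(1))
qed simp

lemma smooth_on_divide:
  fixes f g :: "_ \<Rightarrow> real"
  assumes "open S" "smooth_on S f" "smooth_on S g" "\<And>x. x \<in> S \<Longrightarrow> g x \<noteq> 0"
  shows "smooth_on S (\<lambda>x. f x / g x)"
proof -
  have "smooth_on S (\<lambda>x. inverse (g x))"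
    using assms by (simp add: smooth_on_def Ck_on_inverse)
  then show ?thesis using smooth_on_mult[OF assms(1,2)] by (simp add: divide_inverse)
qed

lemma smooth_on_compose:
  fixes g :: "'a::euclidean_space \<Rightarrow> 'b::euclidean_space" and f :: "'b \<Rightarrow> 'c::real_normed_vector"
  shows "smooth_on T f \<Longrightarrow> smooth_on S g \<Longrightarrow> open S \<Longrightarrow> open T \<Longrightarrow> (\<And>x. x \<in> S \<Longrightarrow> g x \<in> T)
    \<Longrightarrow> smooth_on S (\<lambda>x. f (g x))"
  by (simp add: smooth_on_def Ck_on_compose)

lemma smooth_on_nth: "open S \<Longrightarrow> smooth_on S f \<Longrightarrow> smooth_on S (\<lambda>x. f x $ i)"
  by (rule smooth_on_linear_compose[OF _ bounded_linear_vec_nth])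

lemma smooth_on_vec_lambda:
  fixes f :: "'a::euclidean_space \<Rightarrow> 'n::finite \<Rightarrow> real"
  assumes "open S" "\<And>i. smooth_on S (\<lambda>x. f x i)"
  shows "smooth_on S (\<lambda>x. \<chi> i. f x i)"
proof -
  have eq: "(\<chi> i. f x i) = (\<Sum>i\<in>UNIV. f x i *\<^sub>R axis i 1)" for x
    by (simp add: vec_eq_iff axis_def if_distrib[of "\<lambda>t. _ * t"] cong: if_cong)
  show ?thesis unfolding eq
    by (intro smooth_on_sum smooth_on_scaleR assms smooth_on_const)
qed

lemma smooth_on_det:
  fixes A :: "'a::euclidean_space \<Rightarrow> real^'n^'n"
  assumes "open S" "\<And>i j. smooth_on S (\<lambda>x. A x $ i $ j)"
  shows "smooth_on S (\<lambda>x. det (A x))"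
  unfolding det_def
  by (intro smooth_on_sum smooth_on_mult smooth_on_prod assms smooth_on_const)

lemma linear_axis_expansion:
  fixes f :: "real^'k \<Rightarrow> 'b::real_vector"
  assumes "linear f" shows "f v = (\<Sum>i\<in>UNIV. v $ i *\<^sub>R f (axis i 1))"
proof -
  have v: "v = (\<Sum>i\<in>UNIV. v $ i *\<^sub>R axis i 1)"
    by (simp add: vec_eq_iff axis_def if_distrib[of "\<lambda>t. _ * t"] cong: if_cong)
  have "f (\<Sum>i\<in>UNIV. v $ i *\<^sub>R axis i 1) = (\<Sum>i\<in>UNIV. v $ i *\<^sub>R f (axis i 1))"
    by (simp only: linear_sum[OF assms] linear_cmul[OF assms])
  then show ?thesis using v by simp
qed

lemma smooth_on_apply_derivative:
  fixes f :: "real^'k \<Rightarrow> 'c::real_normed_vector" and g :: "'a::euclidean_space \<Rightarrow> real^'k"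
  assumes S: "open S" and T: "open T" and f: "smooth_on T f" and g: "smooth_on S g" "\<And>x. x \<in> S \<Longrightarrow> g x \<in> T"
    and v: "smooth_on S v"
  shows "smooth_on S (\<lambda>x. frechet_derivative f (at (g x)) (v x))"
proof (rule smooth_on_cong[OF _ S])
  show "smooth_on S (\<lambda>x. \<Sum>i\<in>UNIV. v x $ i *\<^sub>R frechet_derivative f (at (g x)) (axis i 1))"
    by (intro smooth_on_sum smooth_on_scaleR smooth_on_nth v S
        smooth_on_compose[OF smooth_on_derivative[OF f] g(1) S T g(2)])
  show "(\<Sum>i\<in>UNIV. v x $ i *\<^sub>R frechet_derivative f (at (g x)) (axis i 1)) = frechet_derivative f (at (g x)) (v x)"
    if "x \<in> S" for x
    by (rule linear_axis_expansion[OF linear_frechet_derivative_smooth[OF f g(2)[OF that]], symmetric])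
qed

lemma derivative_zero_on_open:
  assumes "open T" "\<And>x. x \<in> T \<Longrightarrow> f x = 0" "x \<in> T"
  shows "frechet_derivative f (at x) v = 0"
proof -
  have "((\<lambda>_. 0) has_derivative (\<lambda>v. 0)) (at x)" by simp
  then have "(f has_derivative (\<lambda>v. 0)) (at x)"
    by (rule has_derivative_transform_within_open[OF _ assms(1,3)]) (use assms in auto)
  from frechet_derivative_at[OF this] show ?thesis by metis
qed

lemma derivative_zero_outside:
  assumes "closed K" "\<And>x. x \<notin> K \<Longrightarrow> f x = 0" "x \<notin> K"
  shows "frechet_derivative f (at x) v = 0"
  by (rule derivative_zero_on_open[of "- K"]) (use assms in auto)

text \<open>
  The solution is smooth because Cramer's rule writes it as a quotient of determinants.
\<close>

lemma smooth_on_solve: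
  fixes A :: "'a::euclidean_space \<Rightarrow> real^'n^'n" and b :: "'a \<Rightarrow> real^'n"
  assumes S: "open S" and A: "\<And>i j. smooth_on S (\<lambda>x. A x $ i $ j)" and b: "smooth_on S b"
    and det: "\<And>x. x \<in> S \<Longrightarrow> det (A x) \<noteq> 0"
  obtains y where "smooth_on S y" "\<And>x. x \<in> S \<Longrightarrow> A x *v y x = b x"
proof
  let ?y = "\<lambda>x. \<chi> k. det (\<chi> i j. if j = k then b x $ i else A x $ i $ j) / det (A x)"
  show "smooth_on S ?y"
  proof (intro smooth_on_vec_lambda smooth_on_divide smooth_on_det S A det)
    show "smooth_on S (\<lambda>x. (\<chi> i j. if j = k then b x $ i else A x $ i $ j) $ i $ j)" for k i j
      by (cases "j = k") (auto intro: A smooth_on_nth[OF S b])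
  qed
  show "A x *v ?y x = b x" if "x \<in> S" for x
    using cramer[OF det[OF that], of "?y x" "b x"] by simp
qed

lemma smooth_on_extend_by_zero:
  fixes f :: "'a::euclidean_space \<Rightarrow> 'b::real_normed_vector"
  assumes "open R" "closed K" "K \<subseteq> R" "smooth_on R f" "\<And>x. x \<in> R \<Longrightarrow> x \<notin> K \<Longrightarrow> f x = 0"
  shows "smooth_on UNIV (\<lambda>x. if x \<in> R then f x else 0)"
proof (rule smooth_on_local)
  fix x :: 'a
  show "\<exists>T. open T \<and> x \<in> T \<and> smooth_on T (\<lambda>x. if x \<in> R then f x else 0)"
  proof (cases "x \<in> R")
    case True
    then show ?thesis using assms by (intro exI[of _ R]) (auto intro: smooth_on_cong[of R f])
  next
    case False
    then show ?thesis using assms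
      by (intro exI[of _ "- K"]) (auto intro: smooth_on_cong[of "-K" "\<lambda>_. 0"])
  qed
qed

section \<open>Calculus of compactly supported functions\<close>

subsection \<open>Bump functions\<close>

text \<open>
  The classical function \<open>exp (-1/t)\<close>, extended by 0, together with its products with powers of \<open>1/t\<close>:
  this family contains the derivatives of its members up to linear combinations, which gives smoothness
  by induction.
\<close>

definition flat :: "nat \<Rightarrow> real \<Rightarrow> real" where
  "flat n t = (if t > 0 then exp (- inverse t) * inverse t ^ n else 0)"

lemma power_le_fact_exp:
  fixes y :: real assumes "y \<ge> 0" shows "y ^ n \<le> fact n * exp y"
proof -
  have "(\<Sum>k\<in>{n}. y ^ k /\<^sub>R fact k) \<le> (\<Sum>k. y ^ k /\<^sub>R fact k)"
    by (rule sum_le_suminf[OF summable_exp_generic]) (use assms in auto)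
  then show ?thesis by (simp add: exp_def field_simps)
qed

text \<open>
  The bound is quadratic in \<open>t\<close>, so that the derivative at 0 exists and is 0.
\<close>

lemma flat_bound: "\<bar>flat n t\<bar> \<le> fact (n + 2) * t\<^sup>2"
proof (cases "t > 0")
  case True
  have "inverse t ^ (n + 2) \<le> fact (n + 2) * exp (inverse t)"
    using True by (intro power_le_fact_exp) auto
  then have "exp (- inverse t) * inverse t ^ (n + 2) \<le> exp (- inverse t) * (fact (n + 2) * exp (inverse t))"
    by (intro mult_left_mono) auto
  also have "\<dots> = fact (n + 2)" by (simp add: exp_minus del: fact_Suc add_2_eq_Suc')
  finally have "exp (- inverse t) * inverse t ^ (n + 2) \<le> fact (n + 2)" .
  then have "exp (- inverse t) * inverse t ^ (n + 2) * t\<^sup>2 \<le> fact (n + 2) * t\<^sup>2"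
    by (intro mult_right_mono) auto
  moreover have "exp (- inverse t) * inverse t ^ (n + 2) * t\<^sup>2 = exp (- inverse t) * inverse t ^ n"
    using True by (simp add: power2_eq_square field_simps)
  ultimately show ?thesis
    using True by (simp add: flat_def abs_mult del: fact_Suc add_2_eq_Suc' power_Suc)
qed (simp add: flat_def)

lemma flat_derivative:
  "(flat n has_real_derivative (flat (n + 2) t - real n * flat (n + 1) t)) (at t)"
proof -
  consider "t > 0" | "t < 0" | "t = 0" by linarith
  then show ?thesis
  proof cases
    case 1
    have pw: "m \<noteq> 0 \<Longrightarrow> inverse t ^ m = inverse t * inverse t ^ (m - Suc 0)" for m
      by (cases m) auto
    have "((\<lambda>t. exp (- inverse t) * inverse t ^ n) has_real_derivative
        (flat (n + 2) t - real n * flat (n + 1) t)) (at t)"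
      using 1 by ((cases n; auto intro!: derivative_eq_intros simp: flat_def power2_eq_square algebra_simps),
        metis pw)
    then show ?thesis
      by (rule has_field_derivative_transform_within_open[where S="{0<..}"])
         (use 1 in \<open>auto simp: flat_def\<close>)
  next
    case 2
    have "((\<lambda>t. 0) has_real_derivative (flat (n + 2) t - real n * flat (n + 1) t)) (at t)"
      using 2 by (simp add: flat_def)
    then show ?thesis
      by (rule has_field_derivative_transform_within_open[where S="{..<0}"])
         (use 2 in \<open>auto simp: flat_def\<close>)
  next
    case 3
    have "((\<lambda>h. fact (n + 2) * \<bar>h\<bar>) \<longlongrightarrow> fact (n + 2) * \<bar>0::real\<bar>) (at 0)"
      by (intro tendsto_intros)
    then have lim: "((\<lambda>h. fact (n + 2) * \<bar>h\<bar>) \<longlongrightarrow> (0::real)) (at 0)" by simp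
    have "((\<lambda>h. flat n h / h) \<longlongrightarrow> 0) (at 0)"
    proof (rule Lim_null_comparison[OF _ lim])
      show "\<forall>\<^sub>F h in at 0. norm (flat n h / h) \<le> fact (n + 2) * \<bar>h\<bar>"
      proof (intro eventually_at_topological[THEN iffD2] exI[of _ UNIV] conjI ballI impI)
        fix h :: real
        show "norm (flat n h / h) \<le> fact (n + 2) * \<bar>h\<bar>"
        proof -
          have "norm (flat n h / h) \<le> fact (n + 2) * h\<^sup>2 / \<bar>h\<bar>"
            using flat_bound[of n h] by (simp add: divide_right_mono del: fact_Suc add_2_eq_Suc')
          also have "\<dots> = fact (n + 2) * \<bar>h\<bar>"
            by (cases "h = 0") (simp_all add: abs_if power2_eq_square)
          finally show ?thesis .
        qed
      qed auto
    qed
    then show ?thesis using 3 by (simp add: DERIV_def flat_def)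
  qed
qed

lemma smooth_flat: "smooth_on UNIV (flat n)"
  unfolding smooth_on_def
proof
  fix k show "Ck_on k UNIV (flat n)"
  proof (induction k arbitrary: n)
    case 0
    then show ?case
      by (auto intro!: continuous_at_imp_continuous_on DERIV_isCont flat_derivative)
  next
    case (Suc k)
    have "(flat n has_derivative (\<lambda>v. v *\<^sub>R flat (n + 2) t + (v * - real n) *\<^sub>R flat (n + 1) t)) (at t)" for t
      by (rule has_derivative_eq_rhs[OF flat_derivative[unfolded has_field_derivative_def]])
         (auto simp: fun_eq_iff algebra_simps)
    then show ?case
      by (rule Ck_on_SucI[OF open_UNIV])
         (intro Ck_on_add Ck_on_bilinear[OF _ bounded_bilinear_scaleR] Ck_on_const Suc open_UNIV)
  qed
qed

lemma bump_exists:
  fixes c :: "'a::euclidean_space"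
  assumes "r > 0"
  obtains g :: "'a \<Rightarrow> real" where "smooth_on UNIV g" "\<And>x. g x \<ge> 0" "\<And>x. g x > 0 \<longleftrightarrow> dist x c < r"
proof
  let ?g = "\<lambda>x. flat 0 (r\<^sup>2 - (x - c) \<bullet> (x - c))"
  show "smooth_on UNIV ?g"
    by (rule smooth_on_compose[OF smooth_flat])
       (auto intro!: smooth_on_diff smooth_on_inner smooth_on_ident)
  show "?g x \<ge> 0" for x by (simp add: flat_def)
  show "?g x > 0 \<longleftrightarrow> dist x c < r" for x
    using assms norm_lt_square[of "x - c" r] by (auto simp: flat_def dist_norm)
qed

subsection \<open>Integrals\<close>

lemma absolutely_integrable_compact_support:
  fixes f :: "'a::euclidean_space \<Rightarrow> 'b::euclidean_space"
  assumes "continuous_on UNIV f" "bounded {x. f x \<noteq> 0}"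
  shows "f absolutely_integrable_on UNIV"
proof -
  obtain a where a: "{x. f x \<noteq> 0} \<subseteq> cbox (-a) a"
    using bounded_subset_cbox_symmetric[OF assms(2)] by blast
  have "f absolutely_integrable_on cbox (-a) a"
    using assms(1) by (intro absolutely_integrable_continuous) (rule continuous_on_subset, auto)
  then have "(\<lambda>x. if x \<in> cbox (-a) a then f x else 0) absolutely_integrable_on UNIV"
    by (simp only: absolutely_integrable_restrict_UNIV)
  moreover have "(\<lambda>x. if x \<in> cbox (-a) a then f x else 0) = f" using a by (auto simp: fun_eq_iff)
  ultimately show ?thesis by simp
qed

lemma integral_support_subset:
  fixes f :: "'a::euclidean_space \<Rightarrow> 'b::banach"
  assumes "{x. f x \<noteq> 0} \<subseteq> S" shows "integral S f = integral UNIV f"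
proof -
  have "(\<lambda>x. if x \<in> S then f x else 0) = f" using assms by (auto simp: fun_eq_iff)
  then show ?thesis using integral_restrict_UNIV[of S f] by simp
qed

lemma integral_translate:
  fixes f :: "'a::euclidean_space \<Rightarrow> 'b::euclidean_space"
  assumes "bounded {x. f x \<noteq> 0}"
  shows "integral UNIV (\<lambda>x. f (x + c)) = integral UNIV f"
proof -
  obtain a where a: "{x. f x \<noteq> 0} \<subseteq> cbox (-a) a"
    using bounded_subset_cbox_symmetric[OF assms] by blast
  have "{x. f (x + c) \<noteq> 0} \<subseteq> cbox (-a - c) (a - c)"
  proof
    fix x assume "x \<in> {x. f (x + c) \<noteq> 0}"
    then have "x + c \<in> cbox (-a) a" using a by auto
    then show "x \<in> cbox (-a - c) (a - c)" by (simp add: mem_box algebra_simps)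
  qed
  then show ?thesis
    using integral_shift_cbox[of "-a" c a f] integral_support_subset[OF a]
      integral_support_subset[of "\<lambda>x. f (x + c)"] by metis
qed

lemma integral_positive:
  fixes f :: "'a::euclidean_space \<Rightarrow> real"
  assumes f: "continuous_on UNIV f" "bounded {x. f x \<noteq> 0}" and nonneg: "\<And>x. f x \<ge> 0"
    and x: "f x > 0"
  shows "integral UNIV f > 0"
proof (rule ccontr)
  assume "\<not> ?thesis"
  moreover have "integral UNIV f \<ge> 0"
    using nonneg by (intro integral_nonneg absolutely_integrable_on_def[THEN iffD1, THEN conjunct1]
        absolutely_integrable_compact_support f) auto
  ultimately have 0: "integral UNIV f = 0" by simp
  obtain a where a: "{y. f y \<noteq> 0} \<subseteq> cbox (-a) a"
    using bounded_subset_cbox_symmetric[OF f(2)] by blast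
  define b where "b = a + One"
  have sub: "cbox (-a) a \<subseteq> cbox (-b) b"
    by (rule subset_box_imp) (auto simp: b_def inner_add_left inner_diff_left)
  have "x \<in> cbox (-a) a" using a x by auto
  then have xb: "x \<in> box (-b) b"
    by (fastforce simp: b_def mem_box inner_add_left inner_diff_left)
  have cont: "continuous_on (cbox (-b) b) f" using f(1) continuous_on_subset by blast
  have xc: "x \<in> cbox (-b) b" using xb box_subset_cbox by blast
  have "integral (cbox (-b) b) f = 0"
    using integral_support_subset[of f "cbox (-b) b"] a sub 0 by (metis subset_trans)
  then have hi: "(f has_integral 0) (cbox (-b) b)"
    using integrable_integral[OF integrable_continuous[OF cont]] by simp
  have "f x = 0"
    by (rule has_integral_0_cbox_imp_0[OF cont nonneg hi _ xc]) (use xb in auto)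
  then show False using x by simp
qed

text \<open>
  Where the function is not zero, it keeps its sign on a small ball, and its integral against a bump on
  this ball has that sign.
\<close>

lemma vanishes_if_bump_integrals_vanish:
  fixes w :: "'a::euclidean_space \<Rightarrow> real"
  assumes S: "open S" and w: "continuous_on S w"
    and int: "\<And>g c r. smooth_on UNIV g \<Longrightarrow> r > 0 \<Longrightarrow> cball c r \<subseteq> S \<Longrightarrow> (\<And>x. g x \<noteq> 0 \<Longrightarrow> x \<in> cball c r)
      \<Longrightarrow> integral UNIV (\<lambda>x. g x * w x) = 0"
    and x: "x \<in> S"
  shows "w x = 0"
proof (rule ccontr)
  assume nz: "w x \<noteq> 0"
  define s where "s = sgn (w x)"
  have "\<forall>\<^sub>F y in nhds x. s * w y > 0"
  proof -
    have "isCont (\<lambda>y. s * w y) x"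
      using S w x by (auto intro!: continuous_intros simp: continuous_on_eq_continuous_at)
    moreover have "s * w x > 0" using nz by (simp add: s_def sgn_mult_self_eq abs_sgn[symmetric] mult.commute)
    ultimately show ?thesis
      by (metis order_tendstoD(1) isCont_def tendsto_at_iff_tendsto_nhds)
  qed
  moreover have "\<forall>\<^sub>F y in nhds x. y \<in> S" using S x eventually_nhds by blast
  ultimately have "\<forall>\<^sub>F y in nhds x. y \<in> S \<and> s * w y > 0" by eventually_elim auto
  then obtain r where r: "r > 0" "\<And>y. dist y x < r \<Longrightarrow> y \<in> S \<and> s * w y > 0"
    by (auto simp: eventually_nhds_metric)
  obtain g :: "'a \<Rightarrow> real" where g: "smooth_on UNIV g" "\<And>y. g y \<ge> 0" "\<And>y. g y > 0 \<longleftrightarrow> dist y x < r/2"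
    using bump_exists[of "r/2" x] r(1) by (metis half_gt_zero)
  have g0: "y \<in> cball x (r/2)" if "g y \<noteq> 0" for y
    using g(2)[of y] g(3)[of y] that by (auto simp: dist_commute)
  have sub: "cball x (r/2) \<subseteq> S" using r by (auto simp: dist_commute)
  have z: "integral UNIV (\<lambda>y. g y * w y) = 0"
    using int[OF g(1) _ sub g0] r(1) by auto
  have eq: "(\<lambda>y. s * (g y * w y)) = (\<lambda>y. if y \<in> S then g y * (s * w y) else 0)"
  proof
    fix y show "s * (g y * w y) = (if y \<in> S then g y * (s * w y) else 0)"
      using g0[of y] sub by (cases "g y = 0") auto
  qed
  have nn: "s * (g y * w y) \<ge> 0" for y
  proof (cases "g y = 0")
    case False
    then have "s * w y > 0" using g0[OF False] r by (auto simp: dist_commute)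
    then show ?thesis using g(2)[of y] by (metis mult.left_commute mult_nonneg_nonneg less_imp_le)
  qed simp
  have bdd: "bounded {y. s * (g y * w y) \<noteq> 0}"
    by (rule bounded_subset[OF bounded_cball[of x "r/2"]]) (use g0 in auto)
  have cont: "continuous_on UNIV (\<lambda>y. s * (g y * w y))"
  proof (rule continuous_at_imp_continuous_on, rule ballI)
    fix y
    show "isCont (\<lambda>y. s * (g y * w y)) y"
    proof (cases "y \<in> S")
      case True
      have "isCont g y" using smooth_on_continuous[OF g(1)] by (simp add: continuous_on_eq_continuous_at)
      moreover have "isCont w y" using w S True by (simp add: continuous_on_eq_continuous_at)
      ultimately show ?thesis by (intro continuous_intros)
    next
      case False
      have "continuous_on (- cball x (r/2)) (\<lambda>y. s * (g y * w y))"
        by (rule continuous_on_cong[THEN iffD2, OF refl _ continuous_on_const[of _ 0]]) (use g0 in auto)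
      then show ?thesis using False sub
        by (metis ComplI closed_cball continuous_on_eq_continuous_at open_Compl subset_eq)
    qed
  qed
  have "s * (g x * w x) > 0"
    using r g(3)[of x] by (metis mult.left_commute dist_self half_gt_zero mult_pos_pos)
  then have "integral UNIV (\<lambda>y. s * (g y * w y)) > 0"
    by (rule integral_positive[OF cont bdd nn])
  then show False using z by simp
qed

text \<open>
  The Leibniz rule, with continuity of the derivative required only for its values on fixed vectors;
  in finite dimension this is the same as continuity in the operator norm.
\<close>

lemma has_derivative_integral:
  fixes g :: "'a::euclidean_space \<Rightarrow> 'c::euclidean_space \<Rightarrow> 'b::euclidean_space"
  assumes S: "open S" "convex S" "x0 \<in> S"
    and der: "\<And>x t. x \<in> S \<Longrightarrow> t \<in> cbox a b \<Longrightarrow> ((\<lambda>x. g x t) has_derivative g' x t) (at x)"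
    and cont: "continuous_on (S \<times> cbox a b) (\<lambda>(x, t). g x t)"
    and cont': "\<And>v. continuous_on (S \<times> cbox a b) (\<lambda>(x, t). g' x t v)"
  shows "((\<lambda>x. integral (cbox a b) (g x)) has_derivative
    (\<lambda>v. integral (cbox a b) (\<lambda>t. g' x0 t v))) (at x0)"
proof -
  define fx where "fx x t = Blinfun (g' x t)" for x t
  have fx: "blinfun_apply (fx x t) = g' x t" if "x \<in> S" "t \<in> cbox a b" for x t
    unfolding fx_def using has_derivative_bounded_linear[OF der[OF that]] by (rule bounded_linear_Blinfun_apply)
  have contfx: "continuous_on (S \<times> cbox a b) (\<lambda>(x, t). fx x t)"
    unfolding split_beta
  proof (rule continuous_on_blinfun_componentwise)
    fix i :: 'a
    show "continuous_on (S \<times> cbox a b) (\<lambda>p. blinfun_apply (fx (fst p) (snd p)) i)"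
      by (rule continuous_on_cong[THEN iffD1, OF refl _ cont'[of i]]) (auto simp: fx)
  qed
  have "((\<lambda>x. integral (cbox a b) (g x)) has_derivative blinfun_apply (integral (cbox a b) (fx x0)))
      (at x0 within S)"
  proof (rule leibniz_rule[OF _ _ contfx S(3,2)])
    show "((\<lambda>x. g x t) has_derivative blinfun_apply (fx x t)) (at x within S)"
      if "x \<in> S" "t \<in> cbox a b" for x t
      using der[OF that] fx[OF that] by (simp add: has_derivative_at_withinI)
    show "g x integrable_on cbox a b" if "x \<in> S" for x
      by (rule integrable_continuous)
         (rule continuous_on_compose2[OF cont, of _ "\<lambda>t. (x, t)", simplified],
           use that in \<open>auto intro!: continuous_intros\<close>)
  qed
  moreover have "fx x0 integrable_on cbox a b"
    by (rule integrable_continuous)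
       (rule continuous_on_compose2[OF contfx, of _ "\<lambda>t. (x0, t)", simplified],
         use S in \<open>auto intro!: continuous_intros\<close>)
  then have "blinfun_apply (integral (cbox a b) (fx x0)) = (\<lambda>v. integral (cbox a b) (\<lambda>t. g' x0 t v))"
    by (simp add: fun_eq_iff blinfun_apply_integral fx[OF S(3)] cong: integral_cong)
  ultimately show ?thesis using at_within_open[OF S(3,1)] by simp
qed

subsection \<open>Integrals along line segments\<close>

lemma has_derivative_translate:
  assumes "(f has_derivative f') (at (x + c))"
  shows "((\<lambda>x. f (x + c)) has_derivative f') (at x)"
proof -
  have "((\<lambda>x. x + c) has_derivative (\<lambda>v. v)) (at x)" by (auto intro!: derivative_eq_intros)
  from has_derivative_compose[OF this assms] show ?thesis .
qed

lemma Ck_on_continuous: "Ck_on k S f \<Longrightarrow> continuous_on S f"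
proof (induction k)
  case (Suc k)
  then show ?case using Ck_on_SucD by blast
qed simp

lemma has_derivative_line_integral:
  fixes f :: "'a::euclidean_space \<Rightarrow> 'b::euclidean_space"
  assumes f: "Ck_on (Suc 0) UNIV f"
  shows "((\<lambda>x. integral (cbox 0 R) (\<lambda>s::real. f (x + s *\<^sub>R v))) has_derivative
    (\<lambda>w. integral (cbox 0 R) (\<lambda>s. frechet_derivative f (at (x + s *\<^sub>R v)) w))) (at x)"
proof (rule has_derivative_integral[OF open_UNIV convex_UNIV UNIV_I])
  show "((\<lambda>x. f (x + t *\<^sub>R v)) has_derivative frechet_derivative f (at (x + t *\<^sub>R v))) (at x)" for x t
    by (rule has_derivative_translate[OF Ck_on_Suc_derivative[OF f UNIV_I]])
  show "continuous_on (UNIV \<times> cbox 0 R) (\<lambda>(x, t). f (x + t *\<^sub>R v))"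
    by (auto simp: split_beta intro!: continuous_on_compose2[OF Ck_on_continuous[OF f]] continuous_intros)
  have cont': "continuous_on UNIV (\<lambda>x. frechet_derivative f (at x) w)" for w
    using f by simp
  have "continuous_on (UNIV \<times> cbox 0 R)
      (\<lambda>p. frechet_derivative f (at (fst p + snd p *\<^sub>R v)) w)" for w
    by (rule continuous_on_compose2[OF cont'[of w]]) (auto intro!: continuous_intros)
  then show "continuous_on (UNIV \<times> cbox 0 R)
      (\<lambda>(x, t). frechet_derivative f (at (x + t *\<^sub>R v)) w)" for w
    by (simp add: split_beta)
qed

lemma Ck_on_line_integral:
  fixes f :: "'a::euclidean_space \<Rightarrow> 'b::euclidean_space"
  assumes "Ck_on k UNIV f"
  shows "Ck_on k UNIV (\<lambda>x. integral (cbox 0 R) (\<lambda>s::real. f (x + s *\<^sub>R v)))"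
  using assms
proof (induction k arbitrary: f)
  case 0
  then have "continuous_on (UNIV \<times> cbox 0 R) (\<lambda>(x, s). f (x + s *\<^sub>R v))"
    by (auto simp: split_beta intro!: continuous_on_compose2[of UNIV f] continuous_intros)
  then show ?case by (simp add: integral_continuous_on_param del: box_real)
next
  case (Suc k)
  have "Ck_on (Suc 0) UNIV f" using Suc.prems by (auto intro: Ck_on_continuous)
  then show ?case
    by (intro Ck_on_SucI[OF open_UNIV has_derivative_line_integral]) (use Suc in auto)
qed

lemma smooth_on_line_integral:
  fixes f :: "'a::euclidean_space \<Rightarrow> 'b::euclidean_space"
  shows "smooth_on UNIV f \<Longrightarrow> smooth_on UNIV (\<lambda>x. integral (cbox 0 R) (\<lambda>s::real. f (x + s *\<^sub>R v)))"
  by (simp add: smooth_on_def Ck_on_line_integral del: box_real)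

lemma derivative_along_line:
  assumes "(f has_derivative f') (at (x + s *\<^sub>R v))"
  shows "((\<lambda>s. f (x + s *\<^sub>R v)) has_vector_derivative f' v) (at s within T)"
proof -
  have "((\<lambda>s. x + s *\<^sub>R v) has_derivative (\<lambda>h. h *\<^sub>R v)) (at s within T)"
    by (auto intro!: derivative_eq_intros)
  from has_derivative_compose[OF this assms]
  show ?thesis
    using linear_cmul[OF has_derivative_linear[OF assms]] by (simp add: has_vector_derivative_def)
qed

lemma line_integral_of_derivative:
  fixes f :: "'a::euclidean_space \<Rightarrow> 'b::euclidean_space"
  assumes "smooth_on UNIV f" "R \<ge> 0"
  shows "integral (cbox 0 R) (\<lambda>s. frechet_derivative f (at (x + s *\<^sub>R v)) v) = f (x + R *\<^sub>R v) - f x"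
proof -
  have "((\<lambda>s. frechet_derivative f (at (x + s *\<^sub>R v)) v) has_integral
      (f (x + R *\<^sub>R v) - f (x + 0 *\<^sub>R v))) {0..R}"
    by (rule fundamental_theorem_of_calculus[OF assms(2)])
       (rule derivative_along_line[OF smooth_on_has_derivative[OF assms(1) UNIV_I]])
  then show ?thesis by (simp add: integral_unique)
qed

text \<open>
  Translating a compactly supported function does not change its integral; differentiating in
  the translation parameter shows that its derivatives integrate to zero.
\<close>

lemma integral_derivative_zero:
  fixes f :: "'a::euclidean_space \<Rightarrow> real"
  assumes f: "smooth_on UNIV f" and bdd: "bounded {x. f x \<noteq> 0}"
  shows "integral UNIV (\<lambda>x. frechet_derivative f (at x) v) = 0"
proof -
  obtain B where "\<forall>x\<in>{x. f x \<noteq> 0}. norm x \<le> B"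
    using bdd unfolding bounded_iff by blast
  then have B: "{x. f x \<noteq> 0} \<subseteq> cball 0 B" by auto
  obtain b :: 'a where b: "cball 0 (B + norm v) \<subseteq> cbox (-b) b"
    using bounded_subset_cbox_symmetric[OF bounded_cball] by blast
  have const: "integral (cbox (-b) b) (\<lambda>x. f (x + t *\<^sub>R v)) = integral UNIV f" if "t \<in> ball 0 1" for t
  proof -
    have "x \<in> cball 0 (B + norm v)" if "f (x + t *\<^sub>R v) \<noteq> 0" for x
    proof -
      have "norm (x + t *\<^sub>R v) \<le> B" using B that by auto
      moreover have "norm (t *\<^sub>R v) \<le> norm v"
        using \<open>t \<in> ball 0 1\<close> by (simp add: mult_left_le_one_le)
      ultimately show ?thesis
        using norm_triangle_ineq4[of "x + t *\<^sub>R v" "t *\<^sub>R v"] by simp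
    qed
    then have "integral (cbox (-b) b) (\<lambda>x. f (x + t *\<^sub>R v)) = integral UNIV (\<lambda>x. f (x + t *\<^sub>R v))"
      using b by (intro integral_support_subset) blast
    then show ?thesis using integral_translate[OF bdd] by simp
  qed
  have "((\<lambda>t. integral (cbox (-b) b) (\<lambda>x. f (x + t *\<^sub>R v))) has_derivative
      (\<lambda>h. integral (cbox (-b) b) (\<lambda>x. h *\<^sub>R frechet_derivative f (at (x + 0 *\<^sub>R v)) v))) (at (0::real))"
  proof (rule has_derivative_integral[OF open_ball convex_ball, of _ 0 1])
    show "((\<lambda>t. f (x + t *\<^sub>R v)) has_derivative (\<lambda>h. h *\<^sub>R frechet_derivative f (at (x + t *\<^sub>R v)) v)) (at t)"
      for x t
      using derivative_along_line[OF smooth_on_has_derivative[OF f UNIV_I], where x=x and s=t and v=v and T=UNIV]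
      by (simp add: has_vector_derivative_def)
    show "continuous_on (ball 0 1 \<times> cbox (-b) b) (\<lambda>(t, x). f (x + t *\<^sub>R v))"
      by (auto simp: split_beta intro!: continuous_on_compose2[OF smooth_on_continuous[OF f]] continuous_intros)
    have "continuous_on (ball 0 1 \<times> cbox (-b) b)
        (\<lambda>p. frechet_derivative f (at (snd p + fst p *\<^sub>R v)) v)"
      by (rule continuous_on_compose2[OF smooth_on_continuous[OF smooth_on_derivative[OF f]]])
         (auto intro!: continuous_intros)
    then show "continuous_on (ball 0 1 \<times> cbox (-b) b)
        (\<lambda>(t, x). h *\<^sub>R frechet_derivative f (at (x + t *\<^sub>R v)) v)" for h
      by (auto simp: split_beta intro!: continuous_intros)
  qed auto
  moreover have "((\<lambda>t. integral UNIV f) has_derivative (\<lambda>h. 0)) (at (0::real))" by simp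
  then have "((\<lambda>t. integral (cbox (-b) b) (\<lambda>x. f (x + t *\<^sub>R v))) has_derivative (\<lambda>h. 0)) (at (0::real))"
    by (rule has_derivative_transform_within_open[OF _ open_ball[of 0 1]]) (use const in auto)
  ultimately have "integral (cbox (-b) b) (\<lambda>x. 1 *\<^sub>R frechet_derivative f (at (x + 0 *\<^sub>R v)) v) = 0"
    using has_derivative_unique by metis
  moreover have "{x. frechet_derivative f (at x) v \<noteq> 0} \<subseteq> cbox (-b) b"
  proof -
    have "frechet_derivative f (at x) v = 0" if "x \<notin> cball 0 B" for x
      by (rule derivative_zero_outside[of "cball 0 B"]) (use B that in auto)
    moreover have "cball 0 B \<subseteq> cball 0 (B + norm v)" by (rule subset_cball) simp
    ultimately show ?thesis using b by blast
  qed
  ultimately show ?thesis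
    using integral_support_subset[of "\<lambda>x. frechet_derivative f (at x) v" "cbox (-b) b"] by simp
qed

text \<open>
  The increment of \<open>f\<close> along \<open>u\<close> is the integral of its derivative in direction \<open>u\<close>.  Differentiate this identity in
  direction \<open>v\<close>, and then with respect to the length of the increment.
\<close>

lemma second_derivative_symmetric:
  fixes f :: "'a::euclidean_space \<Rightarrow> real"
  assumes f: "smooth_on UNIV f"
  shows "frechet_derivative (\<lambda>y. frechet_derivative f (at y) u) (at x) v
       = frechet_derivative (\<lambda>y. frechet_derivative f (at y) v) (at x) u"
proof -
  define Du where "Du = (\<lambda>y. frechet_derivative f (at y) u)"
  define Dv where "Dv = (\<lambda>y. frechet_derivative f (at y) v)"
  have Du: "smooth_on UNIV Du" and Dv: "smooth_on UNIV Dv"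
    unfolding Du_def Dv_def by (rule smooth_on_derivative[OF f])+
  have eq: "Dv (x + t *\<^sub>R u) - Dv x = integral {0..t} (\<lambda>s. frechet_derivative Du (at (x + s *\<^sub>R u)) v)"
    if t: "t \<in> {0..1}" for t
  proof -
    have d: "((\<lambda>y. f (y + t *\<^sub>R u) - f y) has_derivative
        (\<lambda>w. frechet_derivative f (at (x + t *\<^sub>R u)) w - frechet_derivative f (at x) w)) (at x)"
      by (intro has_derivative_diff has_derivative_translate smooth_on_has_derivative[OF f UNIV_I])
    have e: "(\<lambda>y. f (y + t *\<^sub>R u) - f y) = (\<lambda>y. integral (cbox 0 t) (\<lambda>s. Du (y + s *\<^sub>R u)))"
      using line_integral_of_derivative[OF f, of t _ u] t by (simp add: Du_def)
    have "(\<lambda>w. frechet_derivative f (at (x + t *\<^sub>R u)) w - frechet_derivative f (at x) w)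
        = (\<lambda>w. integral (cbox 0 t) (\<lambda>s. frechet_derivative Du (at (x + s *\<^sub>R u)) w))"
      by (rule has_derivative_unique[OF d[unfolded e] has_derivative_line_integral[OF smooth_on_Ck_on[OF Du]]])
    from fun_cong[OF this, of v] show ?thesis by (simp add: Dv_def)
  qed
  have "((\<lambda>t. Dv (x + t *\<^sub>R u) - Dv x) has_vector_derivative frechet_derivative Dv (at (x + 0 *\<^sub>R u)) u - 0)
      (at 0 within {0..1})"
    by (intro has_vector_derivative_diff derivative_along_line smooth_on_has_derivative[OF Dv UNIV_I]
        has_vector_derivative_const)
  moreover have "((\<lambda>t. Dv (x + t *\<^sub>R u) - Dv x) has_vector_derivative
      frechet_derivative Du (at (x + 0 *\<^sub>R u)) v) (at 0 within {0..1})"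
  proof (rule has_vector_derivative_transform[OF _ eq])
    show "((\<lambda>t. integral {0..t} (\<lambda>s. frechet_derivative Du (at (x + s *\<^sub>R u)) v)) has_vector_derivative
        frechet_derivative Du (at (x + 0 *\<^sub>R u)) v) (at 0 within {0..1})"
      by (rule integral_has_vector_derivative)
         (auto intro!: continuous_on_compose2[OF smooth_on_continuous[OF smooth_on_derivative[OF Du]]]
           continuous_intros)
  qed auto
  ultimately show ?thesis
    using vector_derivative_unique_within_closed_interval[of 0 1 0] by (simp add: Du_def Dv_def)
qed

text \<open>
  The primitive is the integral of \<open>A\<close> along the segments from \<open>x0\<close>.  By the symmetry of the derivative of \<open>A\<close>,
  differentiating under the integral in direction \<open>v\<close> yields the \<open>t\<close>-derivative of \<open>t (A \<bullet> v)\<close>.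
\<close>

lemma curl_free_is_gradient:
  fixes A :: "'a::euclidean_space \<Rightarrow> 'a"
  assumes S: "open S" "convex S" "x0 \<in> S" and A: "smooth_on S A"
    and sym: "\<And>x u v. x \<in> S \<Longrightarrow>
      frechet_derivative A (at x) u \<bullet> v = frechet_derivative A (at x) v \<bullet> u"
  obtains l where "\<And>x. x \<in> S \<Longrightarrow> (l has_derivative (\<lambda>v. A x \<bullet> v)) (at x)"
proof
  define p where "p x t = x0 + t *\<^sub>R (x - x0)" for x and t :: real
  let ?l = "\<lambda>x. integral (cbox 0 1) (\<lambda>t. A (p x t) \<bullet> (x - x0))"
  have p: "p x t \<in> S" if "x \<in> S" "t \<in> cbox 0 1" for x t
    using convexD_alt[OF S(2,3) that(1), of t] that(2) by (simp add: p_def algebra_simps)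
  have pc: "continuous_on X (\<lambda>y. p (fst y) (snd y))" for X
    unfolding p_def by (intro continuous_intros)
  fix x assume x: "x \<in> S"
  let ?g' = "\<lambda>x t v. A (p x t) \<bullet> v + frechet_derivative A (at (p x t)) (t *\<^sub>R v) \<bullet> (x - x0)"
  have "(?l has_derivative (\<lambda>v. integral (cbox 0 1) (\<lambda>t. ?g' x t v))) (at x)"
  proof (rule has_derivative_integral[OF S(1,2) x])
    fix x :: 'a and t :: real assume xt: "x \<in> S" "t \<in> cbox 0 1"
    have "((\<lambda>x. p x t) has_derivative (\<lambda>v. t *\<^sub>R v)) (at x)"
      unfolding p_def by (auto intro!: derivative_eq_intros)
    from has_derivative_compose[OF this smooth_on_has_derivative[OF A p[OF xt]]]
    show "((\<lambda>x. A (p x t) \<bullet> (x - x0)) has_derivative ?g' x t) (at x)"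
      by (auto intro!: derivative_eq_intros)
  next
    show "continuous_on (S \<times> cbox 0 1) (\<lambda>(x, t). A (p x t) \<bullet> (x - x0))"
      unfolding split_beta
      by (intro continuous_intros continuous_on_compose2[OF smooth_on_continuous[OF A] pc]) (auto simp: p)
    fix v
    have "continuous_on (S \<times> cbox 0 1) (\<lambda>y. A (p (fst y) (snd y)) \<bullet> v
        + snd y * (frechet_derivative A (at (p (fst y) (snd y))) v \<bullet> (fst y - x0)))"
      by (intro continuous_intros continuous_on_compose2[OF smooth_on_continuous[OF A] pc]
          continuous_on_compose2[OF smooth_on_continuous[OF smooth_on_derivative[OF A]] pc]) (auto simp: p)
    then show "continuous_on (S \<times> cbox 0 1) (\<lambda>(x, t). ?g' x t v)"
      by (rule continuous_on_cong[THEN iffD1, OF refl, rotated])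
         (auto simp: linear_cmul[OF linear_frechet_derivative_smooth[OF A p]])
  qed
  moreover have "integral (cbox 0 1) (\<lambda>t. ?g' x t v) = A x \<bullet> v" for v
  proof -
    have "((\<lambda>t. ?g' x t v) has_integral (1 * (A (p x 1) \<bullet> v) - 0 * (A (p x 0) \<bullet> v))) {0..1}"
    proof (rule fundamental_theorem_of_calculus)
      fix t :: real assume t: "t \<in> {0..1}"
      then have pS: "p x t \<in> S" using p[OF x] by simp
      have "((\<lambda>t. A (p x t)) has_vector_derivative frechet_derivative A (at (p x t)) (x - x0)) (at t within {0..1})"
        unfolding p_def by (rule derivative_along_line) (rule smooth_on_has_derivative[OF A pS[unfolded p_def]])
      then have "((\<lambda>t. t * (A (p x t) \<bullet> v)) has_vector_derivative
          (A (p x t) \<bullet> v + t * (frechet_derivative A (at (p x t)) (x - x0) \<bullet> v))) (at t within {0..1})"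
        by (auto simp: has_vector_derivative_def intro!: derivative_eq_intros simp: algebra_simps)
      then show "((\<lambda>t. t * (A (p x t) \<bullet> v)) has_vector_derivative ?g' x t v) (at t within {0..1})"
        using sym[OF pS, of "x - x0" v]
        by (simp add: linear_cmul[OF linear_frechet_derivative_smooth[OF A pS]])
    qed simp
    then show ?thesis by (simp add: integral_unique p_def)
  qed
  ultimately show "(?l has_derivative (\<lambda>v. A x \<bullet> v)) (at x)" by simp
qed

subsection \<open>Compactly supported functions of integral zero are divergences\<close>

definition cube :: "real^'n \<Rightarrow> real \<Rightarrow> (real^'n) set" where
  "cube c r = {x. \<forall>j. \<bar>x $ j - c $ j\<bar> \<le> r}"

lemma closed_cube: "closed (cube c r)"
  unfolding cube_def by (intro closed_Collect_all closed_Collect_le continuous_intros)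

lemma bounded_cube: "bounded (cube c r)"
proof (rule bounded_subset[of "cbox (\<chi> j. c $ j - r) (\<chi> j. c $ j + r)"])
  show "cube c r \<subseteq> cbox (\<chi> j. c $ j - r) (\<chi> j. c $ j + r)"
    by (auto simp: cube_def mem_box_cart abs_diff_le_iff)
qed simp

lemma integral_reflect_translate:
  fixes p :: "real \<Rightarrow> real"
  assumes "bounded {t. p t \<noteq> 0}"
  shows "integral UNIV (\<lambda>s. p (a - s)) = integral UNIV p"
proof -
  obtain b where b: "{t. p t \<noteq> 0} \<subseteq> cbox (-b) b"
    using bounded_subset_cbox_symmetric[OF assms] by blast
  have b': "{t. p (- t) \<noteq> 0} \<subseteq> cbox (-b) b"
  proof
    fix t assume "t \<in> {t. p (- t) \<noteq> 0}"
    then have "- t \<in> cbox (-b) b" using b by blast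
    then show "t \<in> cbox (-b) b" by auto
  qed
  have "integral UNIV (\<lambda>s. p (a - s)) = integral UNIV (\<lambda>s. (\<lambda>u. p (- u)) (s + - a))" by simp
  also have "\<dots> = integral UNIV (\<lambda>u. p (- u))"
    by (rule integral_translate) (rule bounded_subset[OF bounded_cbox b'])
  also have "\<dots> = integral UNIV p"
    using integral_support_subset[OF b] integral_support_subset[OF b']
      Henstock_Kurzweil_Integration.integral_reflect_real[of b "-b" p] by simp
  finally show ?thesis .
qed

lemma unit_bump_exists:
  fixes c :: "'a::euclidean_space"
  assumes "r > 0"
  obtains g :: "'a \<Rightarrow> real" where "smooth_on UNIV g" "\<And>x. g x \<ge> 0" "\<And>x. g x > 0 \<longleftrightarrow> dist x c < r"
    "integral UNIV g = 1"
proof -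
  obtain g :: "'a \<Rightarrow> real" where g: "smooth_on UNIV g" "\<And>x. g x \<ge> 0" "\<And>x. g x > 0 \<longleftrightarrow> dist x c < r"
    using bump_exists[OF assms, of c] by metis
  have "x \<in> cball c r" if "g x \<noteq> 0" for x
    using g(2)[of x] g(3)[of x] that by (auto simp: dist_commute)
  then have bdd: "bounded {x. g x \<noteq> 0}"
    by (intro bounded_subset[OF bounded_cball[of c r]]) auto
  have pos: "integral UNIV g > 0"
    using assms g(3)[of c]
    by (intro integral_positive[OF smooth_on_continuous[OF g(1)] bdd g(2), of c]) simp
  show ?thesis
  proof (rule that[of "\<lambda>x. (1 / integral UNIV g) * g x"])
    show "smooth_on UNIV (\<lambda>x. (1 / integral UNIV g) * g x)"
      by (intro smooth_on_mult smooth_on_const g open_UNIV)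
    show "integral UNIV (\<lambda>x. (1 / integral UNIV g) * g x) = 1"
      using pos by simp
  qed (use pos g in \<open>auto simp: zero_less_divide_iff zero_less_mult_iff\<close>)
qed

text \<open>
  The integral of a function supported in the cube over the line through \<open>x\<close> in the
  direction of the \<open>i\<close>-th axis.
\<close>

definition line_mass :: "real^'n \<Rightarrow> real \<Rightarrow> 'n \<Rightarrow> (real^'n \<Rightarrow> real) \<Rightarrow> real^'n \<Rightarrow> real" where
  "line_mass c r i f x =
     integral (cbox 0 (2 * r)) (\<lambda>s. f ((x + (c $ i - x $ i - r) *\<^sub>R axis i 1) + s *\<^sub>R axis i 1))"

lemma line_mass_mult:
  assumes "\<And>x t. q (x + t *\<^sub>R axis i 1) = q x"
  shows "line_mass c r i (\<lambda>x. q x * g x) x = q x * line_mass c r i g x"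
  by (simp add: line_mass_def assms del: box_real)

lemma line_mass_invariant:
  "line_mass c r i f (x + t *\<^sub>R axis i 1) = line_mass c r i f x"
proof -
  have "x + t *\<^sub>R axis i 1 + (c $ i - (x + t *\<^sub>R axis i 1) $ i - r) *\<^sub>R axis i 1
      = x + (c $ i - x $ i - r) *\<^sub>R axis i 1"
    by (simp add: vec_eq_iff axis_def algebra_simps)
  then show ?thesis unfolding line_mass_def by metis
qed

lemma line_mass_invariant_other:
  assumes "\<And>x t. g (x + t *\<^sub>R axis j 1) = g x" "i \<noteq> j"
  shows "line_mass c r i g (x + t *\<^sub>R axis j 1) = line_mass c r i g x"
proof -
  have "x + t *\<^sub>R axis j 1 + (c $ i - (x + t *\<^sub>R axis j 1) $ i - r) *\<^sub>R axis i 1 + s *\<^sub>R axis i 1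
      = (x + (c $ i - x $ i - r) *\<^sub>R axis i 1 + s *\<^sub>R axis i 1) + t *\<^sub>R axis j 1" for s
    using assms(2) by (simp add: vec_eq_iff axis_def algebra_simps)
  then show ?thesis unfolding line_mass_def using assms(1) by metis
qed

text \<open>
  Modulo a derivative in the \<open>i\<close>-th direction, a function may be replaced by its line integrals
  in that direction, spread out by a fixed bump.
\<close>

lemma spread_along_axis:
  fixes f :: "real^'n \<Rightarrow> real" and i :: 'n
  assumes r: "r > 0" and f: "smooth_on UNIV f" "\<And>x. f x \<noteq> 0 \<Longrightarrow> x \<in> cube c r"
    and k: "smooth_on UNIV k" "\<And>t. k t \<noteq> 0 \<Longrightarrow> \<bar>t\<bar> \<le> r" "integral UNIV k = 1"
  defines "P \<equiv> \<lambda>x. k (x $ i - c $ i) * line_mass c r i f x"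
  obtains G where "smooth_on UNIV G" "\<And>x. G x \<noteq> 0 \<Longrightarrow> x \<in> cube c r"
    "\<And>x. f x - P x = frechet_derivative G (at x) (axis i 1)"
    "smooth_on UNIV P" "\<And>x. P x \<noteq> 0 \<Longrightarrow> x \<in> cube c r"
proof -
  let ?e = "axis i 1 :: real^'n"
  let ?m = "line_mass c r i f"
  define at_height where "at_height x t = x + (c $ i - x $ i + t) *\<^sub>R ?e" for x t
  have height: "at_height x t $ j = (if j = i then c $ i + t else x $ j)" for x t j
    by (simp add: at_height_def axis_def)
  have shift: "x - s *\<^sub>R ?e = at_height x (x $ i - c $ i - s)" for x s
    by (simp add: at_height_def vec_eq_iff axis_def)
  have m_eq: "?m x = integral (cbox 0 (2 * r)) (\<lambda>s. f (at_height x (s - r)))" for x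
    unfolding line_mass_def at_height_def by (simp add: algebra_simps del: box_real)
  have smP: "smooth_on UNIV P"
  proof -
    have "smooth_on UNIV (\<lambda>x. integral (cbox 0 (2 * r)) (\<lambda>s. f (x + s *\<^sub>R ?e)))"
      by (rule smooth_on_line_integral[OF f(1)])
    then have "smooth_on UNIV ?m"
      unfolding line_mass_def
      by (rule smooth_on_compose) (intro smooth_on_add smooth_on_scaleR smooth_on_diff smooth_on_const
          smooth_on_nth smooth_on_ident open_UNIV, auto)
    moreover have "smooth_on UNIV (\<lambda>x. k (x $ i - c $ i))"
      by (rule smooth_on_compose[OF k(1)])
         (intro smooth_on_diff smooth_on_nth smooth_on_ident smooth_on_const open_UNIV, auto)
    ultimately show ?thesis unfolding P_def by (intro smooth_on_mult open_UNIV)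
  qed
  have suppP: "x \<in> cube c r" if "P x \<noteq> 0" for x
  proof -
    have "?m x \<noteq> 0" using that by (simp add: P_def)
    then obtain s where "f (at_height x (s - r)) \<noteq> 0"
      unfolding m_eq by (metis (mono_tags, lifting) integral_eq_0_iff integral_0 integral_cong)
    then have "\<forall>j. \<bar>at_height x (s - r) $ j - c $ j\<bar> \<le> r" using f(2) by (simp add: cube_def)
    moreover have "\<bar>x $ i - c $ i\<bar> \<le> r" using that k(2) by (auto simp: P_def)
    ultimately show ?thesis by (force simp: cube_def height split: if_splits)
  qed
  define h where "h x = f x - P x" for x
  have h: "smooth_on UNIV h" unfolding h_def by (intro smooth_on_diff f smP open_UNIV)
  have supph: "x \<in> cube c r" if "h x \<noteq> 0" for x
    using that f(2)[of x] suppP[of x] by (cases "f x = 0") (auto simp: h_def)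
  have bdd: "bounded {t::real. p t \<noteq> 0}" if "\<And>t. p t \<noteq> 0 \<Longrightarrow> \<bar>t\<bar> \<le> r" for p :: "real \<Rightarrow> real"
    by (rule bounded_subset[OF bounded_cbox[of "-r" r]]) (auto dest!: that)
  have h_line: "integral UNIV (\<lambda>t. h (at_height x t)) = 0" for x
  proof -
    have hf: "\<bar>t\<bar> \<le> r" if "f (at_height x t) \<noteq> 0" for t
      using f(2)[OF that] height[of x t i] by (auto simp: cube_def dest: spec[of _ i])
    have cf: "continuous_on UNIV (\<lambda>t. f (at_height x t))"
      unfolding at_height_def
      by (rule continuous_on_compose2[OF smooth_on_continuous[OF f(1)]]) (auto intro!: continuous_intros)
    have "integral UNIV (\<lambda>t. f (at_height x t)) = integral UNIV (\<lambda>t. f (at_height x (t + - r)))"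
      by (rule integral_translate[symmetric, OF bdd[OF hf]])
    also have "\<dots> = ?m x" unfolding m_eq
      by (subst integral_support_subset) (use hf in \<open>auto simp: abs_le_iff, fastforce+\<close>)
    finally have 1: "integral UNIV (\<lambda>t. f (at_height x t)) = ?m x" .
    have 2: "P (at_height x t) = k t * ?m x" for t
      unfolding P_def using line_mass_invariant[of c r i f x "c $ i - x $ i + t"] height[of x t i]
      by (simp add: at_height_def)
    have int: "(\<lambda>t. f (at_height x t)) integrable_on UNIV" "(\<lambda>t. k t * ?m x) integrable_on UNIV"
      using absolutely_integrable_compact_support[OF cf bdd[OF hf]]
        absolutely_integrable_compact_support[OF smooth_on_continuous[OF k(1)] bdd[OF k(2)]]
      by (auto simp: absolutely_integrable_on_def intro: integrable_on_mult_left)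
    show ?thesis unfolding h_def 2 by (simp add: integral_diff[OF int] 1 k(3))
  qed
  \<comment> \<open>\<open>G0\<close> integrates \<open>h\<close> downwards over the length \<open>4 * r\<close>.  From the points of \<open>R\<close> this passes through
    the whole cube below the point, so that there \<open>G0\<close> is a primitive of \<open>h\<close>, and it vanishes above the
    cube because \<open>h\<close> has integral 0 on every line.\<close>
  define R where "R = {x. x $ i - c $ i < 2 * r}"
  have R: "open R" unfolding R_def by (intro open_Collect_less continuous_intros)
  have cube_R: "cube c r \<subseteq> R"
  proof
    fix x assume "x \<in> cube c r"
    then have "\<bar>x $ i - c $ i\<bar> \<le> r" by (simp add: cube_def)
    then show "x \<in> R" using r by (simp add: R_def)
  qed
  define G0 where "G0 x = integral (cbox 0 (4 * r)) (\<lambda>s. h (x + s *\<^sub>R (- ?e)))" for x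
  have G0: "smooth_on UNIV G0" unfolding G0_def by (rule smooth_on_line_integral[OF h])
  have suppG0: "G0 x = 0" if "x \<in> R" "x \<notin> cube c r" for x
  proof (cases "\<exists>s\<in>{0..4*r}. h (x - s *\<^sub>R ?e) \<noteq> 0")
    case False
    then have "G0 x = integral (cbox 0 (4 * r)) (\<lambda>s. 0)"
      unfolding G0_def by (intro integral_cong) auto
    then show ?thesis by simp
  next
    case True
    then obtain s where s: "s \<in> {0..4*r}" "h (x - s *\<^sub>R ?e) \<noteq> 0" by blast
    have near: "\<forall>j. \<bar>(x - s *\<^sub>R ?e) $ j - c $ j\<bar> \<le> r"
      using supph[OF s(2)] unfolding cube_def by blast
    then have "\<bar>x $ j - c $ j\<bar> \<le> r" if "j \<noteq> i" for j
      using that by (auto simp: axis_def dest: spec[of _ j])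
    then have "\<bar>x $ i - c $ i\<bar> > r" using that(2) by (force simp: cube_def)
    moreover have "\<bar>x $ i - s - c $ i\<bar> \<le> r" using near by (auto simp: axis_def dest: spec[of _ i])
    ultimately have above: "x $ i - c $ i > r" using s(1) by auto
    have sub: "{s. h (x - s *\<^sub>R ?e) \<noteq> 0} \<subseteq> {0..4*r}"
    proof
      fix s assume "s \<in> {s. h (x - s *\<^sub>R ?e) \<noteq> 0}"
      then have "x - s *\<^sub>R ?e \<in> cube c r" using supph by blast
      then have "\<bar>(x - s *\<^sub>R ?e) $ i - c $ i\<bar> \<le> r" unfolding cube_def by blast
      then have "\<bar>x $ i - s - c $ i\<bar> \<le> r" by (simp add: axis_def)
      then show "s \<in> {0..4*r}" using above \<open>x \<in> R\<close> by (auto simp: R_def)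
    qed
    have hb: "\<bar>t\<bar> \<le> r" if "h (at_height x t) \<noteq> 0" for t
      using supph[OF that] height[of x t i] by (auto simp: cube_def dest: spec[of _ i])
    have "G0 x = integral {0..4*r} (\<lambda>s. h (x - s *\<^sub>R ?e))" by (simp add: G0_def)
    also have "\<dots> = integral UNIV (\<lambda>s. h (x - s *\<^sub>R ?e))" by (rule integral_support_subset[OF sub])
    also have "\<dots> = integral UNIV (\<lambda>s. h (at_height x (x $ i - c $ i - s)))" by (simp add: shift)
    also have "\<dots> = integral UNIV (\<lambda>t. h (at_height x t))"
      by (rule integral_reflect_translate[OF bdd[OF hb]])
    finally show ?thesis using h_line by simp
  qed
  define G where "G x = (if x \<in> R then G0 x else 0)" for x
  have smG: "smooth_on UNIV G"
    unfolding G_def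
    by (rule smooth_on_extend_by_zero[OF R closed_cube cube_R smooth_on_subset[OF G0] suppG0]) auto
  have suppG: "x \<in> cube c r" if "G x \<noteq> 0" for x
    using that suppG0 by (auto simp: G_def split: if_splits)
  have derG: "h x = frechet_derivative G (at x) ?e" for x
  proof (cases "x \<in> R")
    case True
    have "(G has_derivative (\<lambda>w. integral (cbox 0 (4 * r))
        (\<lambda>s. frechet_derivative h (at (x + s *\<^sub>R (- ?e))) w))) (at x)"
      by (rule has_derivative_transform_within_open[OF has_derivative_line_integral[OF smooth_on_Ck_on[OF h]] R True])
         (simp add: G_def G0_def)
    from frechet_derivative_at[OF this]
    have "frechet_derivative G (at x) ?e =
        integral (cbox 0 (4 * r)) (\<lambda>s. frechet_derivative h (at (x + s *\<^sub>R (- ?e))) ?e)"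
      by metis
    also have "\<dots> = - integral (cbox 0 (4 * r)) (\<lambda>s. frechet_derivative h (at (x + s *\<^sub>R (- ?e))) (- ?e))"
      by (simp add: linear_neg[OF linear_frechet_derivative_smooth[OF h UNIV_I]] del: box_real)
    also have "\<dots> = h x - h (x + (4 * r) *\<^sub>R (- ?e))"
      using line_integral_of_derivative[OF h, of "4 * r" x "- ?e"] r by simp
    also have "h (x + (4 * r) *\<^sub>R (- ?e)) = 0"
    proof (rule ccontr)
      assume "h (x + (4 * r) *\<^sub>R (- ?e)) \<noteq> 0"
      from supph[OF this] have "\<bar>x $ i - 4 * r - c $ i\<bar> \<le> r"
        by (auto simp: cube_def axis_def dest: spec[of _ i])
      then show False using True r by (simp add: R_def)
    qed
    finally show ?thesis by simp
  next
    case False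
    then have "x \<notin> cube c r" using cube_R by blast
    then have "h x = 0" "frechet_derivative G (at x) ?e = 0"
      using supph suppG by (auto intro: derivative_zero_outside[OF closed_cube[of c r]])
    then show ?thesis by simp
  qed
  show ?thesis
    by (rule that[OF smG suppG _ smP suppP]) (use derG h_def in auto)
qed

lemma has_derivative_nth: "(f has_derivative f') (at x) \<Longrightarrow> ((\<lambda>x. f x $ i) has_derivative (\<lambda>v. f' v $ i)) (at x)"
  by (rule bounded_linear.has_derivative[OF bounded_linear_vec_nth])

lemma frechet_derivative_nth:
  "smooth_on S f \<Longrightarrow> x \<in> S \<Longrightarrow> frechet_derivative (\<lambda>x. f x $ i) (at x) v = frechet_derivative f (at x) v $ i"
  using frechet_derivative_at[OF has_derivative_nth[OF smooth_on_has_derivative]] by metis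

definition divergence :: "(real^'n \<Rightarrow> real^'n) \<Rightarrow> real^'n \<Rightarrow> real" where
  "divergence X x = (\<Sum>i\<in>UNIV. frechet_derivative X (at x) (axis i 1) $ i)"

text \<open>
  The Poincare lemma with compact supports in top degree: spreading \<open>f\<close> along the three
  axes in turn leaves a multiple of a product of bumps, and the multiple is the integral of \<open>f\<close>
  up to normalisation.
\<close>

lemma integral_zero_is_divergence:
  fixes f :: "real^3 \<Rightarrow> real"
  assumes r: "r > 0" and f: "smooth_on UNIV f" "\<And>x. f x \<noteq> 0 \<Longrightarrow> x \<in> cube c r"
    and int: "integral UNIV f = 0"
  obtains X where "smooth_on UNIV X" "\<And>x. X x \<noteq> 0 \<Longrightarrow> x \<in> cube c r" "\<And>x. divergence X x = f x"
proof -
  obtain k :: "real \<Rightarrow> real" where k: "smooth_on UNIV k" "\<And>t. k t \<ge> 0" "\<And>t. k t > 0 \<longleftrightarrow> dist t 0 < r"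
    "integral UNIV k = 1"
    using unit_bump_exists[OF r, of "0::real"] by metis
  have ksupp: "\<bar>t\<bar> \<le> r" if "k t \<noteq> 0" for t
    using k(2)[of t] k(3)[of t] that by auto
  define P1 where "P1 x = k (x $ 1 - c $ 1) * line_mass c r 1 f x" for x
  define P2 where "P2 x = k (x $ 2 - c $ 2) * line_mass c r 2 P1 x" for x
  define P3 where "P3 x = k (x $ 3 - c $ 3) * line_mass c r 3 P2 x" for x
  obtain G1 where G1: "smooth_on UNIV G1" "\<And>x. G1 x \<noteq> 0 \<Longrightarrow> x \<in> cube c r"
    "\<And>x. f x - P1 x = frechet_derivative G1 (at x) (axis 1 1)"
    "smooth_on UNIV P1" "\<And>x. P1 x \<noteq> 0 \<Longrightarrow> x \<in> cube c r"
    using spread_along_axis[OF r f k(1) ksupp k(4), of 1] unfolding P1_def by blast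
  obtain G2 where G2: "smooth_on UNIV G2" "\<And>x. G2 x \<noteq> 0 \<Longrightarrow> x \<in> cube c r"
    "\<And>x. P1 x - P2 x = frechet_derivative G2 (at x) (axis 2 1)"
    "smooth_on UNIV P2" "\<And>x. P2 x \<noteq> 0 \<Longrightarrow> x \<in> cube c r"
    using spread_along_axis[OF r G1(4,5) k(1) ksupp k(4), of 2] unfolding P2_def by blast
  obtain G3 where G3: "smooth_on UNIV G3" "\<And>x. G3 x \<noteq> 0 \<Longrightarrow> x \<in> cube c r"
    "\<And>x. P2 x - P3 x = frechet_derivative G3 (at x) (axis 3 1)"
    "smooth_on UNIV P3" "\<And>x. P3 x \<noteq> 0 \<Longrightarrow> x \<in> cube c r"
    using spread_along_axis[OF r G2(4,5) k(1) ksupp k(4), of 3] unfolding P3_def by blast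
  \<comment> \<open>The remaining function is a multiple of the product of the three bumps, since \<open>m3\<close> is
    invariant under translation in all three directions.\<close>
  define q where "q x = k (x $ 1 - c $ 1) * k (x $ 2 - c $ 2) * k (x $ 3 - c $ 3)" for x :: "real^3"
  define m1 where "m1 = line_mass c r 1 f"
  define m2 where "m2 = line_mass c r 2 m1"
  define m3 where "m3 = line_mass c r 3 m2"
  have i1: "m1 (x + t *\<^sub>R axis 1 1) = m1 x" for x t
    unfolding m1_def by (rule line_mass_invariant)
  have i2: "m2 (x + t *\<^sub>R axis 2 1) = m2 x" "m2 (x + t *\<^sub>R axis 1 1) = m2 x" for x t
    unfolding m2_def by (rule line_mass_invariant, rule line_mass_invariant_other[OF i1], simp)
  have i3: "m3 (x + t *\<^sub>R axis 3 1) = m3 x" "m3 (x + t *\<^sub>R axis 2 1) = m3 x" "m3 (x + t *\<^sub>R axis 1 1) = m3 x" for x t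
    unfolding m3_def
    by (rule line_mass_invariant, rule line_mass_invariant_other[OF i2(1)], simp,
        rule line_mass_invariant_other[OF i2(2)], simp)
  have const: "m3 x = m3 0" for x
  proof -
    have "x = ((0 + (x $ 1) *\<^sub>R axis 1 1) + (x $ 2) *\<^sub>R axis 2 1) + (x $ 3) *\<^sub>R axis 3 1"
      by (simp add: vec_eq_iff forall_3 axis_def)
    then show ?thesis using i3 by metis
  qed
  have "line_mass c r 2 P1 x = k (x $ 1 - c $ 1) * m2 x" for x
    unfolding P1_def m2_def m1_def by (rule line_mass_mult) (simp add: axis_def)
  then have P2: "P2 = (\<lambda>x. k (x $ 1 - c $ 1) * k (x $ 2 - c $ 2) * m2 x)"
    by (simp add: P2_def fun_eq_iff)
  have L3: "line_mass c r 3 P2 x = k (x $ 1 - c $ 1) * k (x $ 2 - c $ 2) * m3 x" for x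
    unfolding P2 m3_def by (rule line_mass_mult) (simp add: axis_def)
  have P3: "P3 = (\<lambda>x. m3 0 * q x)"
  proof
    fix x show "P3 x = m3 0 * q x"
      unfolding P3_def L3 q_def const[of x] by simp
  qed
  have bddc: "bounded {x. g x \<noteq> 0}" if "\<And>x. g x \<noteq> 0 \<Longrightarrow> x \<in> cube c r" for g :: "real^3 \<Rightarrow> real"
    by (rule bounded_subset[OF bounded_cube[of c r]]) (use that in auto)
  have intc: "g integrable_on UNIV" if "smooth_on UNIV g" "\<And>x. g x \<noteq> 0 \<Longrightarrow> x \<in> cube c r" for g :: "real^3 \<Rightarrow> real"
    using absolutely_integrable_compact_support[OF smooth_on_continuous[OF that(1)] bddc[OF that(2)]]
    by (simp add: absolutely_integrable_on_def)
  have step: "integral UNIV g' = integral UNIV g"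
    if "smooth_on UNIV g" "\<And>x. g x \<noteq> 0 \<Longrightarrow> x \<in> cube c r" "smooth_on UNIV g'" "\<And>x. g' x \<noteq> 0 \<Longrightarrow> x \<in> cube c r"
      "smooth_on UNIV G" "\<And>x. G x \<noteq> 0 \<Longrightarrow> x \<in> cube c r"
      "\<And>x. g x - g' x = frechet_derivative G (at x) v" for g g' G :: "real^3 \<Rightarrow> real" and v
    using integral_derivative_zero[OF that(5) bddc[OF that(6)], of v]
      integral_diff[OF intc[OF that(1,2)] intc[OF that(3,4)]] by (simp flip: that(7))
  have "integral UNIV P3 = 0"
    using step[OF f G1(4,5,1,2,3)] step[OF G1(4,5) G2(4,5,1,2,3)] step[OF G2(4,5) G3(4,5,1,2,3)] int
    by simp
  then have "m3 0 * integral UNIV q = 0" unfolding P3 by simp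
  moreover have "integral UNIV q > 0"
  proof (rule integral_positive)
    show "continuous_on UNIV q" unfolding q_def
      by (intro continuous_intros continuous_on_compose2[OF smooth_on_continuous[OF k(1)]]) auto
    show "bounded {x. q x \<noteq> 0}"
      by (rule bddc) (use ksupp in \<open>auto simp: q_def cube_def forall_3\<close>)
    show "q x \<ge> 0" for x using k(2) by (simp add: q_def)
    show "q c > 0" using k(3)[of 0] r by (simp add: q_def)
  qed
  ultimately have P3_0: "P3 x = 0" for x unfolding P3 by auto
  define X :: "real^3 \<Rightarrow> real^3" where "X x = (\<chi> i. if i = 1 then G1 x else if i = 2 then G2 x else G3 x)" for x
  have X: "smooth_on UNIV X"
    unfolding X_def
  proof (rule smooth_on_vec_lambda[OF open_UNIV])
    show "smooth_on UNIV (\<lambda>x. if i = 1 then G1 x else if i = 2 then G2 x else G3 x)" for i :: 3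
      by (cases "i = 1"; cases "i = 2") (use G1(1) G2(1) G3(1) in simp_all)
  qed
  show ?thesis
  proof (rule that[OF X])
    show "x \<in> cube c r" if "X x \<noteq> 0" for x
    proof -
      have "G1 x \<noteq> 0 \<or> G2 x \<noteq> 0 \<or> G3 x \<noteq> 0"
        using that by (auto simp: X_def vec_eq_iff split: if_splits)
      then show ?thesis using G1(2) G2(2) G3(2) by blast
    qed
    have "divergence X x = frechet_derivative G1 (at x) (axis 1 1)
        + frechet_derivative G2 (at x) (axis 2 1) + frechet_derivative G3 (at x) (axis 3 1)" for x
      unfolding divergence_def sum_3 frechet_derivative_nth[OF X UNIV_I, symmetric]
      by (simp add: X_def)
    then show "divergence X x = f x" for x
      using G1(3)[of x] G2(3)[of x] G3(3)[of x] P3_0[of x] by simp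
  qed
qed

section \<open>Charts of an oriented manifold\<close>

lemma continuous_extend_by_zero:
  fixes f :: "'a::topological_space \<Rightarrow> 'b::real_normed_vector"
  assumes "open R" "closed K" "K \<subseteq> R" "continuous_on R f" "\<And>x. x \<in> R \<Longrightarrow> x \<notin> K \<Longrightarrow> f x = 0"
  shows "continuous_on UNIV (\<lambda>x. if x \<in> R then f x else 0)"
proof -
  have "continuous_on (R \<union> - K) (\<lambda>x. if x \<in> R then f x else 0)"
  proof (rule continuous_on_open_Un)
    show "continuous_on R (\<lambda>x. if x \<in> R then f x else 0)"
      by (rule continuous_on_eq[OF assms(4)]) auto
    show "continuous_on (- K) (\<lambda>x. if x \<in> R then f x else 0)"
      by (rule continuous_on_eq[OF continuous_on_const[of _ 0]]) (use assms(5) in auto)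
  qed (use assms in auto)
  moreover have "R \<union> - K = UNIV" using assms(3) by auto
  ultimately show ?thesis by simp
qed

locale oriented_atlas =
  fixes C :: "('m::{t2_space, second_countable_topology}, real^'n::finite) charts"
  assumes oriented: "oriented_manifold C"
begin

abbreviation trans :: "'m \<Rightarrow> 'm \<Rightarrow> real^'n \<Rightarrow> real^'n" where
  "trans a b \<equiv> chart_at C b \<circ> inv_chart C a"

abbreviation dtrans :: "'m \<Rightarrow> 'm \<Rightarrow> real^'n \<Rightarrow> real^'n \<Rightarrow> real^'n" where
  "dtrans a b x \<equiv> frechet_derivative (chart_at C b \<circ> inv_chart C a) (at x)"

definition overlap :: "'m \<Rightarrow> 'm \<Rightarrow> (real^'n) set" where
  "overlap a b = chart_at C a ` (dom_at C a \<inter> dom_at C b)"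

lemma dom: "p \<in> dom_at C p" "open (dom_at C p)" and open_range: "open (range_at C p)"
  and homeo: "homeomorphism (dom_at C p) (range_at C p) (chart_at C p) (inv_chart C p)"
  using oriented by (auto simp: oriented_manifold_def)

lemma inv_chart_chart: "q \<in> dom_at C p \<Longrightarrow> inv_chart C p (chart_at C p q) = q"
  using homeo[of p] by (simp add: homeomorphism_def)

lemma chart_inv_chart: "x \<in> range_at C p \<Longrightarrow> chart_at C p (inv_chart C p x) = x"
  using homeo[of p] by (simp add: homeomorphism_def)

lemma inv_chart_dom: "x \<in> range_at C p \<Longrightarrow> inv_chart C p x \<in> dom_at C p"
  using homeo[of p] by (auto simp: homeomorphism_def)

lemma chart_range: "q \<in> dom_at C p \<Longrightarrow> chart_at C p q \<in> range_at C p"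
  by (simp add: range_at_def)

lemma continuous_chart: "continuous_on (dom_at C p) (chart_at C p)"
  and continuous_inv_chart: "continuous_on (range_at C p) (inv_chart C p)"
  using homeo[of p] by (auto simp: homeomorphism_def)

lemma overlap_iff: "x \<in> overlap a b \<longleftrightarrow> x \<in> range_at C a \<and> inv_chart C a x \<in> dom_at C b"
  by (auto simp: overlap_def range_at_def inv_chart_chart)

lemma open_preimage_inv_chart:
  assumes "open U" shows "open {x \<in> range_at C a. inv_chart C a x \<in> U}"
proof -
  have "open (range_at C a \<inter> inv_chart C a -` U)"
    by (rule continuous_open_preimage[OF continuous_inv_chart open_range assms])
  moreover have "range_at C a \<inter> inv_chart C a -` U = {x \<in> range_at C a. inv_chart C a x \<in> U}" by auto
  ultimately show ?thesis by simp
qed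

lemma open_preimage_chart:
  assumes "open U" shows "open {q \<in> dom_at C a. chart_at C a q \<in> U}"
proof -
  have "open (dom_at C a \<inter> chart_at C a -` U)"
    by (rule continuous_open_preimage[OF continuous_chart dom(2) assms])
  moreover have "dom_at C a \<inter> chart_at C a -` U = {x \<in> dom_at C a. chart_at C a x \<in> U}" by auto
  ultimately show ?thesis by simp
qed

lemma open_overlap: "open (overlap a b)"
proof -
  have "overlap a b = {x \<in> range_at C a. inv_chart C a x \<in> dom_at C b}" by (auto simp: overlap_iff)
  then show ?thesis using open_preimage_inv_chart[OF dom(2)] by simp
qed

lemma smooth_trans: "smooth_on (overlap a b) (trans a b)"
  and det_dtrans: "x \<in> overlap a b \<Longrightarrow> det (matrix (dtrans a b x)) > 0"
  using oriented by (auto simp: oriented_manifold_def overlap_def)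

lemma has_derivative_trans: "x \<in> overlap a b \<Longrightarrow> (trans a b has_derivative dtrans a b x) (at x)"
  by (rule smooth_on_has_derivative[OF smooth_trans])

lemma linear_dtrans: "x \<in> overlap a b \<Longrightarrow> linear (dtrans a b x)"
  by (rule has_derivative_linear[OF has_derivative_trans])

lemma trans_overlap: "x \<in> overlap a b \<Longrightarrow> trans a b x \<in> overlap b a"
  by (auto simp: overlap_iff inv_chart_chart chart_range inv_chart_dom)

lemma inv_trans: "x \<in> overlap a b \<Longrightarrow> inv_chart C b (trans a b x) = inv_chart C a x"
  by (simp add: overlap_iff inv_chart_chart)

lemma trans_trans:
  "x \<in> overlap a b \<Longrightarrow> trans b c (trans a b x) = trans a c x"
  by (simp add: overlap_iff inv_chart_chart)

lemma trans_self: "x \<in> range_at C a \<Longrightarrow> trans a a x = x"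
  by (simp add: chart_inv_chart)

lemma trans_inverse: "x \<in> overlap a b \<Longrightarrow> trans b a (trans a b x) = x"
  by (simp add: overlap_iff inv_chart_chart chart_inv_chart)

lemma dtrans_chain:
  assumes x: "x \<in> overlap a b" and c: "inv_chart C a x \<in> dom_at C c"
  shows "dtrans b c (trans a b x) (dtrans a b x v) = dtrans a c x v"
proof -
  let ?S = "overlap a b \<inter> overlap a c"
  have xS: "x \<in> ?S" using x c by (auto simp: overlap_iff)
  have y: "trans a b x \<in> overlap b c" using trans_overlap[OF x] c x by (auto simp: overlap_iff inv_chart_chart)
  have "((\<lambda>x. trans b c (trans a b x)) has_derivative (\<lambda>v. dtrans b c (trans a b x) (dtrans a b x v))) (at x)"
    by (rule has_derivative_compose[OF has_derivative_trans[OF x] has_derivative_trans[OF y]])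
  then have "(trans a c has_derivative (\<lambda>v. dtrans b c (trans a b x) (dtrans a b x v))) (at x)"
    by (rule has_derivative_transform_within_open[OF _ open_Int[OF open_overlap open_overlap] xS])
       (use trans_trans in auto)
  from frechet_derivative_at[OF this] show ?thesis by metis
qed

lemma dtrans_self: assumes "x \<in> range_at C a" shows "dtrans a a x v = v"
proof -
  have "((\<lambda>x. x) has_derivative (\<lambda>v. v)) (at x)" by simp
  then have "(trans a a has_derivative (\<lambda>v. v)) (at x)"
    by (rule has_derivative_transform_within_open[OF _ open_range assms]) (simp add: trans_self[simplified])
  from frechet_derivative_at[OF this] show ?thesis by metis
qed

lemma dtrans_inverse: "x \<in> overlap a b \<Longrightarrow> dtrans b a (trans a b x) (dtrans a b x v) = v"
  by (subst dtrans_chain) (auto simp: overlap_iff inv_chart_dom dtrans_self)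

lemma dtrans_inverse': "x \<in> overlap a b \<Longrightarrow> dtrans a b x (dtrans b a (trans a b x) v) = v"
  using dtrans_inverse[OF trans_overlap, of x a b v] by (simp add: trans_inverse[simplified])

lemma det_chain:
  assumes "x \<in> overlap a b" "inv_chart C a x \<in> dom_at C c"
  shows "det (matrix (dtrans b c (trans a b x))) * det (matrix (dtrans a b x)) = det (matrix (dtrans a c x))"
proof -
  have y: "trans a b x \<in> overlap b c"
    using trans_overlap[OF assms(1)] assms by (auto simp: overlap_iff inv_chart_chart)
  have "dtrans a c x = dtrans b c (trans a b x) \<circ> dtrans a b x"
    using dtrans_chain[OF assms] by (simp add: fun_eq_iff)
  then show ?thesis
    by (simp only: matrix_compose[OF linear_dtrans[OF assms(1)] linear_dtrans[OF y]] det_mul)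
qed

lemma det_self: "x \<in> range_at C a \<Longrightarrow> det (matrix (dtrans a a x)) = 1"
proof -
  assume "x \<in> range_at C a"
  then have "dtrans a a x = id" using dtrans_self by (simp add: fun_eq_iff)
  then show ?thesis by (simp add: matrix_id_mat_1)
qed

lemma det_inverse:
  assumes "x \<in> overlap a b"
  shows "det (matrix (dtrans b a (trans a b x))) * det (matrix (dtrans a b x)) = 1"
  using det_chain[OF assms, of a] det_self[of x a] assms by (simp add: overlap_iff inv_chart_dom)

lemma smooth_det_dtrans: "smooth_on (overlap a b) (\<lambda>x. det (matrix (dtrans a b x)))"
  unfolding matrix_def
  by (rule smooth_on_det[OF open_overlap])
     (simp, intro smooth_on_nth smooth_on_derivative smooth_trans open_overlap)

lemma compact_inv_chart_image:
  assumes "compact K" "K \<subseteq> range_at C a"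
  shows "compact (inv_chart C a ` K)" "closed (inv_chart C a ` K)"
proof -
  show "compact (inv_chart C a ` K)"
    by (rule compact_continuous_image[OF continuous_on_subset[OF continuous_inv_chart assms(2)] assms(1)])
  then show "closed (inv_chart C a ` K)" by (rule compact_imp_closed)
qed

text \<open>
  Outside \<open>K\<close>, which is closed in the manifold, the object vanishes; near the points of \<open>K\<close> it is given by the
  smooth expression \<open>t\<close>.
\<close>

lemma smooth_on_chart_extension:
  assumes K: "compact K" "K \<subseteq> range_at C a"
    and t: "smooth_on (overlap b a) t" "\<And>y. y \<in> overlap b a \<Longrightarrow> trans b a y \<notin> K \<Longrightarrow> t y = 0"
  shows "smooth_on (range_at C b) (\<lambda>y. if inv_chart C b y \<in> dom_at C a then t y else 0)"
proof (rule smooth_on_local)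
  fix y assume y: "y \<in> range_at C b"
  show "\<exists>T. open T \<and> y \<in> T \<and> smooth_on T (\<lambda>y. if inv_chart C b y \<in> dom_at C a then t y else 0)"
  proof (cases "inv_chart C b y \<in> dom_at C a")
    case True
    then show ?thesis using y open_overlap[of b a]
      by (intro exI[of _ "overlap b a"]) (auto simp: overlap_iff intro: smooth_on_cong[OF t(1)])
  next
    case False
    let ?T = "{y \<in> range_at C b. inv_chart C b y \<in> - inv_chart C a ` K}"
    have "open ?T"
      by (rule open_preimage_inv_chart) (use compact_inv_chart_image(2)[OF K] in auto)
    moreover have "y \<in> ?T" using y False K(2) inv_chart_dom by auto
    moreover have "smooth_on ?T (\<lambda>y. if inv_chart C b y \<in> dom_at C a then t y else 0)"
    proof (rule smooth_on_cong[OF smooth_on_const[of _ 0] \<open>open ?T\<close>])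
      fix z assume z: "z \<in> ?T"
      show "0 = (if inv_chart C b z \<in> dom_at C a then t z else 0)"
      proof (cases "inv_chart C b z \<in> dom_at C a")
        case True
        then have zo: "z \<in> overlap b a" using z by (simp add: overlap_iff)
        have "trans b a z \<notin> K"
        proof
          assume "trans b a z \<in> K"
          then have "inv_chart C a (trans b a z) \<in> inv_chart C a ` K" by blast
          then show False using z inv_trans[OF zo] by simp
        qed
        then show ?thesis using t(2)[OF zo] by simp
      qed simp
    qed
    ultimately show ?thesis by blast
  qed
qed

definition lift :: "'m \<Rightarrow> (real^'n \<Rightarrow> real) \<Rightarrow> 'm \<Rightarrow> real" where
  "lift a g q = (if q \<in> dom_at C a then g (chart_at C a q) else 0)"

lemma smooth_function_lift:
  assumes K: "compact K" "K \<subseteq> range_at C a" and g: "smooth_on (range_at C a) g"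
    "\<And>x. x \<in> range_at C a \<Longrightarrow> x \<notin> K \<Longrightarrow> g x = 0"
  shows "smooth_function C (lift a g)"
  unfolding smooth_function_def
proof
  fix b
  have sm: "smooth_on (overlap b a) (\<lambda>y. g (trans b a y))"
    by (rule smooth_on_compose[OF g(1) smooth_trans open_overlap open_range])
       (use trans_overlap in \<open>auto simp: overlap_iff\<close>)
  have z: "g (trans b a y) = 0" if "y \<in> overlap b a" "trans b a y \<notin> K" for y
    using g(2) trans_overlap[OF that(1)] that(2) by (auto simp: overlap_iff)
  show "smooth_on (range_at C b) (lift a g \<circ> inv_chart C b)"
    by (rule smooth_on_cong[OF smooth_on_chart_extension[OF K sm z] open_range]) (auto simp: lift_def)
qed

lemma continuous_smooth_function:
  assumes "smooth_function C u" shows "continuous_on UNIV u"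
proof (rule continuous_at_imp_continuous_on, rule ballI)
  fix q
  have sm: "smooth_on (range_at C q) (u \<circ> inv_chart C q)"
    using assms by (simp add: smooth_function_def)
  have "continuous_on (dom_at C q) (\<lambda>p. (u \<circ> inv_chart C q) (chart_at C q p))"
    by (rule continuous_on_compose2[OF smooth_on_continuous[OF sm] continuous_chart])
       (use chart_range in auto)
  then have "continuous_on (dom_at C q) u"
    by (rule continuous_on_cong[THEN iffD1, OF refl, rotated]) (simp add: inv_chart_chart)
  then show "isCont u q" using dom continuous_on_eq_continuous_at by blast
qed

lemma smooth_function_mult: "smooth_function C u \<Longrightarrow> smooth_function C v \<Longrightarrow> smooth_function C (\<lambda>q. u q * v q)"
  using smooth_on_mult[OF open_range] by (fastforce simp: smooth_function_def o_def)

lemma smooth_function_local: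
  assumes "\<And>q. \<exists>W. open W \<and> chart_at C q q \<in> W \<and> W \<subseteq> range_at C q \<and> smooth_on W (u \<circ> inv_chart C q)"
  shows "smooth_function C u"
  unfolding smooth_function_def
proof (intro allI smooth_on_local)
  fix p x assume x: "x \<in> range_at C p"
  define q where "q = inv_chart C p x"
  obtain W where W: "open W" "chart_at C q q \<in> W" "W \<subseteq> range_at C q" "smooth_on W (u \<circ> inv_chart C q)"
    using assms by blast
  let ?T = "overlap p q \<inter> trans p q -` W"
  have "open ?T"
    by (rule continuous_open_preimage[OF smooth_on_continuous[OF smooth_trans] open_overlap W(1)])
  moreover have "x \<in> ?T" using x W(2) dom(1) by (auto simp: overlap_iff q_def)
  moreover have "smooth_on ?T (u \<circ> inv_chart C p)"
  proof (rule smooth_on_cong[OF _ \<open>open ?T\<close>])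
    show "smooth_on ?T (\<lambda>x. (u \<circ> inv_chart C q) (trans p q x))"
      by (rule smooth_on_compose[OF W(4) smooth_on_subset[OF smooth_trans] \<open>open ?T\<close> W(1)]) auto
    show "(u \<circ> inv_chart C q) (trans p q x) = (u \<circ> inv_chart C p) x" if "x \<in> ?T" for x
      using inv_trans[of x p q] that by simp
  qed
  ultimately show "\<exists>T. open T \<and> x \<in> T \<and> smooth_on T (u \<circ> inv_chart C p)" by blast
qed

text \<open>
  Partitions of unity subordinate to an arbitrary choice of coordinate neighbourhoods: lift a
  bump function around every point, select finitely many by compactness, and normalise.
\<close>

lemma partition_of_unity_exists:
  assumes cpt: "compact (UNIV :: 'm set)"
    and N: "\<And>a. open (N a)" "\<And>a. a \<in> N a" "\<And>a. N a \<subseteq> dom_at C a"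
  obtains F h where "partition_of_unity C F h"
    "\<And>a. \<exists>K. compact K \<and> K \<subseteq> chart_at C a ` N a \<and> (\<forall>q. h a q \<noteq> 0 \<longrightarrow> q \<in> inv_chart C a ` K)"
proof -
  have "\<exists>r>0. cball (chart_at C a a) r \<subseteq> chart_at C a ` N a" for a
  proof -
    have "chart_at C a ` N a = {x \<in> range_at C a. inv_chart C a x \<in> N a}"
      using N(3)[of a] by (force simp: inv_chart_chart chart_inv_chart chart_range image_iff)
    then have "open (chart_at C a ` N a)" using open_preimage_inv_chart[OF N(1)] by simp
    then show ?thesis using N(2) open_contains_cball by blast
  qed
  then obtain r where r: "\<And>a. r a > 0" "\<And>a. cball (chart_at C a a) (r a) \<subseteq> chart_at C a ` N a" by metis
  have "\<exists>g::real^'n \<Rightarrow> real. smooth_on UNIV g \<and> (\<forall>x. g x \<ge> 0) \<and> (\<forall>x. g x > 0 \<longleftrightarrow> dist x (chart_at C a a) < r a)" for a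
    using bump_exists[OF r(1), of "chart_at C a a" a] by metis
  then obtain g :: "'m \<Rightarrow> real^'n \<Rightarrow> real" where g: "\<And>a. smooth_on UNIV (g a)" "\<And>a x. g a x \<ge> 0"
    "\<And>a x. g a x > 0 \<longleftrightarrow> dist x (chart_at C a a) < r a"
    by metis
  let ?K = "\<lambda>a. cball (chart_at C a a) (r a)"
  have g0: "x \<in> ?K a" if "g a x \<noteq> 0" for a x
    using g(2)[of a x] g(3)[of a x] that by (auto simp: dist_commute)
  have K: "compact (?K a)" "?K a \<subseteq> range_at C a" for a
    using r(2)[of a] N(3)[of a] by (auto simp: range_at_def)
  define b where "b a = lift a (g a)" for a
  have b: "smooth_function C (b a)" for a
    unfolding b_def by (rule smooth_function_lift[OF K smooth_on_subset[OF g(1)]]) (use g0 in auto)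
  have b_nonneg: "b a q \<ge> 0" for a q using g(2) by (simp add: b_def lift_def)
  have b_supp: "q \<in> inv_chart C a ` ?K a" if "b a q \<noteq> 0" for a q
  proof -
    have "q \<in> dom_at C a" "g a (chart_at C a q) \<noteq> 0" using that by (auto simp: b_def lift_def split: if_splits)
    then show ?thesis using g0 by (metis image_eqI inv_chart_chart)
  qed
  have open_pos: "open {q. b a q > 0}" for a
    using continuous_smooth_function[OF b] by (intro open_Collect_less continuous_on_const)
  have "UNIV \<subseteq> (\<Union>a. {q. b a q > 0})"
  proof
    fix q
    have "b q q > 0" using dom(1)[of q] g(3) r(1) by (simp add: b_def lift_def)
    then show "q \<in> (\<Union>a. {q. b a q > 0})" by blast
  qed
  then obtain F where F: "finite F" "UNIV \<subseteq> (\<Union>a\<in>F. {q. b a q > 0})"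
    using compactE_image[OF cpt, of UNIV "\<lambda>a. {q. b a q > 0}"] open_pos by auto
  define s where "s q = (\<Sum>a\<in>F. b a q)" for q
  have s: "s q > 0" for q
  proof -
    obtain a where "a \<in> F" "b a q > 0" using F(2) by auto
    then show ?thesis unfolding s_def by (intro sum_pos2[OF F(1)]) (use b_nonneg in auto)
  qed
  define h where "h a q = b a q / s q" for a q
  have "smooth_function C (h a)" for a
    unfolding smooth_function_def
  proof
    fix p
    have "smooth_on (range_at C p) (\<lambda>x. (b a \<circ> inv_chart C p) x / (\<Sum>a\<in>F. (b a \<circ> inv_chart C p) x))"
    proof (intro smooth_on_divide smooth_on_sum open_range)
      show "smooth_on (range_at C p) (\<lambda>x. (b a \<circ> inv_chart C p) x)" for a
        using b[of a] unfolding smooth_function_def comp_def by blast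
      then show "smooth_on (range_at C p) (\<lambda>x. (b a \<circ> inv_chart C p) x)" for a .
      show "(\<Sum>a\<in>F. (b a \<circ> inv_chart C p) x) \<noteq> 0" for x
        using s[of "inv_chart C p x"] by (simp add: s_def)
    qed
    then show "smooth_on (range_at C p) (h a \<circ> inv_chart C p)"
      by (simp add: h_def s_def o_def)
  qed
  moreover have h_supp: "q \<in> inv_chart C a ` ?K a" if "h a q \<noteq> 0" for a q
    using that b_supp by (auto simp: h_def)
  moreover have "closure {q. h a q \<noteq> 0} \<subseteq> dom_at C a" for a
  proof -
    have "closure {q. h a q \<noteq> 0} \<subseteq> inv_chart C a ` ?K a"
      by (rule closure_minimal[OF _ compact_inv_chart_image(2)[OF K]]) (use h_supp in blast)
    also have "\<dots> \<subseteq> dom_at C a" using K(2) inv_chart_dom by blast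
    finally show ?thesis .
  qed
  moreover have "h a q \<ge> 0" for a q using b_nonneg s by (simp add: h_def less_imp_le)
  moreover have "(\<Sum>a\<in>F. h a q) = 1" for q
    using s[of q] by (simp add: h_def flip: sum_divide_distrib s_def)
  ultimately have "partition_of_unity C F h" using F(1) by (simp add: partition_of_unity_def)
  moreover have "\<exists>K. compact K \<and> K \<subseteq> chart_at C a ` N a \<and> (\<forall>q. h a q \<noteq> 0 \<longrightarrow> q \<in> inv_chart C a ` K)" for a
    using r(2)[of a] h_supp[of a] by (intro exI[of _ "?K a"]) auto
  ultimately show ?thesis by (rule that)
qed

end

section \<open>Integration on a closed oriented 3-manifold\<close>

lemma integral_subset_zero:
  fixes f :: "'a::euclidean_space \<Rightarrow> 'b::banach"
  assumes "T \<subseteq> R" "\<And>x. x \<in> R \<Longrightarrow> x \<notin> T \<Longrightarrow> f x = 0"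
  shows "integral T f = integral R f"
proof -
  have "(\<lambda>x. if x \<in> T then f x else 0) = (\<lambda>x. if x \<in> R then f x else 0)"
    using assms by (auto simp: fun_eq_iff)
  then show ?thesis by (metis integral_restrict_UNIV)
qed

lemma absolutely_integrable_on_open:
  fixes f :: "'a::euclidean_space \<Rightarrow> 'b::euclidean_space"
  assumes "open R" "compact K" "K \<subseteq> R" "continuous_on R f" "\<And>x. x \<in> R \<Longrightarrow> x \<notin> K \<Longrightarrow> f x = 0"
    and T: "T \<subseteq> R" "\<And>x. x \<in> R \<Longrightarrow> x \<notin> T \<Longrightarrow> f x = 0"
  shows "f absolutely_integrable_on T"
proof -
  have "(\<lambda>x. if x \<in> R then f x else 0) absolutely_integrable_on UNIV"
  proof (rule absolutely_integrable_compact_support)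
    show "continuous_on UNIV (\<lambda>x. if x \<in> R then f x else 0)"
      by (rule continuous_extend_by_zero[OF assms(1) compact_imp_closed[OF assms(2)] assms(3,4,5)])
    show "bounded {x. (if x \<in> R then f x else 0) \<noteq> 0}"
      by (rule bounded_subset[OF compact_imp_bounded[OF assms(2)]]) (use assms(5) in auto)
  qed
  moreover have "(\<lambda>x. if x \<in> R then f x else 0) = (\<lambda>x. if x \<in> T then f x else 0)"
    using T by (auto simp: fun_eq_iff)
  ultimately show ?thesis by (simp add: absolutely_integrable_restrict_UNIV)
qed

lemma frechet_derivative_cong_open:
  assumes "open T" "x \<in> T" "\<And>y. y \<in> T \<Longrightarrow> f y = g y" "f differentiable at x"
  shows "frechet_derivative f (at x) = frechet_derivative g (at x)"
proof -
  have "(g has_derivative frechet_derivative f (at x)) (at x)"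
    by (rule has_derivative_transform_within_open[OF _ assms(1,2,3)])
       (use assms(4) frechet_derivative_works in auto)
  then show ?thesis by (rule frechet_derivative_at)
qed

lemma smooth_on_divergence: "open S \<Longrightarrow> smooth_on S X \<Longrightarrow> smooth_on S (divergence X)"
  unfolding divergence_def by (intro smooth_on_sum smooth_on_nth smooth_on_derivative)

lemma integrable_derivative_compact_support:
  fixes f :: "'a::euclidean_space \<Rightarrow> real"
  assumes "smooth_on UNIV f" "bounded {x. f x \<noteq> 0}"
  shows "(\<lambda>x. frechet_derivative f (at x) v) integrable_on UNIV"
proof -
  obtain B where B: "\<forall>x\<in>{x. f x \<noteq> 0}. norm x \<le> B" using assms(2) unfolding bounded_iff by blast
  have "bounded {x. frechet_derivative f (at x) v \<noteq> 0}"
  proof (rule bounded_subset[OF bounded_cball])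
    show "{x. frechet_derivative f (at x) v \<noteq> 0} \<subseteq> cball 0 B"
      using derivative_zero_outside[OF closed_cball[of 0 B], of f] B by (metis (mono_tags, lifting) mem_Collect_eq mem_cball_0 subsetI)
  qed
  then show ?thesis
    using absolutely_integrable_compact_support[OF smooth_on_continuous[OF smooth_on_derivative[OF assms(1)]]]
    by (simp add: absolutely_integrable_on_def)
qed

text \<open>
  Extended by zero, \<open>u *\<^sub>R Y\<close> is smooth with compact support, so that the integral of its divergence is 0.
\<close>

lemma integral_by_parts:
  fixes u :: "real^'n \<Rightarrow> real" and Y :: "real^'n \<Rightarrow> real^'n"
  assumes R: "open R" and u: "smooth_on R u" and Y: "smooth_on R Y" and K: "compact K" "K \<subseteq> R"
    and supp: "(\<forall>x\<in>R - K. u x = 0) \<or> (\<forall>x\<in>R - K. Y x = 0)"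
  shows "integral R (\<lambda>x. frechet_derivative u (at x) (Y x)) = - integral R (\<lambda>x. u x * divergence Y x)"
proof -
  define Z where "Z x = (if x \<in> R then u x *\<^sub>R Y x else 0)" for x
  have Z: "smooth_on UNIV Z"
    unfolding Z_def
    by (rule smooth_on_extend_by_zero[OF R compact_imp_closed[OF K(1)] K(2) smooth_on_scaleR[OF R u Y]])
       (use supp in auto)
  have Zsupp: "x \<in> K" if "Z x \<noteq> 0" for x using that supp by (auto simp: Z_def split: if_splits)
  have Zi: "smooth_on UNIV (\<lambda>x. Z x $ i)" "bounded {x. Z x $ i \<noteq> 0}" for i
  proof -
    show "smooth_on UNIV (\<lambda>x. Z x $ i)" by (intro smooth_on_nth Z open_UNIV)
    show "bounded {x. Z x $ i \<noteq> 0}"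
      by (rule bounded_subset[OF compact_imp_bounded[OF K(1)]]) (use Zsupp in force)
  qed
  have "integral UNIV (divergence Z)
      = (\<Sum>i\<in>UNIV. integral UNIV (\<lambda>x. frechet_derivative (\<lambda>x. Z x $ i) (at x) (axis i 1)))"
    unfolding divergence_def frechet_derivative_nth[OF Z UNIV_I, symmetric]
    by (rule integral_sum) (use integrable_derivative_compact_support[OF Zi] in auto)
  also have "\<dots> = 0" by (simp add: integral_derivative_zero[OF Zi])
  finally have int0: "integral UNIV (divergence Z) = 0" .
  have div: "divergence Z x = frechet_derivative u (at x) (Y x) + u x * divergence Y x" if x: "x \<in> R" for x
  proof -
    have "((\<lambda>x. u x *\<^sub>R Y x) has_derivative
        (\<lambda>v. u x *\<^sub>R frechet_derivative Y (at x) v + frechet_derivative u (at x) v *\<^sub>R Y x)) (at x)"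
      by (rule has_derivative_scaleR[OF smooth_on_has_derivative[OF u x] smooth_on_has_derivative[OF Y x]])
    then have "(Z has_derivative
        (\<lambda>v. u x *\<^sub>R frechet_derivative Y (at x) v + frechet_derivative u (at x) v *\<^sub>R Y x)) (at x)"
      by (rule has_derivative_transform_within_open[OF _ R x]) (simp add: Z_def)
    from fun_cong[OF frechet_derivative_at[OF this]]
    have dZ: "frechet_derivative Z (at x) v =
        u x *\<^sub>R frechet_derivative Y (at x) v + frechet_derivative u (at x) v *\<^sub>R Y x" for v
      by simp
    have "frechet_derivative u (at x) (Y x) = (\<Sum>i\<in>UNIV. Y x $ i *\<^sub>R frechet_derivative u (at x) (axis i 1))"
      by (rule linear_axis_expansion[OF linear_frechet_derivative_smooth[OF u x]])
    then show ?thesis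
      by (simp add: divergence_def dZ sum.distrib sum_distrib_left mult.commute)
  qed
  have div_out: "divergence Z x = 0" if "x \<notin> R" for x
  proof -
    have "x \<in> - K" using that K by auto
    then have "frechet_derivative Z (at x) v = 0" for v
      by (intro derivative_zero_on_open[OF open_Compl[OF compact_imp_closed[OF K(1)]]]) (use Zsupp in auto)
    then show ?thesis by (simp add: divergence_def)
  qed
  have oRK: "open (R - K)" using R K compact_imp_closed by blast
  have z1: "frechet_derivative u (at x) (Y x) = 0" if "x \<in> R" "x \<notin> K" for x
    using supp
  proof
    assume "\<forall>x\<in>R - K. u x = 0"
    then show ?thesis using derivative_zero_on_open[OF oRK, of u x] that by auto
  next
    assume "\<forall>x\<in>R - K. Y x = 0"
    then show ?thesis using that linear_0[OF linear_frechet_derivative_smooth[OF u]] by simp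
  qed
  have z2: "u x * divergence Y x = 0" if "x \<in> R" "x \<notin> K" for x
    using supp
  proof
    assume "\<forall>x\<in>R - K. Y x = 0"
    then have "frechet_derivative Y (at x) v = 0" for v
      using derivative_zero_on_open[OF oRK, of Y x] that by auto
    then show ?thesis by (simp add: divergence_def)
  qed (use that in auto)
  have c1: "continuous_on R (\<lambda>x. frechet_derivative u (at x) (Y x))"
    by (rule smooth_on_continuous[OF smooth_on_apply_derivative[OF R R u smooth_on_ident[OF R] _ Y]])
  have c2: "continuous_on R (\<lambda>x. u x * divergence Y x)"
    by (intro continuous_intros smooth_on_continuous[OF u] smooth_on_continuous[OF smooth_on_divergence[OF R Y]])
  have i1: "(\<lambda>x. frechet_derivative u (at x) (Y x)) integrable_on R"
    using absolutely_integrable_on_open[OF R K c1 z1 order_refl] by (auto simp: absolutely_integrable_on_def)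
  have i2: "(\<lambda>x. u x * divergence Y x) integrable_on R"
    using absolutely_integrable_on_open[OF R K c2 z2 order_refl] by (auto simp: absolutely_integrable_on_def)
  have "0 = integral R (divergence Z)"
    using integral_subset_zero[of R UNIV "divergence Z"] div_out int0 by simp
  also have "\<dots> = integral R (\<lambda>x. frechet_derivative u (at x) (Y x) + u x * divergence Y x)"
    by (rule integral_cong) (rule div)
  also have "\<dots> = integral R (\<lambda>x. frechet_derivative u (at x) (Y x)) + integral R (\<lambda>x. u x * divergence Y x)"
    by (rule integral_add[OF i1 i2])
  finally show ?thesis by simp
qed

text \<open>
  A differential 3-form is handled through its coefficients \<open>W a\<close> in the charts at the points
  \<open>a\<close>, a 2-form \<open>X \<lrcorner> dx\<^sub>1 \<and> dx\<^sub>2 \<and> dx\<^sub>3\<close> through the vector fields \<open>X a\<close> on the coordinate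
  domains; these change with the determinant of the transition maps.
\<close>

locale closed_3manifold = oriented_atlas P
  for P :: "('p::{t2_space, second_countable_topology}, real^3) charts" +
  fixes F :: "'p set" and h :: "'p \<Rightarrow> 'p \<Rightarrow> real"
  assumes cpt: "compact (UNIV :: 'p set)" and pou: "partition_of_unity P F h"
begin

definition density :: "('p \<Rightarrow> real^3 \<Rightarrow> real) \<Rightarrow> bool" where
  "density W \<longleftrightarrow> (\<forall>a. continuous_on (range_at P a) (W a)) \<and>
     (\<forall>a b. \<forall>x\<in>overlap a b. W a x = det (matrix (dtrans a b x)) * W b (trans a b x))"

definition integrate :: "('p \<Rightarrow> real^3 \<Rightarrow> real) \<Rightarrow> real" where
  "integrate W = (\<Sum>a\<in>F. integral (range_at P a) (\<lambda>x. h a (inv_chart P a x) * W a x))"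

definition vector_density :: "('p \<Rightarrow> real^3 \<Rightarrow> real^3) \<Rightarrow> bool" where
  "vector_density X \<longleftrightarrow> (\<forall>a. smooth_on (range_at P a) (X a)) \<and>
     (\<forall>a b. \<forall>x\<in>overlap a b.
        dtrans a b x (X a x) = det (matrix (dtrans a b x)) *\<^sub>R X b (trans a b x))"

definition derivative_along :: "('p \<Rightarrow> real) \<Rightarrow> ('p \<Rightarrow> real^3 \<Rightarrow> real^3) \<Rightarrow> 'p \<Rightarrow> real^3 \<Rightarrow> real" where
  "derivative_along u X a x = frechet_derivative (u \<circ> inv_chart P a) (at x) (X a x)"

lemma finF: "finite F" and h_smooth: "a \<in> F \<Longrightarrow> smooth_function P (h a)"
  and h_closure: "a \<in> F \<Longrightarrow> closure {q. h a q \<noteq> 0} \<subseteq> dom_at P a"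
  and h_sum: "(\<Sum>a\<in>F. h a q) = 1"
  using pou by (auto simp: partition_of_unity_def)

lemma h_dom: "a \<in> F \<Longrightarrow> h a q \<noteq> 0 \<Longrightarrow> q \<in> dom_at P a"
  using h_closure closure_subset by fastforce

lemma h_support:
  assumes "a \<in> F"
  obtains K where "compact K" "K \<subseteq> range_at P a" "\<And>x. x \<in> range_at P a \<Longrightarrow> x \<notin> K \<Longrightarrow> h a (inv_chart P a x) = 0"
    "\<And>q. h a q \<noteq> 0 \<Longrightarrow> q \<in> inv_chart P a ` K"
proof
  let ?L = "closure {q. h a q \<noteq> 0}"
  have L: "compact ?L" using compact_Int_closed[OF cpt, of ?L] by simp
  show "compact (chart_at P a ` ?L)"
    by (rule compact_continuous_image[OF continuous_on_subset[OF continuous_chart h_closure[OF assms]] L])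
  show "chart_at P a ` ?L \<subseteq> range_at P a" using h_closure[OF assms] chart_range by blast
  show "h a (inv_chart P a x) = 0" if "x \<in> range_at P a" "x \<notin> chart_at P a ` ?L" for x
  proof (rule ccontr)
    assume "h a (inv_chart P a x) \<noteq> 0"
    then have "inv_chart P a x \<in> ?L" using closure_subset by fastforce
    then show False using that chart_inv_chart[OF that(1)] by (metis image_eqI)
  qed
  show "q \<in> inv_chart P a ` chart_at P a ` ?L" if "h a q \<noteq> 0" for q
    using that closure_subset h_dom[OF assms that] inv_chart_chart
    by (metis (mono_tags, lifting) image_eqI in_mono mem_Collect_eq)
qed

lemma smooth_function_chart: "smooth_function P u \<Longrightarrow> smooth_on (range_at P a) (u \<circ> inv_chart P a)"
  by (simp add: smooth_function_def)

lemma continuous_function_chart: "smooth_function P u \<Longrightarrow> continuous_on (range_at P a) (\<lambda>x. u (inv_chart P a x))"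
  using smooth_on_continuous[OF smooth_function_chart] by (simp add: o_def)

lemma density_continuous: "density W \<Longrightarrow> continuous_on (range_at P a) (W a)"
  and density_change: "density W \<Longrightarrow> x \<in> overlap a b \<Longrightarrow> W a x = det (matrix (dtrans a b x)) * W b (trans a b x)"
  by (auto simp: density_def)

lemma integrand_continuous:
  "a \<in> F \<Longrightarrow> density W \<Longrightarrow> continuous_on (range_at P b) (\<lambda>x. h a (inv_chart P b x) * W b x)"
  by (intro continuous_on_mult continuous_function_chart h_smooth density_continuous)

lemma integrand_integrable:
  assumes "a \<in> F" "density W"
  shows "(\<lambda>x. h a (inv_chart P a x) * W a x) integrable_on range_at P a"
proof -
  obtain K where K: "compact K" "K \<subseteq> range_at P a" "\<And>x. x \<in> range_at P a \<Longrightarrow> x \<notin> K \<Longrightarrow> h a (inv_chart P a x) = 0"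
    using h_support[OF assms(1)] by metis
  have "(\<lambda>x. h a (inv_chart P a x) * W a x) absolutely_integrable_on range_at P a"
    by (rule absolutely_integrable_on_open[OF open_range K(1,2) integrand_continuous[OF assms]])
       (use K(3) in auto)
  then show ?thesis by (simp add: absolutely_integrable_on_def)
qed

lemma integrate_add:
  assumes "density W" "density V"
  shows "integrate (\<lambda>a x. W a x + V a x) = integrate W + integrate V"
  unfolding integrate_def sum.distrib[symmetric]
  by (rule sum.cong[OF refl])
     (simp add: distrib_left integral_add integrand_integrable assms)

lemma integrate_cmul: "integrate (\<lambda>a x. c * W a x) = c * integrate W"
proof -
  have "integral (range_at P a) (\<lambda>x. h a (inv_chart P a x) * (c * W a x))
      = c * integral (range_at P a) (\<lambda>x. h a (inv_chart P a x) * W a x)" for a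
    by (subst integral_mult_right[symmetric]) (simp add: mult.left_commute)
  then show ?thesis by (simp add: integrate_def sum_distrib_left)
qed

lemma integrate_minus: "integrate (\<lambda>a x. - W a x) = - integrate W"
  using integrate_cmul[of "-1" W] by simp

lemma integrate_cong: "(\<And>a x. x \<in> range_at P a \<Longrightarrow> W a x = V a x) \<Longrightarrow> integrate W = integrate V"
  unfolding integrate_def by (intro sum.cong refl integral_cong) simp

lemma density_add: "density W \<Longrightarrow> density V \<Longrightarrow> density (\<lambda>a x. W a x + V a x)"
  by (auto simp: density_def distrib_left intro!: continuous_intros)

lemma density_cmul: "density W \<Longrightarrow> density (\<lambda>a x. c * W a x)"
  by (auto simp: density_def intro!: continuous_intros)

lemma density_function_mult:
  assumes "smooth_function P u" "density W" shows "density (\<lambda>a x. u (inv_chart P a x) * W a x)"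
  using assms(2) inv_trans unfolding density_def
  by (auto intro!: continuous_intros continuous_function_chart assms(1))

lemma density_sum: "finite I \<Longrightarrow> (\<And>i. i \<in> I \<Longrightarrow> density (W i)) \<Longrightarrow> density (\<lambda>a x. \<Sum>i\<in>I. W i a x)"
proof (induction I rule: finite_induct)
  case empty
  then show ?case by (simp add: density_def)
next
  case (insert i I)
  then show ?case using density_add[of "W i" "\<lambda>a x. \<Sum>i\<in>I. W i a x"] by simp
qed

lemma integrate_sum:
  assumes "finite I" "\<And>i. i \<in> I \<Longrightarrow> density (W i)"
  shows "integrate (\<lambda>a x. \<Sum>i\<in>I. W i a x) = (\<Sum>i\<in>I. integrate (W i))"
  using assms
proof (induction I rule: finite_induct)
  case empty
  then show ?case by (simp add: integrate_def)
next
  case (insert i I)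
  then show ?case
    using integrate_add[of "W i" "\<lambda>a x. \<Sum>i\<in>I. W i a x"] density_sum[of I W] by simp
qed

lemma image_trans_overlap: "trans a b ` overlap a b = overlap b a"
proof
  show "overlap b a \<subseteq> trans a b ` overlap a b"
  proof
    fix y assume "y \<in> overlap b a"
    then show "y \<in> trans a b ` overlap a b"
      using trans_overlap[of y b a] trans_inverse[of y b a] by (metis image_eqI)
  qed
qed (use trans_overlap in blast)

lemma integral_change_of_chart:
  assumes f: "\<And>x. x \<in> overlap a b \<Longrightarrow> f x = det (matrix (dtrans a b x)) * g (trans a b x)"
    and int: "f absolutely_integrable_on overlap a b"
  shows "integral (overlap b a) g = integral (overlap a b) (f :: real^3 \<Rightarrow> real)"
proof -
  let ?S = "overlap a b"
  have inj: "inj_on (trans a b) ?S" by (rule inj_on_inverseI[of _ "trans b a"]) (rule trans_inverse)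
  have eq: "\<bar>det (matrix (dtrans a b x))\<bar> *\<^sub>R (vec (g (trans a b x)) :: real^1) = vec (f x)" if "x \<in> ?S" for x
    using det_dtrans[OF that] f[OF that] by (simp add: vec_eq_iff)
  have S: "?S \<in> sets lebesgue" using open_overlap by (simp add: borel_open)
  \<comment> \<open>The change of variables formula requires vectors as values, hence the passage to \<open>real^1\<close>; the
    absolute value disappears since the transition maps preserve the orientation.\<close>
  have cov: "(\<lambda>x. \<bar>det (matrix (dtrans a b x))\<bar> *\<^sub>R (vec (g (trans a b x)) :: real^1)) absolutely_integrable_on ?S \<and>
      integral ?S (\<lambda>x. \<bar>det (matrix (dtrans a b x))\<bar> *\<^sub>R (vec (g (trans a b x)) :: real^1)) = (vec (integral ?S f) :: real^1)
    \<longleftrightarrow> (\<lambda>y. vec (g y) :: real^1) absolutely_integrable_on (trans a b ` ?S)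
      \<and> integral (trans a b ` ?S) (\<lambda>y. vec (g y) :: real^1) = vec (integral ?S f)"
    by (rule has_absolute_integral_change_of_variables[OF S _ inj])
       (rule has_derivative_at_withinI[OF has_derivative_trans])
  have "(\<lambda>x. vec (f x) :: real^1) absolutely_integrable_on ?S"
    using int by (simp add: absolutely_integrable_on_1_iff)
  then have "(\<lambda>x. \<bar>det (matrix (dtrans a b x))\<bar> *\<^sub>R (vec (g (trans a b x)) :: real^1)) absolutely_integrable_on ?S"
    by (rule absolutely_integrable_spike[where S="{}"]) (use eq in auto)
  moreover have "integral ?S (\<lambda>x. \<bar>det (matrix (dtrans a b x))\<bar> *\<^sub>R (vec (g (trans a b x)) :: real^1)) = vec (integral ?S f)"
  proof -
    have "integral ?S (\<lambda>x. \<bar>det (matrix (dtrans a b x))\<bar> *\<^sub>R (vec (g (trans a b x)) :: real^1))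
        = integral ?S (\<lambda>x. vec (f x) :: real^1)" by (rule integral_cong) (rule eq)
    then show ?thesis by (simp add: integral_on_1_eq)
  qed
  ultimately have "integral (overlap b a) (\<lambda>y. vec (g y) :: real^1) = vec (integral ?S f)"
    using cov unfolding image_trans_overlap by blast
  then show ?thesis by (simp add: integral_on_1_eq vec_eq_iff)
qed

text \<open>
  Each term of the partition of unity is transported to the chart at \<open>a\<close>, where the terms add up to 1.
\<close>

lemma integrate_localized:
  assumes W: "density W" and K: "compact K" "K \<subseteq> range_at P a"
    and supp: "\<And>b y. y \<in> range_at P b \<Longrightarrow> W b y \<noteq> 0 \<Longrightarrow> inv_chart P b y \<in> inv_chart P a ` K"
  shows "integrate W = integral (range_at P a) (W a)"
proof -
  have supp_a: "W a x = 0" if xr: "x \<in> range_at P a" and xK: "x \<notin> K" for x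
  proof (rule ccontr)
    assume "W a x \<noteq> 0"
    then obtain k where "k \<in> K" "inv_chart P a x = inv_chart P a k" using supp[OF xr] by blast
    then show False using xr xK K(2) chart_inv_chart by (metis subsetD)
  qed
  have summand: "integral (range_at P b) (\<lambda>y. h b (inv_chart P b y) * W b y)
      = integral (range_at P a) (\<lambda>x. h b (inv_chart P a x) * W a x)" if b: "b \<in> F" for b
  proof -
    have sub: "overlap a b \<subseteq> range_at P a" "overlap b a \<subseteq> range_at P b" by (auto simp: overlap_iff)
    have za: "h b (inv_chart P a x) * W a x = 0" if "x \<in> range_at P a" "x \<notin> overlap a b" for x
      using h_dom[OF b] that by (auto simp: overlap_iff)
    have zb: "h b (inv_chart P b y) * W b y = 0" if "y \<in> range_at P b" "y \<notin> overlap b a" for y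
    proof (rule ccontr)
      assume "h b (inv_chart P b y) * W b y \<noteq> 0"
      then have "inv_chart P b y \<in> inv_chart P a ` K" using supp that(1) by auto
      then show False using that K(2) inv_chart_dom by (auto simp: overlap_iff)
    qed
    have abs: "(\<lambda>x. h b (inv_chart P a x) * W a x) absolutely_integrable_on overlap a b"
      by (rule absolutely_integrable_on_open[OF open_range K integrand_continuous[OF b W] _ sub(1) za])
         (use supp_a in auto)
    have "integral (range_at P b) (\<lambda>y. h b (inv_chart P b y) * W b y)
        = integral (overlap b a) (\<lambda>y. h b (inv_chart P b y) * W b y)"
      by (rule integral_subset_zero[symmetric, OF sub(2) zb])
    also have "\<dots> = integral (overlap a b) (\<lambda>x. h b (inv_chart P a x) * W a x)"
      by (rule integral_change_of_chart[OF _ abs])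
         (use inv_trans density_change[OF W] in auto)
    also have "\<dots> = integral (range_at P a) (\<lambda>x. h b (inv_chart P a x) * W a x)"
      by (rule integral_subset_zero[OF sub(1) za])
    finally show ?thesis .
  qed
  have int: "(\<lambda>x. h b (inv_chart P a x) * W a x) integrable_on range_at P a" if b: "b \<in> F" for b
    using absolutely_integrable_on_open[OF open_range K integrand_continuous[OF b W] _ order_refl] supp_a
    by (auto simp: absolutely_integrable_on_def)
  have "integrate W = (\<Sum>b\<in>F. integral (range_at P a) (\<lambda>x. h b (inv_chart P a x) * W a x))"
    unfolding integrate_def by (rule sum.cong[OF refl summand])
  also have "\<dots> = integral (range_at P a) (\<lambda>x. \<Sum>b\<in>F. h b (inv_chart P a x) * W a x)"
    by (rule integral_sum[symmetric, OF finF int])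
  also have "\<dots> = integral (range_at P a) (W a)"
    by (simp add: sum_distrib_right[symmetric] h_sum)
  finally show ?thesis .
qed

end

lemma frechet_derivative_scaleR:
  "smooth_on S f \<Longrightarrow> x \<in> S \<Longrightarrow> frechet_derivative f (at x) (c *\<^sub>R v) = c *\<^sub>R frechet_derivative f (at x) v"
  by (rule linear_cmul[OF linear_frechet_derivative_smooth])

lemma divergence_scaleR_const:
  assumes "open S" "smooth_on S s" "x \<in> S"
  shows "divergence (\<lambda>x. s x *\<^sub>R v) x = frechet_derivative s (at x) v"
proof -
  have "((\<lambda>x. s x *\<^sub>R v) has_derivative (\<lambda>w. frechet_derivative s (at x) w *\<^sub>R v)) (at x)"
    by (rule has_derivative_scaleR_left[OF smooth_on_has_derivative[OF assms(2,3)]])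
  from fun_cong[OF frechet_derivative_at[OF this]]
  have d: "frechet_derivative (\<lambda>x. s x *\<^sub>R v) (at x) w = frechet_derivative s (at x) w *\<^sub>R v" for w
    by simp
  have lin: "linear (frechet_derivative s (at x))"
    by (rule linear_frechet_derivative_smooth[OF assms(2,3)])
  have "v = (\<Sum>i\<in>UNIV. v $ i *\<^sub>R axis i 1)"
    by (simp add: vec_eq_iff axis_def if_distrib[of "\<lambda>t. _ * t"] cong: if_cong)
  then have "frechet_derivative s (at x) v = frechet_derivative s (at x) (\<Sum>i\<in>UNIV. v $ i *\<^sub>R axis i 1)"
    by simp
  also have "\<dots> = (\<Sum>i\<in>UNIV. v $ i *\<^sub>R frechet_derivative s (at x) (axis i 1))"
    by (simp only: linear_sum[OF lin] linear_cmul[OF lin])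
  finally show ?thesis by (simp add: divergence_def d mult.commute)
qed

lemma divergence_diff:
  assumes "smooth_on S X" "smooth_on S Y" "x \<in> S"
  shows "divergence (\<lambda>x. X x - Y x) x = divergence X x - divergence Y x"
proof -
  have "((\<lambda>x. X x - Y x) has_derivative
      (\<lambda>w. frechet_derivative X (at x) w - frechet_derivative Y (at x) w)) (at x)"
    by (rule has_derivative_diff[OF smooth_on_has_derivative[OF assms(1,3)] smooth_on_has_derivative[OF assms(2,3)]])
  from fun_cong[OF frechet_derivative_at[OF this]]
  have d: "frechet_derivative (\<lambda>x. X x - Y x) (at x) w
      = frechet_derivative X (at x) w - frechet_derivative Y (at x) w" for w by simp
  show ?thesis by (simp add: divergence_def d sum_subtractf)
qed

context closed_3manifold
begin

lemma vector_density_smooth: "vector_density X \<Longrightarrow> smooth_on (range_at P a) (X a)"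
  and vector_density_change: "vector_density X \<Longrightarrow> x \<in> overlap a b \<Longrightarrow>
    dtrans a b x (X a x) = det (matrix (dtrans a b x)) *\<^sub>R X b (trans a b x)"
  by (auto simp: vector_density_def)

lemma derivative_change:
  assumes u: "smooth_function P u" and x: "x \<in> overlap a b"
  shows "frechet_derivative (u \<circ> inv_chart P a) (at x) v
    = frechet_derivative (u \<circ> inv_chart P b) (at (trans a b x)) (dtrans a b x v)"
proof -
  have y: "trans a b x \<in> range_at P b" using trans_overlap[OF x] by (simp add: overlap_iff)
  have "((\<lambda>x. (u \<circ> inv_chart P b) (trans a b x)) has_derivative
      (\<lambda>v. frechet_derivative (u \<circ> inv_chart P b) (at (trans a b x)) (dtrans a b x v))) (at x)"
    by (rule has_derivative_compose[OF has_derivative_trans[OF x]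
          smooth_on_has_derivative[OF smooth_function_chart[OF u] y]])
  then have "((u \<circ> inv_chart P a) has_derivative
      (\<lambda>v. frechet_derivative (u \<circ> inv_chart P b) (at (trans a b x)) (dtrans a b x v))) (at x)"
    by (rule has_derivative_transform_within_open[OF _ open_overlap x]) (use inv_trans in auto)
  from fun_cong[OF frechet_derivative_at[OF this]] show ?thesis by simp
qed

lemma density_derivative_along:
  assumes u: "smooth_function P u" and X: "vector_density X"
  shows "density (derivative_along u X)"
  unfolding density_def derivative_along_def
proof (intro conjI allI ballI)
  fix a
  show "continuous_on (range_at P a) (\<lambda>x. frechet_derivative (u \<circ> inv_chart P a) (at x) (X a x))"
    by (rule smooth_on_continuous, rule smooth_on_apply_derivative[OF open_range open_range
          smooth_function_chart[OF u] smooth_on_ident[OF open_range] _ vector_density_smooth[OF X]])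
  fix b x assume x: "x \<in> overlap a b"
  then have y: "trans a b x \<in> range_at P b" using trans_overlap[OF x] by (simp add: overlap_iff)
  show "frechet_derivative (u \<circ> inv_chart P a) (at x) (X a x) = det (matrix (dtrans a b x)) *
      frechet_derivative (u \<circ> inv_chart P b) (at (trans a b x)) (X b (trans a b x))"
    unfolding derivative_change[OF u x] vector_density_change[OF X x]
      frechet_derivative_scaleR[OF smooth_function_chart[OF u] y] by simp
qed

lemma vector_density_add:
  assumes "vector_density X" "vector_density Y" shows "vector_density (\<lambda>a x. X a x + Y a x)"
  unfolding vector_density_def
proof (intro conjI allI ballI)
  fix a b x assume x: "x \<in> overlap a b"
  show "dtrans a b x (X a x + Y a x) = det (matrix (dtrans a b x)) *\<^sub>R (X b (trans a b x) + Y b (trans a b x))"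
    unfolding linear_add[OF linear_dtrans[OF x]] vector_density_change[OF assms(1) x]
      vector_density_change[OF assms(2) x] by (simp add: scaleR_add_right)
qed (intro smooth_on_add open_range vector_density_smooth assms)

lemma vector_density_minus:
  assumes "vector_density X" shows "vector_density (\<lambda>a x. - X a x)"
  unfolding vector_density_def
proof (intro conjI allI ballI)
  fix a b x assume x: "x \<in> overlap a b"
  show "dtrans a b x (- X a x) = det (matrix (dtrans a b x)) *\<^sub>R (- X b (trans a b x))"
    unfolding linear_neg[OF linear_dtrans[OF x]] vector_density_change[OF assms(1) x] by simp
qed (intro smooth_on_minus open_range vector_density_smooth assms)

subsection \<open>Extension of compactly supported objects from a chart\<close>

text \<open>
  A density or a vector field with compact support in the chart at \<open>a\<close> is transported to the other
  charts by the transformation laws of \<open>density\<close> and \<open>vector_density\<close>, and extended by zero.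
\<close>

definition extend_density :: "'p \<Rightarrow> (real^3 \<Rightarrow> real) \<Rightarrow> 'p \<Rightarrow> real^3 \<Rightarrow> real" where
  "extend_density a w b y =
     (if inv_chart P b y \<in> dom_at P a then det (matrix (dtrans b a y)) * w (trans b a y) else 0)"

definition extend_vector :: "'p \<Rightarrow> (real^3 \<Rightarrow> real^3) \<Rightarrow> 'p \<Rightarrow> real^3 \<Rightarrow> real^3" where
  "extend_vector a Y b y =
     (if inv_chart P b y \<in> dom_at P a then
      det (matrix (dtrans b a y)) *\<^sub>R dtrans a b (trans b a y) (Y (trans b a y)) else 0)"

lemma extend_density_self: "x \<in> range_at P a \<Longrightarrow> extend_density a w a x = w x"
  by (simp add: extend_density_def inv_chart_dom det_self[simplified] chart_inv_chart)

lemma extend_vector_self: "x \<in> range_at P a \<Longrightarrow> extend_vector a Y a x = Y x"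
  by (simp add: extend_vector_def inv_chart_dom det_self[simplified] dtrans_self[simplified] chart_inv_chart)

lemma extend_support:
  assumes y: "y \<in> range_at P b" and nz: "extend_density a w b y \<noteq> 0 \<or> extend_vector a Y b y \<noteq> 0"
    and supp: "\<And>x. x \<in> range_at P a \<Longrightarrow> x \<notin> K \<Longrightarrow> w x = 0" "\<And>x. x \<in> range_at P a \<Longrightarrow> x \<notin> K \<Longrightarrow> Y x = 0"
  shows "inv_chart P b y \<in> inv_chart P a ` K"
proof -
  have ya: "inv_chart P b y \<in> dom_at P a"
    using nz by (auto simp: extend_density_def extend_vector_def split: if_splits)
  then have o: "y \<in> overlap b a" using y by (simp add: overlap_iff)
  have x: "trans b a y \<in> overlap a b" by (rule trans_overlap[OF o])
  have "w (trans b a y) \<noteq> 0 \<or> Y (trans b a y) \<noteq> 0"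
    using nz ya linear_0[OF linear_dtrans[OF x]] by (auto simp: extend_density_def extend_vector_def)
  then have "trans b a y \<in> K" using supp x by (auto simp: overlap_iff)
  then show ?thesis using inv_trans[OF o] by (metis image_eqI)
qed

lemma smooth_extend_density:
  assumes K: "compact K" "K \<subseteq> range_at P a" and w: "smooth_on (range_at P a) w"
    "\<And>x. x \<in> range_at P a \<Longrightarrow> x \<notin> K \<Longrightarrow> w x = 0"
  shows "smooth_on (range_at P b) (extend_density a w b)"
proof -
  have "smooth_on (overlap b a) (\<lambda>y. w (trans b a y))"
    by (rule smooth_on_compose[OF w(1) smooth_trans open_overlap open_range])
       (use trans_overlap in \<open>auto simp: overlap_iff\<close>)
  then have sm: "smooth_on (overlap b a) (\<lambda>y. det (matrix (dtrans b a y)) * w (trans b a y))"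
    by (intro smooth_on_mult open_overlap smooth_det_dtrans)
  have z: "det (matrix (dtrans b a y)) * w (trans b a y) = 0" if "y \<in> overlap b a" "trans b a y \<notin> K" for y
    using w(2) that trans_overlap[OF that(1)] by (simp add: overlap_iff)
  show ?thesis using smooth_on_chart_extension[OF K sm z] by (simp add: extend_density_def[abs_def])
qed

lemma density_extend:
  assumes K: "compact K" "K \<subseteq> range_at P a" and w: "smooth_on (range_at P a) w"
    "\<And>x. x \<in> range_at P a \<Longrightarrow> x \<notin> K \<Longrightarrow> w x = 0"
  shows "density (extend_density a w)"
  unfolding density_def
proof (intro conjI allI ballI)
  show "continuous_on (range_at P b) (extend_density a w b)" for b
    by (rule smooth_on_continuous[OF smooth_extend_density[OF K w]])
  fix b c y assume y: "y \<in> overlap b c"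
  have i: "inv_chart P c (trans b c y) = inv_chart P b y" by (rule inv_trans[OF y])
  show "extend_density a w b y = det (matrix (dtrans b c y)) * extend_density a w c (trans b c y)"
  proof (cases "inv_chart P b y \<in> dom_at P a")
    case True
    have "extend_density a w c (trans b c y)
        = det (matrix (dtrans c a (trans b c y))) * w (trans c a (trans b c y))"
      using True by (simp only: extend_density_def i if_True)
    moreover have "extend_density a w b y = det (matrix (dtrans b a y)) * w (trans b a y)"
      using True by (simp only: extend_density_def if_True)
    ultimately show ?thesis
      using det_chain[OF y True] trans_trans[OF y, of a] by (simp only: mult_ac)
  next
    case False
    then show ?thesis by (simp only: extend_density_def i if_False)
  qed
qed

lemma vector_density_extend:
  assumes K: "compact K" "K \<subseteq> range_at P a" and Y: "smooth_on (range_at P a) Y"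
    "\<And>x. x \<in> range_at P a \<Longrightarrow> x \<notin> K \<Longrightarrow> Y x = 0"
  shows "vector_density (extend_vector a Y)"
  unfolding vector_density_def
proof (intro conjI allI ballI)
  fix b
  have in_range: "trans b a y \<in> range_at P a" "trans b a y \<in> overlap a b" if "y \<in> overlap b a" for y
    using trans_overlap[OF that] by (auto simp: overlap_iff)
  have Yt: "smooth_on (overlap b a) (\<lambda>y. Y (trans b a y))"
    by (rule smooth_on_compose[OF Y(1) smooth_trans open_overlap open_range in_range(1)])
  have "smooth_on (overlap b a) (\<lambda>y. dtrans a b (trans b a y) (Y (trans b a y)))"
    by (rule smooth_on_apply_derivative[OF open_overlap open_overlap smooth_trans smooth_trans in_range(2) Yt])
  then have sm: "smooth_on (overlap b a)
      (\<lambda>y. det (matrix (dtrans b a y)) *\<^sub>R dtrans a b (trans b a y) (Y (trans b a y)))"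
    by (intro smooth_on_scaleR open_overlap smooth_det_dtrans)
  have z: "det (matrix (dtrans b a y)) *\<^sub>R dtrans a b (trans b a y) (Y (trans b a y)) = 0"
    if "y \<in> overlap b a" "trans b a y \<notin> K" for y
    using Y(2)[OF in_range(1)[OF that(1)] that(2)] linear_0[OF linear_dtrans[OF in_range(2)[OF that(1)]]]
    by simp
  show "smooth_on (range_at P b) (extend_vector a Y b)"
    using smooth_on_chart_extension[OF K sm z] by (simp add: extend_vector_def[abs_def])
  fix c y assume y: "y \<in> overlap b c"
  have i: "inv_chart P c (trans b c y) = inv_chart P b y" by (rule inv_trans[OF y])
  show "dtrans b c y (extend_vector a Y b y) = det (matrix (dtrans b c y)) *\<^sub>R extend_vector a Y c (trans b c y)"
  proof (cases "inv_chart P b y \<in> dom_at P a")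
    case True
    define x where "x = trans b a y"
    have ya: "y \<in> overlap b a" using True y by (simp add: overlap_iff)
    have x: "x \<in> overlap a b" unfolding x_def by (rule trans_overlap[OF ya])
    have xc: "inv_chart P a x \<in> dom_at P c" unfolding x_def inv_trans[OF ya] using y by (simp add: overlap_iff)
    have xy: "trans a b x = y" unfolding x_def by (rule trans_inverse[OF ya])
    have tt: "trans c a (trans b c y) = x" unfolding x_def by (rule trans_trans[OF y])
    have "dtrans b c y (extend_vector a Y b y)
        = det (matrix (dtrans b a y)) *\<^sub>R dtrans b c (trans a b x) (dtrans a b x (Y x))"
      using True by (simp only: extend_vector_def if_True linear_cmul[OF linear_dtrans[OF y]] xy flip: x_def)
    also have "\<dots> = (det (matrix (dtrans c a (trans b c y))) * det (matrix (dtrans b c y))) *\<^sub>R dtrans a c x (Y x)"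
      unfolding dtrans_chain[OF x xc] det_chain[OF y True] ..
    also have "\<dots> = det (matrix (dtrans b c y)) *\<^sub>R extend_vector a Y c (trans b c y)"
      using True by (simp only: extend_vector_def i if_True tt) simp
    finally show ?thesis .
  next
    case False
    then show ?thesis using linear_0[OF linear_dtrans[OF y]] by (simp only: extend_vector_def i if_False) simp
  qed
qed

lemma integrate_extend_density:
  assumes K: "compact K" "K \<subseteq> range_at P a" and w: "smooth_on (range_at P a) w"
    "\<And>x. x \<in> range_at P a \<Longrightarrow> x \<notin> K \<Longrightarrow> w x = 0"
  shows "integrate (extend_density a w) = integral (range_at P a) w"
proof -
  have dw: "density (extend_density a w)" by (rule density_extend[OF K w])
  have "integrate (extend_density a w) = integral (range_at P a) (extend_density a w a)"
    by (rule integrate_localized[OF dw K])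
       (rule extend_support[where Y="\<lambda>_. 0" and w=w and a=a], use w in auto)
  also have "\<dots> = integral (range_at P a) w" by (rule integral_cong) (rule extend_density_self)
  finally show ?thesis .
qed

subsection \<open>Weak divergence\<close>

text \<open>
  Formulating \<open>d \<eta> = \<mu>\<close> by duality with functions makes it independent of charts: only
  the transformation of integrals is needed, not that of second derivatives.
\<close>

definition weak_divergence :: "('p \<Rightarrow> real^3 \<Rightarrow> real^3) \<Rightarrow> ('p \<Rightarrow> real^3 \<Rightarrow> real) \<Rightarrow> bool" where
  "weak_divergence X W \<longleftrightarrow> (\<forall>g. smooth_function P g \<longrightarrow>
     integrate (derivative_along g X) = - integrate (\<lambda>a x. g (inv_chart P a x) * W a x))"

definition divergence_free :: "('p \<Rightarrow> real^3 \<Rightarrow> real^3) \<Rightarrow> bool" where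
  "divergence_free X \<longleftrightarrow> (\<forall>a. \<forall>x\<in>range_at P a. divergence (X a) x = 0)"

lemma derivative_along_add:
  assumes "smooth_function P g" "x \<in> range_at P a"
  shows "derivative_along g (\<lambda>a x. X a x + Y a x) a x = derivative_along g X a x + derivative_along g Y a x"
  unfolding derivative_along_def
  by (rule linear_add[OF linear_frechet_derivative_smooth[OF smooth_function_chart[OF assms(1)] assms(2)]])

lemma derivative_along_minus:
  assumes "smooth_function P g" "x \<in> range_at P a"
  shows "derivative_along g (\<lambda>a x. - X a x) a x = - derivative_along g X a x"
  unfolding derivative_along_def
  by (rule linear_neg[OF linear_frechet_derivative_smooth[OF smooth_function_chart[OF assms(1)] assms(2)]])

lemma weak_divergence_add:
  assumes "vector_density X" "vector_density Y" "density W" "density V"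
    and "weak_divergence X W" "weak_divergence Y V"
  shows "weak_divergence (\<lambda>a x. X a x + Y a x) (\<lambda>a x. W a x + V a x)"
  unfolding weak_divergence_def
proof (intro allI impI)
  fix g assume g: "smooth_function P g"
  have "integrate (derivative_along g (\<lambda>a x. X a x + Y a x))
      = integrate (\<lambda>a x. derivative_along g X a x + derivative_along g Y a x)"
    by (rule integrate_cong) (rule derivative_along_add[OF g])
  also have "\<dots> = integrate (derivative_along g X) + integrate (derivative_along g Y)"
    by (rule integrate_add) (intro density_derivative_along g assms)+
  also have "\<dots> = - (integrate (\<lambda>a x. g (inv_chart P a x) * W a x) + integrate (\<lambda>a x. g (inv_chart P a x) * V a x))"
    using assms(5,6) g by (simp add: weak_divergence_def)
  also have "integrate (\<lambda>a x. g (inv_chart P a x) * W a x) + integrate (\<lambda>a x. g (inv_chart P a x) * V a x)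
      = integrate (\<lambda>a x. g (inv_chart P a x) * (W a x + V a x))"
    using integrate_add[OF density_function_mult[OF g assms(3)] density_function_mult[OF g assms(4)]]
    by (simp add: distrib_left)
  finally show "integrate (derivative_along g (\<lambda>a x. X a x + Y a x))
      = - integrate (\<lambda>a x. g (inv_chart P a x) * (W a x + V a x))" .
qed

lemma weak_divergence_minus:
  assumes "weak_divergence X W" shows "weak_divergence (\<lambda>a x. - X a x) (\<lambda>a x. - W a x)"
  unfolding weak_divergence_def
proof (intro allI impI)
  fix g assume g: "smooth_function P g"
  have "integrate (derivative_along g (\<lambda>a x. - X a x)) = integrate (\<lambda>a x. - derivative_along g X a x)"
    by (rule integrate_cong) (rule derivative_along_minus[OF g])
  then show "integrate (derivative_along g (\<lambda>a x. - X a x)) = - integrate (\<lambda>a x. g (inv_chart P a x) * - W a x)"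
    using assms g by (simp add: weak_divergence_def integrate_minus)
qed

lemma weak_divergence_cong:
  assumes "weak_divergence X W" "\<And>a x. x \<in> range_at P a \<Longrightarrow> W a x = V a x"
  shows "weak_divergence X V"
proof -
  have "integrate (\<lambda>a x. g (inv_chart P a x) * W a x) = integrate (\<lambda>a x. g (inv_chart P a x) * V a x)" for g
    by (rule integrate_cong) (simp add: assms(2))
  then show ?thesis using assms(1) by (simp add: weak_divergence_def)
qed

text \<open>
  Both integrals are supported in one chart, where the claim is an integration by parts.
\<close>

lemma weak_divergence_extend:
  assumes K: "compact K" "K \<subseteq> range_at P a" and Y: "smooth_on (range_at P a) Y"
    "\<And>x. x \<in> range_at P a \<Longrightarrow> x \<notin> K \<Longrightarrow> Y x = 0"
  shows "weak_divergence (extend_vector a Y) (extend_density a (divergence Y))"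
  unfolding weak_divergence_def
proof (intro allI impI)
  fix g assume g: "smooth_function P g"
  let ?g = "g \<circ> inv_chart P a"
  have oRK: "open (range_at P a - K)" using open_range compact_imp_closed[OF K(1)] by blast
  have d0: "divergence Y x = 0" if "x \<in> range_at P a" "x \<notin> K" for x
  proof -
    have "frechet_derivative Y (at x) v = 0" for v
      by (rule derivative_zero_on_open[OF oRK]) (use Y(2) that in auto)
    then show ?thesis by (simp add: divergence_def)
  qed
  have dd: "density (extend_density a (divergence Y))"
    by (rule density_extend[OF K smooth_on_divergence[OF open_range Y(1)] d0])
  have "integrate (derivative_along g (extend_vector a Y))
      = integral (range_at P a) (derivative_along g (extend_vector a Y) a)"
  proof (rule integrate_localized[OF density_derivative_along[OF g vector_density_extend[OF K Y]] K])
    fix b y assume y: "y \<in> range_at P b" "derivative_along g (extend_vector a Y) b y \<noteq> 0"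
    have "extend_vector a Y b y \<noteq> 0"
      using y linear_0[OF linear_frechet_derivative_smooth[OF smooth_function_chart[OF g] y(1)]]
      by (auto simp: derivative_along_def)
    then show "inv_chart P b y \<in> inv_chart P a ` K"
      by (intro extend_support[OF y(1), of a "\<lambda>_. 0" Y]) (use Y(2) in auto)
  qed
  also have "\<dots> = integral (range_at P a) (\<lambda>x. frechet_derivative ?g (at x) (Y x))"
    by (rule integral_cong) (simp add: derivative_along_def extend_vector_self)
  also have "\<dots> = - integral (range_at P a) (\<lambda>x. ?g x * divergence Y x)"
    by (rule integral_by_parts[OF open_range smooth_function_chart[OF g] Y(1) K]) (use Y(2) in auto)
  also have "integral (range_at P a) (\<lambda>x. ?g x * divergence Y x)
      = integral (range_at P a) (\<lambda>x. g (inv_chart P a x) * extend_density a (divergence Y) a x)"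
    by (rule integral_cong) (simp add: extend_density_self)
  also have "\<dots> = integrate (\<lambda>b x. g (inv_chart P b x) * extend_density a (divergence Y) b x)"
    by (rule integrate_localized[symmetric, OF density_function_mult[OF g dd] K])
       (rule extend_support[where Y="\<lambda>_. 0" and w="divergence Y" and a=a], use d0 in auto)
  finally show "integrate (derivative_along g (extend_vector a Y))
      = - integrate (\<lambda>b x. g (inv_chart P b x) * extend_density a (divergence Y) b x)" .
qed

lemma integrate_derivative_along_localized:
  assumes X: "vector_density X" and g: "smooth_function P g" and K: "compact K" "K \<subseteq> range_at P a"
    and supp: "\<And>q. g q \<noteq> 0 \<Longrightarrow> q \<in> inv_chart P a ` K"
  shows "integrate (derivative_along g X)
    = - integral (range_at P a) (\<lambda>x. g (inv_chart P a x) * divergence (X a) x)"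
proof -
  have "integrate (derivative_along g X) = integral (range_at P a) (derivative_along g X a)"
  proof (rule integrate_localized[OF density_derivative_along[OF g X] K], rule ccontr)
    fix b y assume y: "y \<in> range_at P b" "derivative_along g X b y \<noteq> 0"
      and n: "inv_chart P b y \<notin> inv_chart P a ` K"
    let ?T = "{z \<in> range_at P b. inv_chart P b z \<in> - inv_chart P a ` K}"
    have "open ?T"
      by (rule open_preimage_inv_chart) (use compact_inv_chart_image(2)[OF K] in auto)
    then have "frechet_derivative (g \<circ> inv_chart P b) (at y) (X b y) = 0"
      by (rule derivative_zero_on_open) (use supp y n in auto)
    then show False using y(2) by (simp add: derivative_along_def)
  qed
  also have "\<dots> = integral (range_at P a) (\<lambda>x. frechet_derivative (g \<circ> inv_chart P a) (at x) (X a x))"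
    by (simp add: derivative_along_def[abs_def])
  also have "\<dots> = - integral (range_at P a) (\<lambda>x. (g \<circ> inv_chart P a) x * divergence (X a) x)"
  proof (rule integral_by_parts[OF open_range smooth_function_chart[OF g] vector_density_smooth[OF X] K], rule disjI1, rule ballI)
    fix x assume x: "x \<in> range_at P a - K"
    show "(g \<circ> inv_chart P a) x = 0"
    proof (rule ccontr)
      assume "(g \<circ> inv_chart P a) x \<noteq> 0"
      then obtain k where "k \<in> K" "inv_chart P a x = inv_chart P a k" using supp[of "inv_chart P a x"] by auto
      then show False using x K(2) chart_inv_chart by (metis DiffE subsetD)
    qed
  qed
  finally show ?thesis by simp
qed

text \<open>
  Stokes' theorem.  The partition of unity writes \<open>g\<close> as a sum of functions supported in single charts, for
  which it is an integration by parts.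
\<close>

lemma stokes:
  assumes X: "vector_density X" "divergence_free X" and g: "smooth_function P g"
  shows "integrate (derivative_along g X) = 0"
proof -
  have hg: "smooth_function P (\<lambda>q. h b q * g q)" if "b \<in> F" for b
    by (rule smooth_function_mult[OF h_smooth[OF that] g])
  have split: "derivative_along g X a x = (\<Sum>b\<in>F. derivative_along (\<lambda>q. h b q * g q) X a x)"
    if x: "x \<in> range_at P a" for a x
  proof -
    have "((\<lambda>x. \<Sum>b\<in>F. ((\<lambda>q. h b q * g q) \<circ> inv_chart P a) x) has_derivative
        (\<lambda>v. \<Sum>b\<in>F. frechet_derivative ((\<lambda>q. h b q * g q) \<circ> inv_chart P a) (at x) v)) (at x)"
      by (rule has_derivative_sum) (rule smooth_on_has_derivative[OF smooth_function_chart[OF hg] x])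
    moreover have "(\<lambda>x. \<Sum>b\<in>F. ((\<lambda>q. h b q * g q) \<circ> inv_chart P a) x) = g \<circ> inv_chart P a"
      by (simp add: fun_eq_iff h_sum flip: sum_distrib_right)
    ultimately have "(g \<circ> inv_chart P a has_derivative
        (\<lambda>v. \<Sum>b\<in>F. frechet_derivative ((\<lambda>q. h b q * g q) \<circ> inv_chart P a) (at x) v)) (at x)" by simp
    from fun_cong[OF frechet_derivative_at[OF this]] show ?thesis by (simp add: derivative_along_def)
  qed
  have zero: "integrate (derivative_along (\<lambda>q. h b q * g q) X) = 0" if b: "b \<in> F" for b
  proof -
    obtain K where K: "compact K" "K \<subseteq> range_at P b" "\<And>q. h b q \<noteq> 0 \<Longrightarrow> q \<in> inv_chart P b ` K"
      using h_support[OF b] by metis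
    have "integrate (derivative_along (\<lambda>q. h b q * g q) X)
        = - integral (range_at P b) (\<lambda>x. (h b (inv_chart P b x) * g (inv_chart P b x)) * divergence (X b) x)"
      by (rule integrate_derivative_along_localized[OF X(1) hg[OF b] K(1,2)]) (use K(3) in auto)
    also have "\<dots> = - integral (range_at P b) (\<lambda>x. 0)"
      using X(2) by (intro arg_cong[where f=uminus] integral_cong) (simp add: divergence_free_def)
    finally show ?thesis by simp
  qed
  have "integrate (derivative_along g X) = integrate (\<lambda>a x. \<Sum>b\<in>F. derivative_along (\<lambda>q. h b q * g q) X a x)"
    by (rule integrate_cong) (rule split)
  also have "\<dots> = (\<Sum>b\<in>F. integrate (derivative_along (\<lambda>q. h b q * g q) X))"
    by (rule integrate_sum[OF finF]) (rule density_derivative_along[OF hg X(1)])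
  finally show ?thesis using zero by simp
qed

text \<open>
  Bump functions supported in a chart extend by zero to admissible test functions.
\<close>

lemma weak_divergence_zero_imp_divergence_free:
  assumes X: "vector_density X" and wd: "weak_divergence X (\<lambda>a x. 0)"
  shows "divergence_free X"
  unfolding divergence_free_def
proof (intro allI ballI)
  fix a x assume x: "x \<in> range_at P a"
  note Xs = vector_density_smooth[OF X, of a]
  show "divergence (X a) x = 0"
  proof (rule vanishes_if_bump_integrals_vanish[OF open_range _ _ x])
    show "continuous_on (range_at P a) (divergence (X a))"
      by (rule smooth_on_continuous[OF smooth_on_divergence[OF open_range Xs]])
    fix g :: "real^3 \<Rightarrow> real" and c r
    assume g: "smooth_on UNIV g" and r: "r > 0" "cball c r \<subseteq> range_at P a"
      and supp: "\<And>x. g x \<noteq> 0 \<Longrightarrow> x \<in> cball c r"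
    let ?K = "cball c r"
    have K: "compact ?K" "?K \<subseteq> range_at P a" using r by auto
    have gs: "smooth_on (range_at P a) g" by (rule smooth_on_subset[OF g]) simp
    have g0: "g x = 0" if "x \<notin> range_at P a" for x using supp[of x] r(2) that by blast
    have lg: "smooth_function P (lift a g)"
      by (rule smooth_function_lift[OF K gs]) (use supp in blast)
    have lift_supp: "q \<in> inv_chart P a ` ?K" if "lift a g q \<noteq> 0" for q
    proof -
      have "q \<in> dom_at P a" "g (chart_at P a q) \<noteq> 0" using that by (auto simp: lift_def split: if_splits)
      then show ?thesis using supp by (metis image_eqI inv_chart_chart)
    qed
    have "0 = integrate (derivative_along (lift a g) X)"
      using wd lg by (simp add: weak_divergence_def integrate_def)
    also have "\<dots> = - integral (range_at P a) (\<lambda>x. lift a g (inv_chart P a x) * divergence (X a) x)"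
      by (rule integrate_derivative_along_localized[OF X lg K lift_supp])
    also have "integral (range_at P a) (\<lambda>x. lift a g (inv_chart P a x) * divergence (X a) x)
        = integral (range_at P a) (\<lambda>x. g x * divergence (X a) x)"
      by (rule integral_cong) (simp add: lift_def inv_chart_dom chart_inv_chart)
    also have "integral (range_at P a) (\<lambda>x. g x * divergence (X a) x)
        = integral UNIV (\<lambda>x. g x * divergence (X a) x)"
      by (rule integral_subset_zero) (use g0 in auto)
    finally show "integral UNIV (\<lambda>x. g x * divergence (X a) x) = 0" by simp
  qed
qed

text \<open>
  Tested against bump functions, this is the invariance of \<open>\<integral> dg \<and> \<eta>\<close>; no second derivative of a
  transition map has to be computed.
\<close>

lemma divergence_change:
  assumes X: "vector_density X" and x: "x \<in> overlap a b"
  shows "divergence (X a) x = det (matrix (dtrans a b x)) * divergence (X b) (trans a b x)"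
proof -
  let ?w = "\<lambda>x. divergence (X a) x - det (matrix (dtrans a b x)) * divergence (X b) (trans a b x)"
  have sub: "overlap a b \<subseteq> range_at P a" by (auto simp: overlap_iff)
  have s1: "smooth_on (overlap a b) (divergence (X a))"
    by (rule smooth_on_subset[OF smooth_on_divergence[OF open_range vector_density_smooth[OF X]] sub])
  have s2: "smooth_on (overlap a b) (\<lambda>x. det (matrix (dtrans a b x)) * divergence (X b) (trans a b x))"
  proof (intro smooth_on_mult open_overlap smooth_det_dtrans)
    show "smooth_on (overlap a b) (\<lambda>x. divergence (X b) (trans a b x))"
      by (rule smooth_on_compose[OF smooth_on_divergence[OF open_range vector_density_smooth[OF X]]
            smooth_trans open_overlap open_range])
         (use trans_overlap in \<open>auto simp: overlap_iff\<close>)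
  qed
  have "?w x = 0"
  proof (rule vanishes_if_bump_integrals_vanish[OF open_overlap _ _ x])
    show "continuous_on (overlap a b) ?w"
      by (intro continuous_on_diff smooth_on_continuous s1 s2)
    fix g :: "real^3 \<Rightarrow> real" and c r
    assume g: "smooth_on UNIV g" and r: "r > 0" "cball c r \<subseteq> overlap a b"
      and supp: "\<And>x. g x \<noteq> 0 \<Longrightarrow> x \<in> cball c r"
    let ?K = "cball c r" and ?g = "lift a g"
    have K: "compact ?K" "?K \<subseteq> range_at P a" using r sub by auto
    have gs: "smooth_on (range_at P a) g" by (rule smooth_on_subset[OF g]) simp
    have lg: "smooth_function P ?g"
      by (rule smooth_function_lift[OF K gs]) (use supp in blast)
    have lift_supp: "q \<in> inv_chart P a ` ?K" if "?g q \<noteq> 0" for q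
    proof -
      have "q \<in> dom_at P a" "g (chart_at P a q) \<noteq> 0" using that by (auto simp: lift_def split: if_splits)
      then show ?thesis using supp by (metis image_eqI inv_chart_chart)
    qed
    define K' where "K' = trans a b ` ?K"
    have K': "compact K'" unfolding K'_def
      by (rule compact_continuous_image[OF continuous_on_subset[OF smooth_on_continuous[OF smooth_trans[of a b]]]])
         (use r in auto)
    have K'o: "K' \<subseteq> overlap b a" unfolding K'_def using r(2) trans_overlap by blast
    have K'r: "K' \<subseteq> range_at P b" using K'o by (auto simp: overlap_iff)
    have same: "inv_chart P b ` K' = inv_chart P a ` ?K"
      unfolding K'_def image_image by (rule image_cong[OF refl]) (use r(2) inv_trans in blast)
    have "integral (range_at P a) (\<lambda>x. ?g (inv_chart P a x) * divergence (X a) x)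
        = integral (range_at P b) (\<lambda>x. ?g (inv_chart P b x) * divergence (X b) x)"
      using integrate_derivative_along_localized[OF X lg K lift_supp]
        integrate_derivative_along_localized[OF X lg K' K'r lift_supp[folded same]] by simp
    moreover have "integral (range_at P a) (\<lambda>x. ?g (inv_chart P a x) * divergence (X a) x)
        = integral (overlap a b) (\<lambda>x. g x * divergence (X a) x)"
    proof -
      have "integral (range_at P a) (\<lambda>x. ?g (inv_chart P a x) * divergence (X a) x)
          = integral (range_at P a) (\<lambda>x. g x * divergence (X a) x)"
        by (rule integral_cong) (simp add: lift_def inv_chart_dom chart_inv_chart)
      also have "\<dots> = integral (overlap a b) (\<lambda>x. g x * divergence (X a) x)"
        by (rule integral_subset_zero[symmetric, OF sub]) (use supp r(2) in \<open>auto simp del: mem_cball\<close>)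
      finally show ?thesis .
    qed
    moreover have "integral (range_at P b) (\<lambda>x. ?g (inv_chart P b x) * divergence (X b) x)
        = integral (overlap b a) (\<lambda>x. ?g (inv_chart P b x) * divergence (X b) x)"
      by (rule integral_subset_zero[symmetric]) (auto simp: overlap_iff lift_def)
    moreover have cont2: "continuous_on (overlap a b) (\<lambda>x. g x * (det (matrix (dtrans a b x)) * divergence (X b) (trans a b x)))"
      by (intro continuous_on_mult smooth_on_continuous[OF s2] continuous_on_subset[OF smooth_on_continuous[OF g]]) auto
    have cont1: "continuous_on (overlap a b) (\<lambda>x. g x * divergence (X a) x)"
      by (intro continuous_on_mult smooth_on_continuous[OF s1] continuous_on_subset[OF smooth_on_continuous[OF g]]) auto
    have g0: "g x = 0" if "x \<notin> ?K" for x using supp that by blast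
    have abs2: "(\<lambda>x. g x * (det (matrix (dtrans a b x)) * divergence (X b) (trans a b x))) absolutely_integrable_on overlap a b"
      by (rule absolutely_integrable_on_open[OF open_overlap K(1) r(2) cont2 _ order_refl]) (use g0 in auto)
    have abs1: "(\<lambda>x. g x * divergence (X a) x) absolutely_integrable_on overlap a b"
      by (rule absolutely_integrable_on_open[OF open_overlap K(1) r(2) cont1 _ order_refl]) (use g0 in auto)
    have "integral (overlap b a) (\<lambda>x. ?g (inv_chart P b x) * divergence (X b) x)
        = integral (overlap a b) (\<lambda>x. g x * (det (matrix (dtrans a b x)) * divergence (X b) (trans a b x)))"
    proof (rule integral_change_of_chart[OF _ abs2])
      fix x assume x: "x \<in> overlap a b"
      have "?g (inv_chart P b (trans a b x)) = g x"
        unfolding inv_trans[OF x] using x by (simp add: lift_def overlap_iff inv_chart_dom chart_inv_chart)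
      then show "g x * (det (matrix (dtrans a b x)) * divergence (X b) (trans a b x))
          = det (matrix (dtrans a b x)) * (?g (inv_chart P b (trans a b x)) * divergence (X b) (trans a b x))"
        by (simp only: mult_ac)
    qed
    ultimately have "integral (overlap a b) (\<lambda>x. g x * divergence (X a) x)
        = integral (overlap a b) (\<lambda>x. g x * (det (matrix (dtrans a b x)) * divergence (X b) (trans a b x)))"
      by simp
    then have "integral (overlap a b) (\<lambda>x. g x * ?w x) = 0"
      using abs1 abs2 unfolding right_diff_distrib
      by (subst integral_diff) (simp_all add: absolutely_integrable_on_def)
    moreover have "integral (overlap a b) (\<lambda>x. g x * ?w x) = integral UNIV (\<lambda>x. g x * ?w x)"
    proof (rule integral_subset_zero)
      show "g x * ?w x = 0" if "x \<notin> overlap a b" for x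
      proof -
        have "g x = 0" using g0[of x] r(2) that by blast
        then show ?thesis by (simp only: mult_zero_left)
      qed
    qed simp
    ultimately show "integral UNIV (\<lambda>x. g x * ?w x) = 0" by simp
  qed
  then show ?thesis by simp
qed

text \<open>
  Closedness of a 2-form is defined at each point in the chart belonging to that point only.
\<close>

lemma divergence_free_iff_center:
  assumes X: "vector_density X"
  shows "divergence_free X \<longleftrightarrow> (\<forall>p. divergence (X p) (chart_at P p p) = 0)"
proof
  assume "divergence_free X"
  then show "\<forall>p. divergence (X p) (chart_at P p p) = 0"
    using chart_range dom(1) by (auto simp: divergence_free_def)
next
  assume z: "\<forall>p. divergence (X p) (chart_at P p p) = 0"
  show "divergence_free X"
    unfolding divergence_free_def
  proof (intro allI ballI)
    fix a x assume x: "x \<in> range_at P a"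
    define q where "q = inv_chart P a x"
    have "x \<in> overlap a q" using x dom(1) by (simp add: overlap_iff q_def)
    from divergence_change[OF X this] show "divergence (X a) x = 0"
      using z by (simp add: q_def)
  qed
qed

end

section \<open>One-forms orthogonal to all closed two-forms are exact\<close>

context closed_3manifold
begin

text \<open>
  The vector \<open>A a x\<close> represents the value \<open>v \<mapsto> A a x \<bullet> v\<close> of the form in the chart at \<open>a\<close>.
\<close>

definition one_form :: "('p \<Rightarrow> real^3 \<Rightarrow> real^3) \<Rightarrow> bool" where
  "one_form A \<longleftrightarrow> (\<forall>a. smooth_on (range_at P a) (A a)) \<and>
     (\<forall>a b. \<forall>x\<in>overlap a b. \<forall>v. A a x \<bullet> v = A b (trans a b x) \<bullet> dtrans a b x v)"

definition pairing :: "('p \<Rightarrow> real^3 \<Rightarrow> real^3) \<Rightarrow> ('p \<Rightarrow> real^3 \<Rightarrow> real^3) \<Rightarrow> 'p \<Rightarrow> real^3 \<Rightarrow> real" where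
  "pairing A X a x = A a x \<bullet> X a x"

lemma density_pairing:
  assumes A: "one_form A" and X: "vector_density X"
  shows "density (pairing A X)"
  unfolding density_def pairing_def
proof (intro conjI allI ballI)
  fix a
  show "continuous_on (range_at P a) (\<lambda>x. A a x \<bullet> X a x)"
    using A by (intro continuous_on_inner smooth_on_continuous[OF vector_density_smooth[OF X]] smooth_on_continuous)
      (simp add: one_form_def)
  fix b x assume x: "x \<in> overlap a b"
  have "A a x \<bullet> X a x = A b (trans a b x) \<bullet> dtrans a b x (X a x)"
    using A x unfolding one_form_def by blast
  then show "A a x \<bullet> X a x = det (matrix (dtrans a b x)) * (A b (trans a b x) \<bullet> X b (trans a b x))"
    unfolding vector_density_change[OF X x] by simp
qed

lemma integrate_pairing_add:
  assumes "one_form A" "vector_density X" "vector_density Y"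
  shows "integrate (pairing A (\<lambda>a x. X a x + Y a x)) = integrate (pairing A X) + integrate (pairing A Y)"
  using integrate_add[OF density_pairing[OF assms(1,2)] density_pairing[OF assms(1,3)]]
  by (simp add: pairing_def[abs_def] inner_add_right)

lemma integrate_pairing_minus:
  "integrate (pairing A (\<lambda>a x. - X a x)) = - integrate (pairing A X)"
  using integrate_minus[of "pairing A X"] by (simp add: pairing_def[abs_def])

lemma integrate_pairing_extend:
  assumes A: "one_form A" and K: "compact K" "K \<subseteq> range_at P a" and Y: "smooth_on (range_at P a) Y"
    "\<And>x. x \<in> range_at P a \<Longrightarrow> x \<notin> K \<Longrightarrow> Y x = 0"
  shows "integrate (pairing A (extend_vector a Y)) = integral (range_at P a) (\<lambda>x. A a x \<bullet> Y x)"
proof -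
  have "integrate (pairing A (extend_vector a Y)) = integral (range_at P a) (pairing A (extend_vector a Y) a)"
  proof (rule integrate_localized[OF density_pairing[OF A vector_density_extend[OF K Y]] K])
    fix b y assume y: "y \<in> range_at P b" "pairing A (extend_vector a Y) b y \<noteq> 0"
    then have "extend_vector a Y b y \<noteq> 0" by (auto simp: pairing_def)
    then show "inv_chart P b y \<in> inv_chart P a ` K"
      by (intro extend_support[OF y(1), of a "\<lambda>_. 0" Y]) (use Y(2) in auto)
  qed
  also have "\<dots> = integral (range_at P a) (\<lambda>x. A a x \<bullet> Y x)"
    by (rule integral_cong) (simp add: pairing_def extend_vector_self)
  finally show ?thesis .
qed

end

locale null_one_form = closed_3manifold P F h
  for P :: "('p::{t2_space, second_countable_topology}, real^3) charts" and F h +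
  fixes A :: "'p \<Rightarrow> real^3 \<Rightarrow> real^3"
  assumes A: "one_form A"
    and null: "\<And>X. vector_density X \<Longrightarrow> divergence_free X \<Longrightarrow> integrate (pairing A X) = 0"
begin

lemma A_smooth: "smooth_on (range_at P a) (A a)"
  using A by (simp add: one_form_def)

text \<open>
  Test against the curl of a bump function \<open>g\<close> in the plane of \<open>u\<close> and \<open>v\<close>, which is
  divergence free because second derivatives commute; an integration by parts moves the derivatives to \<open>A\<close>.
\<close>

lemma A_curl_free:
  assumes x: "x \<in> range_at P a"
  shows "frechet_derivative (A a) (at x) u \<bullet> v = frechet_derivative (A a) (at x) v \<bullet> u"
proof -
  let ?R = "range_at P a"
  let ?w = "\<lambda>x. frechet_derivative (A a) (at x) u \<bullet> v - frechet_derivative (A a) (at x) v \<bullet> u"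
  have "?w x = 0"
  proof (rule vanishes_if_bump_integrals_vanish[OF open_range _ _ x])
    show "continuous_on ?R ?w"
      by (intro continuous_intros smooth_on_continuous smooth_on_derivative A_smooth)
    fix g :: "real^3 \<Rightarrow> real" and c r
    assume g: "smooth_on UNIV g" and r: "r > 0" "cball c r \<subseteq> ?R"
      and supp: "\<And>x. g x \<noteq> 0 \<Longrightarrow> x \<in> cball c r"
    let ?K = "cball c r"
    have K: "compact ?K" "?K \<subseteq> ?R" using r by auto
    have g0: "g x = 0" if "x \<notin> ?R" for x using supp[of x] r(2) that by blast
    have gs: "smooth_on ?R g" by (rule smooth_on_subset[OF g]) simp
    have dg: "frechet_derivative g (at x) w = 0" if "x \<notin> ?K" for x w
      by (rule derivative_zero_outside[of ?K]) (use supp that in auto)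
    define Y where "Y x = frechet_derivative g (at x) u *\<^sub>R v - frechet_derivative g (at x) v *\<^sub>R u" for x
    have s1: "smooth_on UNIV (\<lambda>x. frechet_derivative g (at x) w *\<^sub>R z)" for w z
      by (intro smooth_on_scaleR smooth_on_derivative g smooth_on_const open_UNIV)
    have Ysm: "smooth_on UNIV Y" unfolding Y_def by (intro smooth_on_diff s1 open_UNIV)
    have Ys: "smooth_on ?R Y" by (rule smooth_on_subset[OF Ysm]) simp
    have Y0: "Y x = 0" if "x \<in> ?R" "x \<notin> ?K" for x using dg[OF that(2)] by (simp add: Y_def)
    have "divergence Y x = 0" for x
      unfolding Y_def divergence_diff[OF s1 s1 UNIV_I]
        divergence_scaleR_const[OF open_UNIV smooth_on_derivative[OF g] UNIV_I]
      using second_derivative_symmetric[OF g, of u x v] by simp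
    then have "weak_divergence (extend_vector a Y) (\<lambda>a x. 0)"
      by (intro weak_divergence_cong[OF weak_divergence_extend[OF K Ys Y0]]) (auto simp: extend_density_def)
    then have "integrate (pairing A (extend_vector a Y)) = 0"
      by (intro null weak_divergence_zero_imp_divergence_free vector_density_extend[OF K Ys Y0])
    then have int0: "integral ?R (\<lambda>x. A a x \<bullet> Y x) = 0"
      using integrate_pairing_extend[OF A K Ys Y0] by simp
    have sc: "smooth_on ?R (\<lambda>x. A a x \<bullet> z)" for z
      by (intro smooth_on_inner A_smooth smooth_on_const open_range)
    have dA: "divergence (\<lambda>x. (A a x \<bullet> z) *\<^sub>R w) x = frechet_derivative (A a) (at x) w \<bullet> z"
      if "x \<in> ?R" for x z w
    proof -
      have "((\<lambda>x. A a x \<bullet> z) has_derivative (\<lambda>w. frechet_derivative (A a) (at x) w \<bullet> z)) (at x)"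
        by (rule has_derivative_inner_left[OF smooth_on_has_derivative[OF A_smooth that]])
      from fun_cong[OF frechet_derivative_at[OF this]]
      show ?thesis using divergence_scaleR_const[OF open_range sc that] by simp
    qed
    have parts: "integral ?R (\<lambda>x. frechet_derivative g (at x) w * (A a x \<bullet> z))
        = - integral ?R (\<lambda>x. g x * (frechet_derivative (A a) (at x) w \<bullet> z))" for w z
    proof -
      have "integral ?R (\<lambda>x. frechet_derivative g (at x) ((A a x \<bullet> z) *\<^sub>R w))
          = - integral ?R (\<lambda>x. g x * divergence (\<lambda>x. (A a x \<bullet> z) *\<^sub>R w) x)"
        by (rule integral_by_parts[OF open_range gs _ K])
           (use supp in \<open>auto intro!: smooth_on_scaleR sc open_range smooth_on_const\<close>)
      also have "integral ?R (\<lambda>x. g x * divergence (\<lambda>x. (A a x \<bullet> z) *\<^sub>R w) x)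
          = integral ?R (\<lambda>x. g x * (frechet_derivative (A a) (at x) w \<bullet> z))"
        by (rule integral_cong) (simp add: dA)
      finally show ?thesis
        by (simp add: frechet_derivative_scaleR[OF g] mult.commute)
    qed
    have i1: "(\<lambda>x. frechet_derivative g (at x) w * (A a x \<bullet> z)) integrable_on ?R" for w z
    proof -
      have "continuous_on ?R (\<lambda>x. frechet_derivative g (at x) w * (A a x \<bullet> z))"
        by (intro continuous_on_mult smooth_on_continuous[OF sc] smooth_on_continuous[OF smooth_on_derivative[OF gs]])
      from absolutely_integrable_on_open[OF open_range K this _ order_refl] dg
      show ?thesis by (auto simp: absolutely_integrable_on_def)
    qed
    have i2: "(\<lambda>x. g x * (frechet_derivative (A a) (at x) w \<bullet> z)) integrable_on ?R" for w z
    proof -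
      have "continuous_on ?R (\<lambda>x. g x * (frechet_derivative (A a) (at x) w \<bullet> z))"
        by (intro continuous_intros smooth_on_continuous[OF gs] smooth_on_continuous[OF smooth_on_derivative[OF A_smooth]])
      from absolutely_integrable_on_open[OF open_range K this _ order_refl] supp
      show ?thesis by (force simp: absolutely_integrable_on_def)
    qed
    have "integral ?R (\<lambda>x. A a x \<bullet> Y x) = integral ?R (\<lambda>x. frechet_derivative g (at x) u * (A a x \<bullet> v)
        - frechet_derivative g (at x) v * (A a x \<bullet> u))"
      by (simp add: Y_def inner_diff_right)
    also have "\<dots> = - integral ?R (\<lambda>x. g x * (frechet_derivative (A a) (at x) u \<bullet> v))
        + integral ?R (\<lambda>x. g x * (frechet_derivative (A a) (at x) v \<bullet> u))"
      by (simp add: integral_diff[OF i1 i1] parts)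
    also have "\<dots> = - integral ?R (\<lambda>x. g x * ?w x)"
      by (simp add: right_diff_distrib integral_diff[OF i2 i2])
    finally have "integral ?R (\<lambda>x. g x * ?w x) = 0" using int0 by simp
    moreover have "integral ?R (\<lambda>x. g x * ?w x) = integral UNIV (\<lambda>x. g x * ?w x)"
      by (rule integral_subset_zero) (use g0 in auto)
    ultimately show "integral UNIV (\<lambda>x. g x * ?w x) = 0" by simp
  qed
  then show ?thesis by simp
qed

text \<open>
  Around every point \<open>a\<close> a ball, a primitive of the 1-form on it, and a bump of integral 1 are fixed.  The
  bump is supported in a cube, the domain on which functions of integral zero are divergences; the
  factor 4 makes room for the cube in the ball.
\<close>

definition radius :: "'p \<Rightarrow> real" where
  "radius a = (SOME r. r > 0 \<and> ball (chart_at P a a) (4 * r) \<subseteq> range_at P a)"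

abbreviation center :: "'p \<Rightarrow> real^3" where "center a \<equiv> chart_at P a a"

abbreviation nbhd :: "'p \<Rightarrow> (real^3) set" where "nbhd a \<equiv> ball (center a) (4 * radius a)"

abbreviation core :: "'p \<Rightarrow> (real^3) set" where "core a \<equiv> cube (center a) (radius a)"

lemma radius: "radius a > 0" "nbhd a \<subseteq> range_at P a"
proof -
  obtain e where "e > 0" "ball (center a) e \<subseteq> range_at P a"
    using open_contains_ball[of "range_at P a"] open_range chart_range dom(1) by metis
  then have "\<exists>r. r > 0 \<and> ball (center a) (4 * r) \<subseteq> range_at P a"
    by (intro exI[of _ "e / 4"]) auto
  from someI_ex[OF this] show "radius a > 0" "nbhd a \<subseteq> range_at P a"
    unfolding radius_def by blast+
qed

lemma core: "compact (core a)" "core a \<subseteq> nbhd a" "core a \<subseteq> range_at P a"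
proof -
  show "compact (core a)" using closed_cube bounded_cube compact_eq_bounded_closed by blast
  show *: "core a \<subseteq> nbhd a"
  proof
    fix x assume x: "x \<in> core a"
    have "norm (x - center a) \<le> (\<Sum>i\<in>UNIV. \<bar>(x - center a) $ i\<bar>)" by (rule norm_le_l1_cart)
    also have "\<dots> \<le> (\<Sum>i\<in>(UNIV::3 set). radius a)" using x by (intro sum_mono) (simp add: cube_def)
    also have "\<dots> < 4 * radius a" using radius(1)[of a] by simp
    finally show "x \<in> nbhd a" by (simp add: dist_norm norm_minus_commute)
  qed
  then show "core a \<subseteq> range_at P a" using radius(2) by blast
qed

lemma ball_core: "ball (center a) (radius a) \<subseteq> core a"
proof
  fix x assume "x \<in> ball (center a) (radius a)"
  then have "norm (x - center a) < radius a" by (simp add: dist_norm norm_minus_commute)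
  then have "\<bar>(x - center a) $ i\<bar> \<le> radius a" for i
    using component_le_norm_cart[of "x - center a" i] by linarith
  then show "x \<in> core a" by (simp add: cube_def)
qed

definition primitive :: "'p \<Rightarrow> real^3 \<Rightarrow> real" where
  "primitive a = (SOME l. \<forall>x\<in>nbhd a. (l has_derivative (\<lambda>v. A a x \<bullet> v)) (at x))"

lemma primitive: "x \<in> nbhd a \<Longrightarrow> (primitive a has_derivative (\<lambda>v. A a x \<bullet> v)) (at x)"
proof -
  have c: "center a \<in> nbhd a" using radius(1) by simp
  have sym: "frechet_derivative (A a) (at x) u \<bullet> v = frechet_derivative (A a) (at x) v \<bullet> u"
    if "x \<in> nbhd a" for x u v
    by (rule A_curl_free) (use that radius(2) in blast)
  have "\<exists>l. \<forall>x\<in>nbhd a. (l has_derivative (\<lambda>v. A a x \<bullet> v)) (at x)"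
  proof (rule curl_free_is_gradient[OF open_ball convex_ball c smooth_on_subset[OF A_smooth radius(2)] sym])
    fix l assume l: "\<And>x. x \<in> nbhd a \<Longrightarrow> (l has_derivative (\<lambda>v. A a x \<bullet> v)) (at x)"
    show ?thesis by (intro exI[of _ l] ballI l)
  qed
  from someI_ex[OF this] show "x \<in> nbhd a \<Longrightarrow> (primitive a has_derivative (\<lambda>v. A a x \<bullet> v)) (at x)"
    unfolding primitive_def by blast
qed

lemma primitive_smooth: "smooth_on (nbhd a) (primitive a)"
proof (rule smooth_on_derivativeI[OF open_ball])
  show "(primitive a has_derivative (\<lambda>v. A a x \<bullet> v)) (at x)" if "x \<in> nbhd a" for x
    by (rule primitive[OF that])
  show "smooth_on (nbhd a) (\<lambda>x. A a x \<bullet> v)" for v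
    by (intro smooth_on_inner smooth_on_subset[OF A_smooth radius(2)] smooth_on_const open_ball)
qed

definition bump :: "'p \<Rightarrow> real^3 \<Rightarrow> real" where
  "bump a = (SOME g. smooth_on UNIV g \<and> (\<forall>x. g x \<noteq> 0 \<longrightarrow> x \<in> core a) \<and> integral UNIV g = 1)"

lemma bump: "smooth_on UNIV (bump a)" "\<And>x. bump a x \<noteq> 0 \<Longrightarrow> x \<in> core a" "integral UNIV (bump a) = 1"
proof -
  obtain g :: "real^3 \<Rightarrow> real" where g: "smooth_on UNIV g" "\<And>x. g x \<ge> 0"
      "\<And>x. g x > 0 \<longleftrightarrow> dist x (center a) < radius a" "integral UNIV g = 1"
    using unit_bump_exists[OF radius(1), of "center a" a] by metis
  have gc: "x \<in> core a" if "g x \<noteq> 0" for x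
  proof -
    have "g x > 0" using that g(2)[of x] by simp
    then show ?thesis using g(3) ball_core[of a] by (auto simp: dist_commute)
  qed
  have "\<exists>g :: real^3 \<Rightarrow> real. smooth_on UNIV g \<and> (\<forall>x. g x \<noteq> 0 \<longrightarrow> x \<in> core a) \<and> integral UNIV g = 1"
    by (intro exI[of _ g] conjI allI impI g(1,4) gc)
  from someI_ex[OF this] show "smooth_on UNIV (bump a)" "\<And>x. bump a x \<noteq> 0 \<Longrightarrow> x \<in> core a" "integral UNIV (bump a) = 1"
    unfolding bump_def by blast+
qed

lemma bump_range: "smooth_on (range_at P a) (bump a)" "\<And>x. x \<in> range_at P a \<Longrightarrow> x \<notin> core a \<Longrightarrow> bump a x = 0"
  using smooth_on_subset[OF bump(1)] bump(2) by auto

lemma integral_primitive: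
  assumes Y: "smooth_on UNIV Y" "\<And>x. Y x \<noteq> 0 \<Longrightarrow> x \<in> core a"
  shows "integrate (pairing A (extend_vector a Y)) = - integral (nbhd a) (\<lambda>x. primitive a x * divergence Y x)"
proof -
  have "integrate (pairing A (extend_vector a Y)) = integral (range_at P a) (\<lambda>x. A a x \<bullet> Y x)"
    by (rule integrate_pairing_extend[OF A core(1,3) smooth_on_subset[OF Y(1)]]) (use Y(2) in auto)
  also have "\<dots> = integral (nbhd a) (\<lambda>x. A a x \<bullet> Y x)"
    by (rule integral_subset_zero[symmetric, OF radius(2)]) (use Y(2) core(2) in force)
  also have "\<dots> = integral (nbhd a) (\<lambda>x. frechet_derivative (primitive a) (at x) (Y x))"
    by (rule integral_cong) (use fun_cong[OF frechet_derivative_at[OF primitive]] in simp)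
  also have "\<dots> = - integral (nbhd a) (\<lambda>x. primitive a x * divergence Y x)"
    by (rule integral_by_parts[OF open_ball primitive_smooth smooth_on_subset[OF Y(1)] core(1,2)])
       (use Y(2) in auto)
  finally show ?thesis .
qed

text \<open>
  The value that the wanted function takes on a bump differs from the one given by the local
  primitive by a constant, which is found by moving the bump to a reference bump of
  its cohomology class.
\<close>

definition cohomologous :: "'p \<Rightarrow> 'p \<Rightarrow> bool" where
  "cohomologous a b \<longleftrightarrow> (\<exists>X. vector_density X \<and>
     weak_divergence X (\<lambda>c x. extend_density a (bump a) c x + - extend_density b (bump b) c x))"

lemma density_bump: "density (extend_density a (bump a))"
  by (rule density_extend[OF core(1,3) bump_range])

lemma density_minus: "density W \<Longrightarrow> density (\<lambda>a x. - W a x)"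
  using density_cmul[of W "-1"] by simp

lemma density_bump_diff: "density (\<lambda>c x. extend_density a (bump a) c x + - extend_density b (bump b) c x)"
  by (intro density_add density_minus density_bump)

lemma cohomologous_refl: "cohomologous a a"
  unfolding cohomologous_def
proof (intro exI conjI)
  have lin: "linear (dtrans c d x)" if "x \<in> overlap c d" for c d x by (rule linear_dtrans[OF that])
  show "vector_density (\<lambda>a x. 0)" using linear_0[OF lin] by (simp add: vector_density_def)
  show "weak_divergence (\<lambda>a x. 0) (\<lambda>c x. extend_density a (bump a) c x + - extend_density a (bump a) c x)"
    using linear_0[OF linear_frechet_derivative_smooth[OF smooth_function_chart]]
    by (simp add: weak_divergence_def integrate_def derivative_along_def cong: integral_cong)
qed

lemma cohomologous_sym: assumes "cohomologous a b" shows "cohomologous b a"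
proof -
  obtain X where X: "vector_density X"
    "weak_divergence X (\<lambda>c x. extend_density a (bump a) c x + - extend_density b (bump b) c x)"
    using assms by (auto simp: cohomologous_def)
  have "weak_divergence (\<lambda>a x. - X a x) (\<lambda>c x. extend_density b (bump b) c x + - extend_density a (bump a) c x)"
    by (rule weak_divergence_cong[OF weak_divergence_minus[OF X(2)]]) simp
  then show ?thesis using vector_density_minus[OF X(1)] unfolding cohomologous_def by blast
qed

lemma cohomologous_trans:
  assumes "cohomologous a b" "cohomologous b c" shows "cohomologous a c"
proof -
  obtain X where X: "vector_density X"
    "weak_divergence X (\<lambda>c x. extend_density a (bump a) c x + - extend_density b (bump b) c x)"
    using assms(1) by (auto simp: cohomologous_def)
  obtain Y where Y: "vector_density Y"
    "weak_divergence Y (\<lambda>d x. extend_density b (bump b) d x + - extend_density c (bump c) d x)"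
    using assms(2) by (auto simp: cohomologous_def)
  have "weak_divergence (\<lambda>a x. X a x + Y a x) (\<lambda>d x. extend_density a (bump a) d x + - extend_density c (bump c) d x)"
    by (rule weak_divergence_cong[OF weak_divergence_add[OF X(1) Y(1) density_bump_diff density_bump_diff X(2) Y(2)]]) simp
  then show ?thesis using vector_density_add[OF X(1) Y(1)] unfolding cohomologous_def by blast
qed

definition reference :: "'p \<Rightarrow> 'p" where "reference a = (SOME b. cohomologous a b)"

lemma reference: "cohomologous a (reference a)"
  unfolding reference_def by (rule someI[of _ a]) (rule cohomologous_refl)

lemma reference_eq: "cohomologous a b \<Longrightarrow> reference a = reference b"
proof -
  assume ab: "cohomologous a b"
  have "cohomologous a = cohomologous b"
    using cohomologous_trans[OF ab] cohomologous_trans[OF cohomologous_sym[OF ab]] by blast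
  then show ?thesis by (simp add: reference_def)
qed

definition connection :: "'p \<Rightarrow> 'p \<Rightarrow> real^3 \<Rightarrow> real^3" where
  "connection a = (SOME X. vector_density X \<and> weak_divergence X
     (\<lambda>c x. extend_density a (bump a) c x + - extend_density (reference a) (bump (reference a)) c x))"

lemma connection: "vector_density (connection a)"
  "weak_divergence (connection a)
     (\<lambda>c x. extend_density a (bump a) c x + - extend_density (reference a) (bump (reference a)) c x)"
  using someI_ex[OF reference[unfolded cohomologous_def]] unfolding connection_def by blast+

text \<open>
  If \<open>u\<close> is a primitive of the 1-form, the difference between its integrals against the bump at \<open>a\<close> and against the
  reference bump is minus the integral of \<open>pairing A (connection a)\<close>, by the definition of the weak
  divergence.  The constant is chosen so that this holds with the integral against the reference bump being 0.
\<close>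

definition potential :: "'p \<Rightarrow> real^3 \<Rightarrow> real" where
  "potential a x = primitive a x
     - (integrate (pairing A (connection a)) + integral (nbhd a) (\<lambda>x. primitive a x * bump a x))"

lemma integrable_nbhd:
  assumes "continuous_on (nbhd a) f" "\<And>x. f x \<noteq> 0 \<Longrightarrow> x \<in> core a"
  shows "(f :: real^3 \<Rightarrow> real) integrable_on nbhd a"
  using absolutely_integrable_on_open[OF open_ball core(1,2) assms(1) _ order_refl] assms(2)
  by (auto simp: absolutely_integrable_on_def)

text \<open>
  If the two potentials differed at a point, they would differ on a whole neighbourhood of it, and hence
  on a bump supported there.  But the bump is cohomologous to the chosen bumps of both charts, so
  both potentials take the same value on it.
\<close>

lemma potential_le:
  assumes q: "q \<in> dom_at P a" "q \<in> dom_at P b"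
    and qa: "chart_at P a q \<in> ball (center a) (radius a)" and qb: "chart_at P b q \<in> ball (center b) (radius b)"
  shows "potential a (chart_at P a q) \<le> potential b (chart_at P b q)"
proof (rule ccontr)
  assume gt: "\<not> ?thesis"
  define x0 where "x0 = chart_at P a q"
  have x0: "x0 \<in> overlap a b" using q by (simp add: x0_def overlap_iff chart_range inv_chart_chart)
  have tx0: "trans a b x0 = chart_at P b q" using q by (simp add: x0_def inv_chart_chart)
  have small: "ball (center c) (radius c) \<subseteq> nbhd c" for c using ball_core core(2) by blast
  have pot_sm: "smooth_on (nbhd c) (potential c)" for c
    unfolding potential_def by (intro smooth_on_diff primitive_smooth smooth_on_const open_ball)
  define U where "U = {x \<in> overlap a b. x \<in> ball (center a) (radius a) \<and> trans a b x \<in> ball (center b) (radius b)}"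
  have U: "open U"
  proof -
    have "open (overlap a b \<inter> trans a b -` ball (center b) (radius b))"
      by (rule continuous_open_preimage[OF smooth_on_continuous[OF smooth_trans] open_overlap open_ball])
    then have "open ((overlap a b \<inter> trans a b -` ball (center b) (radius b)) \<inter> ball (center a) (radius a))"
      by (rule open_Int[OF _ open_ball])
    moreover have "(overlap a b \<inter> trans a b -` ball (center b) (radius b)) \<inter> ball (center a) (radius a) = U"
      by (auto simp: U_def)
    ultimately show ?thesis by simp
  qed
  have UR: "U \<subseteq> overlap a b" "overlap a b \<subseteq> range_at P a" by (auto simp: U_def overlap_iff)
  have U_a: "U \<subseteq> nbhd a" and U_core: "U \<subseteq> core a"
    using small ball_core[of a] unfolding U_def by blast+
  have U_b: "trans a b x \<in> nbhd b" if "x \<in> U" for x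
    using small that unfolding U_def by blast
  have x0U: "x0 \<in> U" using x0 tx0 qa qb by (simp add: U_def x0_def[symmetric])
  define d where "d x = potential a x - potential b (trans a b x)" for x
  have d_sm: "smooth_on U d"
    unfolding d_def
  proof (intro smooth_on_diff U)
    show "smooth_on U (potential a)" by (rule smooth_on_subset[OF pot_sm U_a])
    show "smooth_on U (\<lambda>x. potential b (trans a b x))"
      by (rule smooth_on_compose[OF pot_sm smooth_on_subset[OF smooth_trans UR(1)] U open_ball U_b])
  qed
  have d0: "d x0 > 0" using gt tx0 by (simp add: d_def x0_def[symmetric])
  have "isCont d x0" using smooth_on_continuous[OF d_sm] U x0U continuous_on_eq_continuous_at by blast
  then have "\<forall>\<^sub>F x in nhds x0. d x > 0"
    using d0 by (metis order_tendstoD(1) isCont_def tendsto_at_iff_tendsto_nhds)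
  moreover have "\<forall>\<^sub>F x in nhds x0. x \<in> U" using U x0U eventually_nhds by blast
  ultimately have "\<forall>\<^sub>F x in nhds x0. x \<in> U \<and> d x > 0" by eventually_elim auto
  then obtain e where e: "e > 0" "\<And>x. dist x x0 < e \<Longrightarrow> x \<in> U \<and> d x > 0"
    by (auto simp: eventually_nhds_metric)
  define K0 where "K0 = cball x0 (e/2)"
  have K0: "compact K0" "K0 \<subseteq> U" and K0d: "x \<in> K0 \<Longrightarrow> d x > 0" for x
    using e by (auto simp: K0_def dist_commute)
  have K0R: "K0 \<subseteq> range_at P a" using UR K0 by blast
  obtain \<delta> :: "real^3 \<Rightarrow> real" where \<delta>: "smooth_on UNIV \<delta>" "\<And>x. \<delta> x \<ge> 0" "\<And>x. \<delta> x > 0 \<longleftrightarrow> dist x x0 < e/2"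
    "integral UNIV \<delta> = 1"
    using unit_bump_exists[of "e/2" x0] e(1) by (metis half_gt_zero)
  have \<delta>_supp: "x \<in> K0" if "\<delta> x \<noteq> 0" for x
    using \<delta>(2)[of x] \<delta>(3)[of x] that by (auto simp: K0_def dist_commute)
  have \<delta>_range: "smooth_on (range_at P a) \<delta>" "\<And>x. x \<in> range_at P a \<Longrightarrow> x \<notin> K0 \<Longrightarrow> \<delta> x = 0"
    using smooth_on_subset[OF \<delta>(1)] \<delta>_supp by auto
  define K1 where "K1 = trans a b ` K0"
  have K1: "compact K1"
    unfolding K1_def
    by (rule compact_continuous_image[OF continuous_on_subset[OF smooth_on_continuous[OF smooth_trans[of a b]]] K0(1)])
       (use K0 UR in blast)
  have K1b: "K1 \<subseteq> ball (center b) (radius b)" using K0(2) by (auto simp: K1_def U_def)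
  have K1o: "K1 \<subseteq> overlap b a" using K0(2) UR trans_overlap by (auto simp: K1_def)
  have K1R: "K1 \<subseteq> range_at P b" using K1o by (auto simp: overlap_iff)
  \<comment> \<open>The bump \<open>\<delta>\<close> as a density in the chart at \<open>b\<close>.\<close>
  define \<delta>' where "\<delta>' y = (if y \<in> overlap b a then det (matrix (dtrans b a y)) * \<delta> (trans b a y) else 0)" for y
  have \<delta>'_supp: "y \<in> K1" if "\<delta>' y \<noteq> 0" for y
  proof -
    have y: "y \<in> overlap b a" "\<delta> (trans b a y) \<noteq> 0" using that by (auto simp: \<delta>'_def split: if_splits)
    then have "trans b a y \<in> K0" using \<delta>_supp by blast
    then show ?thesis unfolding K1_def using trans_inverse[OF y(1)] by (metis image_eqI)
  qed
  have \<delta>'_sm: "smooth_on UNIV \<delta>'"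
    unfolding \<delta>'_def
  proof (rule smooth_on_extend_by_zero[OF open_overlap compact_imp_closed[OF K1] K1o])
    show "smooth_on (overlap b a) (\<lambda>y. det (matrix (dtrans b a y)) * \<delta> (trans b a y))"
      by (intro smooth_on_mult open_overlap smooth_det_dtrans
          smooth_on_compose[OF \<delta>(1) smooth_trans open_overlap open_UNIV UNIV_I])
    show "det (matrix (dtrans b a y)) * \<delta> (trans b a y) = 0" if "y \<in> overlap b a" "y \<notin> K1" for y
      using \<delta>'_supp[of y] that by (auto simp: \<delta>'_def)
  qed
  have \<delta>'_range: "smooth_on (range_at P b) \<delta>'" "\<And>x. x \<in> range_at P b \<Longrightarrow> x \<notin> K1 \<Longrightarrow> \<delta>' x = 0"
    using smooth_on_subset[OF \<delta>'_sm] \<delta>'_supp by auto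
  have same: "extend_density a \<delta> c y = extend_density b \<delta>' c y" if y: "y \<in> range_at P c" for c y
  proof (cases "inv_chart P c y \<in> dom_at P a")
    case True
    then have ya: "y \<in> overlap c a" using y by (simp add: overlap_iff)
    show ?thesis
    proof (cases "inv_chart P c y \<in> dom_at P b")
      case True
      then have yb: "y \<in> overlap c b" using y by (simp add: overlap_iff)
      have z: "trans c b y \<in> overlap b a"
        using trans_overlap[OF yb] inv_trans[OF yb] ya by (simp add: overlap_iff)
      have "extend_density b \<delta>' c y
          = (det (matrix (dtrans b a (trans c b y))) * det (matrix (dtrans c b y))) * \<delta> (trans b a (trans c b y))"
        using True z by (simp only: extend_density_def \<delta>'_def if_True) simp
      also have "\<dots> = extend_density a \<delta> c y"
        using ya det_chain[OF yb, of a] trans_trans[OF yb, of a]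
        by (simp only: extend_density_def overlap_iff if_True)
      finally show ?thesis ..
    next
      case False
      have "\<delta> (trans c a y) = 0"
      proof (rule ccontr)
        assume "\<delta> (trans c a y) \<noteq> 0"
        then have "trans c a y \<in> overlap a b" using \<delta>_supp K0(2) UR(1) by blast
        then show False using False inv_trans[OF ya] by (simp add: overlap_iff)
      qed
      then show ?thesis using False by (simp only: extend_density_def if_False) simp
    qed
  next
    case False
    have "extend_density b \<delta>' c y = 0"
    proof (cases "inv_chart P c y \<in> dom_at P b")
      case True
      then have yb: "y \<in> overlap c b" using y by (simp add: overlap_iff)
      have "trans c b y \<notin> overlap b a" using inv_trans[OF yb] False by (simp add: overlap_iff)
      then show ?thesis by (simp add: extend_density_def \<delta>'_def del: comp_apply)
    qed (simp add: extend_density_def)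
    then show ?thesis using False by (simp only: extend_density_def if_False)
  qed
  have int_sub: "integral R g = integral UNIV g" if "\<And>x. g x \<noteq> 0 \<Longrightarrow> x \<in> R" for g :: "real^3 \<Rightarrow> real" and R
    by (rule integral_support_subset) (use that in auto)
  have "integral (range_at P b) \<delta>' = integrate (extend_density b \<delta>')"
    by (rule integrate_extend_density[symmetric, OF K1 K1R \<delta>'_range])
  also have "\<dots> = integrate (extend_density a \<delta>)" by (rule integrate_cong) (simp add: same)
  also have "\<dots> = integral (range_at P a) \<delta>" by (rule integrate_extend_density[OF K0(1) K0R \<delta>_range])
  also have "\<dots> = 1" using int_sub[of \<delta> "range_at P a"] \<delta>_supp K0R \<delta>(4) by auto
  finally have \<delta>'_int: "integral UNIV \<delta>' = 1"
    using int_sub[of \<delta>' "range_at P b"] \<delta>'_supp K1R by auto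
  have \<delta>_core: "x \<in> core a" if "\<delta> x \<noteq> 0" for x
    using \<delta>_supp[OF that] K0(2) U_core by blast
  have \<delta>'_core: "y \<in> core b" if "\<delta>' y \<noteq> 0" for y
    using \<delta>'_supp[OF that] K1b ball_core[of b] by blast
  \<comment> \<open>In either chart, \<open>\<delta>\<close> is moved to the chosen bump by a vector field in the cube.\<close>
  have move: "\<exists>Y. smooth_on UNIV Y \<and> (\<forall>x. Y x \<noteq> 0 \<longrightarrow> x \<in> core c) \<and> (\<forall>x. divergence Y x = g x - bump c x)"
    if g: "smooth_on UNIV g" "\<And>x. g x \<noteq> 0 \<Longrightarrow> x \<in> core c" "integral UNIV g = 1" for g c
  proof -
    have int: "f integrable_on UNIV" if "smooth_on UNIV f" "\<And>x. f x \<noteq> 0 \<Longrightarrow> x \<in> core c" for f :: "real^3 \<Rightarrow> real"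
      using absolutely_integrable_compact_support[OF smooth_on_continuous[OF that(1)]]
        bounded_subset[OF bounded_cube[of "center c" "radius c"], of "{x. f x \<noteq> 0}"] that(2)
      by (auto simp: absolutely_integrable_on_def)
    have sm: "smooth_on UNIV (\<lambda>x. g x - bump c x)" by (intro smooth_on_diff g bump open_UNIV)
    have sp: "x \<in> core c" if "g x - bump c x \<noteq> 0" for x
      using that g(2)[of x] bump(2)[of c x] by (cases "g x = 0") auto
    have i0: "integral UNIV (\<lambda>x. g x - bump c x) = 0"
      using integral_diff[OF int[OF g(1,2)] int[OF bump(1,2)], of c] g(3) bump(3)[of c] by simp
    obtain Y where "smooth_on UNIV Y" "\<And>x. Y x \<noteq> 0 \<Longrightarrow> x \<in> core c"
      "\<And>x. divergence Y x = g x - bump c x"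
      using integral_zero_is_divergence[OF radius(1)[of c] sm sp i0] by blast
    then show ?thesis by blast
  qed
  obtain Ya where Ya: "smooth_on UNIV Ya" "\<And>x. Ya x \<noteq> 0 \<Longrightarrow> x \<in> core a" "\<And>x. divergence Ya x = \<delta> x - bump a x"
    using move[OF \<delta>(1) \<delta>_core \<delta>(4)] by blast
  obtain Yb where Yb: "smooth_on UNIV Yb" "\<And>x. Yb x \<noteq> 0 \<Longrightarrow> x \<in> core b" "\<And>x. divergence Yb x = \<delta>' x - bump b x"
    using move[OF \<delta>'_sm \<delta>'_core \<delta>'_int] by blast
  have Ya_range: "smooth_on (range_at P a) Ya" "\<And>x. x \<in> range_at P a \<Longrightarrow> x \<notin> core a \<Longrightarrow> Ya x = 0"
    using smooth_on_subset[OF Ya(1)] Ya(2) by auto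
  have Yb_range: "smooth_on (range_at P b) Yb" "\<And>x. x \<in> range_at P b \<Longrightarrow> x \<notin> core b \<Longrightarrow> Yb x = 0"
    using smooth_on_subset[OF Yb(1)] Yb(2) by auto
  let ?Xa = "extend_vector a Ya" and ?Xb = "extend_vector b Yb"
  have Xa: "vector_density ?Xa" by (rule vector_density_extend[OF core(1,3) Ya_range])
  have Xb: "vector_density ?Xb" by (rule vector_density_extend[OF core(1,3) Yb_range])
  let ?Z = "\<lambda>c x. ?Xa c x + - ?Xb c x"
  have Z: "vector_density ?Z" by (intro vector_density_add vector_density_minus Xa Xb)
  have d_a: "density (extend_density a (divergence Ya))"
    unfolding Ya(3)
  proof (rule density_extend[OF core(1,3)])
    show "smooth_on (range_at P a) (\<lambda>x. \<delta> x - bump a x)"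
      by (intro smooth_on_diff \<delta>_range bump_range open_range)
    fix x assume "x \<notin> core a"
    then have "\<delta> x = 0" "bump a x = 0" using \<delta>_core bump(2) by blast+
    then show "\<delta> x - bump a x = 0" by simp
  qed
  have d_b: "density (extend_density b (divergence Yb))"
    unfolding Yb(3)
  proof (rule density_extend[OF core(1,3)])
    show "smooth_on (range_at P b) (\<lambda>x. \<delta>' x - bump b x)"
      by (intro smooth_on_diff \<delta>'_range bump_range open_range)
    fix x assume "x \<notin> core b"
    then have "\<delta>' x = 0" "bump b x = 0" using \<delta>'_core bump(2) by blast+
    then show "\<delta>' x - bump b x = 0" by simp
  qed
  have wZ: "weak_divergence ?Z (\<lambda>c x. extend_density b (bump b) c x + - extend_density a (bump a) c x)"
  proof (rule weak_divergence_cong[OF weak_divergence_add[OF Xa vector_density_minus[OF Xb] d_a density_minus[OF d_b]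
          weak_divergence_extend[OF core(1,3) Ya_range] weak_divergence_minus[OF weak_divergence_extend[OF core(1,3) Yb_range]]]])
    fix c x assume x: "x \<in> range_at P c"
    have e: "extend_density c' (\<lambda>x. f x - g x) c x = extend_density c' f c x - extend_density c' g c x" for c' f g
      by (simp add: extend_density_def right_diff_distrib)
    have fa: "divergence Ya = (\<lambda>x. \<delta> x - bump a x)" "divergence Yb = (\<lambda>x. \<delta>' x - bump b x)"
      using Ya(3) Yb(3) by auto
    show "extend_density a (divergence Ya) c x + - extend_density b (divergence Yb) c x
        = extend_density b (bump b) c x + - extend_density a (bump a) c x"
      unfolding fa e same[OF x] by simp
  qed
  then have "cohomologous b a" using Z unfolding cohomologous_def by blast
  then have ref: "reference b = reference a" by (rule reference_eq)
  \<comment> \<open>From the bump at \<open>b\<close> to \<open>\<delta>\<close>, to the bump at \<open>a\<close>, to the common reference bump, and back to the bump at \<open>b\<close>: this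
    closed circuit has divergence zero, so the integral of the 1-form against it vanishes.\<close>
  let ?T = "\<lambda>c x. ?Z c x + (connection a c x + - connection b c x)"
  have conn: "vector_density (\<lambda>c x. connection a c x + - connection b c x)"
    by (intro vector_density_add vector_density_minus connection)
  have T: "vector_density ?T" by (rule vector_density_add[OF Z conn])
  have wconn: "weak_divergence (\<lambda>c x. connection a c x + - connection b c x)
      (\<lambda>c x. (extend_density a (bump a) c x + - extend_density (reference a) (bump (reference a)) c x)
        + - (extend_density b (bump b) c x + - extend_density (reference b) (bump (reference b)) c x))"
    by (rule weak_divergence_add[OF connection(1) vector_density_minus[OF connection(1)] density_bump_diff
          density_minus[OF density_bump_diff] connection(2) weak_divergence_minus[OF connection(2)]])
  have dconn: "density (\<lambda>c x. (extend_density a (bump a) c x + - extend_density (reference a) (bump (reference a)) c x)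
        + - (extend_density b (bump b) c x + - extend_density (reference b) (bump (reference b)) c x))"
    by (rule density_add[OF density_bump_diff density_minus[OF density_bump_diff]])
  have "weak_divergence ?T (\<lambda>c x. 0)"
    by (rule weak_divergence_cong[OF weak_divergence_add[OF Z conn density_bump_diff dconn wZ wconn]])
       (simp add: ref)
  then have "integrate (pairing A ?T) = 0" by (intro null T weak_divergence_zero_imp_divergence_free)
  then have total: "integrate (pairing A ?Xa) - integrate (pairing A ?Xb)
      + (integrate (pairing A (connection a)) - integrate (pairing A (connection b))) = 0"
    using integrate_pairing_add[OF A Z conn] integrate_pairing_add[OF A Xa vector_density_minus[OF Xb]]
      integrate_pairing_add[OF A connection(1) vector_density_minus[OF connection(1)], of a b]
    by (simp add: integrate_pairing_minus)
  have pot_value: "- integrate (pairing A (extend_vector c Y)) - integrate (pairing A (connection c))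
      = integral (nbhd c) (\<lambda>x. potential c x * g x)"
    if Y: "smooth_on UNIV Y" "\<And>x. Y x \<noteq> 0 \<Longrightarrow> x \<in> core c" "\<And>x. divergence Y x = g x - bump c x"
      and g: "smooth_on UNIV g" "\<And>x. g x \<noteq> 0 \<Longrightarrow> x \<in> core c" "integral UNIV g = 1" for c Y g
  proof -
    have cp: "continuous_on (nbhd c) (primitive c)" by (rule smooth_on_continuous[OF primitive_smooth])
    have cf: "continuous_on (nbhd c) f" if "smooth_on UNIV f" for f :: "real^3 \<Rightarrow> real"
      using smooth_on_continuous[OF that] continuous_on_subset by blast
    have i1: "(\<lambda>x. primitive c x * g x) integrable_on nbhd c"
      by (rule integrable_nbhd[OF continuous_on_mult[OF cp cf[OF g(1)]]]) (use g(2) in auto)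
    have i2: "(\<lambda>x. primitive c x * bump c x) integrable_on nbhd c"
      by (rule integrable_nbhd[OF continuous_on_mult[OF cp cf[OF bump(1)]]]) (use bump(2) in auto)
    have i3: "g integrable_on nbhd c"
      by (rule integrable_nbhd[OF cf[OF g(1)]]) (use g(2) in auto)
    have "x \<in> nbhd c" if "g x \<noteq> 0" for x using g(2)[OF that] core(2) by blast
    then have g1: "integral (nbhd c) g = 1" using int_sub[of g "nbhd c"] g(3) by simp
    have ip: "integrate (pairing A (extend_vector c Y)) = - integral (nbhd c) (\<lambda>x. primitive c x * divergence Y x)"
      by (rule integral_primitive) (use Y in auto)
    define k where "k = integrate (pairing A (connection c)) + integral (nbhd c) (\<lambda>x. primitive c x * bump c x)"
    have "- integrate (pairing A (extend_vector c Y)) = integral (nbhd c) (\<lambda>x. primitive c x * (g x - bump c x))"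
      by (simp add: ip Y(3))
    also have "\<dots> = integral (nbhd c) (\<lambda>x. primitive c x * g x) - integral (nbhd c) (\<lambda>x. primitive c x * bump c x)"
      by (simp add: right_diff_distrib integral_diff[OF i1 i2])
    finally have "- integrate (pairing A (extend_vector c Y)) - integrate (pairing A (connection c))
        = integral (nbhd c) (\<lambda>x. primitive c x * g x) - k * integral (nbhd c) g"
      by (simp add: k_def g1)
    also have "\<dots> = integral (nbhd c) (\<lambda>x. primitive c x * g x - k * g x)"
      by (simp add: integral_diff[OF i1 integrable_on_mult_right[OF i3]])
    also have "\<dots> = integral (nbhd c) (\<lambda>x. potential c x * g x)"
      by (simp add: potential_def k_def left_diff_distrib)
    finally show ?thesis .
  qed
  have eq: "integral (nbhd a) (\<lambda>x. potential a x * \<delta> x) = integral (nbhd b) (\<lambda>x. potential b x * \<delta>' x)"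
    using pot_value[OF Ya \<delta>(1) \<delta>_core \<delta>(4)] pot_value[OF Yb \<delta>'_sm \<delta>'_core \<delta>'_int] total by linarith
  define f where "f x = (if x \<in> U then potential b (trans a b x) * \<delta> x else 0)" for x
  define f' where "f' x = (if x \<in> U then potential a x * \<delta> x else 0)" for x
  have ext_cont: "continuous_on UNIV (\<lambda>x. if x \<in> U then p x * \<delta> x else 0)"
    "bounded {x. (if x \<in> U then p x * \<delta> x else 0) \<noteq> 0}"
    if "continuous_on U p" for p :: "real^3 \<Rightarrow> real"
  proof -
    show "continuous_on UNIV (\<lambda>x. if x \<in> U then p x * \<delta> x else 0)"
      by (rule continuous_extend_by_zero[OF U compact_imp_closed[OF K0(1)] K0(2)])
         (use \<delta>_supp in \<open>auto intro!: continuous_on_mult that continuous_on_subset[OF smooth_on_continuous[OF \<delta>(1)]]\<close>)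
    show "bounded {x. (if x \<in> U then p x * \<delta> x else 0) \<noteq> 0}"
      by (rule bounded_subset[OF compact_imp_bounded[OF K0(1)]]) (use \<delta>_supp in auto)
  qed
  have cb: "continuous_on U (\<lambda>x. potential b (trans a b x))"
    by (rule continuous_on_compose2[OF smooth_on_continuous[OF pot_sm[of b]]
          continuous_on_subset[OF smooth_on_continuous[OF smooth_trans] UR(1)]]) (use U_b in auto)
  have ca: "continuous_on U (potential a)"
    by (rule continuous_on_subset[OF smooth_on_continuous[OF pot_sm] U_a])
  have f_abs: "f absolutely_integrable_on UNIV" "f' absolutely_integrable_on UNIV"
    unfolding f_def[abs_def] f'_def[abs_def]
    using absolutely_integrable_compact_support[OF ext_cont[OF cb]]
      absolutely_integrable_compact_support[OF ext_cont[OF ca]] by simp_all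
  have f_ov: "f absolutely_integrable_on overlap a b"
  proof -
    have "(\<lambda>x. if x \<in> overlap a b then f x else 0) = f" using UR(1) by (auto simp: f_def fun_eq_iff)
    then show ?thesis using f_abs(1) absolutely_integrable_restrict_UNIV[of "overlap a b" f] by simp
  qed
  have "integral (overlap b a) (\<lambda>y. potential b y * \<delta>' y) = integral (overlap a b) f"
  proof (rule integral_change_of_chart[OF _ f_ov])
    fix x assume x: "x \<in> overlap a b"
    have y: "trans a b x \<in> overlap b a" by (rule trans_overlap[OF x])
    have xx: "trans b a (trans a b x) = x" by (rule trans_inverse[OF x])
    have "f x = potential b (trans a b x) * \<delta> x" using \<delta>_supp[of x] K0(2) by (auto simp: f_def)
    also have "\<dots> = det (matrix (dtrans a b x)) * (potential b (trans a b x) * \<delta>' (trans a b x))"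
    proof -
      have "\<delta>' (trans a b x) = det (matrix (dtrans b a (trans a b x))) * \<delta> x"
        using y by (simp only: \<delta>'_def if_True xx)
      then have "det (matrix (dtrans a b x)) * (potential b (trans a b x) * \<delta>' (trans a b x))
          = (det (matrix (dtrans b a (trans a b x))) * det (matrix (dtrans a b x)))
            * (potential b (trans a b x) * \<delta> x)"
        by (simp only: mult_ac)
      then show ?thesis by (simp only: det_inverse[OF x] mult_1)
    qed
    finally show "f x = det (matrix (dtrans a b x)) * (potential b (trans a b x) * \<delta>' (trans a b x))" .
  qed
  moreover have "integral (overlap b a) (\<lambda>y. potential b y * \<delta>' y) = integral UNIV (\<lambda>y. potential b y * \<delta>' y)"
    by (rule int_sub) (use \<delta>'_supp K1o in auto)
  moreover have "integral (nbhd b) (\<lambda>y. potential b y * \<delta>' y) = integral UNIV (\<lambda>y. potential b y * \<delta>' y)"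
    by (rule int_sub) (use \<delta>'_core core(2)[of b] in \<open>auto simp del: mem_ball\<close>)
  moreover have "integral (overlap a b) f = integral UNIV f"
    by (rule int_sub) (use UR(1) in \<open>auto simp: f_def split: if_splits\<close>)
  moreover have "integral (nbhd a) (\<lambda>x. potential a x * \<delta> x) = integral UNIV (\<lambda>x. potential a x * \<delta> x)"
    by (rule int_sub) (use \<delta>_core core(2)[of a] in \<open>auto simp del: mem_ball\<close>)
  moreover have "(\<lambda>x. potential a x * \<delta> x) = f'" using \<delta>_supp K0(2) by (auto simp: f'_def fun_eq_iff)
  ultimately have "integral UNIV f' = integral UNIV f" using eq by simp
  then have "integral UNIV (\<lambda>x. f' x - f x) = 0"
    using integral_diff[of f' UNIV f] f_abs by (simp add: absolutely_integrable_on_def)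
  moreover have "(\<lambda>x. f' x - f x) = (\<lambda>x. if x \<in> U then d x * \<delta> x else 0)"
    by (auto simp: f_def f'_def d_def left_diff_distrib fun_eq_iff)
  moreover have "integral UNIV (\<lambda>x. if x \<in> U then d x * \<delta> x else 0) > 0"
  proof (rule integral_positive[OF ext_cont[OF smooth_on_continuous[OF d_sm]]])
    show "0 \<le> (if x \<in> U then d x * \<delta> x else 0)" for x
      using \<delta>_supp[of x] K0d[of x] \<delta>(2)[of x] by (cases "\<delta> x = 0") auto
    show "(if x0 \<in> U then d x0 * \<delta> x0 else 0) > 0"
      using x0U d0 \<delta>(3)[of x0] e(1) by simp
  qed
  ultimately show False by simp
qed

lemma potential_eq:
  assumes "q \<in> dom_at P a" "q \<in> dom_at P b"
    and "chart_at P a q \<in> ball (center a) (radius a)" and "chart_at P b q \<in> ball (center b) (radius b)"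
  shows "potential a (chart_at P a q) = potential b (chart_at P b q)"
  using potential_le[OF assms] potential_le[OF assms(2,1,4,3)] by simp

text \<open>
  By \<open>potential_eq\<close> the potentials agree on overlaps and define a global function.
\<close>

theorem null_one_form_exact:
  obtains u where "smooth_function P u"
    "\<And>a. ((u \<circ> inv_chart P a) has_derivative (\<lambda>v. A a (center a) \<bullet> v)) (at (center a))"
proof -
  define u where "u q = potential q (chart_at P q q)" for q
  let ?B = "\<lambda>a. ball (center a) (radius a)"
  have B: "?B a \<subseteq> nbhd a" "?B a \<subseteq> range_at P a" for a
    using ball_core core(2,3) by blast+
  have u_eq: "(u \<circ> inv_chart P a) x = potential a x" if x: "x \<in> ?B a" for a x
  proof -
    define q where "q = inv_chart P a x"
    have "x \<in> range_at P a" using x B by blast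
    then have "q \<in> dom_at P a" "chart_at P a q = x" by (simp_all add: q_def inv_chart_dom chart_inv_chart)
    moreover have "chart_at P q q \<in> ?B q" using radius(1) by simp
    ultimately show ?thesis
      using potential_eq[of q q a] x dom(1)[of q] by (simp add: u_def q_def[symmetric])
  qed
  have pd: "(potential a has_derivative (\<lambda>v. A a x \<bullet> v)) (at x)" if "x \<in> nbhd a" for a x
  proof -
    have "((\<lambda>x. primitive a x - (integrate (pairing A (connection a)) + integral (nbhd a) (\<lambda>x. primitive a x * bump a x)))
        has_derivative (\<lambda>v. A a x \<bullet> v - 0)) (at x)"
      by (intro has_derivative_diff primitive that has_derivative_const)
    then show ?thesis by (simp add: potential_def[abs_def])
  qed
  have psm: "smooth_on (?B a) (potential a)" for a
    unfolding potential_def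
    by (intro smooth_on_diff smooth_on_subset[OF primitive_smooth B(1)] smooth_on_const open_ball)
  show ?thesis
  proof (rule that)
    show "smooth_function P u"
    proof (rule smooth_function_local)
      fix q
      have "smooth_on (?B q) (u \<circ> inv_chart P q)"
        by (rule smooth_on_cong[OF psm open_ball]) (use u_eq in auto)
      then show "\<exists>W. open W \<and> center q \<in> W \<and> W \<subseteq> range_at P q \<and> smooth_on W (u \<circ> inv_chart P q)"
        using B(2) radius(1) by (intro exI[of _ "?B q"]) auto
    qed
    fix a
    have c: "center a \<in> ?B a" using radius(1) by simp
    show "((u \<circ> inv_chart P a) has_derivative (\<lambda>v. A a (center a) \<bullet> v)) (at (center a))"
      by (rule has_derivative_transform_within_open[OF pd open_ball c]) (use c B u_eq in auto)
  qed
qed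

end

section \<open>Alternating forms\<close>

lemma alt_forms_linear:
  "\<alpha> \<in> alt_forms k \<Longrightarrow> length us + 1 + length ws = k \<Longrightarrow> linear (\<lambda>v. \<alpha> (us @ v # ws))"
  by (simp add: alt_forms_def)

lemma alt_forms_length: "\<alpha> \<in> alt_forms k \<Longrightarrow> length vs \<noteq> k \<Longrightarrow> \<alpha> vs = 0"
  by (simp add: alt_forms_def)

lemma alt_forms_not_distinct: "\<alpha> \<in> alt_forms k \<Longrightarrow> \<not> distinct vs \<Longrightarrow> \<alpha> vs = 0"
  by (simp add: alt_forms_def)

lemma alt_forms_swap:
  assumes \<alpha>: "\<alpha> \<in> alt_forms k"
  shows "\<alpha> (us @ a # ms @ b # ws) = - \<alpha> (us @ b # ms @ a # ws)"
proof (cases "length us + length ms + length ws + 2 = k")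
  case False
  then show ?thesis using \<alpha> by (simp add: alt_forms_length)
next
  case True
  have l1: "linear (\<lambda>v. \<alpha> (us @ v # ms @ c # ws))" for c
    using True by (intro alt_forms_linear[OF \<alpha>]) auto
  have l2: "linear (\<lambda>v. \<alpha> (us @ c # ms @ v # ws))" for c
    using alt_forms_linear[OF \<alpha>, of "us @ c # ms" ws] True by simp
  have z: "\<alpha> (us @ c # ms @ c # ws) = 0" for c
    using \<alpha> by (rule alt_forms_not_distinct) simp
  have "0 = \<alpha> (us @ (a + b) # ms @ (a + b) # ws)" by (simp add: z)
  also have "\<dots> = \<alpha> (us @ a # ms @ b # ws) + \<alpha> (us @ b # ms @ a # ws)"
    by (simp only: linear_add[OF l1] linear_add[OF l2]) (simp add: z)
  finally show ?thesis by simp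
qed

lemma alt_forms_zero_insort:
  assumes \<alpha>: "\<alpha> \<in> alt_forms k"
  shows "\<alpha> (us @ map e (insort x ys)) = 0 \<longleftrightarrow> \<alpha> (us @ map e (x # ys)) = 0"
proof (induction ys arbitrary: us)
  case (Cons y ys)
  show ?case
  proof (cases "x \<le> y")
    case False
    then show ?thesis
      using Cons[of "us @ [e y]"] alt_forms_swap[OF \<alpha>, of us "e x" "[]" "e y" "map e ys"] by simp
  qed simp
qed simp

lemma alt_forms_zero_sort:
  assumes \<alpha>: "\<alpha> \<in> alt_forms k"
  shows "\<alpha> (us @ map e (sort xs)) = 0 \<longleftrightarrow> \<alpha> (us @ map e xs) = 0"
proof (induction xs arbitrary: us)
  case (Cons x xs)
  then show ?case
    using alt_forms_zero_insort[OF \<alpha>, of us e x "sort xs"] Cons[of "us @ [e x]"] by simp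
qed simp

lemma alt_forms_zero_on_axes:
  fixes \<alpha> :: "(real^'n) form"
  assumes \<alpha>: "\<alpha> \<in> alt_forms k"
    and zero: "\<And>js. length js = k \<Longrightarrow> \<alpha> (map (\<lambda>i. axis i 1) js) = 0"
  shows "\<alpha> vs = 0"
proof (cases "length vs = k")
  case True
  have "length us + length js = k \<Longrightarrow> \<alpha> (us @ map (\<lambda>i. axis i 1) js) = 0" for us js
  proof (induction us arbitrary: js rule: rev_induct)
    case Nil
    then show ?case using zero by simp
  next
    case (snoc v us)
    have lin: "linear (\<lambda>v. \<alpha> (us @ v # map (\<lambda>i. axis i 1) js))"
      using snoc.prems by (intro alt_forms_linear[OF \<alpha>]) auto
    have "\<alpha> (us @ v # map (\<lambda>i. axis i 1) js) = (\<Sum>i\<in>UNIV. v $ i *\<^sub>R \<alpha> (us @ axis i 1 # map (\<lambda>i. axis i 1) js))"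
      by (rule linear_axis_expansion[OF lin])
    also have "\<dots> = 0"
      using snoc.IH[of "i # js" for i] snoc.prems by simp
    finally show ?case by simp
  qed
  from this[of vs "[]"] show ?thesis using True by simp
qed (simp add: alt_forms_length[OF \<alpha>])

lemma alt_forms_dependent:
  fixes \<alpha> :: "'v::real_vector form"
  assumes \<alpha>: "\<alpha> \<in> alt_forms k" and v: "v \<in> span (set us \<union> set ws)"
  shows "\<alpha> (us @ v # ws) = 0"
proof (cases "length us + 1 + length ws = k")
  case True
  note lin = alt_forms_linear[OF \<alpha> True]
  have "span (set us \<union> set ws) \<subseteq> {v. \<alpha> (us @ v # ws) = 0}"
  proof (rule span_minimal)
    show "set us \<union> set ws \<subseteq> {v. \<alpha> (us @ v # ws) = 0}"
      using alt_forms_not_distinct[OF \<alpha>] by auto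
    show "subspace {v. \<alpha> (us @ v # ws) = 0}"
      using linear_0[OF lin] linear_add[OF lin] linear_cmul[OF lin] by (auto simp: subspace_def)
  qed
  then show ?thesis using v by blast
qed (simp add: alt_forms_length[OF \<alpha>])

lemma pull_alt_forms:
  assumes "linear g" "\<alpha> \<in> alt_forms k" shows "pull g \<alpha> \<in> alt_forms k"
  unfolding alt_forms_def
proof (intro CollectI conjI allI impI)
  fix us ws :: "'a list" assume "length us + 1 + length ws = k"
  then have "linear (\<lambda>w. \<alpha> (map g us @ w # map g ws))"
    by (intro alt_forms_linear[OF assms(2)]) simp
  from linear_compose[OF assms(1) this]
  show "linear (\<lambda>v. pull g \<alpha> (us @ v # ws))" by (simp add: pull_def o_def)
qed (use assms(2) in \<open>auto simp: pull_def alt_forms_length distinct_map intro: alt_forms_not_distinct\<close>)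

subsection \<open>Forms of top degree\<close>

lemma linear_inv_bij:
  assumes f: "linear f" "bij f" shows "linear (inv f)"
proof (rule linearI)
  have ff: "f (inv f y) = y" "inv f (f x) = x" for x y
    using f(2) by (simp_all add: bij_is_surj surj_f_inv_f bij_is_inj)
  show "inv f (x + y) = inv f x + inv f y" for x y by (metis ff linear_add[OF f(1)])
  show "inv f (c *\<^sub>R x) = c *\<^sub>R inv f x" for c x by (metis ff linear_cmul[OF f(1)])
qed

definition frame :: "(real^'n) list \<Rightarrow> bool" where
  "frame fs \<longleftrightarrow> (\<exists>js. distinct js \<and> set js = UNIV \<and> fs = map (\<lambda>i. axis i 1) js)"

lemma frame_split:
  fixes fs :: "(real^'n) list"
  assumes "frame fs" "m \<noteq> n"
  obtains us ms ws where
    "fs = us @ axis m 1 # ms @ axis n 1 # ws \<or> fs = us @ axis n 1 # ms @ axis m 1 # ws"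
    "\<And>v. v \<in> set us \<union> set ms \<union> set ws \<Longrightarrow> \<exists>i. i \<noteq> m \<and> i \<noteq> n \<and> v = axis i 1"
proof -
  obtain js where i: "distinct js" "set js = UNIV" "fs = map (\<lambda>i. axis i 1) js"
    using assms(1) by (auto simp: frame_def)
  obtain us vs where uv: "js = us @ m # vs" using i(2) by (metis UNIV_I split_list)
  have "n \<in> set us \<or> n \<in> set vs" using i(2) uv assms(2) by auto
  then show ?thesis
  proof
    assume "n \<in> set us"
    then obtain us1 us2 where "us = us1 @ n # us2" by (metis split_list)
    then show ?thesis using uv i
      by (intro that[of "map (\<lambda>i. axis i 1) us1" "map (\<lambda>i. axis i 1) us2" "map (\<lambda>i. axis i 1) vs"]) auto
  next
    assume "n \<in> set vs"
    then obtain vs1 vs2 where "vs = vs1 @ n # vs2" by (metis split_list)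
    then show ?thesis using uv i
      by (intro that[of "map (\<lambda>i. axis i 1) us" "map (\<lambda>i. axis i 1) vs1" "map (\<lambda>i. axis i 1) vs2"]) auto
  qed
qed

lemma alt_forms_scale_slots:
  assumes \<alpha>: "\<alpha> \<in> alt_forms k"
  shows "\<alpha> (us @ map (\<lambda>i. c i *\<^sub>R e i) js) = (\<Prod>i\<leftarrow>js. c i) * \<alpha> (us @ map e js)"
proof (induction js arbitrary: us)
  case (Cons i js)
  show ?case
  proof (cases "length us + 1 + length js = k")
    case True
    have lin: "linear (\<lambda>v. \<alpha> (us @ v # map (\<lambda>i. c i *\<^sub>R e i) js))"
      by (rule alt_forms_linear[OF \<alpha>]) (use True in simp)
    show ?thesis
      using linear_cmul[OF lin, of "c i" "e i"] Cons[of "us @ [e i]"] by simp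
  qed (simp add: alt_forms_length[OF \<alpha>])
qed simp

lemma dependent_list_alt_forms:
  fixes \<alpha> :: "'v::real_vector form"
  assumes \<alpha>: "\<alpha> \<in> alt_forms k" and dep: "distinct vs \<Longrightarrow> dependent (set vs)"
  shows "\<alpha> vs = 0"
proof (cases "distinct vs")
  case True
  obtain a where a: "a \<in> set vs" "a \<in> span (set vs - {a})"
    using dep[OF True] by (auto simp: dependent_def)
  obtain us ws where s: "vs = us @ a # ws" using a(1) by (metis split_list)
  have "set vs - {a} = set us \<union> set ws" using True s by auto
  then show ?thesis using alt_forms_dependent[OF \<alpha>, of a us ws] a(2) s by simp
qed (simp add: alt_forms_not_distinct[OF \<alpha>])

text \<open>
  Both sides are multiplicative in the map, so it suffices to check elementary maps.
\<close>

lemma top_form_det: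
  fixes \<omega> :: "(real^'n) form" and g :: "real^'n \<Rightarrow> real^'n"
  assumes fs: "frame fs" and \<omega>: "\<omega> \<in> alt_forms CARD('n)" and g: "linear g"
  shows "\<omega> (map g fs) = det (matrix g) * \<omega> fs"
proof -
  obtain js where i: "distinct js" "set js = UNIV" "fs = map (\<lambda>i. axis i 1) js"
    using fs by (auto simp: frame_def)
  have len: "length js = CARD('n)" using i(1,2) by (metis distinct_card)
  have "\<forall>\<omega>\<in>alt_forms CARD('n). \<omega> (map g fs) = det (matrix g) * \<omega> fs"
  proof (rule induct_linear_elementary[OF g]; intro ballI)
    fix f g :: "real^'n \<Rightarrow> real^'n" and \<omega> :: "(real^'n) form"
    assume lin: "linear f" "linear g"
      and f: "\<forall>\<omega>\<in>alt_forms CARD('n). \<omega> (map f fs) = det (matrix f) * \<omega> fs"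
      and g: "\<forall>\<omega>\<in>alt_forms CARD('n). \<omega> (map g fs) = det (matrix g) * \<omega> fs"
      and \<omega>: "\<omega> \<in> alt_forms CARD('n)"
    have "\<omega> (map (f \<circ> g) fs) = pull f \<omega> (map g fs)" by (simp add: pull_def)
    also have "\<dots> = det (matrix g) * pull f \<omega> fs" using g pull_alt_forms[OF lin(1) \<omega>] by blast
    also have "pull f \<omega> fs = det (matrix f) * \<omega> fs" using f \<omega> by (simp add: pull_def)
    finally show "\<omega> (map (f \<circ> g) fs) = det (matrix (f \<circ> g)) * \<omega> fs"
      unfolding matrix_compose[OF lin(2,1)] det_mul by (simp add: o_def mult_ac)
  next
    fix f :: "real^'n \<Rightarrow> real^'n" and j and \<omega> :: "(real^'n) form"
    assume f: "linear f" "\<And>x. f x $ j = 0" and \<omega>: "\<omega> \<in> alt_forms CARD('n)"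
    have "dependent (set (map f fs))" if d: "distinct (map f fs)"
    proof (rule ccontr)
      assume ind: "independent (set (map f fs))"
      have "card (set (map f fs)) = CARD('n)" using distinct_card[OF d] len i(3) by simp
      then have "UNIV \<subseteq> span (set (map f fs))"
        using ind by (intro card_ge_dim_independent) auto
      moreover have "span (set (map f fs)) \<subseteq> {x. x $ j = 0}"
        by (rule span_minimal) (use f(2) in \<open>auto simp: subspace_def\<close>)
      ultimately have "axis j 1 \<in> {x :: real^'n. x $ j = 0}" by blast
      then show False by simp
    qed
    then have "\<omega> (map f fs) = 0" by (rule dependent_list_alt_forms[OF \<omega>])
    moreover have "det (matrix f) = 0"
      by (rule det_zero_row(2)[of j]) (simp add: row_def matrix_def f(2) vec_eq_iff)
    ultimately show "\<omega> (map f fs) = det (matrix f) * \<omega> fs" by simp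
  next
    fix c :: "'n \<Rightarrow> real" and \<omega> :: "(real^'n) form"
    assume \<omega>: "\<omega> \<in> alt_forms CARD('n)"
    let ?f = "\<lambda>x::real^'n. \<chi> i. c i * x $ i"
    have fe: "?f (axis i 1) = c i *\<^sub>R axis i 1" for i by (simp add: vec_eq_iff axis_def)
    have "\<omega> (map ?f fs) = \<omega> ([] @ map (\<lambda>i. c i *\<^sub>R axis i 1) js)"
      by (simp add: i(3) o_def fe)
    also have "\<dots> = (\<Prod>i\<leftarrow>js. c i) * \<omega> fs"
      unfolding alt_forms_scale_slots[OF \<omega>] by (simp add: i(3))
    also have "(\<Prod>i\<leftarrow>js. c i) = (\<Prod>i\<in>UNIV. c i)"
      using prod.distinct_set_conv_list[OF i(1), of c] i(2) by simp
    also have "\<dots> = det (matrix ?f)"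
      by (subst det_diagonal) (auto simp: matrix_def axis_def)
    finally show "\<omega> (map ?f fs) = det (matrix ?f) * \<omega> fs" .
  next
    fix m n :: 'n and \<omega> :: "(real^'n) form"
    assume mn: "m \<noteq> n" and \<omega>: "\<omega> \<in> alt_forms CARD('n)"
    let ?f = "\<lambda>x::real^'n. \<chi> i. x $ Transposition.transpose m n i"
    have fe: "?f (axis i 1) = axis (Transposition.transpose m n i) 1" for i
      by (auto simp: vec_eq_iff axis_def Transposition.transpose_def)
    obtain us ms ws where s: "fs = us @ axis m 1 # ms @ axis n 1 # ws \<or> fs = us @ axis n 1 # ms @ axis m 1 # ws"
      "\<And>v. v \<in> set us \<union> set ms \<union> set ws \<Longrightarrow> \<exists>i. i \<noteq> m \<and> i \<noteq> n \<and> v = axis i 1"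
      using frame_split[OF fs mn] by blast
    have same: "map ?f xs = xs" if sub: "set xs \<subseteq> set us \<union> set ms \<union> set ws" for xs
    proof (rule map_idI)
      fix v assume "v \<in> set xs"
      then obtain i where "i \<noteq> m" "i \<noteq> n" "v = axis i 1" using s(2) sub by blast
      then show "?f v = v" using fe[of i] by simp
    qed
    have same3: "map ?f us = us" "map ?f ms = ms" "map ?f ws = ws" by (rule same, blast)+
    have "\<omega> (map ?f fs) = - \<omega> fs"
      using s(1) alt_forms_swap[OF \<omega>, of us "axis m 1" ms "axis n 1" ws]
      by (auto simp: same3 fe)
    moreover have "det (matrix ?f) = -1"
    proof -
      have "matrix ?f = (\<chi> i. (mat 1 :: real^'n^'n) $ Transposition.transpose m n i)"
        by (auto simp: matrix_def mat_def axis_def vec_eq_iff)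
      then show ?thesis
        using det_permute_rows[OF permutes_swap_id[of m UNIV n], of "mat 1 :: real^'n^'n"] mn
        by (simp add: sign_swap_id)
    qed
    ultimately show "\<omega> (map ?f fs) = det (matrix ?f) * \<omega> fs" by simp
  next
    fix m n :: 'n and \<omega> :: "(real^'n) form"
    assume mn: "m \<noteq> n" and \<omega>: "\<omega> \<in> alt_forms CARD('n)"
    let ?f = "\<lambda>x::real^'n. \<chi> i. if i = m then x $ m + x $ n else x $ i"
    have fe: "?f (axis i 1) = (if i = n then axis n 1 + axis m 1 else axis i 1)" for i
      using mn by (auto simp: vec_eq_iff axis_def)
    obtain us ms ws where s: "fs = us @ axis m 1 # ms @ axis n 1 # ws \<or> fs = us @ axis n 1 # ms @ axis m 1 # ws"
      "\<And>v. v \<in> set us \<union> set ms \<union> set ws \<Longrightarrow> \<exists>i. i \<noteq> m \<and> i \<noteq> n \<and> v = axis i 1"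
      using frame_split[OF fs mn] by blast
    have lfs: "length fs = CARD('n)" using len i(3) by simp
    have same: "map ?f xs = xs" if sub: "set xs \<subseteq> set us \<union> set ms \<union> set ws" for xs
    proof (rule map_idI)
      fix v assume "v \<in> set xs"
      then obtain i where v: "i \<noteq> n" "v = axis i 1" using s(2) sub by blast
      show "?f v = v" unfolding v(2) fe using v(1) by simp
    qed
    have fm: "?f (axis m 1) = axis m 1" and fn: "?f (axis n 1) = axis n 1 + axis m 1"
      using fe[of m] fe[of n] mn by simp_all
    have same3: "map ?f us = us" "map ?f ms = ms" "map ?f ws = ws" by (rule same, blast)+
    have "\<omega> (map ?f fs) = \<omega> fs"
      using s(1)
    proof
      assume e: "fs = us @ axis m 1 # ms @ axis n 1 # ws"
      have lin: "linear (\<lambda>v. \<omega> ((us @ axis m 1 # ms) @ v # ws))"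
        by (rule alt_forms_linear[OF \<omega>]) (use lfs e in simp)
      have "\<omega> ((us @ axis m 1 # ms) @ axis m 1 # ws) = 0"
        by (rule alt_forms_not_distinct[OF \<omega>]) simp
      moreover have "map ?f fs = (us @ axis m 1 # ms) @ (axis n 1 + axis m 1) # ws"
        unfolding e by (simp only: map_append list.map fm fn same3 append_assoc append_Cons)
      ultimately show ?thesis using linear_add[OF lin, of "axis n 1" "axis m 1"] e by simp
    next
      assume e: "fs = us @ axis n 1 # ms @ axis m 1 # ws"
      have lin: "linear (\<lambda>v. \<omega> (us @ v # ms @ axis m 1 # ws))"
        by (rule alt_forms_linear[OF \<omega>]) (use lfs e in simp)
      have "\<omega> (us @ axis m 1 # ms @ axis m 1 # ws) = 0"
        by (rule alt_forms_not_distinct[OF \<omega>]) simp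
      moreover have "map ?f fs = us @ (axis n 1 + axis m 1) # ms @ axis m 1 # ws"
        unfolding e by (simp only: map_append list.map fm fn same3 append_assoc append_Cons)
      ultimately show ?thesis using linear_add[OF lin, of "axis n 1" "axis m 1"] e by simp
    qed
    moreover have "det (matrix ?f) = 1"
    proof -
      have "matrix ?f = (\<chi> k. if k = m then row m (mat 1 :: real^'n^'n) + 1 *s row n (mat 1) else row k (mat 1))"
        by (auto simp: matrix_def mat_def axis_def row_def vec_eq_iff)
      then show ?thesis using det_row_operation[OF mn, of "mat 1 :: real^'n^'n" 1] by simp
    qed
    ultimately show "\<omega> (map ?f fs) = det (matrix ?f) * \<omega> fs" by simp
  qed
  then show ?thesis using \<omega> by blast
qed

subsection \<open>Wedge products\<close>

definition alternating_sum :: "nat \<Rightarrow> 'v form \<Rightarrow> 'v form" where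
  "alternating_sum n F vs =
     (\<Sum>\<sigma> | \<sigma> permutes {..<n}. of_int (sign \<sigma>) * F (map (\<lambda>i. vs ! \<sigma> i) [0..<n]))"

lemma wedge_eq_alternating_sum:
  "length vs = k + l \<Longrightarrow>
    wedge k l \<alpha> \<beta> vs = alternating_sum (k + l) (\<lambda>us. \<alpha> (take k us) * \<beta> (drop k us)) vs / (fact k * fact l)"
  by (simp add: wedge_def alternating_sum_def take_map drop_map mult.assoc upt_add_eq_append[of 0 k l] del: upt_add_eq_append)

lemma alternating_sum_0: "alternating_sum 0 F vs = F []"
proof -
  have "{\<sigma>. \<sigma> permutes {..<(0::nat)}} = {id}" by auto
  then show ?thesis by (simp add: alternating_sum_def)
qed

text \<open>
  Expansion along the last slot, which turns the sum over permutations into a recursion that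
  can be evaluated.
\<close>

lemma alternating_sum_Suc:
  assumes len: "n < length vs"
  shows "alternating_sum (Suc n) F vs =
    alternating_sum n (\<lambda>us. F (us @ [vs ! n])) vs
    - (\<Sum>j<n. alternating_sum n (\<lambda>us. F (us @ [vs ! j])) (vs[j := vs ! n]))"
proof -
  have summand: "of_int (sign (Transposition.transpose n j \<circ> q))
      * F (map (\<lambda>i. vs ! (Transposition.transpose n j \<circ> q) i) [0..<Suc n])
    = (if j = n then 1 else -1) * (of_int (sign q) * F (map (\<lambda>i. vs[j := vs ! n] ! q i) [0..<n] @ [vs ! j]))"
    if j: "j \<le> n" and q: "q permutes {..<n}" for j q
  proof -
    have "sign (Transposition.transpose n j \<circ> q) = sign (Transposition.transpose n j) * sign q"
    proof (rule sign_compose)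
      show "permutation q" unfolding permutation_permutes using q finite_lessThan by blast
    qed (rule permutation_swap_id)
    moreover have m: "map (\<lambda>i. vs ! (Transposition.transpose n j \<circ> q) i) [0..<n]
        = map (\<lambda>i. vs[j := vs ! n] ! q i) [0..<n]"
    proof (rule map_cong[OF refl])
      fix i assume "i \<in> set [0..<n]"
      then have "q i < n" using permutes_in_image[OF q, of i] by simp
      then show "vs ! (Transposition.transpose n j \<circ> q) i = vs[j := vs ! n] ! q i"
        using j len by (auto simp: Transposition.transpose_def)
    qed
    have "q n = n" by (rule permutes_not_in[OF q]) simp
    then have "map (\<lambda>i. vs ! (Transposition.transpose n j \<circ> q) i) [0..<Suc n]
        = map (\<lambda>i. vs[j := vs ! n] ! q i) [0..<n] @ [vs ! j]"
      unfolding upt_Suc_append[OF le0] map_append m by simp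
    ultimately show ?thesis by (simp only: sign_swap_id) simp
  qed
  have "alternating_sum (Suc n) F vs =
    (\<Sum>j\<in>insert n {..<n}. \<Sum>q | q permutes {..<n}. (if j = n then 1 else -1) *
      (of_int (sign q) * F (map (\<lambda>i. vs[j := vs ! n] ! q i) [0..<n] @ [vs ! j])))"
  proof -
    have "alternating_sum (Suc n) F vs = (\<Sum>j\<in>insert n {..<n}. \<Sum>q | q permutes {..<n}.
        of_int (sign (Transposition.transpose n j \<circ> q))
        * F (map (\<lambda>i. vs ! (Transposition.transpose n j \<circ> q) i) [0..<Suc n]))"
      unfolding alternating_sum_def lessThan_Suc by (rule sum_over_permutations_insert) auto
    also have "\<dots> = (\<Sum>j\<in>insert n {..<n}. \<Sum>q | q permutes {..<n}. (if j = n then 1 else -1) *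
      (of_int (sign q) * F (map (\<lambda>i. vs[j := vs ! n] ! q i) [0..<n] @ [vs ! j])))"
      by (intro sum.cong refl summand) auto
    finally show ?thesis .
  qed
  also have "\<dots> = (\<Sum>j\<in>insert n {..<n}. (if j = n then 1 else -1) *
      alternating_sum n (\<lambda>us. F (us @ [vs ! j])) (vs[j := vs ! n]))"
    by (simp only: alternating_sum_def sum_distrib_left)
  also have "\<dots> = alternating_sum n (\<lambda>us. F (us @ [vs ! n])) vs
    - (\<Sum>j<n. alternating_sum n (\<lambda>us. F (us @ [vs ! j])) (vs[j := vs ! n]))"
    by (simp add: sum_negf[symmetric])
  finally show ?thesis .
qed

lemma alternating_sum_alt_forms:
  fixes F :: "'v::real_vector form"
  assumes lin: "\<And>us ws. length us + 1 + length ws = n \<Longrightarrow> linear (\<lambda>v. F (us @ v # ws))"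
  shows "(\<lambda>vs. if length vs = n then alternating_sum n F vs else 0) \<in> alt_forms n"
  unfolding alt_forms_def
proof (intro CollectI conjI allI impI)
  fix us ws :: "'v list" assume len: "length us + 1 + length ws = n"
  define p where "p = length us"
  have "linear (\<lambda>v. of_int (sign \<sigma>) * F (map (\<lambda>i. (us @ v # ws) ! \<sigma> i) [0..<n]))"
    if \<sigma>: "\<sigma> permutes {..<n}" for \<sigma>
  proof -
    define q where "q = inv \<sigma> p"
    have pq: "\<sigma> q = p" unfolding q_def by (rule permutes_inverses(1)[OF \<sigma>])
    have q: "q < n" using permutes_in_image[OF \<sigma>, of q] pq len by (simp add: p_def)
    have other: "(us @ v # ws) ! \<sigma> i = (us @ 0 # ws) ! \<sigma> i" if "i \<noteq> q" for i v
    proof -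
      have "\<sigma> i \<noteq> p" using that pq permutes_inj[OF \<sigma>] by (metis injD)
      then show ?thesis by (auto simp: nth_append nth_Cons' p_def)
    qed
    have split: "[0..<n] = [0..<q] @ q # [Suc q..<n]"
      using q upt_add_eq_append[of 0 q "n - q"] upt_conv_Cons[of q n] by simp
    have same: "map (\<lambda>i. (us @ v # ws) ! \<sigma> i) xs = map (\<lambda>i. (us @ 0 # ws) ! \<sigma> i) xs"
      if "q \<notin> set xs" for xs v
      using that by (intro map_cong refl other) auto
    have slot: "(us @ v # ws) ! p = v" for v by (simp add: p_def)
    have "map (\<lambda>i. (us @ v # ws) ! \<sigma> i) [0..<n] =
        map (\<lambda>i. (us @ 0 # ws) ! \<sigma> i) [0..<q] @ v # map (\<lambda>i. (us @ 0 # ws) ! \<sigma> i) [Suc q..<n]" for v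
      using same[of "[0..<q]" v] same[of "[Suc q..<n]" v] by (simp only: split map_append list.map pq slot) simp
    moreover have "linear (\<lambda>v. F (map (\<lambda>i. (us @ 0 # ws) ! \<sigma> i) [0..<q] @ v # map (\<lambda>i. (us @ 0 # ws) ! \<sigma> i) [Suc q..<n]))"
      by (rule lin) (use q in simp)
    ultimately show ?thesis
      by (simp add: linear_iff algebra_simps)
  qed
  then have "linear (\<lambda>v. alternating_sum n F (us @ v # ws))"
    unfolding alternating_sum_def by (intro linear_compose_sum ballI) simp
  then show "linear (\<lambda>v. if length (us @ v # ws) = n then alternating_sum n F (us @ v # ws) else 0)"
    using len by simp
next
  fix vs :: "'v list" assume "\<not> distinct vs"
  then obtain i j where ij: "i < j" "j < length vs" "vs ! i = vs ! j"
    by (metis distinct_conv_nth linorder_neqE_nat)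
  show "(if length vs = n then alternating_sum n F vs else 0) = 0"
  proof (cases "length vs = n")
    case True
    let ?t = "Transposition.transpose i j"
    let ?f = "\<lambda>\<sigma>. of_int (sign \<sigma>) * F (map (\<lambda>i. vs ! \<sigma> i) [0..<n])"
    have t: "?t permutes {..<n}" using ij True by (intro permutes_swap_id) auto
    have "alternating_sum n F vs = (\<Sum>\<sigma> | \<sigma> permutes {..<n}. ?f (?t \<circ> \<sigma>))"
      unfolding alternating_sum_def by (rule setum_permutations_compose_left[OF t])
    also have "\<dots> = (\<Sum>\<sigma> | \<sigma> permutes {..<n}. - ?f \<sigma>)"
    proof (rule sum.cong[OF refl])
      fix \<sigma> assume "\<sigma> \<in> {\<sigma>. \<sigma> permutes {..<n}}"
      then have \<sigma>: "\<sigma> permutes {..<n}" by simp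
      have "sign (?t \<circ> \<sigma>) = sign ?t * sign \<sigma>"
      proof (rule sign_compose)
        show "permutation \<sigma>" unfolding permutation_permutes using \<sigma> finite_lessThan by blast
      qed (rule permutation_swap_id)
      moreover have "vs ! (?t \<circ> \<sigma>) k = vs ! \<sigma> k" for k
        using ij by (auto simp: Transposition.transpose_def)
      ultimately show "?f (?t \<circ> \<sigma>) = - ?f \<sigma>" using ij by (simp add: sign_swap_id)
    qed
    also have "\<dots> = - alternating_sum n F vs" by (simp add: alternating_sum_def sum_negf)
    finally show ?thesis by simp
  qed simp
qed simp

lemma wedge_alt_forms:
  fixes \<alpha> \<beta> :: "'v::real_vector form"
  assumes \<alpha>: "\<alpha> \<in> alt_forms k" and \<beta>: "\<beta> \<in> alt_forms l"
  shows "wedge k l \<alpha> \<beta> \<in> alt_forms (k + l)"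
proof -
  let ?F = "\<lambda>us. (\<alpha> (take k us) * \<beta> (drop k us)) / (fact k * fact l)"
  have lin: "linear (\<lambda>v. ?F (us @ v # ws))" if len: "length us + 1 + length ws = k + l" for us ws
  proof (cases "length us < k")
    case True
    then have "take k (us @ v # ws) = us @ v # take (k - length us - 1) ws"
      "drop k (us @ v # ws) = drop (k - length us - 1) ws" for v
      by (simp_all add: take_Cons' drop_Cons')
    moreover have "linear (\<lambda>v. \<alpha> (us @ v # take (k - length us - 1) ws))"
      by (rule alt_forms_linear[OF \<alpha>]) (use True len in auto)
    ultimately show ?thesis by (simp add: linear_iff add_divide_distrib distrib_right)
  next
    case False
    then have "take k (us @ v # ws) = take k us" "drop k (us @ v # ws) = drop k us @ v # ws" for v
      by simp_all
    moreover have "linear (\<lambda>v. \<beta> (drop k us @ v # ws))"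
      by (rule alt_forms_linear[OF \<beta>]) (use False len in auto)
    ultimately show ?thesis by (simp add: linear_iff add_divide_distrib distrib_left)
  qed
  have "wedge k l \<alpha> \<beta> vs = (if length vs = k + l then alternating_sum (k + l) ?F vs else 0)" for vs
    by (simp add: wedge_eq_alternating_sum alternating_sum_def sum_divide_distrib)
       (simp add: wedge_def)
  then have "wedge k l \<alpha> \<beta> = (\<lambda>vs. if length vs = k + l then alternating_sum (k + l) ?F vs else 0)"
    by (rule ext)
  then show ?thesis using alternating_sum_alt_forms[OF lin] by simp
qed

lemma pull_wedge: "pull g (wedge k l \<alpha> \<beta>) = wedge k l (pull g \<alpha>) (pull g \<beta>)"
proof
  fix vs
  have *: "map (\<lambda>i. map g vs ! \<sigma> i) [a..<b] = map g (map (\<lambda>i. vs ! \<sigma> i) [a..<b])"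
    if "\<sigma> permutes {..<k + l}" "length vs = k + l" "b \<le> k + l" for \<sigma> a b
    using permutes_in_image[OF that(1)] that(2,3) by (auto simp: o_def)
  show "pull g (wedge k l \<alpha> \<beta>) vs = wedge k l (pull g \<alpha>) (pull g \<beta>) vs"
    by (auto simp: pull_def wedge_def * intro!: sum.cong arg_cong[where f="\<lambda>t. t / _"])
qed

lemmas alternating_sum_simps = alternating_sum_Suc alternating_sum_0 numeral_eq_Suc lessThan_Suc

lemma wedge_1_1: "wedge 1 1 \<alpha> \<beta> [a, b] = \<alpha> [a] * \<beta> [b] - \<alpha> [b] * \<beta> [a]"
  by (subst wedge_eq_alternating_sum) (simp_all add: alternating_sum_simps)

lemma wedge_1_2: "wedge 1 2 \<alpha> \<beta> [a, b, c] =
    (\<alpha> [a] * \<beta> [b, c] - \<alpha> [a] * \<beta> [c, b] - \<alpha> [b] * \<beta> [a, c] + \<alpha> [b] * \<beta> [c, a]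
      + \<alpha> [c] * \<beta> [a, b] - \<alpha> [c] * \<beta> [b, a]) / 2"
  by (subst wedge_eq_alternating_sum) (simp_all add: alternating_sum_simps)

lemma wedge_1_3: "wedge 1 3 \<alpha> \<beta> [a, b, c, d] =
    (\<alpha> [a] * (\<beta> [b, c, d] - \<beta> [c, b, d] - \<beta> [b, d, c] - \<beta> [d, c, b] + \<beta> [c, d, b] + \<beta> [d, b, c])
   - \<alpha> [b] * (\<beta> [a, c, d] - \<beta> [c, a, d] - \<beta> [a, d, c] - \<beta> [d, c, a] + \<beta> [c, d, a] + \<beta> [d, a, c])
   + \<alpha> [c] * (\<beta> [a, b, d] - \<beta> [b, a, d] - \<beta> [a, d, b] - \<beta> [d, b, a] + \<beta> [b, d, a] + \<beta> [d, a, b])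
   - \<alpha> [d] * (\<beta> [a, b, c] - \<beta> [b, a, c] - \<beta> [a, c, b] - \<beta> [c, b, a] + \<beta> [b, c, a] + \<beta> [c, a, b])) / 6"
  by (subst wedge_eq_alternating_sum) (simp_all add: alternating_sum_simps fact_numeral algebra_simps)

section \<open>The form stabilised by the group G2\<close>

lemma exhaust_7:
  fixes x :: 7
  shows "x = 1 \<or> x = 2 \<or> x = 3 \<or> x = 4 \<or> x = 5 \<or> x = 6 \<or> x = 7"
proof (induct x)
  case (of_int z)
  then have "z = 0 \<or> z = 1 \<or> z = 2 \<or> z = 3 \<or> z = 4 \<or> z = 5 \<or> z = 6" by fastforce
  then show ?case by auto
qed

lemma forall_7: "(\<forall>i::7. P i) \<longleftrightarrow> P 1 \<and> P 2 \<and> P 3 \<and> P 4 \<and> P 5 \<and> P 6 \<and> P 7"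
  by (metis exhaust_7)

lemma UNIV_7: "UNIV = {1, 2, 3, 4, 5, 6, 7::7}"
  using exhaust_7 by auto

lemma sum_7: "sum f (UNIV::7 set) = f 1 + f 2 + f 3 + f 4 + f 5 + f 6 + f 7"
  unfolding UNIV_7 by (simp add: ac_simps)

lemma dx_alt_forms: "dx i \<in> alt_forms 1"
  by (auto simp: alt_forms_def dx_def linear_iff length_Suc_conv)

lemma dx3_alt_forms: "dx3 i j k \<in> alt_forms 3"
proof -
  have "wedge 1 1 (dx j) (dx k) \<in> alt_forms 2"
    by (metis one_add_one wedge_alt_forms dx_alt_forms)
  moreover have "(1 + 2 :: nat) = 3" by simp
  ultimately show ?thesis unfolding dx3_def by (metis wedge_alt_forms dx_alt_forms)
qed

lemma alt_forms_add: "\<alpha> \<in> alt_forms k \<Longrightarrow> \<beta> \<in> alt_forms k \<Longrightarrow> (\<lambda>vs. \<alpha> vs + \<beta> vs) \<in> alt_forms k"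
  by (auto simp: alt_forms_def intro: linear_compose_add)

lemma alt_forms_scale: "\<alpha> \<in> alt_forms k \<Longrightarrow> (\<lambda>vs. c * \<alpha> vs) \<in> alt_forms k"
  unfolding alt_forms_def by (auto intro: linear_compose_scale_right[where 'b=real, simplified])

lemma alt_forms_diff: "\<alpha> \<in> alt_forms k \<Longrightarrow> \<beta> \<in> alt_forms k \<Longrightarrow> (\<lambda>vs. \<alpha> vs - \<beta> vs) \<in> alt_forms k"
  by (auto simp: alt_forms_def intro: linear_compose_sub)

lemma dx3_expand: "dx3 i j k [a, b, c] = a $ i * (b $ j * c $ k - b $ k * c $ j)
    - b $ i * (a $ j * c $ k - a $ k * c $ j) + c $ i * (a $ j * b $ k - a $ k * b $ j)"
  unfolding dx3_def wedge_1_2 wedge_1_1 by (simp add: dx_def field_simps)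

lemma phi0_alt_forms: "phi0 \<in> alt_forms 3"
  unfolding phi0_def by (intro alt_forms_add alt_forms_diff dx3_alt_forms)

lemma phi0_linear:
  "linear (\<lambda>x. phi0 [x, y, z])" "linear (\<lambda>y. phi0 [x, y, z])" "linear (\<lambda>z. phi0 [x, y, z])"
  using alt_forms_linear[OF phi0_alt_forms, of "[]" "[y, z]"]
    alt_forms_linear[OF phi0_alt_forms, of "[x]" "[z]"]
    alt_forms_linear[OF phi0_alt_forms, of "[x, y]" "[]"] by simp_all

lemma phi0_swap: "phi0 [y, x, z] = - phi0 [x, y, z]" "phi0 [x, z, y] = - phi0 [x, y, z]"
  using alt_forms_swap[OF phi0_alt_forms, of "[]" y "[]" x "[z]"]
    alt_forms_swap[OF phi0_alt_forms, of "[x]" z "[]" y "[]"] by simp_all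

subsection \<open>The cross product on seven-dimensional space\<close>

text \<open>
  The imaginary part of the product of two imaginary octonions.
\<close>

definition cross7 :: "real^7 \<Rightarrow> real^7 \<Rightarrow> real^7" where
  "cross7 x y = (\<chi> i. phi0 [x, y, axis i 1])"

lemma inner_cross7: "cross7 x y \<bullet> z = phi0 [x, y, z]"
  using linear_axis_expansion[OF phi0_linear(3), of x y z]
  by (simp add: cross7_def inner_vec_def mult.commute)

lemma cross7_eqI: "(\<And>z. x \<bullet> z = y \<bullet> z) \<Longrightarrow> x = (y :: real^7)"
  by (metis vector_eq_rdot)

lemma cross7_linear: "linear (cross7 x)" "linear (\<lambda>x. cross7 x y)"
  by (simp_all add: linear_iff cross7_def vec_eq_iff linear_add[OF phi0_linear(1)] linear_cmul[OF phi0_linear(1)]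
      linear_add[OF phi0_linear(2)] linear_cmul[OF phi0_linear(2)])

lemma cross7_swap: "cross7 y x = - cross7 x y"
  by (simp add: cross7_def vec_eq_iff phi0_swap(1)[of y x])

lemma cross7_components:
  "cross7 x y $ 1 = x $ 2 * y $ 3 - x $ 3 * y $ 2 + x $ 4 * y $ 5 - x $ 5 * y $ 4 + x $ 6 * y $ 7 - x $ 7 * y $ 6"
  "cross7 x y $ 2 = x $ 3 * y $ 1 - x $ 1 * y $ 3 + x $ 4 * y $ 6 - x $ 6 * y $ 4 - x $ 5 * y $ 7 + x $ 7 * y $ 5"
  "cross7 x y $ 3 = x $ 1 * y $ 2 - x $ 2 * y $ 1 - x $ 4 * y $ 7 + x $ 7 * y $ 4 - x $ 5 * y $ 6 + x $ 6 * y $ 5"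
  "cross7 x y $ 4 = x $ 5 * y $ 1 - x $ 1 * y $ 5 + x $ 6 * y $ 2 - x $ 2 * y $ 6 + x $ 3 * y $ 7 - x $ 7 * y $ 3"
  "cross7 x y $ 5 = x $ 1 * y $ 4 - x $ 4 * y $ 1 + x $ 2 * y $ 7 - x $ 7 * y $ 2 + x $ 3 * y $ 6 - x $ 6 * y $ 3"
  "cross7 x y $ 6 = x $ 7 * y $ 1 - x $ 1 * y $ 7 + x $ 2 * y $ 4 - x $ 4 * y $ 2 - x $ 3 * y $ 5 + x $ 5 * y $ 3"
  "cross7 x y $ 7 = x $ 1 * y $ 6 - x $ 6 * y $ 1 - x $ 2 * y $ 5 + x $ 5 * y $ 2 - x $ 3 * y $ 4 + x $ 4 * y $ 3"
  by (simp_all add: cross7_def phi0_def dx3_expand axis_def)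

lemma cross7_cross7_same: "cross7 u (cross7 u x) = (u \<bullet> x) *\<^sub>R u - (u \<bullet> u) *\<^sub>R x"
  by (simp add: vec_eq_iff forall_7 cross7_components inner_vec_def sum_7) (simp add: algebra_simps)

text \<open>Polarisation in \<open>u\<close>.\<close>

lemma cross7_cross7:
  "cross7 u (cross7 y x) + cross7 y (cross7 u x)
    = (u \<bullet> x) *\<^sub>R y + (y \<bullet> x) *\<^sub>R u - (2 * (u \<bullet> y)) *\<^sub>R x"
  using cross7_cross7_same[of "u + y" x] cross7_cross7_same[of u x] cross7_cross7_same[of y x]
  by (simp add: linear_add[OF cross7_linear(1)] linear_add[OF cross7_linear(2)]
      inner_add_left inner_add_right algebra_simps inner_commute scaleR_2)

lemma inner_cross7_cross7: "cross7 a b \<bullet> cross7 a d = (a \<bullet> a) * (b \<bullet> d) - (a \<bullet> b) * (a \<bullet> d)"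
proof -
  have "cross7 a b \<bullet> cross7 a d = - (cross7 a (cross7 a d) \<bullet> b)"
    by (simp add: inner_cross7 phi0_swap(2)[of a b])
  then show ?thesis by (simp add: cross7_cross7_same inner_diff_left inner_commute algebra_simps)
qed

text \<open>
  Up to sign the Hodge dual of \<open>phi0\<close>.  Expressed through the cross product and the inner product, it is visibly
  invariant under the orthogonal elements of \<open>G2\<close>.
\<close>

definition psi0 :: "(real^7) form" where
  "psi0 vs = (if length vs = 4 then
     cross7 (vs ! 0) (vs ! 1) \<bullet> cross7 (vs ! 2) (vs ! 3)
       - (vs ! 0 \<bullet> vs ! 2) * (vs ! 1 \<bullet> vs ! 3) + (vs ! 0 \<bullet> vs ! 3) * (vs ! 1 \<bullet> vs ! 2) else 0)"

lemma psi0_expand: "psi0 [a, b, c, d] = cross7 a b \<bullet> cross7 c d - (a \<bullet> c) * (b \<bullet> d) + (a \<bullet> d) * (b \<bullet> c)"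
  by (simp add: psi0_def)

lemma psi0_repeated:
  "psi0 [a, a, c, d] = 0" "psi0 [a, b, a, d] = 0" "psi0 [a, b, c, a] = 0"
  "psi0 [a, b, b, d] = 0" "psi0 [a, b, c, b] = 0" "psi0 [a, b, c, c] = 0"
proof -
  have aa: "cross7 x x = 0" for x
    by (simp add: cross7_def vec_eq_iff alt_forms_not_distinct[OF phi0_alt_forms])
  show "psi0 [a, a, c, d] = 0" "psi0 [a, b, c, c] = 0" by (simp_all add: psi0_expand aa)
  show "psi0 [a, b, a, d] = 0" by (simp add: psi0_expand inner_cross7_cross7 inner_commute)
  show "psi0 [a, b, c, a] = 0"
    using inner_cross7_cross7[of a b c] by (simp add: psi0_expand cross7_swap[of c a] inner_commute)
  show "psi0 [a, b, b, d] = 0"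
    using inner_cross7_cross7[of b a d] by (simp add: psi0_expand cross7_swap[of a b] inner_commute)
  show "psi0 [a, b, c, b] = 0"
    using inner_cross7_cross7[of b a c]
    by (simp add: psi0_expand cross7_swap[of a b] cross7_swap[of c b] inner_commute)
qed

lemma list_length_4: "length vs = 4 \<Longrightarrow> \<exists>a b c d. vs = [a, b, c, d]"
  by (auto simp: numeral_eq_Suc length_Suc_conv)

lemma psi0_alt_forms: "psi0 \<in> alt_forms 4"
  unfolding alt_forms_def
proof (intro CollectI conjI allI impI)
  fix us ws :: "(real^7) list" assume "length us + 1 + length ws = 4"
  then have "(length us = 0 \<and> length ws = 3) \<or> (length us = 1 \<and> length ws = 2)
      \<or> (length us = 2 \<and> length ws = 1) \<or> (length us = 3 \<and> length ws = 0)" by linarith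
  then consider b c d where "us = []" "ws = [b, c, d]" | a c d where "us = [a]" "ws = [c, d]"
    | a b d where "us = [a, b]" "ws = [d]" | a b c where "us = [a, b, c]" "ws = []"
    by (elim disjE conjE) (auto simp: numeral_eq_Suc length_Suc_conv)
  then show "linear (\<lambda>v. psi0 (us @ v # ws))"
    by cases (simp_all add: psi0_expand linear_iff linear_add[OF cross7_linear(1)] linear_add[OF cross7_linear(2)]
        linear_cmul[OF cross7_linear(1)] linear_cmul[OF cross7_linear(2)] inner_add_left inner_add_right algebra_simps)
next
  fix vs :: "(real^7) list" assume d: "\<not> distinct vs"
  show "psi0 vs = 0"
  proof (cases "length vs = 4")
    case True
    then obtain a b c d where "vs = [a, b, c, d]" using list_length_4 by blast
    then show ?thesis using d psi0_repeated by auto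
  qed (simp add: psi0_def)
qed (simp add: psi0_def)

subsection \<open>Invariant 4-forms\<close>

text \<open>
  The group G2 contains the diagonal sign matrices that are even on each of the seven index
  triples of \<open>phi0\<close>, and a permutation matrix that moves these triples cyclically.
\<close>

definition sign_map :: "7 set \<Rightarrow> real^7 \<Rightarrow> real^7" where
  "sign_map L x = (\<chi> i. (if i \<in> L then -1 else 1) * x $ i)"

definition cycle_index :: "7 \<Rightarrow> 7" where
  "cycle_index i = (if i = 1 then 2 else if i = 2 then 4 else if i = 3 then 6 else if i = 4 then 3
     else if i = 5 then 1 else if i = 6 then 7 else 5)"

definition cycle_map :: "real^7 \<Rightarrow> real^7" where
  "cycle_map x = (\<chi> i. x $ (if i = 1 then 5 else if i = 2 then 1 else if i = 3 then 4 else if i = 4 then 2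
     else if i = 5 then 7 else if i = 6 then 3 else 6))"

lemma sign_map_axis: "sign_map L (axis i 1) = (if i \<in> L then -1 else 1) *\<^sub>R axis i 1"
  by (simp add: sign_map_def vec_eq_iff axis_def)

lemma cycle_map_axis: "cycle_map (axis i 1) = axis (cycle_index i) 1"
  using exhaust_7[of i] by (auto simp: cycle_map_def cycle_index_def vec_eq_iff forall_7 axis_def)

lemma phi0_length: "length vs \<noteq> 3 \<Longrightarrow> phi0 vs = 0"
  by (rule alt_forms_length[OF phi0_alt_forms])

lemma pull_phi0_eqI:
  assumes "\<And>a b c. phi0 [g a, g b, g c] = phi0 [a, b, c]"
  shows "pull g phi0 = phi0"
proof
  fix vs :: "(real^7) list"
  show "pull g phi0 vs = phi0 vs"
  proof (cases "length vs = 3")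
    case True
    then obtain a b c where "vs = [a, b, c]" by (auto simp: numeral_eq_Suc length_Suc_conv)
    then show ?thesis using assms by (simp add: pull_def)
  qed (simp add: pull_def phi0_length)
qed

lemma sign_map_G2:
  assumes "L = {4, 5, 6, 7} \<or> L = {2, 3, 6, 7} \<or> L = {1, 3, 5, 7}"
  shows "sign_map L \<in> G2" "sign_map L x \<bullet> sign_map L y = x \<bullet> y"
proof -
  have inv: "sign_map L (sign_map L x) = x" for x by (simp add: sign_map_def vec_eq_iff)
  have "linear (sign_map L)" by (simp add: linear_iff sign_map_def vec_eq_iff algebra_simps)
  moreover have "bij (sign_map L)" by (rule o_bij[of "sign_map L"]) (simp_all add: fun_eq_iff inv)
  moreover have "phi0 [sign_map L a, sign_map L b, sign_map L c] = phi0 [a, b, c]" for a b c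
    using assms by (elim disjE) (simp_all add: phi0_def dx3_expand sign_map_def algebra_simps)
  ultimately show "sign_map L \<in> G2" by (simp add: G2_def stabilizer_def GL_def pull_phi0_eqI)
  show "sign_map L x \<bullet> sign_map L y = x \<bullet> y"
    by (auto simp: inner_vec_def sign_map_def intro!: sum.cong)
qed

lemma cycle_map_G2: "cycle_map \<in> G2" "cycle_map x \<bullet> cycle_map y = x \<bullet> y"
proof -
  have lin: "linear cycle_map" by (simp add: linear_iff cycle_map_def vec_eq_iff)
  have "inj cycle_map"
  proof (rule injI)
    fix x y assume "cycle_map x = cycle_map y"
    then show "x = y" by (simp add: cycle_map_def vec_eq_iff forall_7)
  qed
  then have "bij cycle_map" using linear_injective_imp_surjective[OF lin] by (simp add: bij_def)
  moreover have "phi0 [cycle_map a, cycle_map b, cycle_map c] = phi0 [a, b, c]" for a b c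
    by (simp add: phi0_def dx3_expand cycle_map_def algebra_simps)
  ultimately show "cycle_map \<in> G2" using lin by (simp add: G2_def stabilizer_def GL_def pull_phi0_eqI)
  show "cycle_map x \<bullet> cycle_map y = x \<bullet> y"
    by (simp add: inner_vec_def sum_7 cycle_map_def)
qed

lemma psi0_invariant:
  assumes g: "g \<in> G2" and orth: "\<And>x y. g x \<bullet> g y = x \<bullet> y"
  shows "psi0 (map g vs) = psi0 vs"
proof (cases "length vs = 4")
  case True
  have surj: "surj g" using g by (simp add: G2_def stabilizer_def GL_def bij_def)
  have "phi0 [g x, g y, g z] = phi0 [x, y, z]" for x y z
  proof -
    have "pull g phi0 [x, y, z] = phi0 [x, y, z]" using g by (simp add: G2_def stabilizer_def)
    then show ?thesis by (simp add: pull_def)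
  qed
  then have "cross7 (g x) (g y) \<bullet> g z = g (cross7 x y) \<bullet> g z" for x y z
    by (simp add: orth inner_cross7)
  then have "cross7 (g x) (g y) = g (cross7 x y)" for x y
    by (intro cross7_eqI) (metis surj surjD)
  moreover obtain a b c d where "vs = [a, b, c, d]" using list_length_4[OF True] by blast
  ultimately show ?thesis by (simp add: psi0_expand orth)
qed (simp add: psi0_def)

text \<open>
  The sign matrices kill all components except those on the complements of the seven
  index triples, and the permutation matrix relates these seven components to each other.  So the invariant
  forms are determined by one component.
\<close>

lemma invariant_4form_is_multiple_of_psi0:
  assumes \<psi>: "\<psi> \<in> alt_forms 4" and inv: "\<And>g. g \<in> G2 \<Longrightarrow> pull g \<psi> = \<psi>"
  obtains c where "\<psi> = (\<lambda>vs. c * psi0 vs)"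
proof -
  define c where "c = \<psi> [axis 4 1, axis 5 1, axis 6 1, axis 7 1]"
  define \<omega> where "\<omega> vs = \<psi> vs - c * psi0 vs" for vs
  have \<omega>: "\<omega> \<in> alt_forms 4"
    unfolding \<omega>_def by (intro alt_forms_diff alt_forms_scale \<psi> psi0_alt_forms)
  have \<omega>_inv: "\<omega> (map g vs) = \<omega> vs" if "g \<in> G2" "\<And>x y. g x \<bullet> g y = x \<bullet> y" for g vs
    using inv[OF that(1)] psi0_invariant[OF that] by (simp add: \<omega>_def pull_def fun_eq_iff)
  define e :: "nat \<Rightarrow> real^7" where "e n = axis (of_nat n) 1" for n
  have sign_kill: "\<omega> (map e ns) = 0"
    if L: "L = {4, 5, 6, 7} \<or> L = {2, 3, 6, 7} \<or> L = {1, 3, 5, 7}"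
      and odd: "(\<Prod>n\<leftarrow>ns. if of_nat n \<in> L then -1 else 1 :: real) = -1" for L :: "7 set" and ns
  proof -
    have "\<omega> (map e ns) = \<omega> (map (sign_map L) (map e ns))"
      by (rule \<omega>_inv[OF sign_map_G2[OF L], symmetric])
    also have "\<dots> = \<omega> ([] @ map (\<lambda>n. (if of_nat n \<in> L then -1 else 1) *\<^sub>R e n) ns)"
      by (simp add: o_def e_def sign_map_axis)
    also have "\<dots> = - \<omega> (map e ns)"
      unfolding alt_forms_scale_slots[OF \<omega>] odd by simp
    finally show ?thesis by simp
  qed
  have cyc: "\<omega> (map (\<lambda>i. axis i 1) js) = 0 \<Longrightarrow> \<omega> (map (\<lambda>i. axis (cycle_index i) 1) js) = 0" for js
    using \<omega>_inv[OF cycle_map_G2, of "map (\<lambda>i. axis i 1) js"] by (simp add: o_def cycle_map_axis)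
  have sorted_zero: "\<omega> (map e (sort ns)) = 0 \<longleftrightarrow> \<omega> (map e ns) = 0" for ns
    using alt_forms_zero_sort[OF \<omega>, of "[]" e ns] by simp
  \<comment> \<open>Starting with the component that defines \<open>c\<close>, each quadruple is the image of the preceding one under
    \<open>cycle_index\<close>, up to order.\<close>
  have q1: "\<omega> (map e [4, 5, 6, 7]) = 0"
    by (simp add: \<omega>_def c_def e_def psi0_expand inner_vec_def sum_7 cross7_components axis_def)
  have q2: "\<omega> (map e [1, 3, 5, 7]) = 0"
    using cyc[of "[4, 5, 6, 7]"] q1 sorted_zero[of "[3, 1, 7, 5]"] by (simp add: e_def cycle_index_def)
  have q3: "\<omega> (map e [1, 2, 5, 6]) = 0"
    using cyc[of "[1, 3, 5, 7]"] q2 sorted_zero[of "[2, 6, 1, 5]"] by (simp add: e_def cycle_index_def)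
  have q4: "\<omega> (map e [1, 2, 4, 7]) = 0"
    using cyc[of "[1, 2, 5, 6]"] q3 sorted_zero[of "[2, 4, 1, 7]"] by (simp add: e_def cycle_index_def)
  have q5: "\<omega> (map e [2, 3, 4, 5]) = 0"
    using cyc[of "[1, 2, 4, 7]"] q4 sorted_zero[of "[2, 4, 3, 5]"] by (simp add: e_def cycle_index_def)
  have q6: "\<omega> (map e [1, 3, 4, 6]) = 0"
    using cyc[of "[2, 3, 4, 5]"] q5 sorted_zero[of "[4, 6, 3, 1]"] by (simp add: e_def cycle_index_def)
  have q7: "\<omega> (map e [2, 3, 6, 7]) = 0"
    using cyc[of "[1, 3, 4, 6]"] q6 sorted_zero[of "[2, 6, 3, 7]"] by (simp add: e_def cycle_index_def)
  have quad: "\<omega> (map e [a, b, c, d]) = 0" if "1 \<le> a" "a < b" "b < c" "c < d" "d \<le> 7" for a b c d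
  proof -
    have "a = 1 \<or> a = 2 \<or> a = 3 \<or> a = 4" "b = 2 \<or> b = 3 \<or> b = 4 \<or> b = 5"
      "c = 3 \<or> c = 4 \<or> c = 5 \<or> c = 6" "d = 4 \<or> d = 5 \<or> d = 6 \<or> d = 7"
      using that by linarith+
    then have "[a, b, c, d] \<in> {[4, 5, 6, 7], [1, 3, 5, 7], [1, 2, 5, 6], [1, 2, 4, 7], [2, 3, 4, 5],
        [1, 3, 4, 6], [2, 3, 6, 7]}
      \<or> (\<Prod>n\<leftarrow>[a, b, c, d]. if of_nat n \<in> {4, 5, 6, 7::7} then -1 else 1 :: real) = -1
      \<or> (\<Prod>n\<leftarrow>[a, b, c, d]. if of_nat n \<in> {2, 3, 6, 7::7} then -1 else 1 :: real) = -1
      \<or> (\<Prod>n\<leftarrow>[a, b, c, d]. if of_nat n \<in> {1, 3, 5, 7::7} then -1 else 1 :: real) = -1"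
      using that(2-4) by (elim disjE) simp_all
    then show ?thesis using sign_kill q1 q2 q3 q4 q5 q6 q7 by blast
  qed
  have "\<omega> vs = 0" for vs
  proof (rule alt_forms_zero_on_axes[OF \<omega>])
    fix js :: "7 list" assume len: "length js = 4"
    have "\<exists>n. 1 \<le> n \<and> n \<le> 7 \<and> i = of_nat n" for i :: 7
    proof -
      have "\<exists>n\<in>{1, 2, 3, 4, 5, 6, 7::nat}. i = of_nat n" using exhaust_7[of i] by auto
      then obtain n :: nat where n: "n \<in> {1, 2, 3, 4, 5, 6, 7}" "i = of_nat n" by blast
      have "1 \<le> n \<and> n \<le> 7" using n(1) by auto
      then show ?thesis using n(2) by blast
    qed
    then obtain n where n: "\<And>i::7. 1 \<le> n i \<and> n i \<le> (7::nat) \<and> i = of_nat (n i)" by metis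
    let ?ns = "map n js"
    have "map (\<lambda>i. axis i 1) js = map e ?ns" using n by (simp add: e_def o_def)
    moreover have "\<omega> (map e (sort ?ns)) = 0"
    proof (cases "distinct ?ns")
      case True
      obtain a b c d where s: "sort ?ns = [a, b, c, d]" using list_length_4[of "sort ?ns"] len by auto
      have "sorted [a, b, c, d]" "distinct [a, b, c, d]" "set [a, b, c, d] = set ?ns"
        unfolding s[symmetric] using True by auto
      then have "a < b" "b < c" "c < d" and "a \<in> n ` set js" "d \<in> n ` set js"
        by (auto simp: set_eq_iff)
      moreover from this have "1 \<le> a" "d \<le> 7" using n by auto
      ultimately show ?thesis unfolding s by (intro quad)
    next
      case False
      then have "\<not> distinct (map e (sort ?ns))"
        unfolding distinct_map distinct_sort by blast
      then show ?thesis by (rule alt_forms_not_distinct[OF \<omega>])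
    qed
    ultimately show "\<omega> (map (\<lambda>i. axis i 1) js) = 0" using sorted_zero by metis
  qed
  then show ?thesis by (intro that[of c]) (simp add: \<omega>_def fun_eq_iff)
qed

text \<open>
  The factor is not zero because the stabiliser of the zero form contains homotheties.
\<close>

lemma stable4_normal_form:
  fixes \<psi> :: "'v::euclidean_space form"
  assumes "stable4 \<psi>"
  obtains f :: "'v \<Rightarrow> real^7" and c where "linear f" "bij f" "c \<noteq> 0" "\<psi> = pull f (\<lambda>vs. c * psi0 vs)"
proof -
  obtain f :: "'v \<Rightarrow> real^7" where f: "linear f" "bij f"
    and stab: "stabilizer \<psi> = (\<lambda>g. inv f \<circ> g \<circ> f) ` pmG2" and \<psi>: "\<psi> \<in> alt_forms 4"
    using assms by (auto simp: stable4_def)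
  have ff: "f (inv f y) = y" "inv f (f x) = x" for x y
    using f(2) by (simp_all add: bij_is_surj surj_f_inv_f bij_is_inj)
  have invf: "linear (inv f)" by (rule linear_inv_bij[OF f])
  have "pull g (pull (inv f) \<psi>) = pull (inv f) \<psi>" if "g \<in> G2" for g
  proof -
    have "inv f \<circ> g \<circ> f \<in> stabilizer \<psi>" using that stab by (auto simp: pmG2_def)
    then have "\<psi> (map (inv f \<circ> g \<circ> f) vs) = \<psi> vs" for vs by (simp add: stabilizer_def pull_def fun_eq_iff)
    from this[of "map (inv f) _"] show ?thesis by (simp add: pull_def fun_eq_iff o_def ff)
  qed
  then obtain c where c: "pull (inv f) \<psi> = (\<lambda>vs. c * psi0 vs)"
    using invariant_4form_is_multiple_of_psi0[OF pull_alt_forms[OF invf \<psi>]] by blast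
  have "\<psi> vs = pull (inv f) \<psi> (map f vs)" for vs by (simp add: pull_def o_def ff)
  then have \<psi>_eq: "\<psi> = pull f (\<lambda>vs. c * psi0 vs)" unfolding c by (simp add: pull_def fun_eq_iff)
  have "c \<noteq> 0"
  proof
    assume "c = 0"
    then have "\<psi> vs = 0" for vs using \<psi>_eq by (simp add: pull_def)
    moreover have "(\<lambda>v::'v. 2 *\<^sub>R v) \<in> GL"
      unfolding GL_def using o_bij[of "\<lambda>v. (1/2) *\<^sub>R v" "\<lambda>v::'v. 2 *\<^sub>R v"]
      by (simp add: linear_iff algebra_simps fun_eq_iff)
    ultimately have "(\<lambda>v::'v. 2 *\<^sub>R v) \<in> stabilizer \<psi>"
      by (simp add: stabilizer_def pull_def fun_eq_iff)
    then obtain g where g: "g \<in> pmG2" "(\<lambda>v::'v. 2 *\<^sub>R v) = inv f \<circ> g \<circ> f" using stab by auto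
    have "g y = 2 *\<^sub>R y" for y
    proof -
      have "inv f (g y) = 2 *\<^sub>R inv f y" using fun_cong[OF g(2), of "inv f y"] by (simp add: ff)
      then have "g y = f (2 *\<^sub>R inv f y)" by (metis ff(1))
      then show ?thesis by (simp add: linear_cmul[OF f(1)] ff)
    qed
    then consider "(\<lambda>y. 2 *\<^sub>R y) \<in> G2" | "(\<lambda>y. (- 2) *\<^sub>R y) \<in> G2"
    proof -
      assume g2: "\<And>y. g y = 2 *\<^sub>R y"
      have "g \<in> G2 \<or> (\<exists>h\<in>G2. g = (\<lambda>v. - h v))" using g(1) by (auto simp: pmG2_def)
      then show thesis
      proof
        assume "g \<in> G2" then show thesis using that(1) g2 by (metis ext)
      next
        assume "\<exists>h\<in>G2. g = (\<lambda>v. - h v)"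
        then obtain h where h: "h \<in> G2" "g = (\<lambda>v. - h v)" by blast
        have "h = (\<lambda>y. (- 2) *\<^sub>R y)"
        proof
          fix y show "h y = (- 2) *\<^sub>R y" using g2[of y] h(2) by (metis minus_minus scaleR_minus_left)
        qed
        then show thesis using that(2) h(1) by simp
      qed
    qed
    then show False
    proof cases
      case 1
      then have "phi0 (map (\<lambda>y. 2 *\<^sub>R y) [axis 1 1, axis 2 1, axis 3 1]) = phi0 [axis 1 1, axis 2 1, axis 3 1]"
        by (simp add: G2_def stabilizer_def pull_def fun_eq_iff del: list.map)
      then show False by (simp add: phi0_def dx3_expand axis_def)
    next
      case 2
      then have "phi0 (map (\<lambda>y. (-2) *\<^sub>R y) [axis 1 1, axis 2 1, axis 3 1]) = phi0 [axis 1 1, axis 2 1, axis 3 1]"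
        by (simp add: G2_def stabilizer_def pull_def fun_eq_iff del: list.map)
      then show False by (simp add: phi0_def dx3_expand axis_def)
    qed
  qed
  then show ?thesis using that[OF f _ \<psi>_eq] by blast
qed

section \<open>Three-forms that are real parts of complex volume forms\<close>

definition cdet :: "complex^3 \<Rightarrow> complex^3 \<Rightarrow> complex^3 \<Rightarrow> complex" where
  "cdet x y z = det (vector [x, y, z])"

lemma cdet_expand: "cdet x y z = x$1 * y$2 * z$3 + x$2 * y$3 * z$1 + x$3 * y$1 * z$2
    - x$1 * y$3 * z$2 - x$2 * y$1 * z$3 - x$3 * y$2 * z$1"
  by (simp add: cdet_def det_3 vector_3)

lemma cdet_scale: "cdet (c *s x) y z = c * cdet x y z" "cdet x (c *s y) z = c * cdet x y z"
  "cdet x y (c *s z) = c * cdet x y z"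
  by (simp_all add: cdet_expand algebra_simps)

lemma cdet_matrix: "cdet (A *v x) (A *v y) (A *v z) = det A * cdet x y z"
proof -
  have "(vector [A *v x, A *v y, A *v z] :: complex^3^3) = vector [x, y, z] ** transpose A"
    by (simp add: vec_eq_iff forall_3 vector_3 matrix_matrix_mult_def matrix_vector_mult_def transpose_def sum_3 mult.commute)
  then show ?thesis by (simp add: cdet_def det_mul det_transpose mult.commute)
qed

lemma scale_eq_scaleR: "c *s x = Re c *\<^sub>R x + Im c *\<^sub>R (\<i> *s (x :: complex^3))"
  by (simp add: vec_eq_iff complex_eq_iff)

lemma linear_scale_complex: "linear (\<lambda>z. c *s (z :: complex^3))"
  by (simp add: linear_iff vec_eq_iff algebra_simps scaleR_conv_of_real)

lemma exists_cdet_nonzero: assumes "v \<noteq> 0" obtains y z where "cdet v y z \<noteq> 0"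
proof -
  have "v $ 1 \<noteq> 0 \<or> v $ 2 \<noteq> 0 \<or> v $ 3 \<noteq> 0" using assms by (simp add: vec_eq_iff forall_3)
  moreover have "cdet v (axis 2 1) (axis 3 1) = v $ 1" "cdet v (axis 3 1) (axis 1 1) = v $ 2"
    "cdet v (axis 1 1) (axis 2 1) = v $ 3"
    by (simp_all add: cdet_expand axis_def)
  ultimately show ?thesis using that by metis
qed

text \<open>
  Replacing \<open>z\<close> by \<open>\<i> z\<close> shows that the whole determinant of \<open>v\<close>, \<open>w\<close> and \<open>z\<close> vanishes for all \<open>z\<close>, so
  that \<open>v\<close> and \<open>w\<close> are dependent.
\<close>

lemma kernel_is_complex_line:
  assumes v: "v \<noteq> 0" and zero: "\<And>z. Re (cdet v w z) = 0"
  shows "\<exists>c. w = c *s v"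
proof -
  have "cdet v w z = 0" for z
  proof -
    have "Re (cdet v w (\<i> *s z)) = 0" by (rule zero)
    then have "Im (cdet v w z) = 0" by (simp add: cdet_scale)
    then show ?thesis using zero[of z] by (simp add: complex_eq_iff)
  qed
  from this[of "axis 1 1"] this[of "axis 2 1"] this[of "axis 3 1"]
  have e: "v $ 2 * w $ 3 = v $ 3 * w $ 2" "v $ 3 * w $ 1 = v $ 1 * w $ 3" "v $ 1 * w $ 2 = v $ 2 * w $ 1"
    by (simp_all add: cdet_expand axis_def algebra_simps)
  have "v $ 1 \<noteq> 0 \<or> v $ 2 \<noteq> 0 \<or> v $ 3 \<noteq> 0" using v by (simp add: vec_eq_iff forall_3)
  then show ?thesis
  proof (elim disjE)
    assume n: "v $ 1 \<noteq> 0"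
    show ?thesis by (rule exI[of _ "w $ 1 / v $ 1"]) (use n e in \<open>simp add: vec_eq_iff forall_3 field_simps\<close>)
  next
    assume n: "v $ 2 \<noteq> 0"
    show ?thesis by (rule exI[of _ "w $ 2 / v $ 2"]) (use n e in \<open>simp add: vec_eq_iff forall_3 field_simps\<close>)
  next
    assume n: "v $ 3 \<noteq> 0"
    show ?thesis by (rule exI[of _ "w $ 3 / v $ 3"]) (use n e in \<open>simp add: vec_eq_iff forall_3 field_simps\<close>)
  qed
qed

lemma cdet_dependent: "cdet v (c *s v) z = 0"
  by (simp add: cdet_expand algebra_simps)

text \<open>
  A real-linear map that multiplies every value of \<open>m\<close> by some complex number multiplies
  all of them by the same number, as one sees on sums of independent vectors.
\<close>

lemma pointwise_multiple_is_multiple: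
  fixes p m :: "complex^3 \<Rightarrow> complex^3"
  assumes p: "linear p" and m: "linear m" and mult: "\<And>v. \<exists>c. p v = c *s m v"
    and indep: "\<And>v w c. v \<noteq> 0 \<Longrightarrow> m w = c *s m v \<Longrightarrow> \<exists>d. w = d *s v"
    and nz: "\<And>v. m v = 0 \<Longrightarrow> v = 0"
  obtains c where "\<And>v. p v = c *s m v"
proof -
  obtain k where k: "\<And>v. p v = k v *s m v" using mult by metis
  have eq_indep: "k v = k w" if v: "v \<noteq> 0" and w: "\<not> (\<exists>d. w = d *s v)" for v w
  proof -
    have "k (v + w) *s (m v + m w) = k v *s m v + k w *s m w"
      using k[of "v + w"] k[of v] k[of w] by (simp add: linear_add[OF p] linear_add[OF m])
    then have eq: "(k (v + w) - k v) *s m v = (k w - k (v + w)) *s m w"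
      by (simp add: vec_eq_iff algebra_simps)
    have 1: "k w = k (v + w)"
    proof (rule ccontr)
      assume n: "k w \<noteq> k (v + w)"
      define d where "d = k w - k (v + w)"
      have d: "d \<noteq> 0" using n by (simp add: d_def)
      have "m w = (1 / d) *s (d *s m w)" using d by (simp add: vector_smult_assoc)
      also have "\<dots> = (1 / d * (k (v + w) - k v)) *s m v"
        unfolding d_def eq[symmetric] by (simp only: vector_smult_assoc)
      finally show False using indep[OF v] w by blast
    qed
    then have "(k (v + w) - k v) *s m v = 0" using eq by (simp add: vec_eq_iff)
    moreover have "m v \<noteq> 0" using nz v by blast
    ultimately have "k (v + w) = k v" by (auto simp: vec_eq_iff)
    then show ?thesis using 1 by simp
  qed
  let ?e1 = "axis 1 1 :: complex^3" and ?e2 = "axis 2 1 :: complex^3"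
  have eq: "k v = k w" if v: "v \<noteq> 0" and w: "w \<noteq> 0" for v w
  proof (cases "\<exists>d. w = d *s v")
    case False
    then show ?thesis using eq_indep[OF v] by blast
  next
    case True
    then obtain d where d: "w = d *s v" by blast
    obtain e where e: "\<not> (\<exists>c. e = c *s v)"
    proof (cases "\<exists>c. ?e1 = c *s v")
      case True
      then obtain c where c: "?e1 = c *s v" by blast
      have "c \<noteq> 0" "v $ 1 \<noteq> 0" "v $ 2 = 0"
        using c by (auto simp: vec_eq_iff forall_3 axis_def)
      have "\<not> (\<exists>c. ?e2 = c *s v)"
      proof
        assume "\<exists>c. ?e2 = c *s v"
        then obtain c' where "?e2 = c' *s v" by blast
        then have "?e2 $ 2 = c' * v $ 2" by simp
        then show False using \<open>v $ 2 = 0\<close> by (simp add: axis_def)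
      qed
      then show ?thesis by (rule that)
    next
      case False
      then show ?thesis by (rule that)
    qed
    have "\<not> (\<exists>c. e = c *s w)"
    proof
      assume "\<exists>c. e = c *s w"
      then obtain c where "e = (c * d) *s v" using d by auto
      then show False using e by blast
    qed
    then show ?thesis using eq_indep[OF v e] eq_indep[OF w] by metis
  qed
  show ?thesis
  proof (rule that[of "k ?e1"])
    fix v
    show "p v = k ?e1 *s m v"
    proof (cases "v = 0")
      case True
      then show ?thesis by (simp add: linear_0[OF p] linear_0[OF m])
    next
      case False
      have "?e1 \<noteq> 0" by (simp add: axis_eq_0_iff)
      then show ?thesis using k[of v] eq[OF False] by simp
    qed
  qed
qed

subsection \<open>The stabiliser and its centraliser\<close>

lemma complex_linear_matrix:
  fixes k :: "complex^3 \<Rightarrow> complex^3"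
  assumes k: "linear k" and i: "\<And>v. k (\<i> *s v) = \<i> *s k v"
  obtains A :: "complex^3^3" where "\<And>v. k v = A *v v"
proof -
  have sc: "k (c *s v) = c *s k v" for c v
    unfolding scale_eq_scaleR[of c v] scale_eq_scaleR[of c "k v"]
    by (simp only: linear_add[OF k] linear_cmul[OF k] i)
  let ?A = "\<chi> i j. k (axis j 1) $ i"
  have "k v = ?A *v v" for v
  proof -
    have "v = v $ 1 *s axis 1 1 + v $ 2 *s axis 2 1 + v $ 3 *s axis 3 1"
      by (simp add: vec_eq_iff forall_3 axis_def)
    then have "k v = v $ 1 *s k (axis 1 1) + v $ 2 *s k (axis 2 1) + v $ 3 *s k (axis 3 1)"
      by (metis linear_add[OF k] sc)
    then show ?thesis by (simp add: vec_eq_iff matrix_vector_mult_def sum_3 mult.commute)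
  qed
  then show ?thesis by (rule that)
qed

text \<open>
  By \<open>kernel_is_complex_line\<close> the map preserves complex lines, so it is complex linear or antilinear.
\<close>

lemma preserves_Re_cdet:
  fixes k :: "complex^3 \<Rightarrow> complex^3"
  assumes k: "linear k" "surj k" "inj k"
    and pres: "\<And>x y z. Re (cdet (k x) (k y) (k z)) = Re (cdet x y z)"
  shows "(\<exists>A. det A = 1 \<and> k = (*v) A) \<or> (\<forall>x y z. cdet (k x) (k y) (k z) = cnj (cdet x y z))"
proof -
  have k0: "k v = 0 \<Longrightarrow> v = 0" for v using k(3) linear_0[OF k(1)] by (metis injD)
  have "\<exists>c. k (\<i> *s v) = c *s k v" for v
  proof (cases "v = 0")
    case True
    then show ?thesis using linear_0[OF k(1)] by (intro exI[of _ 0]) simp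
  next
    case False
    show ?thesis
    proof (rule kernel_is_complex_line)
      show "k v \<noteq> 0" using k0 False by blast
      fix z
      obtain z' where "z = k z'" using k(2) by blast
      then show "Re (cdet (k v) (k (\<i> *s v)) z) = 0" by (simp add: pres cdet_dependent)
    qed
  qed
  moreover have "\<exists>d. w = d *s v" if "v \<noteq> 0" "k w = c *s k v" for v w c
  proof (rule kernel_is_complex_line[OF that(1)])
    fix z
    have "Re (cdet v w z) = Re (cdet (k v) (c *s k v) (k z))" using pres[of v w z] that(2) by simp
    then show "Re (cdet v w z) = 0" by (simp add: cdet_dependent)
  qed
  moreover have "linear (\<lambda>v. k (\<i> *s v))"
    using linear_compose[OF linear_scale_complex k(1)] by (simp add: o_def)
  ultimately obtain c where c: "\<And>v. k (\<i> *s v) = c *s k v"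
    using pointwise_multiple_is_multiple[OF _ k(1) _ _ k0, of "\<lambda>v. k (\<i> *s v)"] by metis
  let ?e = "axis 1 1 :: complex^3"
  have "k (\<i> *s (\<i> *s ?e)) = (c * c) *s k ?e" unfolding c by simp
  moreover have "k (\<i> *s (\<i> *s ?e)) = (-1) *s k ?e"
  proof -
    have "\<i> *s (\<i> *s ?e) = - ?e" by (simp add: vec_eq_iff)
    then show ?thesis by (simp add: linear_neg[OF k(1)] vec_eq_iff)
  qed
  moreover obtain i where "k ?e $ i \<noteq> 0"
  proof -
    have "k ?e \<noteq> 0" using k0 axis_eq_0_iff[of 1 "1::complex"] by (metis zero_neq_one)
    then show ?thesis using that by (auto simp: vec_eq_iff)
  qed
  ultimately have "c * c * k ?e $ i = - 1 * k ?e $ i" "k ?e $ i \<noteq> 0" by (metis vector_smult_component)+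
  then have "c * c = -1" using mult_right_cancel by blast
  then have "(c - \<i>) * (c + \<i>) = 0" by (simp add: algebra_simps)
  then have "c = \<i> \<or> c = - \<i>" by (simp add: eq_neg_iff_add_eq_0)
  then show ?thesis
  proof
    assume ci: "c = \<i>"
    obtain A where A: "\<And>v. k v = A *v v" using complex_linear_matrix[OF k(1)] c ci by metis
    have *: "Re (det A * cdet x y z) = Re (cdet x y z)" for x y z
      using pres[of x y z] by (simp add: A cdet_matrix)
    have e1: "cdet ?e (axis 2 1) (axis 3 1) = 1" by (simp add: cdet_expand axis_def)
    have e2: "cdet (\<i> *s ?e) (axis 2 1) (axis 3 1) = \<i>" by (simp add: cdet_scale e1)
    have "det A = 1" using *[of ?e "axis 2 1" "axis 3 1"] *[of "\<i> *s ?e" "axis 2 1" "axis 3 1"]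
      unfolding e1 e2 by (simp add: complex_eq_iff)
    then show ?thesis using A by blast
  next
    assume ci: "c = - \<i>"
    have "cdet (k x) (k y) (k z) = cnj (cdet x y z)" for x y z
    proof -
      have "Re (cdet (k (\<i> *s x)) (k y) (k z)) = Re (cdet (\<i> *s x) y z)" by (rule pres)
      then have "Im (cdet (k x) (k y) (k z)) = - Im (cdet x y z)"
        unfolding c ci by (simp only: cdet_scale) simp
      then show ?thesis using pres[of x y z] by (simp add: complex_eq_iff)
    qed
    then show ?thesis by blast
  qed
qed

text \<open>
  For \<open>l(w) = 0\<close> the transvection \<open>v \<mapsto> v + l(v) w\<close> has determinant 1.  Commuting with it at a vector \<open>x\<close> with
  \<open>l(x) = 1\<close> forces \<open>k w\<close> into the complex line of \<open>w\<close>.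
\<close>

lemma commutes_with_SL3:
  fixes k :: "complex^3 \<Rightarrow> complex^3"
  assumes k: "linear k" and sq: "\<And>v. k (k v) = - v"
    and comm: "\<And>A v. det A = 1 \<Longrightarrow> k (A *v v) = A *v k v"
  shows "(\<forall>v. k v = \<i> *s v) \<or> (\<forall>v. k v = (- \<i>) *s v)"
proof -
  have line: "\<exists>c. k w = c *s w" for w
  proof -
    define l :: "complex^3" where
      "l = (if w $ 1 = 0 \<and> w $ 2 = 0 then axis 1 1 else vector [- w $ 2, w $ 1, 0])"
    have lw: "l $ 1 * w $ 1 + l $ 2 * w $ 2 + l $ 3 * w $ 3 = 0"
      by (simp add: l_def axis_def vector_3)
    have "l $ 1 \<noteq> 0 \<or> l $ 2 \<noteq> 0" by (auto simp: l_def axis_def vector_3)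
    then obtain x :: "complex^3" where lx: "l $ 1 * x $ 1 + l $ 2 * x $ 2 + l $ 3 * x $ 3 = 1"
    proof
      assume "l $ 1 \<noteq> 0"
      then show ?thesis by (intro that[of "axis 1 (1 / l $ 1)"]) (simp add: axis_def)
    next
      assume "l $ 2 \<noteq> 0"
      then show ?thesis by (intro that[of "axis 2 (1 / l $ 2)"]) (simp add: axis_def)
    qed
    define A :: "complex^3^3" where "A = (\<chi> i j. (if i = j then 1 else 0) + w $ i * l $ j)"
    have Av: "A *v v = v + (l $ 1 * v $ 1 + l $ 2 * v $ 2 + l $ 3 * v $ 3) *s w" for v
      by (simp add: A_def vec_eq_iff forall_3 matrix_vector_mult_def sum_3 algebra_simps)
    have "det A = 1 + (l $ 1 * w $ 1 + l $ 2 * w $ 2 + l $ 3 * w $ 3)"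
      by (simp add: A_def det_3 algebra_simps)
    then have "det A = 1" using lw by simp
    from comm[OF this, of x] have "k x + k w = k x + (l $ 1 * k x $ 1 + l $ 2 * k x $ 2 + l $ 3 * k x $ 3) *s w"
      by (simp add: Av lx linear_add[OF k])
    then have "k w = (l $ 1 * k x $ 1 + l $ 2 * k x $ 2 + l $ 3 * k x $ 3) *s w" by (simp only: add_left_cancel)
    then show ?thesis by blast
  qed
  have "linear (\<lambda>v::complex^3. v)" by (simp add: linear_iff)
  then obtain c where c: "\<And>v. k v = c *s v"
    using pointwise_multiple_is_multiple[OF k, of "\<lambda>v. v"] line by metis
  have "(c * c) *s axis 1 1 = - (axis 1 1 :: complex^3)" using sq[of "axis 1 1"] unfolding c by simp
  then have "c * c = -1" by (simp add: vec_eq_iff forall_3 axis_def)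
  then have "(c - \<i>) * (c + \<i>) = 0" by (simp add: algebra_simps)
  then have "c = \<i> \<or> c = - \<i>" by (simp add: eq_neg_iff_add_eq_0)
  then show ?thesis using c by auto
qed

subsection \<open>The wedge product of the real and imaginary parts\<close>

definition re_form :: "(complex^3) form" where
  "re_form vs = (if length vs = 3 then Re (cdet (vs ! 0) (vs ! 1) (vs ! 2)) else 0)"

definition im_form :: "(complex^3) form" where
  "im_form vs = (if length vs = 3 then Im (cdet (vs ! 0) (vs ! 1) (vs ! 2)) else 0)"

lemma re_form_expand: "re_form [a, b, c] = Re (cdet a b c)"
  and im_form_expand: "im_form [a, b, c] = Im (cdet a b c)"
  by (simp_all add: re_form_def im_form_def)

lemma list_length_3: "length vs = 3 \<Longrightarrow> \<exists>a b c. vs = [a, b, c]"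
  by (auto simp: numeral_eq_Suc length_Suc_conv)

lemma re_im_alt_forms: "re_form \<in> alt_forms 3" "im_form \<in> alt_forms 3"
proof -
  have slots: "(us = [] \<and> (\<exists>b c. ws = [b, c])) \<or> (\<exists>a c. us = [a] \<and> ws = [c]) \<or> (\<exists>a b. us = [a, b] \<and> ws = [])"
    if "length us + 1 + length ws = 3" for us ws :: "(complex^3) list"
  proof -
    have "(length us = 0 \<and> length ws = 2) \<or> (length us = 1 \<and> length ws = 1)
      \<or> (length us = 2 \<and> length ws = 0)" using that by linarith
    then show ?thesis by (elim disjE conjE) (auto simp: numeral_eq_Suc length_Suc_conv)
  qed
  have lin: "linear (\<lambda>v. Re (cdet v b c))" "linear (\<lambda>v. Re (cdet a v c))" "linear (\<lambda>v. Re (cdet a b v))"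
    "linear (\<lambda>v. Im (cdet v b c))" "linear (\<lambda>v. Im (cdet a v c))" "linear (\<lambda>v. Im (cdet a b v))" for a b c
    by (simp_all add: linear_iff cdet_expand algebra_simps)
  have rep: "cdet a a c = 0" "cdet a b a = 0" "cdet a b b = 0" for a b c
    by (simp_all add: cdet_expand algebra_simps)
  show "re_form \<in> alt_forms 3"
    unfolding alt_forms_def
  proof (intro CollectI conjI allI impI)
    fix us ws :: "(complex^3) list" assume "length us + 1 + length ws = 3"
    from slots[OF this] show "linear (\<lambda>v. re_form (us @ v # ws))"
      by (auto simp: re_form_expand lin)
  next
    fix vs :: "(complex^3) list" assume "\<not> distinct vs"
    then show "re_form vs = 0"
      using list_length_3[of vs] by (cases "length vs = 3") (auto simp: re_form_expand rep, simp add: re_form_def)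
  qed (simp add: re_form_def)
  show "im_form \<in> alt_forms 3"
    unfolding alt_forms_def
  proof (intro CollectI conjI allI impI)
    fix us ws :: "(complex^3) list" assume "length us + 1 + length ws = 3"
    from slots[OF this] show "linear (\<lambda>v. im_form (us @ v # ws))"
      by (auto simp: im_form_expand lin)
  next
    fix vs :: "(complex^3) list" assume "\<not> distinct vs"
    then show "im_form vs = 0"
      using list_length_3[of vs] by (cases "length vs = 3") (auto simp: im_form_expand rep, simp add: im_form_def)
  qed (simp add: im_form_def)
qed

text \<open>
  The value of \<open>re_form \<and> im_form\<close> on the real basis \<open>e\<^sub>1, e\<^sub>2, e\<^sub>3, \<i> e\<^sub>1, \<i> e\<^sub>2, \<i> e\<^sub>3\<close> is a sum
  over 720 permutations of products of two integers, which is evaluated by recursion.  The basis vectors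
  are numbered 0 to 5, and \<open>eps_part\<close> tabulates the real or imaginary part of the determinant
  of three of them, according to the number of factors \<open>\<i>\<close>.
\<close>

definition real_basis :: "nat \<Rightarrow> complex^3" where
  "real_basis n = (if n < 3 then 1 else \<i>) *s axis (if n mod 3 = 0 then 1 else if n mod 3 = 1 then 2 else 3) 1"

definition levi_civita :: "nat \<Rightarrow> nat \<Rightarrow> nat \<Rightarrow> int" where
  "levi_civita i j k = (if [i, j, k] \<in> set [[0, 1, 2], [1, 2, 0], [2, 0, 1]] then 1
     else if [i, j, k] \<in> set [[0, 2, 1], [1, 0, 2], [2, 1, 0]] then -1 else 0)"

definition i_count :: "nat \<Rightarrow> nat" where "i_count n = (if n < 3 then 0 else 1)"

definition eps_part :: "int list \<Rightarrow> nat list \<Rightarrow> int" where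
  "eps_part t js = levi_civita (js ! 0 mod 3) (js ! 1 mod 3) (js ! 2 mod 3)
     * t ! (i_count (js ! 0) + i_count (js ! 1) + i_count (js ! 2))"

fun alternating_eval :: "nat \<Rightarrow> (nat list \<Rightarrow> int) \<Rightarrow> nat list \<Rightarrow> nat list \<Rightarrow> int" where
  "alternating_eval 0 F vs acc = F acc"
| "alternating_eval (Suc n) F vs acc = alternating_eval n F vs (vs ! n # acc)
     - (\<Sum>j\<leftarrow>[0..<n]. alternating_eval n F (vs[j := vs ! n]) (vs ! j # acc))"

lemma alternating_eval:
  "n \<le> length js \<Longrightarrow>
    alternating_sum n (\<lambda>us. real_of_int (F (us @ acc))) js = real_of_int (alternating_eval n F js acc)"
proof (induction n arbitrary: js acc)
  case 0
  then show ?case by (simp add: alternating_sum_0)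
next
  case (Suc n)
  then have n: "n < length js" by simp
  have "alternating_sum n (\<lambda>us. real_of_int (F (us @ x # acc))) ys = real_of_int (alternating_eval n F ys (x # acc))"
    if "length ys = length js" for ys x
    using Suc.IH[of ys "x # acc"] Suc.prems that by simp
  then show ?case
    unfolding alternating_sum_Suc[OF n]
    by (simp add: sum_list_distinct_conv_sum_set atLeast0LessThan)
qed

lemma alternating_sum_map:
  assumes "n \<le> length js" shows "alternating_sum n F (map b js) = alternating_sum n (\<lambda>us. F (map b us)) js"
proof -
  have "map (\<lambda>i. map b js ! \<sigma> i) [0..<n] = map b (map (\<lambda>i. js ! \<sigma> i) [0..<n])" if s: "\<sigma> permutes {..<n}" for \<sigma>
  proof -
    have "\<sigma> i < length js" if "i < n" for i using permutes_in_image[OF s, of i] that assms by simp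
    then show ?thesis by simp
  qed
  then show ?thesis unfolding alternating_sum_def by (intro sum.cong refl) (simp only: mem_Collect_eq)
qed

lemma cdet_real_basis:
  assumes "i < 6" "j < 6" "k < 6"
  shows "Re (cdet (real_basis i) (real_basis j) (real_basis k)) = real_of_int (eps_part [1, 0, -1, 0] [i, j, k])"
    "Im (cdet (real_basis i) (real_basis j) (real_basis k)) = real_of_int (eps_part [0, 1, 0, -1] [i, j, k])"
proof -
  define u where "u n = (if n mod 3 = 0 then 1 else if n mod 3 = 1 then 2 else 3 :: 3)" for n :: nat
  define p where "p n = (if n < 3 then 1 else \<i>)" for n :: nat
  have b: "real_basis n = p n *s axis (u n) 1" for n by (simp add: real_basis_def u_def p_def)
  have m: "n mod 3 = 0 \<or> n mod 3 = 1 \<or> n mod 3 = 2" for n :: nat by linarith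
  have axes: "cdet (axis (u i) 1) (axis (u j) 1) (axis (u k) 1) = of_int (levi_civita (i mod 3) (j mod 3) (k mod 3))"
    using m[of i] m[of j] m[of k]
    by (elim disjE) (simp_all add: u_def levi_civita_def cdet_expand axis_def)
  have e: "cdet (real_basis i) (real_basis j) (real_basis k)
      = p i * p j * p k * of_int (levi_civita (i mod 3) (j mod 3) (k mod 3))"
    unfolding b cdet_scale axes by simp
  obtain L where L: "levi_civita (i mod 3) (j mod 3) (k mod 3) = L" by blast
  have eps: "eps_part t [i, j, k] = L * t ! (i_count i + i_count j + i_count k)" for t
    by (simp add: eps_part_def L)
  show "Re (cdet (real_basis i) (real_basis j) (real_basis k)) = real_of_int (eps_part [1, 0, -1, 0] [i, j, k])"
    unfolding e eps L p_def i_count_def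
    by (cases "i < 3"; cases "j < 3"; cases "k < 3") simp_all
  show "Im (cdet (real_basis i) (real_basis j) (real_basis k)) = real_of_int (eps_part [0, 1, 0, -1] [i, j, k])"
    unfolding e eps L p_def i_count_def
    by (cases "i < 3"; cases "j < 3"; cases "k < 3") simp_all
qed

lemma alternating_eval_value:
  "alternating_eval 6 (\<lambda>us. eps_part [1, 0, -1, 0] (take 3 us) * eps_part [0, 1, 0, -1] (drop 3 us)) [0, 1, 2, 3, 4, 5] [] = -144"
  by code_simp

lemma wedge_re_im_nonzero: "wedge 3 3 re_form im_form (map real_basis [0, 1, 2, 3, 4, 5]) \<noteq> 0"
proof -
  let ?js = "[0, 1, 2, 3, 4, 5] :: nat list"
  let ?F = "\<lambda>us. eps_part [1, 0, -1, 0] (take 3 us) * eps_part [0, 1, 0, -1] (drop 3 us)"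
  have F: "re_form (map real_basis (take 3 us)) * im_form (map real_basis (drop 3 us)) = real_of_int (?F (us @ []))"
    if len: "length us = 6" and sub: "set us \<subseteq> {..<6}" for us :: "nat list"
  proof -
    obtain i j k l m n where us: "us = [i, j, k, l, m, n]"
    proof -
      have "\<exists>i j k l m n. us = [i, j, k, l, m, n]"
        using len by (auto simp: numeral_eq_Suc length_Suc_conv)
      then show ?thesis using that by blast
    qed
    have "i < 6" "j < 6" "k < 6" "l < 6" "m < 6" "n < 6" using sub us by auto
    then show ?thesis by (simp add: us re_form_expand im_form_expand cdet_real_basis)
  qed
  have "alternating_sum 6 (\<lambda>us. re_form (take 3 us) * im_form (drop 3 us)) (map real_basis ?js)
      = alternating_sum 6 (\<lambda>us. re_form (map real_basis (take 3 us)) * im_form (map real_basis (drop 3 us))) ?js"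
    by (subst alternating_sum_map) (simp_all add: take_map drop_map)
  also have "\<dots> = alternating_sum 6 (\<lambda>us. real_of_int (?F (us @ []))) ?js"
    unfolding alternating_sum_def
  proof (intro sum.cong refl arg_cong[where f="\<lambda>t. _ * t"] F)
    fix \<sigma> assume "\<sigma> \<in> {\<sigma>. \<sigma> permutes {..<6::nat}}"
    then have s: "\<sigma> i < 6" if "i < 6" for i using permutes_in_image[of \<sigma> "{..<6}" i] that by simp
    have "?js ! n < 6" if "n < 6" for n
      using that by (auto simp: less_Suc_eq numeral_eq_Suc)
    then show "set (map (\<lambda>i. ?js ! \<sigma> i) [0..<6]) \<subseteq> {..<6}" using s by auto
  qed simp
  also have "\<dots> = -144" using alternating_eval[of 6 ?js ?F "[]"] alternating_eval_value by simp
  finally show ?thesis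
    using wedge_eq_alternating_sum[of "map real_basis ?js" 3 3 re_form im_form] by simp
qed

section \<open>The 3-form of a G2-pair\<close>

lemma injective_linear_bij:
  fixes g :: "'a::euclidean_space \<Rightarrow> 'b::euclidean_space"
  assumes g: "linear g" and inj: "\<And>z. g z = 0 \<Longrightarrow> z = 0" and dims: "DIM('a) = DIM('b)"
  shows "bij g"
proof -
  have i: "inj g" using linear_injective_0[OF g] inj by blast
  have "dim (range g) = dim (UNIV :: 'a set)"
    by (rule dim_image_eq[OF g]) (use i in \<open>simp add: span_UNIV\<close>)
  then have "dim (range g) = DIM('b)" using dims by simp
  then have "span (range g) = UNIV" by (simp only: dim_eq_full)
  moreover have "span (range g) = range g"
    by (rule span_eq_iff[THEN iffD2]) (rule linear_subspace_image[OF g subspace_UNIV])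
  ultimately show ?thesis using i by (simp add: bij_def)
qed

lemma alt_forms_3_linear:
  assumes "\<rho> \<in> alt_forms 3"
  shows "linear (\<lambda>x. \<rho> [x, b, c])" "linear (\<lambda>x. \<rho> [a, x, c])" "linear (\<lambda>x. \<rho> [a, b, x])"
  using alt_forms_linear[OF assms, of "[]" "[b, c]"] alt_forms_linear[OF assms, of "[a]" "[c]"]
    alt_forms_linear[OF assms, of "[a, b]" "[]"] by simp_all

lemma alt_forms_3_swap:
  assumes "\<rho> \<in> alt_forms 3"
  shows "\<rho> [b, a, c] = - \<rho> [a, b, c]" "\<rho> [a, c, b] = - \<rho> [a, b, c]" "\<rho> [c, b, a] = - \<rho> [a, b, c]"
  using alt_forms_swap[OF assms, of "[]" b "[]" a "[c]"] alt_forms_swap[OF assms, of "[a]" c "[]" b "[]"]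
    alt_forms_swap[OF assms, of "[]" c "[b]" a "[]"] by simp_all

lemma alt_forms_3_repeat:
  assumes "\<rho> \<in> alt_forms 3"
  shows "\<rho> [a, a, c] = 0" "\<rho> [a, b, a] = 0" "\<rho> [a, b, b] = 0"
  using alt_forms_not_distinct[OF assms] by simp_all

text \<open>
  A nonzero real 3-form on which a complex structure \<open>J\<close> acts in the same way in every slot is the real part
  of a complex trilinear form; a basis on which the latter takes the value 1 identifies it with the determinant.
\<close>

lemma Re_cdet_normal_form:
  fixes \<rho> :: "(real^6) form"
  assumes \<rho>: "\<rho> \<in> alt_forms 3" and J: "linear J" and JJ: "\<And>a. J (J a) = - a"
    and type: "\<And>a b c. \<rho> [J a, b, c] = \<rho> [a, J b, c]" and nz: "\<rho> [a0, b0, c0] \<noteq> 0"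
  obtains g :: "complex^3 \<Rightarrow> real^6" where "linear g" "bij g"
    "\<And>x y z. \<rho> [g x, g y, g z] = Re (cdet x y z)"
proof -
  note lin = alt_forms_3_linear[OF \<rho>] and swap = alt_forms_3_swap[OF \<rho>] and rep = alt_forms_3_repeat[OF \<rho>]
  have type3: "\<rho> [a, b, J c] = \<rho> [J a, b, c]" for a b c
    using swap(3)[of a b "J c"] swap(1)[of b c "J a"] type[of c b a] type[of a b c] swap(2)[of "J a" b c]
      type[of a c b] swap(3)[of c b "J a"] swap(1) swap(2) swap(3) by (metis minus_minus)
  define \<Omega> where "\<Omega> a b c = Complex (\<rho> [a, b, c]) (- \<rho> [J a, b, c])" for a b c
  define act where "act z v = Re z *\<^sub>R v + Im z *\<^sub>R J v" for z and v :: "real^6"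
  have add: "\<Omega> (a + a') b c = \<Omega> a b c + \<Omega> a' b c" "\<Omega> a (b + b') c = \<Omega> a b c + \<Omega> a b' c"
    "\<Omega> a b (c + c') = \<Omega> a b c + \<Omega> a b c'" for a a' b b' c c'
    by (simp_all add: \<Omega>_def complex_eq_iff linear_add[OF J] linear_add[OF lin(1)] linear_add[OF lin(2)] linear_add[OF lin(3)])
  have neg: "\<rho> [- a, b, c] = - \<rho> [a, b, c]" for a b c by (rule linear_neg[OF lin(1)])
  have act1: "\<Omega> (act z a) b c = z * \<Omega> a b c" for z a b c
    by (simp add: \<Omega>_def act_def complex_eq_iff linear_add[OF J] linear_cmul[OF J] linear_add[OF lin(1)]
        linear_cmul[OF lin(1)] linear_diff[OF lin(1)] JJ neg algebra_simps)
  have act2: "\<Omega> a (act z b) c = z * \<Omega> a b c" for z a b c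
    by (simp add: \<Omega>_def act_def complex_eq_iff linear_add[OF lin(2)] linear_cmul[OF lin(2)]
        type[symmetric] JJ neg algebra_simps)
  have act3: "\<Omega> a b (act z c) = z * \<Omega> a b c" for z a b c
    by (simp add: \<Omega>_def act_def complex_eq_iff linear_add[OF lin(3)] linear_cmul[OF lin(3)]
        type3 JJ neg algebra_simps)
  have \<Omega>swap: "\<Omega> b a c = - \<Omega> a b c" "\<Omega> a c b = - \<Omega> a b c" for a b c
  proof -
    have "\<rho> [J b, a, c] = - \<rho> [J a, b, c]" using swap(1)[of "J b" a c] type[of a b c] by simp
    then show "\<Omega> b a c = - \<Omega> a b c" by (simp add: \<Omega>_def complex_eq_iff swap(1)[of a b c])
    show "\<Omega> a c b = - \<Omega> a b c" by (simp add: \<Omega>_def complex_eq_iff swap(2)[of _ b c])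
  qed
  have \<Omega>rep: "\<Omega> a a c = 0" "\<Omega> a b a = 0" "\<Omega> a b b = 0" for a b c
  proof -
    show 1: "\<Omega> a a c = 0" for a c using \<Omega>swap(1)[of a a c] by simp
    show "\<Omega> a b b = 0" using \<Omega>swap(2)[of a b b] by simp
    show "\<Omega> a b a = 0" using \<Omega>swap(2)[of a a b] 1 by simp
  qed
  define b1 where "b1 = act (1 / \<Omega> a0 b0 c0) a0"
  have "\<Omega> a0 b0 c0 \<noteq> 0" using nz by (simp add: \<Omega>_def complex_eq_iff)
  then have one: "\<Omega> b1 b0 c0 = 1" by (simp add: b1_def act1)
  define g where "g z = act (z $ 1) b1 + act (z $ 2) b0 + act (z $ 3) c0" for z :: "complex^3"
  have gl: "linear g"
    by (simp add: linear_iff g_def act_def algebra_simps scaleR_add_left)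
  have perms: "\<Omega> b1 b0 c0 = 1" "\<Omega> b0 c0 b1 = 1" "\<Omega> c0 b1 b0 = 1" "\<Omega> b1 c0 b0 = -1" "\<Omega> b0 b1 c0 = -1" "\<Omega> c0 b0 b1 = -1"
    using one \<Omega>swap by (metis minus_minus)+
  have \<Omega>g: "\<Omega> (g x) (g y) (g z) = cdet x y z" for x y z
    by (simp add: g_def add act1 act2 act3 \<Omega>rep perms cdet_expand algebra_simps)
  have "z = 0" if "g z = 0" for z
  proof (rule ccontr)
    assume "z \<noteq> 0"
    then obtain x y where xy: "cdet z x y \<noteq> 0" by (rule exists_cdet_nonzero)
    have "\<Omega> 0 (g x) (g y) = 0" using add(1)[of 0 0 "g x" "g y"] by simp
    then show False using \<Omega>g[of z x y] xy that by simp
  qed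
  moreover have "DIM(complex^3) = DIM(real^6)" by (simp add: DIM_cart)
  ultimately have "bij g" using injective_linear_bij[OF gl] by blast
  moreover have "\<rho> [g x, g y, g z] = Re (cdet x y z)" for x y z
    unfolding \<Omega>g[symmetric] by (simp add: \<Omega>_def)
  ultimately show ?thesis using gl that by blast
qed

text \<open>
  For a stable 4-form \<open>dt \<and> \<rho> + \<tau>\<close> the 3-form \<open>\<rho>\<close> is the contraction of a multiple of \<open>psi0\<close> with
  a vector \<open>u\<close>.  On the orthogonal complement of \<open>u\<close> it is \<open>(x, y, z) \<mapsto> \<phi> (u \<times> x, y, z)\<close> up to a factor,
  and the cross product with \<open>u\<close> is the complex structure.
\<close>

lemma G2_pair_3form_normal_form:
  fixes \<rho> \<tau> :: "(real^6) form"
  assumes \<rho>: "\<rho> \<in> alt_forms 3" and \<tau>: "\<tau> \<in> alt_forms 4"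
    and stable: "stable4 (\<lambda>vs. wedge 1 3 dt (pull snd \<rho>) vs + pull snd \<tau> vs)"
  obtains g :: "complex^3 \<Rightarrow> real^6" where "linear g" "bij g"
    "\<And>x y z. \<rho> [g x, g y, g z] = Re (cdet x y z)"
proof -
  obtain f :: "real \<times> (real^6) \<Rightarrow> real^7" and c where f: "linear f" "bij f" "c \<noteq> 0"
    and eq: "(\<lambda>vs. wedge 1 3 dt (pull snd \<rho>) vs + pull snd \<tau> vs) = pull f (\<lambda>vs. c * psi0 vs)"
    using stable4_normal_form[OF stable] by blast
  define u where "u = f (1, 0)"
  define F where "F a = f (0, a)" for a
  have \<rho>_eq: "\<rho> [x, y, z] = c * psi0 [u, F x, F y, F z]" for x y z
  proof -
    have "\<tau> [0, x, y, z] = 0"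
      using linear_0[OF alt_forms_linear[OF \<tau>, of "[]" "[x, y, z]"]] by simp
    moreover have "wedge 1 3 dt (pull snd \<rho>) [(1, 0), (0, x), (0, y), (0, z)] = \<rho> [x, y, z]"
      unfolding wedge_1_3 using alt_forms_3_swap[OF \<rho>, of y x z] alt_forms_3_swap[OF \<rho>, of x y z]
        alt_forms_3_swap[OF \<rho>, of z x y]
      by (simp add: dt_def pull_def)
    ultimately show ?thesis
      using fun_cong[OF eq, of "[(1, 0), (0, x), (0, y), (0, z)]"] by (simp add: pull_def u_def F_def)
  qed
  have f0: "f p = 0 \<Longrightarrow> p = 0" for p using f(1,2) linear_0[OF f(1)] by (metis bij_is_inj injD)
  have u: "u \<noteq> 0" using f0[of "(1, 0)"] by (auto simp: u_def zero_prod_def)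
  then have uu: "u \<bullet> u > 0" by simp
  have Fl: "linear F"
  proof -
    have "linear (\<lambda>a::real^6. (0::real, a))" by (simp add: linear_iff)
    from linear_compose[OF this f(1)] show ?thesis by (simp add: F_def[abs_def] o_def)
  qed
  \<comment> \<open>\<open>E\<close> identifies \<open>\<real>\<^sup>6\<close> with the orthogonal complement of \<open>u\<close>; it differs from \<open>F\<close> by multiples of \<open>u\<close>,
    which do not change the contraction with \<open>u\<close>.\<close>
  define E where "E a = F a - ((F a \<bullet> u) / (u \<bullet> u)) *\<^sub>R u" for a
  have El: "linear E"
    by (simp add: linear_iff E_def linear_add[OF Fl] linear_cmul[OF Fl] inner_add_left add_divide_distrib algebra_simps)
  have Eu: "E a \<bullet> u = 0" for a using uu by (simp add: E_def inner_diff_left)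
  have E_onto: "\<exists>a. E a = y" if y: "y \<bullet> u = 0" for y
  proof -
    obtain t a where ta: "y = f (t, a)" using f(2) by (metis bij_pointE surj_pair)
    have "(t, a) = t *\<^sub>R (1, 0) + (0, a)" by simp
    then have yt: "y = t *\<^sub>R u + F a"
      unfolding ta u_def F_def using linear_add[OF f(1)] linear_cmul[OF f(1)] by metis
    then have "F a = y - t *\<^sub>R u" by simp
    moreover from this have "F a \<bullet> u = - t * (u \<bullet> u)" using y by (simp add: inner_diff_left)
    ultimately have "E a = y" using uu by (simp add: E_def)
    then show ?thesis by blast
  qed
  have E_inj: "a = b" if "E a = E b" for a b
  proof -
    have "E (a - b) = 0" using that by (simp add: linear_diff[OF El])
    then have "F (a - b) = ((F (a - b) \<bullet> u) / (u \<bullet> u)) *\<^sub>R u" by (simp add: E_def)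
    then have "f (0, a - b) = f (((F (a - b) \<bullet> u) / (u \<bullet> u)) *\<^sub>R (1, 0))"
      unfolding F_def u_def linear_cmul[OF f(1)] by simp
    then have "(0::real, a - b) = ((F (a - b) \<bullet> u) / (u \<bullet> u)) *\<^sub>R (1, 0)" using f(2) by (metis bij_is_inj injD)
    then show ?thesis by simp
  qed
  define N where "N = norm u"
  have N: "N > 0" "N * N = u \<bullet> u" using u by (simp_all add: N_def power2_norm_eq_inner[symmetric] power2_eq_square)
  define j where "j y = (1 / N) *\<^sub>R cross7 u y" for y
  have jl: "linear j" by (simp add: linear_iff j_def linear_add[OF cross7_linear(1)] linear_cmul[OF cross7_linear(1)] algebra_simps)
  have ju: "j y \<bullet> u = 0" for y
    by (simp add: j_def inner_cross7 alt_forms_not_distinct[OF phi0_alt_forms])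
  have jj: "j (j y) = - y" if "y \<bullet> u = 0" for y
  proof -
    have "j (j y) = (1 / (N * N)) *\<^sub>R cross7 u (cross7 u y)"
      by (simp add: j_def linear_cmul[OF cross7_linear(1)])
    then show ?thesis using that N uu by (simp add: cross7_cross7_same inner_commute)
  qed
  have jtype: "phi0 [j x, y, z] = phi0 [x, y, j z]" if "x \<bullet> u = 0" "y \<bullet> u = 0" "z \<bullet> u = 0" for x y z
  proof -
    have "(cross7 u (cross7 x y) + cross7 x (cross7 u y)) \<bullet> z = 0"
      unfolding cross7_cross7 using that by (simp add: inner_commute[of u] inner_diff_left inner_add_left)
    then have "phi0 [u, cross7 x y, z] + phi0 [x, cross7 u y, z] = 0" by (simp add: inner_add_left inner_cross7)
    moreover have "phi0 [u, cross7 x y, z] = - phi0 [x, y, cross7 u z]"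
      using phi0_swap(2)[of u z "cross7 x y"] inner_cross7[of u z "cross7 x y"] inner_cross7[of x y "cross7 u z"]
      by (simp add: inner_commute)
    ultimately have a: "phi0 [x, cross7 u y, z] = phi0 [x, y, cross7 u z]" by simp
    have "(cross7 u (cross7 y x) + cross7 y (cross7 u x)) \<bullet> z = 0"
      unfolding cross7_cross7 using that by (simp add: inner_commute[of u] inner_diff_left inner_add_left)
    then have "phi0 [u, cross7 y x, z] + phi0 [y, cross7 u x, z] = 0" by (simp add: inner_add_left inner_cross7)
    moreover have "phi0 [u, cross7 y x, z] = - phi0 [y, x, cross7 u z]"
      using phi0_swap(2)[of u z "cross7 y x"] inner_cross7[of u z "cross7 y x"] inner_cross7[of y x "cross7 u z"]
      by (simp add: inner_commute)
    ultimately have "phi0 [cross7 u x, y, z] = phi0 [x, y, cross7 u z]"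
      using phi0_swap(1)[of y "cross7 u x" z] phi0_swap(1)[of y x "cross7 u z"] by simp
    then show ?thesis by (simp add: j_def linear_cmul[OF phi0_linear(1)] linear_cmul[OF phi0_linear(3)])
  qed
  have \<rho>_phi: "\<rho> [x, y, z] = (c * N) * phi0 [j (E x), E y, E z]" for x y z
  proof -
    have remove: "psi0 (us @ (w - t *\<^sub>R u) # ws) = psi0 (us @ w # ws)"
      if "length us + 1 + length ws = 4" "u \<in> set us \<union> set ws" for us ws w t
    proof -
      note l = alt_forms_linear[OF psi0_alt_forms that(1)]
      have "psi0 (us @ u # ws) = 0"
        by (rule alt_forms_not_distinct[OF psi0_alt_forms]) (use that(2) in auto)
      then show ?thesis using linear_diff[OF l, of w "t *\<^sub>R u"] linear_cmul[OF l, of t u] by simp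
    qed
    have "psi0 [u, F x, F y, F z] = psi0 [u, E x, E y, E z]"
      unfolding E_def
      using remove[of "[u]" "[F y, F z]" "F x"] remove[of "[u, F x - ((F x \<bullet> u) / (u \<bullet> u)) *\<^sub>R u]" "[F z]" "F y"]
        remove[of "[u, F x - ((F x \<bullet> u) / (u \<bullet> u)) *\<^sub>R u, F y - ((F y \<bullet> u) / (u \<bullet> u)) *\<^sub>R u]" "[]" "F z"]
      by simp
    also have "\<dots> = cross7 u (E x) \<bullet> cross7 (E y) (E z)"
      using Eu by (simp add: psi0_expand inner_commute[of u])
    also have "\<dots> = N * (j (E x) \<bullet> cross7 (E y) (E z))" using N(1) by (simp add: j_def)
    also have "j (E x) \<bullet> cross7 (E y) (E z) = phi0 [E y, E z, j (E x)]"
      using inner_cross7[of "E y" "E z" "j (E x)"] by (metis inner_commute)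
    also have "\<dots> = phi0 [j (E x), E y, E z]"
      using phi0_swap(2)[of "E y" "j (E x)" "E z"] phi0_swap(1)[of "E y" "j (E x)" "E z"] by simp
    finally show ?thesis by (simp add: \<rho>_eq)
  qed
  define J where "J a = (SOME b. E b = j (E a))" for a
  have EJ: "E (J a) = j (E a)" for a
    unfolding J_def by (rule someI_ex) (rule E_onto[OF ju])
  have Jl: "linear J"
  proof (rule linearI)
    show "J (a + b) = J a + J b" for a b
      by (rule E_inj) (simp add: EJ linear_add[OF El] linear_add[OF jl])
    show "J (r *\<^sub>R a) = r *\<^sub>R J a" for r a
      by (rule E_inj) (simp add: EJ linear_cmul[OF El] linear_cmul[OF jl])
  qed
  have JJ: "J (J a) = - a" for a
    by (rule E_inj) (simp add: EJ jj[OF Eu] linear_neg[OF El])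
  \<comment> \<open>\<open>jtype\<close> moves \<open>j\<close> between the first and the last slot; a transposition brings it to the second one.\<close>
  have Jtype: "\<rho> [J x, y, z] = \<rho> [x, J y, z]" for x y z
  proof -
    have "phi0 [j (j (E x)), E y, E z] = phi0 [j (E x), E y, j (E z)]"
      by (rule jtype[OF ju Eu Eu])
    also have "\<dots> = - phi0 [E y, j (E x), j (E z)]" by (rule phi0_swap(1))
    also have "phi0 [E y, j (E x), j (E z)] = phi0 [j (E y), j (E x), E z]"
      by (rule jtype[symmetric, OF Eu ju Eu])
    also have "- phi0 [j (E y), j (E x), E z] = phi0 [j (E x), j (E y), E z]" by (simp add: phi0_swap(1)[of "j (E x)"])
    finally show ?thesis by (simp add: \<rho>_phi EJ)
  qed
  obtain x0 :: "real^6" where x0: "x0 \<noteq> 0" using axis_eq_0_iff[of 1 "1::real"] by (metis zero_neq_one)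
  define w where "w = j (E x0)"
  have Ex0: "E x0 \<noteq> 0" using E_inj[of x0 0] x0 linear_0[OF El] by auto
  have w: "w \<noteq> 0"
  proof
    assume "w = 0"
    then have "j w = 0" by (simp add: linear_0[OF jl])
    then show False using jj[OF Eu, of x0] Ex0 by (simp add: w_def)
  qed
  have wu: "w \<bullet> u = 0" by (simp add: w_def ju)
  \<comment> \<open>For \<open>y\<close> orthogonal to \<open>u\<close>, \<open>w\<close> and \<open>w \<times> u\<close>, the vectors \<open>w\<close>, \<open>y\<close> and \<open>w \<times> y\<close> are orthogonal to \<open>u\<close>, and \<open>\<phi>\<close> is
    not zero on them.\<close>
  have "dim {u, w, cross7 w u} < DIM(real^7)"
  proof -
    have "dim {u, w, cross7 w u} \<le> card {u, w, cross7 w u}" by (rule dim_le_card') simp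
    also have "\<dots> \<le> 3" by (simp add: card_insert_if)
    finally show ?thesis by simp
  qed
  then obtain y where y: "y \<noteq> 0" "\<And>v. v \<in> span {u, w, cross7 w u} \<Longrightarrow> orthogonal y v"
    using orthogonal_to_subspace_exists by metis
  have yo: "y \<bullet> u = 0" "y \<bullet> w = 0" "y \<bullet> cross7 w u = 0"
    using y(2) by (simp_all add: orthogonal_def span_base)
  define z where "z = cross7 w y"
  have zu: "z \<bullet> u = 0"
    using yo(3) phi0_swap(2)[of w y u] by (simp add: z_def inner_cross7 inner_commute[of y])
  obtain b0 where b0: "E b0 = y" using E_onto[OF yo(1)] by blast
  obtain c0 where c0: "E c0 = z" using E_onto[OF zu] by blast
  have "phi0 [w, y, z] = (w \<bullet> w) * (y \<bullet> y)"
    using inner_cross7[of w y z] inner_cross7_cross7[of w y y] yo(2) by (simp add: z_def inner_commute)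
  then have "phi0 [w, y, z] \<noteq> 0" using w y(1) by simp
  then have "\<rho> [x0, b0, c0] \<noteq> 0"
    using f(3) N(1) by (simp add: \<rho>_phi b0 c0 flip: w_def)
  from Re_cdet_normal_form[OF \<rho> Jl JJ Jtype this] show ?thesis using that by blast
qed

section \<open>The Hitchin dual\<close>

lemma exhaust_6: "(x::6) = 1 \<or> x = 2 \<or> x = 3 \<or> x = 4 \<or> x = 5 \<or> x = 6"
proof (induct x)
  case (of_int z)
  then have "z = 0 \<or> z = 1 \<or> z = 2 \<or> z = 3 \<or> z = 4 \<or> z = 5" by simp linarith
  then show ?case by auto
qed

lemma frame_frame6: "frame frame6"
  unfolding frame_def frame6_def
  by (intro exI[of _ "[1, 2, 3, 4, 5, 6]"]) (use exhaust_6 in auto)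

lemma frame_frame3: "frame frame3"
  unfolding frame_def frame3_def
  by (intro exI[of _ "[1, 2, 3]"]) (use exhaust_3 in auto)

lemma wedge_minus_right: "wedge k l \<alpha> (\<lambda>vs. - \<beta> vs) vs = - wedge k l \<alpha> \<beta> vs"
  by (simp add: wedge_def sum_negf)

definition vec_cnj :: "complex^3 \<Rightarrow> complex^3" where "vec_cnj z = (\<chi> i. cnj (z $ i))"

lemma vec_cnj: "linear vec_cnj" "bij vec_cnj" "cdet (vec_cnj x) (vec_cnj y) (vec_cnj z) = cnj (cdet x y z)"
proof -
  show "linear vec_cnj" by (simp add: linear_iff vec_cnj_def vec_eq_iff)
  show "bij vec_cnj" by (rule o_bij[of vec_cnj]) (simp_all add: vec_cnj_def fun_eq_iff vec_eq_iff)
qed (simp add: cdet_expand vec_cnj_def)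

text \<open>
  The last condition selects the imaginary part of the determinant, and not its negative, as the Hitchin dual.
\<close>

definition complex_coordinates :: "(real^6) form \<Rightarrow> (real^6 \<Rightarrow> complex^3) \<Rightarrow> bool" where
  "complex_coordinates \<rho> f \<longleftrightarrow> linear f \<and> bij f \<and> \<rho> = pull f re_form \<and> wedge 3 3 \<rho> (pull f im_form) frame6 > 0"

lemma complex_coordinates_exist:
  assumes \<rho>: "\<rho> \<in> alt_forms 3" and g: "linear g" "bij g"
    and eq: "\<And>x y z. \<rho> [g x, g y, g z] = Re (cdet x y z)"
  obtains f where "complex_coordinates \<rho> f"
proof -
  define f where "f = inv g"
  have ff: "g (f y) = y" "f (g x) = x" for x y
    unfolding f_def using g(2) by (simp_all add: bij_is_surj surj_f_inv_f bij_is_inj)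
  have f: "linear f" "bij f" unfolding f_def using linear_inv_bij[OF g] bij_imp_bij_inv[OF g(2)] by auto
  have \<rho>_eq: "\<rho> vs = re_form (map f vs)" for vs
  proof (cases "length vs = 3")
    case True
    then obtain a b c where "vs = [a, b, c]" using list_length_3 by blast
    then show ?thesis using eq[of "f a" "f b" "f c"] by (simp add: re_form_expand ff)
  next
    case False
    then show ?thesis using alt_forms_length[OF \<rho> False] by (simp add: re_form_def)
  qed
  then have \<rho>_pull: "\<rho> = pull f re_form" by (simp add: pull_def fun_eq_iff)
  let ?\<sigma> = "pull f im_form"
  let ?W = "wedge 3 3 \<rho> ?\<sigma>"
  have W: "?W \<in> alt_forms CARD(6)"
    using wedge_alt_forms[OF \<rho> pull_alt_forms[OF f(1) re_im_alt_forms(2)]] by simp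
  have "?W (map g (map real_basis [0, 1, 2, 3, 4, 5])) = wedge 3 3 re_form im_form (map real_basis [0, 1, 2, 3, 4, 5])"
  proof -
    have "?W = pull f (wedge 3 3 re_form im_form)" unfolding pull_wedge \<rho>_pull ..
    then show ?thesis by (simp add: pull_def ff)
  qed
  then have nz: "?W (map g (map real_basis [0, 1, 2, 3, 4, 5])) \<noteq> 0" using wedge_re_im_nonzero by simp
  define b where "b n = g (real_basis n)" for n
  define h where "h v = v $ 1 *\<^sub>R b 0 + v $ 2 *\<^sub>R b 1 + v $ 3 *\<^sub>R b 2 + v $ 4 *\<^sub>R b 3 + v $ 5 *\<^sub>R b 4 + v $ 6 *\<^sub>R b 5"
    for v :: "real^6"
  have h: "linear h" by (simp add: linear_iff h_def algebra_simps)
  have "map h frame6 = map g (map real_basis [0, 1, 2, 3, 4, 5])"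
    by (simp add: frame6_def h_def axis_def b_def)
  then have W0: "?W frame6 \<noteq> 0" using top_form_det[OF frame_frame6 W h] nz by auto
  show ?thesis
  proof (cases "?W frame6 > 0")
    case True
    then show ?thesis using that[of f] f \<rho>_pull by (simp add: complex_coordinates_def)
  next
    case False
    \<comment> \<open>Complex conjugation preserves the real part and reverses the orientation.\<close>
    have re: "pull (vec_cnj \<circ> f) re_form = pull f re_form"
      by (simp add: pull_def fun_eq_iff re_form_def vec_cnj)
    have im: "pull (vec_cnj \<circ> f) im_form = (\<lambda>vs. - pull f im_form vs)"
      by (simp add: pull_def fun_eq_iff im_form_def vec_cnj)
    have "complex_coordinates \<rho> (vec_cnj \<circ> f)"
      unfolding complex_coordinates_def re im wedge_minus_right
      using linear_compose[OF f(1) vec_cnj(1)] bij_comp[OF f(2) vec_cnj(2)] \<rho>_pull W0 False by auto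
    then show ?thesis by (rule that)
  qed
qed

locale oriented_complex_coordinates =
  fixes \<rho> :: "(real^6) form" and f :: "real^6 \<Rightarrow> complex^3"
  assumes coordinates: "complex_coordinates \<rho> f"
begin

abbreviation \<sigma> :: "(real^6) form" where "\<sigma> \<equiv> pull f im_form"

definition J :: "real^6 \<Rightarrow> real^6" where "J = inv f \<circ> (\<lambda>z. \<i> *s z) \<circ> f"

lemma f: "linear f" "bij f" and \<rho>_eq: "\<rho> = pull f re_form" and positive: "wedge 3 3 \<rho> \<sigma> frame6 > 0"
  using coordinates by (auto simp: complex_coordinates_def)

lemma f_inv: "f (inv f y) = y" "inv f (f x) = x"
  using f(2) by (simp_all add: bij_is_surj surj_f_inv_f bij_is_inj)

lemma inv_f: "linear (inv f)" by (rule linear_inv_bij[OF f])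

lemma alt: "\<rho> \<in> alt_forms 3" "\<sigma> \<in> alt_forms 3"
  using pull_alt_forms[OF f(1) re_im_alt_forms(1)] pull_alt_forms[OF f(1) re_im_alt_forms(2)] \<rho>_eq by auto

lemma coordinate_value: "\<rho> [a, b, c] = Re (cdet (f a) (f b) (f c))" "\<sigma> [a, b, c] = Im (cdet (f a) (f b) (f c))"
  by (simp_all add: \<rho>_eq pull_def re_form_expand im_form_expand)

lemma f_J: "f (J v) = \<i> *s f v" by (simp add: J_def f_inv)

lemma wedge_det: assumes "linear h" shows "wedge 3 3 \<rho> \<sigma> (map h frame6) = det (matrix h) * wedge 3 3 \<rho> \<sigma> frame6"
  using top_form_det[OF frame_frame6 _ assms] wedge_alt_forms[OF alt] by simp

text \<open>
  An antilinear element of the stabiliser changes the sign of \<open>\<sigma>\<close>, hence that of \<open>\<rho> \<and> \<sigma>\<close>, and so its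
  determinant is \<open>-1\<close>.
\<close>

lemma oriented_stabilizer_eq:
  "oriented_stabilizer \<rho> = {inv f \<circ> (\<lambda>z. A *v z) \<circ> f | A :: complex^3^3. det A = 1}"
proof (intro set_eqI iffI)
  fix h assume "h \<in> oriented_stabilizer \<rho>"
  then have h: "linear h" "bij h" "pull h \<rho> = \<rho>" "det (matrix h) > 0"
    by (auto simp: oriented_stabilizer_def stabilizer_def GL_def)
  define k where "k = f \<circ> h \<circ> inv f"
  have k: "linear k" "bij k"
    unfolding k_def using linear_compose[OF inv_f linear_compose[OF h(1) f(1)]]
      bij_comp[OF bij_imp_bij_inv[OF f(2)] bij_comp[OF h(2) f(2)]] by (simp_all add: o_assoc)
  have hk: "f (h v) = k (f v)" for v by (simp add: k_def f_inv)
  have "Re (cdet (k x) (k y) (k z)) = Re (cdet x y z)" for x y z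
    using fun_cong[OF h(3), of "[inv f x, inv f y, inv f z]"]
    by (simp add: pull_def coordinate_value hk f_inv)
  from preserves_Re_cdet[OF k(1) bij_is_surj[OF k(2)] bij_is_inj[OF k(2)] this]
  show "h \<in> {inv f \<circ> (\<lambda>z. A *v z) \<circ> f | A :: complex^3^3. det A = 1}"
  proof
    assume "\<exists>A. det A = 1 \<and> k = (*v) A"
    then obtain A where A: "det A = 1" "k = (*v) A" by blast
    have "h = inv f \<circ> (\<lambda>z. A *v z) \<circ> f"
    proof
      fix v
      have "h v = inv f (k (f v))" unfolding hk[symmetric] f_inv ..
      then show "h v = (inv f \<circ> (\<lambda>z. A *v z) \<circ> f) v" unfolding A(2) by simp
    qed
    then show ?thesis using A(1) by blast
  next
    assume a: "\<forall>x y z. cdet (k x) (k y) (k z) = cnj (cdet x y z)"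
    have "pull h \<sigma> = (\<lambda>vs. - \<sigma> vs)"
      using a by (simp add: pull_def fun_eq_iff im_form_def hk)
    then have "pull h (wedge 3 3 \<rho> \<sigma>) frame6 = - wedge 3 3 \<rho> \<sigma> frame6"
      unfolding pull_wedge h(3) by (simp add: wedge_minus_right)
    then have "det (matrix h) * wedge 3 3 \<rho> \<sigma> frame6 = - wedge 3 3 \<rho> \<sigma> frame6"
      using wedge_det[OF h(1)] by (simp add: pull_def)
    moreover have "det (matrix h) * wedge 3 3 \<rho> \<sigma> frame6 > 0" using h(4) positive by simp
    ultimately show ?thesis using positive by linarith
  qed
next
  fix h assume "h \<in> {inv f \<circ> (\<lambda>z. A *v z) \<circ> f | A :: complex^3^3. det A = 1}"
  then obtain A :: "complex^3^3" where A: "det A = 1" "h = inv f \<circ> (\<lambda>z. A *v z) \<circ> f" by blast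
  have fh: "f (h v) = A *v f v" for v by (simp add: A(2) f_inv)
  have "invertible A" using A(1) by (simp add: invertible_det_nz)
  then obtain B where B: "A ** B = mat 1" "B ** A = mat 1" unfolding invertible_def by blast
  have "bij ((*v) A)"
    by (rule o_bij[of "(*v) B"]) (simp_all add: fun_eq_iff matrix_vector_mul_assoc B)
  then have bij: "bij h"
    unfolding A(2) using bij_comp[OF f(2) bij_comp[OF _ bij_imp_bij_inv[OF f(2)]]] by (simp add: o_assoc)
  have lin: "linear h"
  proof -
    have "linear ((*v) A)"
      by (simp add: linear_iff vec_eq_iff matrix_vector_mult_def sum.distrib scaleR_sum_right algebra_simps)
    from linear_compose[OF f(1) linear_compose[OF this inv_f]] show ?thesis by (simp add: A(2) o_assoc)
  qed
  have re: "pull h \<rho> = \<rho>" and im: "pull h \<sigma> = \<sigma>"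
    by (simp_all add: \<rho>_eq pull_def fun_eq_iff re_form_def im_form_def fh cdet_matrix A(1))
  have "pull h (wedge 3 3 \<rho> \<sigma>) frame6 = wedge 3 3 \<rho> \<sigma> frame6" unfolding pull_wedge re im ..
  then have "det (matrix h) * wedge 3 3 \<rho> \<sigma> frame6 = wedge 3 3 \<rho> \<sigma> frame6"
    using wedge_det[OF lin] by (simp add: pull_def)
  then have "det (matrix h) = 1" using positive by simp
  then show "h \<in> oriented_stabilizer \<rho>"
    using lin bij re by (simp add: oriented_stabilizer_def stabilizer_def GL_def)
qed

lemma induced_J: "induced_complex_structure \<rho> J"
  unfolding induced_complex_structure_def using f oriented_stabilizer_eq J_def by blast

lemma volume_J: "complex_volume_form J \<rho> \<sigma>"
  unfolding complex_volume_form_def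
proof (intro conjI allI impI alt)
  fix vs :: "(real^6) list" and i :: nat
  assume "length vs = 3" "i < 3"
  then obtain a b c where vs: "vs = [a, b, c]" using list_length_3 by blast
  have "i = 0 \<or> i = 1 \<or> i = 2" using \<open>i < 3\<close> by linarith
  then show "Complex (\<rho> (vs[i := J (vs ! i)])) (\<sigma> (vs[i := J (vs ! i)])) = \<i> * Complex (\<rho> vs) (\<sigma> vs)"
    unfolding vs by (elim disjE) (simp_all add: coordinate_value f_J cdet_scale complex_eq_iff)
next
  have "\<rho> [inv f (axis 1 1), inv f (axis 2 1), inv f (axis 3 1)] = 1"
    by (simp add: coordinate_value f_inv cdet_expand axis_def)
  then have "Complex (\<rho> [inv f (axis 1 1), inv f (axis 2 1), inv f (axis 3 1)])
      (\<sigma> [inv f (axis 1 1), inv f (axis 2 1), inv f (axis 3 1)]) \<noteq> 0"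
    by (simp add: complex_eq_iff)
  then show "\<exists>vs. Complex (\<rho> vs) (\<sigma> vs) \<noteq> 0" by blast
qed

lemma volume_form_eq:
  assumes "complex_volume_form K \<rho> \<tau>" shows "\<tau> [a, b, c] = - \<rho> [K a, b, c]"
proof -
  have "Complex (\<rho> ([a, b, c][0 := K ([a, b, c] ! 0)])) (\<tau> ([a, b, c][0 := K ([a, b, c] ! 0)]))
      = \<i> * Complex (\<rho> [a, b, c]) (\<tau> [a, b, c])"
    using assms unfolding complex_volume_form_def by (metis length_Cons list.size(3) numeral_3_eq_3 zero_less_numeral)
  then show ?thesis by (simp add: complex_eq_iff)
qed

text \<open>
  Any other choice of the complex structure commutes with \<open>oriented_stabilizer \<rho>\<close> and thus agrees with \<open>J\<close> up to
  sign; the sign is fixed by positivity.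
\<close>

lemma volume_form_unique:
  assumes ind: "induced_complex_structure \<rho> K" and vol: "complex_volume_form K \<rho> \<tau>"
    and pos: "wedge 3 3 \<rho> \<tau> frame6 > 0"
  shows "\<tau> = \<sigma>"
proof -
  obtain f' :: "real^6 \<Rightarrow> complex^3" where f': "linear f'" "bij f'"
    and stab: "oriented_stabilizer \<rho> = {inv f' \<circ> (\<lambda>z. A *v z) \<circ> f' | A :: complex^3^3. det A = 1}"
    and K: "K = inv f' \<circ> (\<lambda>z. \<i> *s z) \<circ> f'"
    using ind unfolding induced_complex_structure_def by blast
  have ff': "f' (inv f' y) = y" "inv f' (f' x) = x" for x y
    using f'(2) by (simp_all add: bij_is_surj surj_f_inv_f bij_is_inj)
  have Kl: "linear K"
    unfolding K using linear_compose[OF f'(1) linear_compose[OF linear_scale_complex linear_inv_bij[OF f']]]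
    by (simp add: o_assoc)
  have KK: "K (K v) = - v" for v
  proof -
    have "K (K v) = inv f' (- f' v)" by (simp add: K ff' vec_eq_iff)
    also have "\<dots> = - v" by (simp add: linear_neg[OF linear_inv_bij[OF f']] ff')
    finally show ?thesis .
  qed
  define k where "k = f \<circ> K \<circ> inv f"
  have kl: "linear k"
    unfolding k_def using linear_compose[OF inv_f linear_compose[OF Kl f(1)]] by (simp add: o_assoc)
  have "k (k v) = - v" for v by (simp add: k_def f_inv KK linear_neg[OF f(1)])
  moreover have "k (A *v v) = A *v k v" if "det A = 1" for A v
  proof -
    have "inv f \<circ> (\<lambda>z. A *v z) \<circ> f \<in> oriented_stabilizer \<rho>" unfolding oriented_stabilizer_eq using that by blast
    then obtain B :: "complex^3^3" where B: "inv f \<circ> (\<lambda>z. A *v z) \<circ> f = inv f' \<circ> (\<lambda>z. B *v z) \<circ> f'"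
      unfolding stab by blast
    have B': "inv f (A *v f w) = inv f' (B *v f' w)" for w using fun_cong[OF B, of w] by simp
    have "K (inv f (A *v f w)) = inv f (A *v f (K w))" for w
    proof -
      have "\<i> *s (B *v z) = B *v (\<i> *s z)" for z
        by (simp add: vec_eq_iff matrix_vector_mult_def sum_distrib_left mult.left_commute)
      then show ?thesis unfolding B' by (simp add: K ff')
    qed
    from arg_cong[OF this[of "inv f v"], of f] show ?thesis by (simp add: k_def f_inv)
  qed
  ultimately consider "\<forall>v. k v = \<i> *s v" | "\<forall>v. k v = (- \<i>) *s v"
    using commutes_with_SL3[OF kl] by blast
  then have "(\<forall>a b c. \<tau> [a, b, c] = \<sigma> [a, b, c]) \<or> (\<forall>a b c. \<tau> [a, b, c] = - \<sigma> [a, b, c])"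
  proof cases
    case 1
    have "f (K v) = \<i> *s f v" for v using 1[rule_format, of "f v"] by (simp add: k_def f_inv)
    then show ?thesis by (simp add: volume_form_eq[OF vol] coordinate_value cdet_scale)
  next
    case 2
    have "f (K v) = (- \<i>) *s f v" for v using 2[rule_format, of "f v"] by (simp add: k_def f_inv)
    then show ?thesis by (simp only: volume_form_eq[OF vol] coordinate_value cdet_scale) simp
  qed
  moreover have "\<tau> \<in> alt_forms 3" using vol by (simp add: complex_volume_form_def)
  ultimately have "(\<forall>vs. \<tau> vs = \<sigma> vs) \<or> (\<forall>vs. \<tau> vs = - \<sigma> vs)"
    using alt_forms_length[of \<tau> 3] alt_forms_length[OF alt(2)] list_length_3 by (metis neg_equal_0_iff_equal)
  then show ?thesis
  proof
    assume "\<forall>vs. \<tau> vs = - \<sigma> vs"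
    then have "\<tau> = (\<lambda>vs. - \<sigma> vs)" by (simp add: fun_eq_iff)
    then show ?thesis using pos positive by (simp add: wedge_minus_right)
  qed (simp add: fun_eq_iff)
qed

lemma hitchin_dual_eq: "hitchin_dual \<rho> = \<sigma>"
  unfolding hitchin_dual_def
proof (rule the_equality)
  show "\<exists>J. induced_complex_structure \<rho> J \<and> complex_volume_form J \<rho> \<sigma> \<and> wedge 3 3 \<rho> \<sigma> frame6 > 0"
    using induced_J volume_J positive by blast
qed (use volume_form_unique in blast)

end

text \<open>
  The vectors \<open>J t\<close> for tangent vectors \<open>t\<close> suffice: \<open>J t \<lrcorner> \<rho>\<close> is minus the contraction of the Hitchin dual
  with \<open>t\<close>, and the dual is a volume form on the tangent space.
\<close>

lemma contractions_onto:
  fixes \<rho> \<tau> :: "(real^6) form" and T :: "real^3 \<Rightarrow> real^6"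
  assumes \<rho>: "\<rho> \<in> alt_forms 3" and \<tau>: "\<tau> \<in> alt_forms 4"
    and stable: "stable4 (\<lambda>vs. wedge 1 3 dt (pull snd \<rho>) vs + pull snd \<tau> vs)"
    and zero: "\<rho> (map T frame3) = 0" and pos: "hitchin_dual \<rho> (map T frame3) > 0"
  obtains n where "\<rho> [n, T (axis 2 1), T (axis 3 1)] = x1"
    "\<rho> [n, T (axis 3 1), T (axis 1 1)] = x2" "\<rho> [n, T (axis 1 1), T (axis 2 1)] = x3"
proof -
  obtain g :: "complex^3 \<Rightarrow> real^6" where g: "linear g" "bij g" "\<And>x y z. \<rho> [g x, g y, g z] = Re (cdet x y z)"
    using G2_pair_3form_normal_form[OF \<rho> \<tau> stable] by blast
  obtain f where "complex_coordinates \<rho> f" using complex_coordinates_exist[OF \<rho> g] by blast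
  then interpret oriented_complex_coordinates \<rho> f by unfold_locales
  define t where "t i = f (T (axis i 1))" for i :: 3
  define s where "s = Im (cdet (t 1) (t 2) (t 3))"
  have s: "s > 0" using pos by (simp add: hitchin_dual_eq frame3_def coordinate_value s_def t_def)
  have "Re (cdet (t 1) (t 2) (t 3)) = 0" using zero by (simp add: frame3_def coordinate_value t_def)
  then have d: "cdet (t 1) (t 2) (t 3) = \<i> * complex_of_real s" by (simp add: complex_eq_iff s_def)
  define c where "c x = \<i> * complex_of_real (- x / s)" for x
  define n where "n = inv f (c x1 *s t 1 + c x2 *s t 2 + c x3 *s t 3)"
  have fn: "f n = c x1 *s t 1 + c x2 *s t 2 + c x3 *s t 3" by (simp add: n_def f_inv)
  have e: "cdet (f n) (t 2) (t 3) = c x1 * cdet (t 1) (t 2) (t 3)"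
    "cdet (f n) (t 3) (t 1) = c x2 * cdet (t 1) (t 2) (t 3)"
    "cdet (f n) (t 1) (t 2) = c x3 * cdet (t 1) (t 2) (t 3)"
    unfolding fn by (simp_all add: cdet_expand algebra_simps)
  have "Re (c x * cdet (t 1) (t 2) (t 3)) = x" for x unfolding d c_def using s by simp
  then show ?thesis using that[of n] by (simp add: coordinate_value t_def[symmetric] e)
qed

section \<open>Two-forms on three-space\<close>

lemma cross3_nth: "(cross3 a b) $ 1 = a $ 2 * b $ 3 - a $ 3 * b $ 2" "(cross3 a b) $ 2 = a $ 3 * b $ 1 - a $ 1 * b $ 3"
  "(cross3 a b) $ 3 = a $ 1 * b $ 2 - a $ 2 * b $ 1"
  by (simp_all add: cross3_def)

lemma interior_alt_forms:
  fixes L :: "'v::real_vector \<Rightarrow> 'w::real_vector"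
  assumes \<alpha>: "\<alpha> \<in> alt_forms (Suc k)" and L: "linear L"
  shows "(\<lambda>vs. \<alpha> (n # map L vs)) \<in> alt_forms k"
  unfolding alt_forms_def
proof (intro CollectI conjI allI impI)
  fix us ws :: "'v list" assume "length us + 1 + length ws = k"
  then have "linear (\<lambda>v. \<alpha> ((n # map L us) @ v # map L ws))"
    by (intro alt_forms_linear[OF \<alpha>]) simp
  from linear_compose[OF L this] show "linear (\<lambda>v. \<alpha> (n # map L (us @ v # ws)))" by (simp add: o_def)
next
  fix vs :: "'v list" assume "length vs \<noteq> k"
  then show "\<alpha> (n # map L vs) = 0" by (intro alt_forms_length[OF \<alpha>]) simp
next
  fix vs :: "'v list" assume "\<not> distinct vs"
  then have "\<not> distinct (n # map L vs)" by (auto simp: distinct_map)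
  then show "\<alpha> (n # map L vs) = 0" by (rule alt_forms_not_distinct[OF \<alpha>])
qed

text \<open>The vector \<open>H\<close> that represents a 2-form on three-space as \<open>(u, v) \<mapsto> H \<bullet> (u \<times> v)\<close>.\<close>

definition two_form_vector :: "(real^3) form \<Rightarrow> real^3" where
  "two_form_vector \<eta> = vector [\<eta> [axis 2 1, axis 3 1], \<eta> [axis 3 1, axis 1 1], \<eta> [axis 1 1, axis 2 1]]"

lemma two_form_vector:
  assumes \<eta>: "\<eta> \<in> alt_forms 2" shows "\<eta> [u, v] = two_form_vector \<eta> \<bullet> cross3 u v"
proof -
  have l1: "linear (\<lambda>x. \<eta> [x, b])" and l2: "linear (\<lambda>x. \<eta> [b, x])" for b
    using alt_forms_linear[OF \<eta>, of "[]" "[b]"] alt_forms_linear[OF \<eta>, of "[b]" "[]"] by simp_all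
  have z: "\<eta> [a, a] = 0" for a by (rule alt_forms_not_distinct[OF \<eta>]) simp
  have s: "\<eta> [axis 2 1, axis 1 1] = - \<eta> [axis 1 1, axis 2 1]" "\<eta> [axis 3 1, axis 2 1] = - \<eta> [axis 2 1, axis 3 1]"
    "\<eta> [axis 1 1, axis 3 1] = - \<eta> [axis 3 1, axis 1 1]"
    using alt_forms_swap[OF \<eta>, of "[]" "axis 2 1" "[]" "axis 1 1" "[]"]
      alt_forms_swap[OF \<eta>, of "[]" "axis 3 1" "[]" "axis 2 1" "[]"]
      alt_forms_swap[OF \<eta>, of "[]" "axis 1 1" "[]" "axis 3 1" "[]"] by simp_all
  have "\<eta> [u, v] = (\<Sum>i\<in>UNIV. \<Sum>j\<in>UNIV. u $ i * v $ j * \<eta> [axis i 1, axis j 1])"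
  proof -
    have 1: "\<eta> [u, v] = (\<Sum>i\<in>UNIV. u $ i * \<eta> [axis i 1, v])"
      using linear_axis_expansion[OF l1, of u v] by simp
    have 2: "\<eta> [axis i 1, v] = (\<Sum>j\<in>UNIV. v $ j * \<eta> [axis i 1, axis j 1])" for i
      using linear_axis_expansion[OF l2, of "axis i 1" v] by simp
    show ?thesis unfolding 1 2 by (simp add: sum_distrib_left mult.assoc)
  qed
  then show ?thesis
    by (simp add: sum_3 z s two_form_vector_def vector_3 inner_vec_def cross3_nth algebra_simps)
qed

text \<open>
  The components of \<open>two_form_vector (pull D \<eta>)\<close> are cofactor expansions, so this is the identity between a
  matrix and its adjugate.
\<close>

lemma two_form_vector_pull:
  assumes \<eta>: "\<eta> \<in> alt_forms 2" and D: "linear (D :: real^3 \<Rightarrow> real^3)"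
  shows "D (two_form_vector (pull D \<eta>)) = det (matrix D) *\<^sub>R two_form_vector \<eta>"
proof -
  define H where "H = two_form_vector \<eta>"
  define d where "d i = D (axis i 1)" for i
  have m: "matrix D $ i $ j = d j $ i" for i j by (simp add: matrix_def d_def)
  have p: "pull D \<eta> [axis i 1, axis j 1] = H \<bullet> cross3 (d i) (d j)" for i j
    by (simp add: pull_def two_form_vector[OF \<eta>] H_def d_def)
  have "D w = w $ 1 *\<^sub>R d 1 + w $ 2 *\<^sub>R d 2 + w $ 3 *\<^sub>R d 3" for w
    using linear_axis_expansion[OF D, of w] by (simp add: sum_3 d_def)
  then have "D (two_form_vector (pull D \<eta>)) = (H \<bullet> cross3 (d 2) (d 3)) *\<^sub>R d 1
      + (H \<bullet> cross3 (d 3) (d 1)) *\<^sub>R d 2 + (H \<bullet> cross3 (d 1) (d 2)) *\<^sub>R d 3"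
    by (simp add: two_form_vector_def[of "pull D \<eta>"] vector_3 p)
  also have "\<dots> = det (matrix D) *\<^sub>R H"
    by (simp add: vec_eq_iff forall_3 det_3 m inner_vec_def sum_3 cross3_nth algebra_simps)
  finally show ?thesis by (simp add: H_def)
qed

text \<open>
  Both sides are the derivative of the volume form along the linear vector field \<open>m\<close>.
\<close>

lemma triple_product_identity:
  assumes "linear (m :: real^3 \<Rightarrow> real^3)"
  shows "m a \<bullet> cross3 b c - m b \<bullet> cross3 a c + m c \<bullet> cross3 a b
    = (m (axis 1 1) $ 1 + m (axis 2 1) $ 2 + m (axis 3 1) $ 3) * (a \<bullet> cross3 b c)"
  unfolding linear_axis_expansion[OF assms, of a] linear_axis_expansion[OF assms, of b] linear_axis_expansion[OF assms, of c]
  by (simp add: sum_3 inner_vec_def cross3_nth algebra_simps)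

lemma top_form_on_three_space:
  assumes \<theta>: "\<theta> \<in> alt_forms 3" shows "\<theta> [a, b, c] = \<theta> frame3 * (a \<bullet> cross3 b c)"
proof -
  define g where "g v = v $ 1 *\<^sub>R a + v $ 2 *\<^sub>R b + v $ 3 *\<^sub>R c" for v :: "real^3"
  have g: "linear g" by (simp add: linear_iff g_def algebra_simps)
  have e: "g (axis 1 1) = a" "g (axis 2 1) = b" "g (axis 3 1) = c" by (simp_all add: g_def axis_def)
  have "map g frame3 = [a, b, c]" by (simp add: frame3_def e)
  moreover have "det (matrix g) = a \<bullet> cross3 b c"
  proof -
    have "matrix g $ i $ 1 = a $ i" "matrix g $ i $ 2 = b $ i" "matrix g $ i $ 3 = c $ i" for i
      by (simp_all add: matrix_def e)
    then show ?thesis by (simp add: det_3 inner_vec_def sum_3 cross3_nth algebra_simps)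
  qed
  ultimately show ?thesis using top_form_det[OF frame_frame3 _ g, of \<theta>] \<theta> by simp
qed

lemma cross3_frame3: "axis 1 1 \<bullet> cross3 (axis 2 1) (axis 3 1) = (1::real)"
  by (simp add: inner_vec_def sum_3 cross3_nth axis_def)

lemma wedge_one_two_form:
  assumes \<eta>: "\<eta> \<in> alt_forms 2" and \<alpha>: "\<And>v. \<alpha> [v] = g \<bullet> v"
  shows "wedge 1 2 \<alpha> \<eta> [a, b, c] = (g \<bullet> two_form_vector \<eta>) * (a \<bullet> cross3 b c)"
proof -
  let ?H = "two_form_vector \<eta>"
  have anti: "cross3 v u = - cross3 u v" for u v by (rule cross_skew)
  have l: "linear (\<lambda>v. (g \<bullet> v) *\<^sub>R ?H)" by (simp add: linear_iff inner_add_right algebra_simps)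
  have "wedge 1 2 \<alpha> \<eta> [a, b, c] = (g \<bullet> a) *\<^sub>R ?H \<bullet> cross3 b c - (g \<bullet> b) *\<^sub>R ?H \<bullet> cross3 a c + (g \<bullet> c) *\<^sub>R ?H \<bullet> cross3 a b"
    unfolding wedge_1_2 \<alpha> two_form_vector[OF \<eta>] anti[of c b] anti[of c a] anti[of b a] by (simp add: field_simps)
  also have "\<dots> = (g \<bullet> ?H) * (a \<bullet> cross3 b c)"
    unfolding triple_product_identity[OF l] by (simp add: inner_vec_def[of g ?H] inner_axis sum_3)
  finally show ?thesis .
qed

text \<open>
  Multilinearity allows to expand the vector fields in the coordinate basis, one slot after the other.
\<close>

lemma smooth_on_form_apply:
  fixes \<Phi> :: "'a::euclidean_space \<Rightarrow> (real^'n) form"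
  assumes S: "open S" and alt: "\<And>x. x \<in> S \<Longrightarrow> \<Phi> x \<in> alt_forms k"
    and sm: "\<And>vs. smooth_on S (\<lambda>x. \<Phi> x vs)"
    and V: "\<And>V. V \<in> set Vs \<Longrightarrow> smooth_on S V"
  shows "smooth_on S (\<lambda>x. \<Phi> x (map (\<lambda>V. V x) Vs))"
proof -
  have "smooth_on S (\<lambda>x. \<Phi> x (us @ map (\<lambda>V. V x) Vs))" if "length us + length Vs = k" for us
    using V that
  proof (induction Vs arbitrary: us)
    case Nil
    then show ?case using sm by simp
  next
    case (Cons V Vs)
    have "smooth_on S (\<lambda>x. \<Sum>i\<in>UNIV. V x $ i * \<Phi> x ((us @ [axis i 1]) @ map (\<lambda>V. V x) Vs))"
      using Cons.prems by (intro smooth_on_sum smooth_on_mult smooth_on_nth S Cons.IH) auto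
    then show ?case
    proof (rule smooth_on_cong[OF _ S])
      fix x assume x: "x \<in> S"
      have "linear (\<lambda>v. \<Phi> x (us @ v # map (\<lambda>V. V x) Vs))"
        by (rule alt_forms_linear[OF alt[OF x]]) (use Cons.prems in simp)
      from linear_axis_expansion[OF this, of "V x"]
      show "(\<Sum>i\<in>UNIV. V x $ i * \<Phi> x ((us @ [axis i 1]) @ map (\<lambda>V. V x) Vs))
          = \<Phi> x (us @ map (\<lambda>V. V x) (V # Vs))"
        by simp
    qed
  qed
  from this[of "[]"] show ?thesis
  proof (cases "length Vs = k")
    case False
    have "smooth_on S (\<lambda>x. 0::real)" by simp
    then show ?thesis
      by (rule smooth_on_cong[OF _ S]) (use False in \<open>simp add: alt_forms_length[OF alt]\<close>)
  qed simp
qed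

section \<open>Vector fields along a submanifold\<close>

locale submanifold = P: closed_3manifold P F h + M: oriented_atlas M
  for P :: "('p::{t2_space, second_countable_topology}, real^3) charts" and F h
    and M :: "('m::{t2_space, second_countable_topology}, real^6) charts" +
  fixes \<iota> :: "'p \<Rightarrow> 'm"
  assumes smooth: "smooth_map P M \<iota>"
begin

definition patch :: "'p \<Rightarrow> 'm \<Rightarrow> (real^3) set" where
  "patch a b = chart_at P a ` (dom_at P a \<inter> \<iota> -` dom_at M b)"

abbreviation loc :: "'p \<Rightarrow> 'm \<Rightarrow> real^3 \<Rightarrow> real^6" where
  "loc a b \<equiv> chart_at M b \<circ> \<iota> \<circ> inv_chart P a"

abbreviation dloc :: "'p \<Rightarrow> 'm \<Rightarrow> real^3 \<Rightarrow> real^3 \<Rightarrow> real^6" where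
  "dloc a b x \<equiv> frechet_derivative (loc a b) (at x)"

lemma patch_iff: "x \<in> patch a b \<longleftrightarrow> x \<in> range_at P a \<and> \<iota> (inv_chart P a x) \<in> dom_at M b"
  by (auto simp: patch_def range_at_def P.inv_chart_chart)

lemma open_patch: "open (patch a b)"
proof -
  have "open (\<iota> -` dom_at M b)" using smooth M.dom(2) by (intro open_vimage) (auto simp: smooth_map_def)
  moreover have "{x \<in> range_at P a. inv_chart P a x \<in> \<iota> -` dom_at M b} = patch a b" by (auto simp: patch_iff)
  ultimately show ?thesis using P.open_preimage_inv_chart[of "\<iota> -` dom_at M b" a] by simp
qed

lemma smooth_loc: "smooth_on (patch a b) (loc a b)"
  using smooth by (simp add: smooth_map_def patch_def)

lemma has_derivative_loc: "x \<in> patch a b \<Longrightarrow> (loc a b has_derivative dloc a b x) (at x)"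
  by (rule smooth_on_has_derivative[OF smooth_loc])

lemma loc_range: "x \<in> patch a b \<Longrightarrow> loc a b x \<in> range_at M b"
  by (simp add: patch_iff M.chart_range)

lemma inv_loc: "x \<in> patch a b \<Longrightarrow> inv_chart M b (loc a b x) = \<iota> (inv_chart P a x)"
  by (simp add: patch_iff M.inv_chart_chart)

lemma center_patch: "chart_at P p p \<in> patch p (\<iota> p)"
  by (simp add: patch_iff P.chart_range P.dom(1) P.inv_chart_chart M.dom(1))

lemma linear_tangent_map: "linear (tangent_map P M \<iota> p)"
  unfolding tangent_map_def by (rule has_derivative_linear[OF has_derivative_loc[OF center_patch]])

text \<open>
  The derivative of \<open>\<iota>\<close> at the point with coordinates \<open>x\<close> in the chart at \<open>a\<close>, as a map into the
  tangent space of \<open>M\<close> in its distinguished chart.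
\<close>

definition push :: "'p \<Rightarrow> real^3 \<Rightarrow> real^3 \<Rightarrow> real^6" where
  "push a x v = tangent_map P M \<iota> (inv_chart P a x) (P.dtrans a (inv_chart P a x) x v)"

lemma linear_push: assumes "x \<in> range_at P a" shows "linear (push a x)"
proof -
  have "x \<in> P.overlap a (inv_chart P a x)" using assms by (simp add: P.overlap_iff P.dom(1))
  from linear_compose[OF P.linear_dtrans[OF this] linear_tangent_map]
  show ?thesis by (simp add: push_def[abs_def] o_def)
qed

lemma push_change:
  assumes x: "x \<in> P.overlap a b" shows "push b (P.trans a b x) (P.dtrans a b x v) = push a x v"
  unfolding push_def P.inv_trans[OF x] by (subst P.dtrans_chain[OF x P.dom(1)]) (rule refl)

lemma push_center: "push p (chart_at P p p) = tangent_map P M \<iota> p"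
  by (simp add: push_def fun_eq_iff P.inv_chart_chart P.dom(1) P.dtrans_self[simplified] P.chart_range)

text \<open>
  Both sides are the derivative at \<open>x\<close> of \<open>\<iota>\<close>, read in the chart at \<open>a\<close> and the chart at the image point.
\<close>

lemma push_eq_dloc:
  assumes x: "x \<in> patch a b"
  shows "push a x v = M.dtrans b (\<iota> (inv_chart P a x)) (loc a b x) (dloc a b x v)"
proof -
  define q where "q = inv_chart P a x"
  have xr: "x \<in> range_at P a" using x by (simp add: patch_iff)
  have xq: "x \<in> P.overlap a q" using xr by (simp add: P.overlap_iff q_def P.dom(1))
  have xp: "x \<in> patch a (\<iota> q)" using xr by (simp add: patch_iff q_def M.dom(1))
  have y: "loc a b x \<in> M.overlap b (\<iota> q)"
    using x by (simp add: M.overlap_iff patch_iff M.chart_range M.inv_chart_chart q_def M.dom(1))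
  have tx: "P.trans a q x = chart_at P q q" by (simp add: q_def)
  have "((\<lambda>x. M.trans b (\<iota> q) (loc a b x)) has_derivative (\<lambda>v. M.dtrans b (\<iota> q) (loc a b x) (dloc a b x v))) (at x)"
    by (rule has_derivative_compose[OF has_derivative_loc[OF x] M.has_derivative_trans[OF y]])
  then have 1: "(loc a (\<iota> q) has_derivative (\<lambda>v. M.dtrans b (\<iota> q) (loc a b x) (dloc a b x v))) (at x)"
    by (rule has_derivative_transform_within_open[OF _ open_patch x]) (simp add: patch_iff M.inv_chart_chart)
  have tq: "P.trans a q x \<in> patch q (\<iota> q)" using center_patch[of q] by (simp add: tx del: comp_apply)
  have "((\<lambda>x. loc q (\<iota> q) (P.trans a q x)) has_derivative (\<lambda>v. dloc q (\<iota> q) (P.trans a q x) (P.dtrans a q x v))) (at x)"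
    by (rule has_derivative_compose[OF P.has_derivative_trans[OF xq] has_derivative_loc[OF tq]])
  then have 2: "(loc a (\<iota> q) has_derivative (\<lambda>v. dloc q (\<iota> q) (P.trans a q x) (P.dtrans a q x v))) (at x)"
    by (rule has_derivative_transform_within_open[OF _ P.open_overlap xq]) (simp add: P.overlap_iff P.inv_chart_chart)
  have "(\<lambda>v. dloc q (\<iota> q) (P.trans a q x) (P.dtrans a q x v)) = (\<lambda>v. M.dtrans b (\<iota> q) (loc a b x) (dloc a b x v))"
    by (rule has_derivative_unique[OF 2 1])
  from fun_cong[OF this, of v] show ?thesis
    unfolding push_def tangent_map_def q_def[symmetric] tx by simp
qed

subsection \<open>Contractions\<close>

definition contraction :: "('p \<Rightarrow> real^6) \<Rightarrow> ('m \<Rightarrow> (real^6) form) \<Rightarrow> 'p \<Rightarrow> real^3 \<Rightarrow> (real^3) form" where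
  "contraction n \<omega> a x vs = \<omega> (\<iota> (inv_chart P a x)) (n (inv_chart P a x) # map (push a x) vs)"

lemma contraction_alt_forms:
  assumes "diff_form (Suc k) M \<omega>" "x \<in> range_at P a" shows "contraction n \<omega> a x \<in> alt_forms k"
  unfolding contraction_def[abs_def]
  by (rule interior_alt_forms[OF _ linear_push[OF assms(2)]]) (use assms(1) in \<open>simp add: diff_form_def\<close>)

lemma contraction_change:
  assumes x: "x \<in> P.overlap a b" shows "contraction n \<omega> a x = pull (P.dtrans a b x) (contraction n \<omega> b (P.trans a b x))"
proof -
  have eq: "map (push b (P.trans a b x)) (map (P.dtrans a b x) vs) = map (push a x) vs" for vs
    by (induction vs) (simp_all add: push_change[OF x] del: comp_apply map_map)
  show ?thesis unfolding contraction_def[abs_def] pull_def P.inv_trans[OF x] by (simp only: eq)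
qed

lemma contraction_local_form: "local_form P (pullback_interior P M \<iota> n \<omega>) a x = contraction n \<omega> a x"
  by (simp add: local_form_def pull_def pullback_interior_def contraction_def push_def[abs_def] fun_eq_iff o_def)

lemma contraction_patch:
  assumes x: "x \<in> patch a b" and w: "n (inv_chart P a x) = M.dtrans b (\<iota> (inv_chart P a x)) (loc a b x) w"
  shows "contraction n \<omega> a x vs = local_form M \<omega> b (loc a b x) (w # map (dloc a b x) vs)"
proof -
  have eq: "map (push a x) vs = map (M.dtrans b (\<iota> (inv_chart P a x)) (loc a b x)) (map (dloc a b x) vs)"
    using push_eq_dloc[OF x] by simp
  then show ?thesis
    by (simp only: contraction_def w local_form_def pull_def inv_loc[OF x] list.map eq)
qed

lemma smooth_contraction_patch:
  assumes \<omega>: "diff_form k M \<omega>" and S: "open S" "S \<subseteq> patch a b" and W: "smooth_on S W"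
    and n: "\<And>x. x \<in> S \<Longrightarrow> n (inv_chart P a x) = M.dtrans b (\<iota> (inv_chart P a x)) (loc a b x) (W x)"
  shows "smooth_on S (\<lambda>x. contraction n \<omega> a x vs)"
proof -
  have "smooth_on S (\<lambda>x. local_form M \<omega> b (loc a b x) (map (\<lambda>V. V x) (W # map (\<lambda>v x. dloc a b x v) vs)))"
  proof (rule smooth_on_form_apply[OF S(1)])
    fix x assume x: "x \<in> S"
    have y: "loc a b x \<in> M.overlap b (inv_chart M b (loc a b x))"
      using loc_range[of x a b] S(2) x by (auto simp: M.overlap_iff M.dom(1))
    show "local_form M \<omega> b (loc a b x) \<in> alt_forms k"
      unfolding local_form_def
      by (rule pull_alt_forms[OF M.linear_dtrans[OF y]]) (use \<omega> in \<open>simp add: diff_form_def\<close>)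
  next
    show "smooth_on S (\<lambda>x. local_form M \<omega> b (loc a b x) us)" for us
      by (rule smooth_on_compose[OF _ smooth_on_subset[OF smooth_loc S(2)] S(1) M.open_range])
         (use \<omega> loc_range S(2) in \<open>auto simp: diff_form_def\<close>)
    show "smooth_on S V" if V: "V \<in> set (W # map (\<lambda>v x. dloc a b x v) vs)" for V
    proof -
      have "smooth_on S (\<lambda>x. dloc a b x v)" for v
        by (rule smooth_on_derivative[OF smooth_on_subset[OF smooth_loc S(2)]])
      then show ?thesis using V W by auto
    qed
  qed
  then show ?thesis
  proof (rule smooth_on_cong[OF _ S(1)])
    fix x assume x: "x \<in> S"
    show "local_form M \<omega> b (loc a b x) (map (\<lambda>V. V x) (W # map (\<lambda>v x. dloc a b x v) vs)) = contraction n \<omega> a x vs"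
      using contraction_patch[of x a b n "W x" \<omega> vs] n[OF x] S(2) x by (auto simp: o_def)
  qed
qed

lemma tangent_coords_dtrans:
  assumes x: "x \<in> patch a b"
  shows "M.dtrans b (\<iota> (inv_chart P a x)) (loc a b x) (tangent_coords M b (\<iota> (inv_chart P a x)) v) = v"
proof -
  have y: "loc a b x \<in> M.overlap b (\<iota> (inv_chart P a x))"
    using x by (simp add: M.overlap_iff patch_iff M.chart_range M.inv_chart_chart M.dom(1))
  have "M.trans b (\<iota> (inv_chart P a x)) (loc a b x) = chart_at M (\<iota> (inv_chart P a x)) (\<iota> (inv_chart P a x))"
    using inv_loc[OF x] by simp
  then show ?thesis using M.dtrans_inverse'[OF y] by (simp only: tangent_coords_def)
qed

lemma smooth_contraction:
  assumes \<omega>: "diff_form k M \<omega>" and n: "section_along P M \<iota> n"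
  shows "smooth_on (range_at P a) (\<lambda>x. contraction n \<omega> a x vs)"
proof (rule smooth_on_local)
  fix x assume x: "x \<in> range_at P a"
  let ?b = "\<iota> (inv_chart P a x)"
  have "smooth_on (patch a ?b) (\<lambda>x. contraction n \<omega> a x vs)"
  proof (rule smooth_contraction_patch[OF \<omega> open_patch order_refl])
    show "smooth_on (patch a ?b) (\<lambda>x. tangent_coords M ?b (\<iota> (inv_chart P a x)) (n (inv_chart P a x)))"
      using n by (simp add: section_along_def patch_def)
    show "n (inv_chart P a y) = M.dtrans ?b (\<iota> (inv_chart P a y)) (loc a ?b y)
        (tangent_coords M ?b (\<iota> (inv_chart P a y)) (n (inv_chart P a y)))" if "y \<in> patch a ?b" for y
      using tangent_coords_dtrans[OF that] by simp
  qed
  moreover have "x \<in> patch a ?b" using x by (simp add: patch_iff M.dom(1))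
  ultimately show "\<exists>T. open T \<and> x \<in> T \<and> smooth_on T (\<lambda>x. contraction n \<omega> a x vs)"
    using open_patch by blast
qed

definition contraction_vector :: "('m \<Rightarrow> (real^6) form) \<Rightarrow> ('p \<Rightarrow> real^6) \<Rightarrow> 'p \<Rightarrow> real^3 \<Rightarrow> real^3" where
  "contraction_vector \<rho> n a x = two_form_vector (contraction n \<rho> a x)"

lemma smooth_two_form_vector:
  assumes "open S" "\<And>vs. smooth_on S (\<lambda>x. \<eta> x vs)" shows "smooth_on S (\<lambda>x. two_form_vector (\<eta> x))"
proof -
  have e: "two_form_vector \<beta> = (\<chi> i. if i = 1 then \<beta> [axis 2 1, axis 3 1] else if i = 2 then \<beta> [axis 3 1, axis 1 1]
      else \<beta> [axis 1 1, axis 2 1])" for \<beta> :: "(real^3) form"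
    by (simp add: two_form_vector_def vec_eq_iff forall_3 vector_3)
  show ?thesis unfolding e
  proof (rule smooth_on_vec_lambda[OF assms(1)])
    fix i :: 3
    show "smooth_on S (\<lambda>x. if i = 1 then \<eta> x [axis 2 1, axis 3 1] else if i = 2 then \<eta> x [axis 3 1, axis 1 1]
        else \<eta> x [axis 1 1, axis 2 1])"
      by (cases "i = 1"; cases "i = 2") (simp_all add: assms(2))
  qed
qed

lemma contraction_vector_change:
  assumes \<rho>: "diff_form 3 M \<rho>" and x: "x \<in> P.overlap a b"
  shows "P.dtrans a b x (contraction_vector \<rho> n a x)
    = det (matrix (P.dtrans a b x)) *\<^sub>R contraction_vector \<rho> n b (P.trans a b x)"
proof -
  have y: "P.trans a b x \<in> range_at P b" using P.trans_overlap[OF x] by (simp add: P.overlap_iff)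
  have "contraction n \<rho> b (P.trans a b x) \<in> alt_forms 2"
    by (rule contraction_alt_forms[OF _ y]) (use \<rho> in simp)
  from two_form_vector_pull[OF this P.linear_dtrans[OF x]]
  show ?thesis by (simp only: contraction_vector_def contraction_change[OF x])
qed

lemma vector_density_contraction:
  assumes \<rho>: "diff_form 3 M \<rho>" and n: "section_along P M \<iota> n"
  shows "P.vector_density (contraction_vector \<rho> n)"
  unfolding P.vector_density_def
proof (intro conjI allI ballI contraction_vector_change[OF \<rho>])
  show "smooth_on (range_at P a) (contraction_vector \<rho> n a)" for a
    unfolding contraction_vector_def[abs_def]
    by (intro smooth_two_form_vector P.open_range smooth_contraction[OF \<rho> n])
qed

lemma contraction_frame_change:
  assumes \<tau>: "diff_form 4 M \<tau>" and x: "x \<in> P.overlap a b"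
  shows "contraction n \<tau> a x frame3 = det (matrix (P.dtrans a b x)) * contraction n \<tau> b (P.trans a b x) frame3"
proof -
  have y: "P.trans a b x \<in> range_at P b" using P.trans_overlap[OF x] by (simp add: P.overlap_iff)
  have "contraction n \<tau> b (P.trans a b x) \<in> alt_forms CARD(3)"
    using contraction_alt_forms[OF _ y, of 3 \<tau> n] \<tau> by simp
  from top_form_det[OF frame_frame3 this P.linear_dtrans[OF x]]
  show ?thesis unfolding contraction_change[OF x] pull_def .
qed

lemma divergence_eq_sum: "divergence (X :: real^3 \<Rightarrow> real^3) x = frechet_derivative X (at x) (axis 1 1) $ 1
    + frechet_derivative X (at x) (axis 2 1) $ 2 + frechet_derivative X (at x) (axis 3 1) $ 3"
  by (simp add: divergence_def sum_3)

text \<open>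
  With the 2-form written as \<open>H \<lrcorner> vol\<close>, its exterior derivative is \<open>div H\<close> times \<open>vol\<close>.
\<close>

lemma ext_deriv_contraction:
  assumes \<rho>: "diff_form 3 M \<rho>" and n: "section_along P M \<iota> n"
  shows "ext_deriv P (pullback_interior P M \<iota> n \<rho>) p [a, b, c]
    = divergence (contraction_vector \<rho> n p) (chart_at P p p) * (a \<bullet> cross3 b c)"
proof -
  let ?x = "chart_at P p p" and ?X = "contraction_vector \<rho> n p"
  have xr: "?x \<in> range_at P p" by (simp add: P.chart_range P.dom(1))
  have d: "(?X has_derivative frechet_derivative ?X (at ?x)) (at ?x)"
    by (rule smooth_on_has_derivative[OF P.vector_density_smooth[OF vector_density_contraction[OF \<rho> n]] xr])
  have e: "frechet_derivative (\<lambda>x. contraction n \<rho> p x [u, v]) (at ?x) w = frechet_derivative ?X (at ?x) w \<bullet> cross3 u v"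
    for u v w
  proof -
    have "((\<lambda>x. ?X x \<bullet> cross3 u v) has_derivative (\<lambda>w. frechet_derivative ?X (at ?x) w \<bullet> cross3 u v)) (at ?x)"
      by (rule has_derivative_inner_left[OF d])
    then have "((\<lambda>x. contraction n \<rho> p x [u, v]) has_derivative (\<lambda>w. frechet_derivative ?X (at ?x) w \<bullet> cross3 u v)) (at ?x)"
    proof (rule has_derivative_transform_within_open[OF _ P.open_range xr])
      fix x assume "x \<in> range_at P p"
      then have "contraction n \<rho> p x \<in> alt_forms 2" using contraction_alt_forms[of 2 \<rho>] \<rho> by simp
      then show "?X x \<bullet> cross3 u v = contraction n \<rho> p x [u, v]"
        by (simp add: two_form_vector contraction_vector_def)
    qed
    from frechet_derivative_at[OF this] show ?thesis by metis
  qed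
  have "ext_deriv P (pullback_interior P M \<iota> n \<rho>) p [a, b, c]
      = frechet_derivative ?X (at ?x) a \<bullet> cross3 b c - frechet_derivative ?X (at ?x) b \<bullet> cross3 a c
        + frechet_derivative ?X (at ?x) c \<bullet> cross3 a b"
    unfolding ext_deriv_def contraction_local_form by (simp add: lessThan_nat_numeral numeral_3_eq_3 lessThan_Suc e)
  then show ?thesis
    unfolding triple_product_identity[OF has_derivative_linear[OF d]] divergence_eq_sum .
qed

lemma closed_contraction_iff:
  assumes \<rho>: "diff_form 3 M \<rho>" and n: "section_along P M \<iota> n"
  shows "closed_form P (pullback_interior P M \<iota> n \<rho>) \<longleftrightarrow> P.divergence_free (contraction_vector \<rho> n)"
proof -
  have other: "ext_deriv P (pullback_interior P M \<iota> n \<rho>) p vs = 0" if len: "length vs \<noteq> 3" for p vs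
  proof -
    have "frechet_derivative (\<lambda>x. contraction n \<rho> p x us) (at (chart_at P p p)) v = 0" if "length us \<noteq> 2" for us v
    proof (rule derivative_zero_on_open[OF P.open_range])
      show "contraction n \<rho> p x us = 0" if "x \<in> range_at P p" for x
        using alt_forms_length[OF contraction_alt_forms[of 2 \<rho>, OF _ that]] \<rho> \<open>length us \<noteq> 2\<close> by simp
    qed (simp add: P.chart_range P.dom(1))
    moreover have "length (take i vs @ drop (Suc i) vs) \<noteq> 2" if "i < length vs" for i
      using len that by simp
    ultimately show ?thesis unfolding ext_deriv_def contraction_local_form by (intro sum.neutral) simp
  qed
  have "closed_form P (pullback_interior P M \<iota> n \<rho>)
      \<longleftrightarrow> (\<forall>p. divergence (contraction_vector \<rho> n p) (chart_at P p p) = 0)"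
  proof
    assume cl: "closed_form P (pullback_interior P M \<iota> n \<rho>)"
    show "\<forall>p. divergence (contraction_vector \<rho> n p) (chart_at P p p) = 0"
    proof
      fix p
      have "ext_deriv P (pullback_interior P M \<iota> n \<rho>) p [axis 1 1, axis 2 1, axis 3 1] = 0"
        using cl by (simp add: closed_form_def)
      then show "divergence (contraction_vector \<rho> n p) (chart_at P p p) = 0"
        unfolding ext_deriv_contraction[OF \<rho> n] cross3_frame3 by simp
    qed
  next
    assume z: "\<forall>p. divergence (contraction_vector \<rho> n p) (chart_at P p p) = 0"
    show "closed_form P (pullback_interior P M \<iota> n \<rho>)"
      unfolding closed_form_def
    proof (intro allI)
      fix p and vs :: "(real^3) list"
      show "ext_deriv P (pullback_interior P M \<iota> n \<rho>) p vs = 0"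
      proof (cases "length vs = 3")
        case True
        then obtain a b c where vs: "vs = [a, b, c]" using list_length_3 by blast
        then show ?thesis using z ext_deriv_contraction[OF \<rho> n] by simp
      qed (rule other)
    qed
  qed
  then show ?thesis unfolding P.divergence_free_iff_center[OF vector_density_contraction[OF \<rho> n]] .
qed

end

section \<open>The Lagrange multiplier\<close>

locale isotropic_submanifold = submanifold P F h M \<iota>
  for P :: "('p::{t2_space, second_countable_topology}, real^3) charts" and F h
    and M :: "('m::{t2_space, second_countable_topology}, real^6) charts" and \<iota> +
  fixes \<rho> \<tau> :: "'m \<Rightarrow> (real^6) form"
  assumes \<rho>: "diff_form 3 M \<rho>" and \<tau>: "diff_form 4 M \<tau>"
    and inj_tangent: "inj (tangent_map P M \<iota> p)"
    and isotropic: "\<rho> (\<iota> p) (map (tangent_map P M \<iota> p) vs) = 0"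
    and onto: "\<exists>w. two_form_vector (\<lambda>vs. \<rho> (\<iota> p) (w # map (tangent_map P M \<iota> p) vs)) = y"
begin

text \<open>
  At the point \<open>p\<close>, the 2-form \<open>\<iota>\<^sup>*(w \<lrcorner> \<rho>)\<close> as a vector, and the 3-form \<open>\<iota>\<^sup>*(w \<lrcorner> \<tau>)\<close> as a number.
\<close>

definition normal_two_form :: "'p \<Rightarrow> real^6 \<Rightarrow> real^3" where
  "normal_two_form p w = two_form_vector (\<lambda>vs. \<rho> (\<iota> p) (w # map (tangent_map P M \<iota> p) vs))"

definition normal_volume :: "'p \<Rightarrow> real^6 \<Rightarrow> real" where
  "normal_volume p w = \<tau> (\<iota> p) (w # map (tangent_map P M \<iota> p) frame3)"

definition dual_basis :: "'p \<Rightarrow> 3 \<Rightarrow> real^6" where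
  "dual_basis p i = (SOME w. normal_two_form p w = axis i 1)"

definition multiplier :: "'p \<Rightarrow> real^3" where
  "multiplier p = (\<chi> i. normal_volume p (dual_basis p i))"

lemma alt_\<rho>: "\<rho> q \<in> alt_forms 3" and alt_\<tau>: "\<tau> q \<in> alt_forms 4"
  using \<rho> \<tau> by (simp_all add: diff_form_def)

lemma linear_two_form_vector:
  assumes "\<alpha> \<in> alt_forms 3" shows "linear (\<lambda>w. two_form_vector (\<lambda>vs. \<alpha> (w # map L vs)))"
  using alt_forms_linear[OF assms, of "[]" "[L a, L b]" for a b]
  by (simp add: linear_iff two_form_vector_def vec_eq_iff forall_3 vector_3)

lemma linear_normal_two_form: "linear (normal_two_form p)"
  unfolding normal_two_form_def[abs_def] by (rule linear_two_form_vector[OF alt_\<rho>])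

lemma linear_normal_volume: "linear (normal_volume p)"
  using alt_forms_linear[OF alt_\<tau>[of "\<iota> p"], of "[]" "map (tangent_map P M \<iota> p) frame3"]
  by (simp add: normal_volume_def[abs_def] frame3_def)

lemma dual_basis: "normal_two_form p (dual_basis p i) = axis i 1"
proof -
  have "\<exists>w. normal_two_form p w = axis i 1" unfolding normal_two_form_def by (rule onto)
  then show ?thesis unfolding dual_basis_def by (rule someI_ex)
qed

text \<open>
  The tangent vectors and \<open>dual_basis\<close> together form a basis, and \<open>\<tau>\<close> vanishes on four tangent vectors;
  hence \<open>normal_volume\<close> factors through \<open>normal_two_form\<close>.
\<close>

lemma normal_volume_eq: "normal_volume p w = multiplier p \<bullet> normal_two_form p w"
proof -
  let ?T = "tangent_map P M \<iota> p" and ?m = "dual_basis p"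
  note T = linear_tangent_map[of p]
  define \<Psi> where "\<Psi> ab = ?T (fst ab) + (\<Sum>i\<in>UNIV. snd ab $ i *\<^sub>R ?m i)" for ab :: "(real^3) \<times> (real^3)"
  have lin: "linear \<Psi>"
    by (simp add: linear_iff \<Psi>_def linear_add[OF T] linear_cmul[OF T] sum_3 algebra_simps)
  have tangent: "normal_two_form p (?T v) = 0" for v
    using isotropic[of p "v # us" for us] by (simp add: normal_two_form_def two_form_vector_def vec_eq_iff forall_3 vector_3)
  have two: "normal_two_form p (\<Psi> ab) = snd ab" for ab
  proof -
    have "normal_two_form p (\<Psi> ab) = (\<Sum>i\<in>UNIV. snd ab $ i *\<^sub>R axis i 1)"
      unfolding \<Psi>_def linear_add[OF linear_normal_two_form] linear_sum[OF linear_normal_two_form]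
        linear_cmul[OF linear_normal_two_form] dual_basis tangent by simp
    also have "\<dots> = snd ab" by (simp add: vec_eq_iff forall_3 sum_3 axis_def)
    finally show ?thesis .
  qed
  have "bij \<Psi>"
  proof (rule injective_linear_bij[OF lin])
    fix ab assume z: "\<Psi> ab = 0"
    then have "snd ab = 0" using two[of ab] linear_0[OF linear_normal_two_form] by simp
    moreover from this have "?T (fst ab) = 0" using z by (simp add: \<Psi>_def)
    then have "fst ab = 0" using inj_tangent[of p] linear_0[OF T] by (metis injD)
    ultimately show "ab = 0" by (simp add: prod_eq_iff)
  qed simp
  then obtain ab where ab: "w = \<Psi> ab" by (metis bij_pointE)
  have "normal_volume p (?T v) = 0" for v
  proof -
    have "?T v = (\<Sum>i\<in>UNIV. v $ i *\<^sub>R ?T (axis i 1))" by (rule linear_axis_expansion[OF T])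
    also have "\<dots> \<in> span (set (map ?T frame3))"
    proof (intro span_sum span_scale span_base)
      show "?T (axis i 1) \<in> set (map ?T frame3)" for i
        using exhaust_3[of i] by (auto simp: frame3_def)
    qed
    finally show ?thesis
      unfolding normal_volume_def
      using alt_forms_dependent[OF alt_\<tau>, of "?T v" "[]" "map ?T frame3"] by simp
  qed
  then have "normal_volume p w = (\<Sum>i\<in>UNIV. snd ab $ i * normal_volume p (?m i))"
    unfolding ab \<Psi>_def linear_add[OF linear_normal_volume] linear_sum[OF linear_normal_volume]
      linear_cmul[OF linear_normal_volume] by simp
  then show ?thesis unfolding ab two by (simp add: multiplier_def inner_vec_def mult.commute)
qed

subsection \<open>The multiplier as a one-form\<close>

lemma contraction_center: "contraction n \<omega> p (chart_at P p p) = (\<lambda>vs. \<omega> (\<iota> p) (n p # map (tangent_map P M \<iota> p) vs))"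
  by (simp add: contraction_def[abs_def] push_center P.inv_chart_chart P.dom(1))

lemma contraction_vector_center: "contraction_vector \<rho> n p (chart_at P p p) = normal_two_form p (n p)"
  by (simp add: contraction_vector_def contraction_center normal_two_form_def)

lemma to_center: assumes "x \<in> range_at P a"
  shows "x \<in> P.overlap a (inv_chart P a x)"
    "P.trans a (inv_chart P a x) x = chart_at P (inv_chart P a x) (inv_chart P a x)"
  using assms by (simp_all add: P.overlap_iff P.dom(1))

definition multiplier_form :: "'p \<Rightarrow> real^3 \<Rightarrow> real^3" where
  "multiplier_form a x = (\<chi> i. multiplier (inv_chart P a x) \<bullet> P.dtrans a (inv_chart P a x) x (axis i 1))"

lemma multiplier_form_inner:
  assumes "x \<in> range_at P a"
  shows "multiplier_form a x \<bullet> v = multiplier (inv_chart P a x) \<bullet> P.dtrans a (inv_chart P a x) x v"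
proof -
  have "P.dtrans a (inv_chart P a x) x v = (\<Sum>i\<in>UNIV. v $ i *\<^sub>R P.dtrans a (inv_chart P a x) x (axis i 1))"
    by (rule linear_axis_expansion[OF P.linear_dtrans[OF to_center(1)[OF assms]]])
  then show ?thesis by (simp add: multiplier_form_def inner_vec_def[of "vec_lambda _"] inner_sum_right mult.commute)
qed

lemma multiplier_form_center: "multiplier_form p (chart_at P p p) \<bullet> v = multiplier p \<bullet> v"
proof -
  have "chart_at P p p \<in> range_at P p" by (simp add: P.chart_range P.dom(1))
  then show ?thesis by (simp add: multiplier_form_inner P.inv_chart_chart P.dom(1) P.dtrans_self[simplified])
qed

text \<open>
  The identity \<open>normal_volume_eq\<close> holds in the chart at the point itself; in another chart
  both sides are multiplied with the determinant of the transition map.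
\<close>

lemma multiplier_form_contraction:
  assumes x: "x \<in> range_at P a"
  shows "multiplier_form a x \<bullet> contraction_vector \<rho> n a x = contraction n \<tau> a x frame3"
proof -
  define q where "q = inv_chart P a x"
  have o: "x \<in> P.overlap a q" and t: "P.trans a q x = chart_at P q q"
    using to_center[OF x] by (simp_all only: q_def)
  have "multiplier_form a x \<bullet> contraction_vector \<rho> n a x = multiplier q \<bullet> P.dtrans a q x (contraction_vector \<rho> n a x)"
    unfolding q_def by (rule multiplier_form_inner[OF x])
  also have "\<dots> = det (matrix (P.dtrans a q x)) * (multiplier q \<bullet> normal_two_form q (n q))"
    unfolding contraction_vector_change[OF \<rho> o] t contraction_vector_center by simp
  also have "\<dots> = det (matrix (P.dtrans a q x)) * contraction n \<tau> q (P.trans a q x) frame3"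
    unfolding t contraction_center by (simp add: normal_volume_eq[symmetric] normal_volume_def)
  also have "\<dots> = contraction n \<tau> a x frame3" by (rule contraction_frame_change[OF \<tau> o, symmetric])
  finally show ?thesis .
qed

lemma multiplier_form_change:
  assumes x: "x \<in> P.overlap a b"
  shows "multiplier_form a x \<bullet> v = multiplier_form b (P.trans a b x) \<bullet> P.dtrans a b x v"
proof -
  have xa: "x \<in> range_at P a" and xb: "P.trans a b x \<in> range_at P b"
    using x P.trans_overlap[OF x] by (simp_all add: P.overlap_iff)
  show ?thesis
    unfolding multiplier_form_inner[OF xa] multiplier_form_inner[OF xb] P.inv_trans[OF x]
    by (subst P.dtrans_chain[OF x P.dom(1)]) (rule refl)
qed

text \<open>
  Near the centre of a chart the vectors of \<open>dual_basis\<close> extend to fields with constant coordinates,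
  whose associated 2-forms still are a basis.
\<close>

definition frame_field :: "'p \<Rightarrow> 3 \<Rightarrow> 'p \<Rightarrow> real^6" where
  "frame_field p i q = M.dtrans (\<iota> p) (\<iota> q) (loc p (\<iota> p) (chart_at P p q)) (dual_basis p i)"

definition frame_matrix :: "'p \<Rightarrow> real^3 \<Rightarrow> real^3^3" where
  "frame_matrix p x = (\<chi> k j. contraction_vector \<rho> (frame_field p j) p x $ k)"

definition regular :: "'p \<Rightarrow> (real^3) set" where
  "regular p = {x \<in> patch p (\<iota> p). det (frame_matrix p x) \<noteq> 0}"

lemma frame_field_center: "frame_field p i p = dual_basis p i"
  by (simp add: frame_field_def P.inv_chart_chart P.dom(1) M.dtrans_self[simplified] M.chart_range M.dom(1))

lemma smooth_frame_contraction:
  assumes "diff_form k M \<omega>" shows "smooth_on (patch p (\<iota> p)) (\<lambda>x. contraction (frame_field p i) \<omega> p x vs)"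
proof (rule smooth_contraction_patch[OF assms open_patch order_refl])
  show "smooth_on (patch p (\<iota> p)) (\<lambda>x. dual_basis p i)" by simp
  show "frame_field p i (inv_chart P p x) = M.dtrans (\<iota> p) (\<iota> (inv_chart P p x)) (loc p (\<iota> p) x) (dual_basis p i)"
    if "x \<in> patch p (\<iota> p)" for x
    using that by (simp add: frame_field_def patch_iff P.chart_inv_chart)
qed

lemma smooth_frame_matrix: "smooth_on (patch p (\<iota> p)) (\<lambda>x. frame_matrix p x $ k $ j)"
  unfolding frame_matrix_def contraction_vector_def
  by (simp, intro smooth_on_nth smooth_two_form_vector open_patch smooth_frame_contraction[OF \<rho>])

lemma regular: "open (regular p)" "chart_at P p p \<in> regular p" "regular p \<subseteq> patch p (\<iota> p)" "regular p \<subseteq> range_at P p"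
proof -
  have "continuous_on (patch p (\<iota> p)) (\<lambda>x. det (frame_matrix p x))"
    by (rule smooth_on_continuous[OF smooth_on_det[OF open_patch smooth_frame_matrix]])
  then have "open (patch p (\<iota> p) \<inter> (\<lambda>x. det (frame_matrix p x)) -` (- {0}))"
    by (rule continuous_open_preimage[OF _ open_patch]) auto
  moreover have "regular p = patch p (\<iota> p) \<inter> (\<lambda>x. det (frame_matrix p x)) -` (- {0})"
    by (auto simp: regular_def)
  ultimately show "open (regular p)" by simp
  have "frame_matrix p (chart_at P p p) = mat 1"
    by (simp add: frame_matrix_def contraction_vector_center frame_field_center dual_basis vec_eq_iff axis_def mat_def)
  then show "chart_at P p p \<in> regular p" by (simp add: regular_def center_patch)
  show "regular p \<subseteq> patch p (\<iota> p)" "regular p \<subseteq> range_at P p" by (auto simp: regular_def patch_iff)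
qed

text \<open>
  Evaluated on the frame fields, \<open>multiplier_form_contraction\<close> is a linear system for the multiplier with smooth
  coefficients.
\<close>

lemma smooth_multiplier_form: "smooth_on (range_at P a) (multiplier_form a)"
proof -
  have near: "smooth_on (regular p) (multiplier_form p)" for p
  proof -
    let ?s = "\<lambda>x. \<chi> j. contraction (frame_field p j) \<tau> p x frame3"
    note on_patch = smooth_on_subset[OF _ regular(3)]
    have tr: "smooth_on (regular p) (\<lambda>x. transpose (frame_matrix p x) $ i $ j)" for i j
      unfolding transpose_def by (simp add: on_patch[OF smooth_frame_matrix])
    have s: "smooth_on (regular p) ?s"
      by (intro smooth_on_vec_lambda regular(1) on_patch[OF smooth_frame_contraction[OF \<tau>]])
    have d: "det (transpose (frame_matrix p x)) \<noteq> 0" if "x \<in> regular p" for x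
      using that by (simp add: regular_def det_transpose)
    obtain y where y: "smooth_on (regular p) y"
        "\<And>x. x \<in> regular p \<Longrightarrow> transpose (frame_matrix p x) *v y x = ?s x"
      using smooth_on_solve[OF regular(1) tr s d] by blast
    show ?thesis
    proof (rule smooth_on_cong[OF y(1) regular(1)])
      fix x assume x: "x \<in> regular p"
      have m: "transpose (frame_matrix p x) *v multiplier_form p x = ?s x"
      proof (rule vec_eq_iff[THEN iffD2], rule allI)
        fix j
        have "(transpose (frame_matrix p x) *v multiplier_form p x) $ j
            = multiplier_form p x \<bullet> contraction_vector \<rho> (frame_field p j) p x"
          by (simp add: matrix_vector_mult_def transpose_def frame_matrix_def inner_vec_def mult.commute)
        then show "(transpose (frame_matrix p x) *v multiplier_form p x) $ j = ?s x $ j"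
          using multiplier_form_contraction[of x p "frame_field p j"] x regular(4) by auto
      qed
      show "y x = multiplier_form p x"
        by (rule trans[OF iffD1[OF cramer[OF d[OF x]] y(2)[OF x]] sym[OF iffD1[OF cramer[OF d[OF x]] m]]])
    qed
  qed
  show ?thesis
  proof (rule smooth_on_local)
    fix x assume x: "x \<in> range_at P a"
    define p where "p = inv_chart P a x"
    let ?T = "P.overlap a p \<inter> P.trans a p -` regular p"
    have "open ?T"
      by (rule continuous_open_preimage[OF smooth_on_continuous[OF P.smooth_trans] P.open_overlap regular(1)])
    moreover have "x \<in> ?T" using to_center[OF x] regular(2) by (simp add: p_def)
    moreover have "smooth_on ?T (multiplier_form a)"
    proof (rule smooth_on_cong[OF _ \<open>open ?T\<close>])
      have sub: "?T \<subseteq> P.overlap a p" by auto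
      have t: "smooth_on ?T (P.trans a p)" by (rule smooth_on_subset[OF P.smooth_trans sub])
      have "smooth_on ?T (\<lambda>x. multiplier_form p (P.trans a p x))"
        by (rule smooth_on_compose[OF near t \<open>open ?T\<close> regular(1)]) auto
      then show "smooth_on ?T (\<lambda>x. \<chi> i. multiplier_form p (P.trans a p x) \<bullet> P.dtrans a p x (axis i 1))"
        by (intro smooth_on_vec_lambda smooth_on_inner smooth_on_derivative t \<open>open ?T\<close>)
      show "(\<chi> i. multiplier_form p (P.trans a p y) \<bullet> P.dtrans a p y (axis i 1)) = multiplier_form a y"
        if "y \<in> ?T" for y
      proof (rule vec_eq_iff[THEN iffD2], rule allI)
        fix i
        have "multiplier_form a y \<bullet> axis i 1 = multiplier_form p (P.trans a p y) \<bullet> P.dtrans a p y (axis i 1)"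
          by (rule multiplier_form_change) (use that in auto)
        then show "(\<chi> i. multiplier_form p (P.trans a p y) \<bullet> P.dtrans a p y (axis i 1)) $ i = multiplier_form a y $ i"
          by (simp add: inner_axis)
      qed
    qed
    ultimately show "\<exists>T. open T \<and> x \<in> T \<and> smooth_on T (multiplier_form a)" by blast
  qed
qed

lemma one_form_multiplier: "P.one_form multiplier_form"
  unfolding P.one_form_def
  using smooth_multiplier_form multiplier_form_change by blast

subsection \<open>Every 2-form on the submanifold is a contraction\<close>

lemma contraction_vector_linear:
  "contraction_vector \<rho> n a x = two_form_vector (\<lambda>vs. \<rho> (\<iota> (inv_chart P a x)) (n (inv_chart P a x) # map (push a x) vs))"
  by (simp add: contraction_vector_def contraction_def[abs_def])

lemma tangent_coords_frame_field:
  assumes q: "q \<in> dom_at P p" "\<iota> q \<in> dom_at M (\<iota> p)" "\<iota> q \<in> dom_at M b"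
  shows "tangent_coords M b (\<iota> q) (frame_field p i q)
    = M.dtrans (\<iota> p) b (chart_at M (\<iota> p) (\<iota> q)) (dual_basis p i)"
proof -
  have o: "chart_at M (\<iota> p) (\<iota> q) \<in> M.overlap (\<iota> p) (\<iota> q)"
    using q by (simp add: M.overlap_iff M.chart_range M.inv_chart_chart M.dom(1))
  have c: "inv_chart M (\<iota> p) (chart_at M (\<iota> p) (\<iota> q)) \<in> dom_at M b"
    using q by (simp add: M.inv_chart_chart)
  have l: "loc p (\<iota> p) (chart_at P p q) = chart_at M (\<iota> p) (\<iota> q)" using q by (simp add: P.inv_chart_chart)
  have t: "M.trans (\<iota> p) (\<iota> q) (chart_at M (\<iota> p) (\<iota> q)) = chart_at M (\<iota> q) (\<iota> q)"
    using q by (simp add: M.inv_chart_chart)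
  show ?thesis
    using M.dtrans_chain[OF o c, of "dual_basis p i"] unfolding tangent_coords_def frame_field_def l t .
qed

lemma linear_tangent_coords:
  assumes "r \<in> dom_at M b" shows "linear (tangent_coords M b r)"
proof -
  have "chart_at M r r \<in> M.overlap r b"
    using assms by (simp add: M.overlap_iff M.chart_range M.inv_chart_chart M.dom(1))
  from M.linear_dtrans[OF this] show ?thesis by (simp add: tangent_coords_def[abs_def])
qed

text \<open>
  On the \<open>regular\<close> neighbourhoods the equation is solved by a combination of the frame fields.  As the contraction is
  linear in the section, a convex combination of local solutions is a solution.
\<close>

lemma vector_density_is_contraction:
  assumes X: "P.vector_density X"
  obtains n where "section_along P M \<iota> n" "\<And>a x. x \<in> range_at P a \<Longrightarrow> contraction_vector \<rho> n a x = X a x"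
proof -
  have "\<exists>c. smooth_on (regular p) c \<and> (\<forall>x\<in>regular p. frame_matrix p x *v c x = X p x)" for p
  proof -
    have fm: "smooth_on (regular p) (\<lambda>x. frame_matrix p x $ i $ j)" for i j
      by (rule smooth_on_subset[OF smooth_frame_matrix regular(3)])
    have Xp: "smooth_on (regular p) (X p)"
      by (rule smooth_on_subset[OF P.vector_density_smooth[OF X] regular(4)])
    have d: "det (frame_matrix p x) \<noteq> 0" if "x \<in> regular p" for x using that by (simp add: regular_def)
    obtain y where y: "smooth_on (regular p) y" "\<And>x. x \<in> regular p \<Longrightarrow> frame_matrix p x *v y x = X p x"
      using smooth_on_solve[OF regular(1) fm Xp d] by blast
    show ?thesis by (intro exI[of _ y] conjI ballI y)
  qed
  then obtain c where c: "\<And>p. smooth_on (regular p) (c p)"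
    "\<And>p x. x \<in> regular p \<Longrightarrow> frame_matrix p x *v c p x = X p x" by metis
  define N where "N p = {q \<in> dom_at P p. chart_at P p q \<in> regular p}" for p
  have N: "open (N p)" "p \<in> N p" "N p \<subseteq> dom_at P p" for p
    using P.open_preimage_chart[OF regular(1)] regular(2) P.dom(1) by (auto simp: N_def)
  obtain F' h' where F': "partition_of_unity P F' h'"
    and K': "\<And>p. \<exists>K. compact K \<and> K \<subseteq> chart_at P p ` N p \<and> (\<forall>q. h' p q \<noteq> 0 \<longrightarrow> q \<in> inv_chart P p ` K)"
    using P.partition_of_unity_exists[OF P.cpt N] by blast
  obtain K where K: "\<And>p. compact (K p)" "\<And>p. K p \<subseteq> chart_at P p ` N p"
      "\<And>p q. h' p q \<noteq> 0 \<Longrightarrow> q \<in> inv_chart P p ` K p"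
    using K' by metis
  have Kr: "K p \<subseteq> range_at P p" for p using K(2)[of p] N(3)[of p] by (auto simp: range_at_def)
  have KN: "inv_chart P p ` K p \<subseteq> N p" for p
    using K(2)[of p] by (auto simp: N_def P.inv_chart_chart)
  have sum1: "(\<Sum>p\<in>F'. h' p q) = 1" for q using F' by (simp add: partition_of_unity_def)
  have h'_smooth: "smooth_function P (h' p)" if "p \<in> F'" for p using F' that by (simp add: partition_of_unity_def)
  define n0 where "n0 p q = (\<Sum>i\<in>UNIV. c p (chart_at P p q) $ i *\<^sub>R frame_field p i q)" for p q
  define n where "n q = (\<Sum>p\<in>F'. h' p q *\<^sub>R n0 p q)" for q
  have n0: "contraction_vector \<rho> (n0 p) a x = X a x" if x: "x \<in> range_at P a" and q: "inv_chart P a x \<in> N p" for p a x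
  proof -
    have o: "x \<in> P.overlap a p" using x q N(3) by (auto simp: P.overlap_iff)
    define y where "y = P.trans a p x"
    have y: "y \<in> regular p" using q by (simp add: y_def N_def)
    have "y \<in> range_at P p" using y regular(4) by blast
    then have iy: "chart_at P p (inv_chart P p y) = y" by (rule P.chart_inv_chart)
    note lin = linear_two_form_vector[OF alt_\<rho>, of "\<iota> (inv_chart P p y)" "push p y"]
    have "contraction_vector \<rho> (n0 p) p y = (\<Sum>i\<in>UNIV. c p y $ i *\<^sub>R contraction_vector \<rho> (frame_field p i) p y)"
      unfolding contraction_vector_linear n0_def iy linear_sum[OF lin] linear_cmul[OF lin] ..
    also have "\<dots> = frame_matrix p y *v c p y"
      by (simp add: vec_eq_iff matrix_vector_mult_def frame_matrix_def mult.commute)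
    also have "\<dots> = X p y" by (rule c(2)[OF y])
    finally have "P.dtrans a p x (contraction_vector \<rho> (n0 p) a x) = P.dtrans a p x (X a x)"
      unfolding contraction_vector_change[OF \<rho> o] P.vector_density_change[OF X o] y_def by (rule arg_cong)
    then show ?thesis using P.dtrans_inverse[OF o] by metis
  qed
  have "contraction_vector \<rho> n a x = X a x" if x: "x \<in> range_at P a" for a x
  proof -
    define q where "q = inv_chart P a x"
    note lin = linear_two_form_vector[OF alt_\<rho>, of "\<iota> q" "push a x"]
    have "contraction_vector \<rho> n a x = (\<Sum>p\<in>F'. h' p q *\<^sub>R contraction_vector \<rho> (n0 p) a x)"
      unfolding contraction_vector_linear n_def q_def[symmetric] linear_sum[OF lin] linear_cmul[OF lin] ..
    also have "\<dots> = (\<Sum>p\<in>F'. h' p q *\<^sub>R X a x)"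
    proof (rule sum.cong[OF refl])
      fix p
      show "h' p q *\<^sub>R contraction_vector \<rho> (n0 p) a x = h' p q *\<^sub>R X a x"
      proof (cases "h' p q = 0")
        case False
        then have "q \<in> N p" using K(3) KN by blast
        then show ?thesis using n0[OF x] by (simp add: q_def)
      qed simp
    qed
    also have "\<dots> = X a x" by (simp add: sum1 flip: scaleR_sum_left)
    finally show ?thesis .
  qed
  moreover have "section_along P M \<iota> n"
    unfolding section_along_def patch_def[symmetric]
  proof (intro allI)
    fix a b
    have summand: "smooth_on (patch a b) (\<lambda>x. tangent_coords M b (\<iota> (inv_chart P a x)) (h' p (inv_chart P a x) *\<^sub>R n0 p (inv_chart P a x)))"
      if p: "p \<in> F'" for p
    proof (rule smooth_on_local)
      fix x assume x: "x \<in> patch a b"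
      have xr: "x \<in> range_at P a" using x by (simp add: patch_iff)
      show "\<exists>T. open T \<and> x \<in> T \<and> smooth_on T
          (\<lambda>x. tangent_coords M b (\<iota> (inv_chart P a x)) (h' p (inv_chart P a x) *\<^sub>R n0 p (inv_chart P a x)))"
      proof (cases "inv_chart P a x \<in> N p")
        case True
        let ?T = "patch a b \<inter> (P.overlap a p \<inter> P.trans a p -` regular p)"
        have T: "open ?T"
          by (intro open_Int open_patch continuous_open_preimage[OF smooth_on_continuous[OF P.smooth_trans] P.open_overlap regular(1)])
        have xT: "x \<in> ?T" using x xr True N(3) by (auto simp: P.overlap_iff N_def)
        have in_T: "y \<in> range_at P a" "inv_chart P a y \<in> dom_at P p" "\<iota> (inv_chart P a y) \<in> dom_at M b"
            "\<iota> (inv_chart P a y) \<in> dom_at M (\<iota> p)" "y \<in> patch a (\<iota> p)" if y: "y \<in> ?T" for y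
        proof -
          show 1: "y \<in> range_at P a" "inv_chart P a y \<in> dom_at P p" "\<iota> (inv_chart P a y) \<in> dom_at M b"
            using y by (auto simp: patch_iff P.overlap_iff)
          have "P.trans a p y \<in> patch p (\<iota> p)" using y regular(3) by blast
          then show "\<iota> (inv_chart P a y) \<in> dom_at M (\<iota> p)" using 1 by (simp add: patch_iff P.inv_chart_chart)
          then show "y \<in> patch a (\<iota> p)" using 1 by (simp add: patch_iff)
        qed
        have t: "smooth_on ?T (P.trans a p)" by (rule smooth_on_subset[OF P.smooth_trans]) auto
        have "smooth_on ?T (\<lambda>x. c p (P.trans a p x))"
          by (rule smooth_on_compose[OF c(1) t T regular(1)]) auto
        moreover have "smooth_on ?T (h' p \<circ> inv_chart P a)"
          by (rule smooth_on_subset[OF P.smooth_function_chart[OF h'_smooth[OF p]]]) (use in_T(1) in blast)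
        moreover have "smooth_on ?T (\<lambda>x. M.dtrans (\<iota> p) b (loc a (\<iota> p) x) (dual_basis p i))" for i
        proof (rule smooth_on_apply_derivative[OF T M.open_overlap M.smooth_trans])
          show "smooth_on ?T (loc a (\<iota> p))" by (rule smooth_on_subset[OF smooth_loc]) (use in_T(5) in blast)
          show "loc a (\<iota> p) y \<in> M.overlap (\<iota> p) b" if "y \<in> ?T" for y
            using in_T[OF that] by (simp add: M.overlap_iff M.chart_range M.inv_chart_chart)
        qed simp
        ultimately have "smooth_on ?T (\<lambda>x. (h' p \<circ> inv_chart P a) x *\<^sub>R
            (\<Sum>i\<in>UNIV. c p (P.trans a p x) $ i *\<^sub>R M.dtrans (\<iota> p) b (loc a (\<iota> p) x) (dual_basis p i)))"
          by (intro smooth_on_scaleR smooth_on_sum smooth_on_nth T)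
        then have "smooth_on ?T (\<lambda>x. tangent_coords M b (\<iota> (inv_chart P a x)) (h' p (inv_chart P a x) *\<^sub>R n0 p (inv_chart P a x)))"
        proof (rule smooth_on_cong[OF _ T])
          fix y assume y: "y \<in> ?T"
          let ?q = "inv_chart P a y"
          note l = linear_tangent_coords[OF in_T(3)[OF y]]
          have "tangent_coords M b (\<iota> ?q) (h' p ?q *\<^sub>R n0 p ?q)
              = h' p ?q *\<^sub>R (\<Sum>i\<in>UNIV. c p (chart_at P p ?q) $ i *\<^sub>R tangent_coords M b (\<iota> ?q) (frame_field p i ?q))"
            unfolding n0_def linear_cmul[OF l] linear_sum[OF l] ..
          also have "\<dots> = (h' p \<circ> inv_chart P a) y *\<^sub>R
              (\<Sum>i\<in>UNIV. c p (P.trans a p y) $ i *\<^sub>R M.dtrans (\<iota> p) b (loc a (\<iota> p) y) (dual_basis p i))"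
            unfolding tangent_coords_frame_field[OF in_T(2,4,3)[OF y]] by simp
          finally show "(h' p \<circ> inv_chart P a) y *\<^sub>R
              (\<Sum>i\<in>UNIV. c p (P.trans a p y) $ i *\<^sub>R M.dtrans (\<iota> p) b (loc a (\<iota> p) y) (dual_basis p i))
              = tangent_coords M b (\<iota> ?q) (h' p ?q *\<^sub>R n0 p ?q)" by (rule sym)
        qed
        then show ?thesis using T xT by blast
      next
        case False
        let ?U = "- (inv_chart P p ` K p)"
        let ?T = "patch a b \<inter> {y \<in> range_at P a. inv_chart P a y \<in> ?U}"
        have "open ?U" using P.compact_inv_chart_image(2)[OF K(1) Kr] by (rule open_Compl)
        then have T: "open ?T" by (intro open_Int open_patch P.open_preimage_inv_chart)
        have xT: "x \<in> ?T" using x xr False KN by blast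
        have "smooth_on ?T (\<lambda>x. tangent_coords M b (\<iota> (inv_chart P a x)) (h' p (inv_chart P a x) *\<^sub>R n0 p (inv_chart P a x)))"
        proof (rule smooth_on_cong[OF smooth_on_const T])
          fix y assume y: "y \<in> ?T"
          have "h' p (inv_chart P a y) = 0" using y K(3) by blast
          moreover have "\<iota> (inv_chart P a y) \<in> dom_at M b" using y by (simp add: patch_iff)
          ultimately show "0 = tangent_coords M b (\<iota> (inv_chart P a y)) (h' p (inv_chart P a y) *\<^sub>R n0 p (inv_chart P a y))"
            using linear_0[OF linear_tangent_coords] by simp
        qed
        then show ?thesis using T xT by blast
      qed
    qed
    have "smooth_on (patch a b) (\<lambda>x. \<Sum>p\<in>F'. tangent_coords M b (\<iota> (inv_chart P a x)) (h' p (inv_chart P a x) *\<^sub>R n0 p (inv_chart P a x)))"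
      by (intro smooth_on_sum open_patch summand)
    then show "smooth_on (patch a b) (\<lambda>x. tangent_coords M b (\<iota> (inv_chart P a x)) (n (inv_chart P a x)))"
    proof (rule smooth_on_cong[OF _ open_patch])
      fix x assume "x \<in> patch a b"
      then have "linear (tangent_coords M b (\<iota> (inv_chart P a x)))" by (intro linear_tangent_coords) (simp add: patch_iff)
      from linear_sum[OF this]
      show "(\<Sum>p\<in>F'. tangent_coords M b (\<iota> (inv_chart P a x)) (h' p (inv_chart P a x) *\<^sub>R n0 p (inv_chart P a x)))
          = tangent_coords M b (\<iota> (inv_chart P a x)) (n (inv_chart P a x))"
        unfolding n_def by metis
    qed
  qed
  ultimately show ?thesis using that by blast
qed

subsection \<open>The multiplier equation\<close>

lemma ext_deriv_zero_form:
  "ext_deriv P (zero_form u) p [v] = frechet_derivative (u \<circ> inv_chart P p) (at (chart_at P p p)) v"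
  by (simp add: ext_deriv_def local_form_def pull_def zero_form_def o_def)

text \<open>Both sides of the multiplier equation are top forms on the tangent space, so it suffices to compare their values on the frame.\<close>

lemma multiplier_equation_iff:
  assumes g: "\<And>v. frechet_derivative (u \<circ> inv_chart P p) (at (chart_at P p p)) v = g \<bullet> v"
  shows "(\<forall>vs w. length vs = 3 \<longrightarrow> normal_part P M \<iota> \<tau> p vs w
      + wedge 1 2 (ext_deriv P (zero_form u) p) (\<lambda>us. normal_part P M \<iota> \<rho> p us w) vs = 0)
    \<longleftrightarrow> g = multiplier p"
proof -
  let ?T = "tangent_map P M \<iota> p"
  have eq: "normal_part P M \<iota> \<tau> p [a, b, c] w
      + wedge 1 2 (ext_deriv P (zero_form u) p) (\<lambda>us. normal_part P M \<iota> \<rho> p us w) [a, b, c]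
    = ((g - multiplier p) \<bullet> normal_two_form p w) * (a \<bullet> cross3 b c)" for a b c w
  proof -
    define \<eta> where "\<eta> vs = \<rho> (\<iota> p) (w # map ?T vs)" for vs
    define \<theta> where "\<theta> vs = \<tau> (\<iota> p) (w # map ?T vs)" for vs
    have \<eta>: "\<eta> \<in> alt_forms 2" and \<theta>: "\<theta> \<in> alt_forms 3"
      using interior_alt_forms[OF _ linear_tangent_map, of "\<rho> (\<iota> p)" 2 w p] interior_alt_forms[OF _ linear_tangent_map, of "\<tau> (\<iota> p)" 3 w p]
        alt_\<rho> alt_\<tau> by (simp_all add: \<eta>_def[abs_def] \<theta>_def[abs_def])
    have n\<rho>: "normal_part P M \<iota> \<rho> p [x, y] w = \<eta> [x, y]" for x y
      using alt_forms_swap[OF alt_\<rho>, of "\<iota> p" "[]" "?T x" "[?T y]" w "[]"]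
        alt_forms_swap[OF alt_\<rho>, of "\<iota> p" "[w]" "?T y" "[]" "?T x" "[]"]
      by (simp add: normal_part_def \<eta>_def)
    have n\<tau>: "normal_part P M \<iota> \<tau> p [a, b, c] w = - \<theta> [a, b, c]"
      using alt_forms_swap[OF alt_\<tau>, of "\<iota> p" "[]" "?T a" "[?T b, ?T c]" w "[]"]
        alt_forms_swap[OF alt_\<tau>, of "\<iota> p" "[w]" "?T b" "[?T c]" "?T a" "[]"]
        alt_forms_swap[OF alt_\<tau>, of "\<iota> p" "[w, ?T a]" "?T c" "[]" "?T b" "[]"]
      by (simp add: normal_part_def \<theta>_def)
    have "wedge 1 2 (ext_deriv P (zero_form u) p) (\<lambda>us. normal_part P M \<iota> \<rho> p us w) [a, b, c]
        = wedge 1 2 (ext_deriv P (zero_form u) p) \<eta> [a, b, c]"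
      unfolding wedge_1_2 n\<rho> ..
    also have "\<dots> = (g \<bullet> two_form_vector \<eta>) * (a \<bullet> cross3 b c)"
      by (rule wedge_one_two_form[OF \<eta>]) (simp only: ext_deriv_zero_form g)
    also have "two_form_vector \<eta> = normal_two_form p w" by (simp add: \<eta>_def[abs_def] normal_two_form_def)
    finally show ?thesis
      unfolding n\<tau> top_form_on_three_space[OF \<theta>, of a b c]
      using normal_volume_eq[of p w]
      by (simp add: \<theta>_def normal_volume_def inner_diff_left algebra_simps)
  qed
  show ?thesis
  proof
    assume a: "\<forall>vs w. length vs = 3 \<longrightarrow> normal_part P M \<iota> \<tau> p vs w
      + wedge 1 2 (ext_deriv P (zero_form u) p) (\<lambda>us. normal_part P M \<iota> \<rho> p us w) vs = 0"
    have "(g - multiplier p) \<bullet> normal_two_form p w = 0" for w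
    proof -
      have "normal_part P M \<iota> \<tau> p [axis 1 1, axis 2 1, axis 3 1] w
        + wedge 1 2 (ext_deriv P (zero_form u) p) (\<lambda>us. normal_part P M \<iota> \<rho> p us w) [axis 1 1, axis 2 1, axis 3 1] = 0"
        using a by simp
      then show ?thesis unfolding eq cross3_frame3 by simp
    qed
    moreover obtain w where "normal_two_form p w = g - multiplier p"
      using onto[of p "g - multiplier p"] unfolding normal_two_form_def by blast
    ultimately have "(g - multiplier p) \<bullet> (g - multiplier p) = 0" by metis
    then show "g = multiplier p" by simp
  next
    assume "g = multiplier p"
    then show "\<forall>vs w. length vs = 3 \<longrightarrow> normal_part P M \<iota> \<tau> p vs w
      + wedge 1 2 (ext_deriv P (zero_form u) p) (\<lambda>us. normal_part P M \<iota> \<rho> p us w) vs = 0"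
      using eq list_length_3 by fastforce
  qed
qed

lemma integrate_contraction:
  "P.integrate (\<lambda>a x. contraction n \<tau> a x frame3) = P.integrate (P.pairing multiplier_form (contraction_vector \<rho> n))"
  by (rule P.integrate_cong) (simp add: P.pairing_def multiplier_form_contraction)

text \<open>
  By \<open>vector_density_is_contraction\<close>, being critical means that the multiplier form annihilates all divergence-free
  vector densities, and by \<open>multiplier_equation_iff\<close> a solution of the multiplier equation is a
  primitive of this form.
\<close>

theorem critical_iff_multiplier:
  assumes choice: "(SOME (F, h). partition_of_unity P F h) = (F, h)"
  shows "(\<forall>n. tangent_to_constraint P M \<rho> \<iota> n \<longrightarrow> d_functional P M \<tau> \<iota> n = 0) \<longleftrightarrow>
    (\<exists>u. smooth_function P u \<and> (\<forall>p vs w. length vs = 3 \<longrightarrow> normal_part P M \<iota> \<tau> p vs w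
      + wedge 1 2 (ext_deriv P (zero_form u) p) (\<lambda>us. normal_part P M \<iota> \<rho> p us w) vs = 0))"
proof -
  have d: "d_functional P M \<tau> \<iota> n = P.integrate (P.pairing multiplier_form (contraction_vector \<rho> n))" for n
    unfolding d_functional_def integral_form_def choice contraction_local_form
    using integrate_contraction[of n] by (simp add: P.integrate_def)
  show ?thesis
  proof
    assume crit: "\<forall>n. tangent_to_constraint P M \<rho> \<iota> n \<longrightarrow> d_functional P M \<tau> \<iota> n = 0"
    have null: "P.integrate (P.pairing multiplier_form X) = 0"
      if X: "P.vector_density X" "P.divergence_free X" for X
    proof -
      obtain n where n: "section_along P M \<iota> n"
          "\<And>a x. x \<in> range_at P a \<Longrightarrow> contraction_vector \<rho> n a x = X a x"
        using vector_density_is_contraction[OF X(1)] by blast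
      have "divergence (contraction_vector \<rho> n a) x = divergence (X a) x" if x: "x \<in> range_at P a" for a x
      proof -
        have "contraction_vector \<rho> n a differentiable at x"
          using smooth_on_has_derivative[OF P.vector_density_smooth[OF vector_density_contraction[OF \<rho> n(1)]] x]
          by (auto simp: differentiable_def)
        from frechet_derivative_cong_open[OF P.open_range x n(2) this]
        show ?thesis by (simp add: divergence_def)
      qed
      then have "P.divergence_free (contraction_vector \<rho> n)" using X(2) by (simp add: P.divergence_free_def)
      then have "tangent_to_constraint P M \<rho> \<iota> n"
        unfolding tangent_to_constraint_def closed_contraction_iff[OF \<rho> n(1)] using n(1) by blast
      then have "P.integrate (P.pairing multiplier_form (contraction_vector \<rho> n)) = 0" using crit d by metis
      moreover have "P.integrate (P.pairing multiplier_form (contraction_vector \<rho> n)) = P.integrate (P.pairing multiplier_form X)"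
        by (rule P.integrate_cong) (simp add: P.pairing_def n(2))
      ultimately show ?thesis by simp
    qed
    interpret null_one_form P F h multiplier_form
      by unfold_locales (use one_form_multiplier null in auto)
    obtain u where u: "smooth_function P u"
      "\<And>a. ((u \<circ> inv_chart P a) has_derivative (\<lambda>v. multiplier_form a (chart_at P a a) \<bullet> v)) (at (chart_at P a a))"
      using null_one_form_exact by blast
    have "frechet_derivative (u \<circ> inv_chart P p) (at (chart_at P p p)) v = multiplier p \<bullet> v" for p v
      using fun_cong[OF frechet_derivative_at[OF u(2)[of p]], of v] multiplier_form_center[of p v] by simp
    then show "\<exists>u. smooth_function P u \<and> (\<forall>p vs w. length vs = 3 \<longrightarrow> normal_part P M \<iota> \<tau> p vs w
      + wedge 1 2 (ext_deriv P (zero_form u) p) (\<lambda>us. normal_part P M \<iota> \<rho> p us w) vs = 0)"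
      using u(1) multiplier_equation_iff by blast
  next
    assume "\<exists>u. smooth_function P u \<and> (\<forall>p vs w. length vs = 3 \<longrightarrow> normal_part P M \<iota> \<tau> p vs w
      + wedge 1 2 (ext_deriv P (zero_form u) p) (\<lambda>us. normal_part P M \<iota> \<rho> p us w) vs = 0)"
    then obtain u where u: "smooth_function P u" and eq: "\<forall>p vs w. length vs = 3 \<longrightarrow> normal_part P M \<iota> \<tau> p vs w
      + wedge 1 2 (ext_deriv P (zero_form u) p) (\<lambda>us. normal_part P M \<iota> \<rho> p us w) vs = 0"
      by blast
    have du: "frechet_derivative (u \<circ> inv_chart P p) (at (chart_at P p p)) v = multiplier p \<bullet> v" for p v
    proof -
      have xr: "chart_at P p p \<in> range_at P p" by (simp add: P.chart_range P.dom(1))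
      define g where "g = (\<chi> i. frechet_derivative (u \<circ> inv_chart P p) (at (chart_at P p p)) (axis i 1))"
      have g: "frechet_derivative (u \<circ> inv_chart P p) (at (chart_at P p p)) v = g \<bullet> v" for v
        using linear_axis_expansion[OF linear_frechet_derivative_smooth[OF P.smooth_function_chart[OF u] xr], of v]
        by (simp add: g_def inner_vec_def mult.commute)
      have "g = multiplier p" using multiplier_equation_iff[of u p g, OF g] eq by blast
      then show ?thesis using g by simp
    qed
    show "\<forall>n. tangent_to_constraint P M \<rho> \<iota> n \<longrightarrow> d_functional P M \<tau> \<iota> n = 0"
    proof (intro allI impI)
      fix n assume "tangent_to_constraint P M \<rho> \<iota> n"
      then have n: "section_along P M \<iota> n" and cl: "closed_form P (pullback_interior P M \<iota> n \<rho>)"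
        by (simp_all add: tangent_to_constraint_def)
      have free: "P.divergence_free (contraction_vector \<rho> n)"
        using cl unfolding closed_contraction_iff[OF \<rho> n] .
      have "P.integrate (P.pairing multiplier_form (contraction_vector \<rho> n))
          = P.integrate (P.derivative_along u (contraction_vector \<rho> n))"
      proof (rule P.integrate_cong)
        fix a x assume x: "x \<in> range_at P a"
        show "P.pairing multiplier_form (contraction_vector \<rho> n) a x = P.derivative_along u (contraction_vector \<rho> n) a x"
          unfolding P.pairing_def P.derivative_along_def multiplier_form_inner[OF x]
            P.derivative_change[OF u to_center(1)[OF x]] to_center(2)[OF x] du ..
      qed
      also have "\<dots> = 0" by (rule P.stokes[OF vector_density_contraction[OF \<rho> n] free u])
      finally show "d_functional P M \<tau> \<iota> n = 0" unfolding d .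
    qed
  qed
qed

end

theorem proposition1p1:
  fixes M :: "('m::{t2_space, second_countable_topology}, real^6) charts"
    and P :: "('p::{t2_space, second_countable_topology}, real^3) charts"
    and \<rho> \<tau> :: "'m \<Rightarrow> (real^6) form"
    and \<iota> :: "'p \<Rightarrow> 'm"
  assumes "oriented_manifold M"
    and "G2_pair M \<rho> \<tau>"
    and "closed_form M \<rho>" and "closed_form M \<tau>"
    and "oriented_manifold P" and "compact (UNIV :: 'p set)"
    and "smooth_embedding P M \<iota>"
    and "positive_3form (pullback_form P M \<iota> (\<lambda>x. hitchin_dual (\<rho> x)))"
  shows "lagrange_solution P M \<rho> \<tau> \<iota> \<longleftrightarrow>
    (\<exists>u :: 'p \<Rightarrow> real. smooth_function P u \<and>
       (\<forall>p vs w. length vs = 3 \<longrightarrow>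
          normal_part P M \<iota> \<tau> p vs w
          + wedge 1 2 (ext_deriv P (zero_form u) p) (\<lambda>us. normal_part P M \<iota> \<rho> p us w) vs = 0) \<and>
       vanishes (pullback_form P M \<iota> \<rho>))"
proof (cases "vanishes (pullback_form P M \<iota> \<rho>)")
  case False
  then show ?thesis by (simp add: lagrange_solution_def)
next
  case True
  interpret P: oriented_atlas P by unfold_locales (rule assms)
  interpret M: oriented_atlas M by unfold_locales (rule assms)
  obtain F0 h0 where "partition_of_unity P F0 h0"
  proof (rule P.partition_of_unity_exists[OF assms(6) P.dom(2,1) order_refl])
    fix F h assume "partition_of_unity P F h"
    then show thesis by (rule that)
  qed
  then have ex: "\<exists>Fh. case Fh of (F, h) \<Rightarrow> partition_of_unity P F h" by auto
  \<comment> \<open>The partition of unity that the definition of the integral chooses.\<close>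
  obtain F h where choice: "(SOME (F, h). partition_of_unity P F h) = (F, h)"
    by (cases "SOME (F, h). partition_of_unity P F h") (rule that)
  have pou: "partition_of_unity P F h" using someI_ex[OF ex] unfolding choice by simp
  have T: "\<rho> (\<iota> p) (map (tangent_map P M \<iota> p) vs) = 0" for p vs
    using True by (simp add: vanishes_def pullback_form_def pull_def)
  interpret isotropic_submanifold P F h M \<iota> \<rho> \<tau>
  proof unfold_locales
    show "compact (UNIV :: 'p set)" by (rule assms)
    show "partition_of_unity P F h" by (rule pou)
    show "smooth_map P M \<iota>" "inj (tangent_map P M \<iota> p)" for p
      using assms(7) by (simp_all add: smooth_embedding_def)
    show "diff_form 3 M \<rho>" "diff_form 4 M \<tau>" using assms(2) by (simp_all add: G2_pair_def)
    show "\<rho> (\<iota> p) (map (tangent_map P M \<iota> p) vs) = 0" for p vs by (rule T)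
    show "\<exists>w. two_form_vector (\<lambda>vs. \<rho> (\<iota> p) (w # map (tangent_map P M \<iota> p) vs)) = y" for p y
    proof -
      have alt: "\<rho> (\<iota> p) \<in> alt_forms 3" "\<tau> (\<iota> p) \<in> alt_forms 4"
        and st: "stable4 (\<lambda>vs. wedge 1 3 dt (pull snd (\<rho> (\<iota> p))) vs + pull snd (\<tau> (\<iota> p)) vs)"
        using assms(2) by (simp_all add: G2_pair_def diff_form_def)
      have pos: "hitchin_dual (\<rho> (\<iota> p)) (map (tangent_map P M \<iota> p) frame3) > 0"
        using assms(8) by (simp add: positive_3form_def pullback_form_def pull_def)
      obtain w where w: "\<rho> (\<iota> p) [w, tangent_map P M \<iota> p (axis 2 1), tangent_map P M \<iota> p (axis 3 1)] = y $ 1"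
        "\<rho> (\<iota> p) [w, tangent_map P M \<iota> p (axis 3 1), tangent_map P M \<iota> p (axis 1 1)] = y $ 2"
        "\<rho> (\<iota> p) [w, tangent_map P M \<iota> p (axis 1 1), tangent_map P M \<iota> p (axis 2 1)] = y $ 3"
        using contractions_onto[OF alt st T pos] by blast
      then show ?thesis
        by (intro exI[of _ w]) (simp add: two_form_vector_def vec_eq_iff forall_3 vector_3)
    qed
  qed
  show ?thesis using critical_iff_multiplier[OF choice] True by (auto simp: lagrange_solution_def)
qed

end
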